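(* Let $G=\mathrm{SL}(2,\mathbb H)$ and let $(A,B)\in G^2$ be a pair such that $A$, $B$ and $(AB)^{-1}$ are regular loxodromic, $\mathfrak z(A)\cap\mathfrak z(B)=0$, $A$ and $B$ have disjoint fixed point sets, and $[(A,B)]$ lies in the dense open trace-coordinate locus $\mathcal O\subset\mathcal M^{\mathrm{reg}}_*$. Then, near $[(A,B)]$, the relative deformation space $$\mathcal M_Y\bigl([A],[B],[(AB)^{-1}]\bigr)=\{(A',B')\in G^2: A'\in[A],\ B'\in[B],\ (A'B')^{-1}\in[(AB)^{-1}]\}/G$$ (quotient by simultaneous conjugation) admits six real-analytic local coordinates. These coordinates may be taken to be real-analytic functions of the fifteen trace coordinates $\mathrm{tr}(W(A',B'))$, $W\in\mathcal W$, where $$\mathcal W=(A,A^{-1},A^2,B,B^{-1},B^2,AB,AB^{-1},A^{-1}B,A^{-1}B^{-1},A^2B,AB^2,A^2B^2,ABAB^{-1},ABA^{-1}B^{-1}).$$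
   Context: $\mathbb H$ denotes the quaternions with units $i,j,k$, real part $\mathrm{Re}$ and norm $|\cdot|$; $\mathbb S^2=\{I\in\mathbb H: I^2=-1\}$; $e^{I\theta}=\cos\theta+I\sin\theta$. The Dieudonné determinant of $\left(\begin{smallmatrix}a&b\\c&d\end{smallmatrix}\right)\in\mathrm{GL}(2,\mathbb H)$ is $|ad-aca^{-1}b|$ if $a\neq0$ and $|cb|$ if $a=0$; $\mathrm{SL}(2,\mathbb H)$ is the 15-dimensional Lie group of matrices of Dieudonné determinant $1$, with Lie algebra $\mathfrak{sl}(2,\mathbb H)$, acting on $\widehat{\mathbb H}=\mathbb H\cup\{\infty\}$ by $z\mapsto(az+b)(cz+d)^{-1}$; $\mathrm{PSL}(2,\mathbb H)=\mathrm{SL}(2,\mathbb H)/\{\pm I\}$. $\mathfrak z(g)=\ker(1-\mathrm{Ad}_g)\subset\mathfrak{sl}(2,\mathbb H)$. $\mathrm{tr}\left(\begin{smallmatrix}a&b\\c&d\end{smallmatrix}\right)=\mathrm{Re}(a+d)$. $A\in\mathrm{SL}(2,\mathbb H)$ is regular loxodromic if it is conjugate to $\mathrm{diag}(re^{I\theta},r^{-1}e^{J\varphi})$ with $r>1$, $\theta,\varphi\in(0,\pi)$, $I,J\in\mathbb S^2$. A regular loxodromic pair is a pair of regular loxodromic elements with disjoint fixed point sets in $\widehat{\mathbb H}$. $[A]$ is the conjugacy class of $A$, $[(A,B)]$ the simultaneous conjugacy class. $\mathcal M^{\mathrm{reg}}_*$ is the set of classes of regular loxodromic pairs simultaneously conjugate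 to a pair $A_0=\mathrm{diag}(re^{I\theta},r^{-1}e^{J\varphi})$, $B_0=P\,\mathrm{diag}(se^{K\theta'},s^{-1}e^{L\varphi'})P^{-1}$, $P=|1-w|^{-1/2}\left(\begin{smallmatrix}1&w\\1&1\end{smallmatrix}\right)$, with $r,s>1$, angles in $(0,\pi)$, $I,J,K,L\in\mathbb S^2$ not all in $\{i,-i\}$, $w=x+yi$, $x\in\mathbb R$, $y>0$. It is a 15-dimensional real-analytic manifold, the quotient of the corresponding open set in $G^2$ by the free proper conjugation action of $\mathrm{PSL}(2,\mathbb H)$. $\mathcal O$ is the open dense subset of points of $\mathcal M^{\mathrm{reg}}_*$ at which the map $[(A,B)]\mapsto(\mathrm{tr}\,W(A,B))_{W\in\mathcal W}\in\mathbb R^{15}$ has invertible differential (i.e. where the fifteen word traces are local coordinates). *)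

theory Defs
  imports "HOL-Analysis.Analysis"
begin

section \<open>Quaternions\<close>

datatype quat = Quat (qre: real) (qim1: real) (qim2: real) (qim3: real)

lemma quat_eq_iff:
  "x = y \<longleftrightarrow> qre x = qre y \<and> qim1 x = qim1 y \<and> qim2 x = qim2 y \<and> qim3 x = qim3 y"
  by (auto intro: quat.expand)

instantiation quat :: real_div_algebra
begin

definition "0 = Quat 0 0 0 0"

definition "1 = Quat 1 0 0 0"

definition "x + y = Quat (qre x + qre y) (qim1 x + qim1 y) (qim2 x + qim2 y) (qim3 x + qim3 y)"

definition "- x = Quat (- qre x) (- qim1 x) (- qim2 x) (- qim3 x)"

definition "x - (y::quat) = x + (- y)"

definition "r *\<^sub>R x = Quat (r * qre x) (r * qim1 x) (r * qim2 x) (r * qim3 x)"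

definition
  "x * y = Quat
     (qre x * qre y - qim1 x * qim1 y - qim2 x * qim2 y - qim3 x * qim3 y)
     (qre x * qim1 y + qim1 x * qre y + qim2 x * qim3 y - qim3 x * qim2 y)
     (qre x * qim2 y - qim1 x * qim3 y + qim2 x * qre y + qim3 x * qim1 y)
     (qre x * qim3 y + qim1 x * qim2 y - qim2 x * qim1 y + qim3 x * qre y)"

definition
  "inverse x = (1 / ((qre x)\<^sup>2 + (qim1 x)\<^sup>2 + (qim2 x)\<^sup>2 + (qim3 x)\<^sup>2)) *\<^sub>R
     Quat (qre x) (- qim1 x) (- qim2 x) (- qim3 x)"

definition "x div (y::quat) = x * inverse y"

lemmas quat_defs = zero_quat_def one_quat_def plus_quat_def uminus_quat_def minus_quat_def
  scaleR_quat_def times_quat_def inverse_quat_def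

instance
proof
  fix x y z :: quat and r s :: real
  show "x + y + z = x + (y + z)" "x + y = y + x" "0 + x = x" "- x + x = 0" "x - y = x + - y"
    by (simp_all add: quat_defs)
  show "r *\<^sub>R (x + y) = r *\<^sub>R x + r *\<^sub>R y" "(r + s) *\<^sub>R x = r *\<^sub>R x + s *\<^sub>R x"
    "r *\<^sub>R s *\<^sub>R x = (r * s) *\<^sub>R x" "1 *\<^sub>R x = x"
    by (simp_all add: quat_defs algebra_simps)
  show "x * y * z = x * (y * z)" "(x + y) * z = x * z + y * z" "x * (y + z) = x * y + x * z"
    by (simp_all add: quat_defs algebra_simps)
  show "1 * x = x" "x * 1 = x" "(0::quat) \<noteq> 1"
    by (simp_all add: quat_defs)
  show "r *\<^sub>R x * y = r *\<^sub>R (x * y)" "x * r *\<^sub>R y = r *\<^sub>R (x * y)"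
    by (simp_all add: quat_defs algebra_simps)
  show "x div y = x * inverse y" "inverse (0::quat) = 0"
    by (simp_all add: quat_defs divide_quat_def)
  let ?N = "\<lambda>x. (qre x)\<^sup>2 + (qim1 x)\<^sup>2 + (qim2 x)\<^sup>2 + (qim3 x)\<^sup>2"
  have N0: "?N x = 0 \<longleftrightarrow> x = 0" for x
    by (simp add: zero_quat_def quat_eq_iff add_nonneg_eq_0_iff)
  show "inverse x * x = 1" "x * inverse x = 1" if "x \<noteq> 0"
  proof -
    define c where "c = Quat (qre x) (- qim1 x) (- qim2 x) (- qim3 x)"
    have sc: "r *\<^sub>R (u * v) = r *\<^sub>R u * v" "r *\<^sub>R (u * v) = u * r *\<^sub>R v" for r and u v :: quat
      by (simp_all add: quat_defs algebra_simps)
    have "c * x = ?N x *\<^sub>R 1" "x * c = ?N x *\<^sub>R 1"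
      by (simp_all add: c_def quat_defs power2_eq_square)
    moreover have "inverse x = (1 / ?N x) *\<^sub>R c"
      by (simp add: c_def inverse_quat_def)
    moreover have "?N x \<noteq> 0" using that N0 by blast
    moreover have "(1 / r) *\<^sub>R r *\<^sub>R (1::quat) = 1" if "r \<noteq> 0" for r
      using that by (simp add: quat_defs)
    ultimately show "inverse x * x = 1" "x * inverse x = 1"
      by (simp_all flip: sc)
  qed
qed

end

instantiation quat :: real_normed_div_algebra
begin

definition "norm x = sqrt ((qre x)\<^sup>2 + (qim1 x)\<^sup>2 + (qim2 x)\<^sup>2 + (qim3 x)\<^sup>2)"

definition "sgn x = x /\<^sub>R norm (x::quat)"

definition "dist x y = norm (x - y :: quat)"

definition "(uniformity :: (quat \<times> quat) filter) = (INF e\<in>{0<..}. principal {(x, y). dist x y < e})"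

definition "open (U :: quat set) \<longleftrightarrow> (\<forall>x\<in>U. eventually (\<lambda>(x', y). x' = x \<longrightarrow> y \<in> U) uniformity)"

instance
proof
  fix x y z :: quat and r :: real
  show "sgn x = x /\<^sub>R norm x" "dist x y = norm (x - y)"
    by (simp_all add: sgn_quat_def dist_quat_def)
  show "(uniformity :: (quat \<times> quat) filter) = (INF e\<in>{0<..}. principal {(x, y). dist x y < e})"
    by (simp add: uniformity_quat_def)
  show "open U \<longleftrightarrow> (\<forall>x\<in>U. eventually (\<lambda>(x', y). x' = x \<longrightarrow> y \<in> U) uniformity)" for U :: "quat set"
    by (simp add: open_quat_def)
  let ?N = "\<lambda>x. (qre x)\<^sup>2 + (qim1 x)\<^sup>2 + (qim2 x)\<^sup>2 + (qim3 x)\<^sup>2"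
  have N0: "?N x = 0 \<longleftrightarrow> x = 0" for x
    by (simp add: zero_quat_def quat_eq_iff add_nonneg_eq_0_iff)
  show "norm x = 0 \<longleftrightarrow> x = 0"
    using N0[of x] by (simp add: norm_quat_def)
  show "norm (r *\<^sub>R x) = \<bar>r\<bar> * norm x"
  proof -
    have "?N (r *\<^sub>R x) = r\<^sup>2 * ?N x"
      by (simp add: scaleR_quat_def power_mult_distrib distrib_left)
    then show ?thesis by (simp add: norm_quat_def real_sqrt_mult)
  qed
  show "norm (x * y) = norm x * norm y"
  proof -
    have "?N (x * y) = ?N x * ?N y"
      by (simp add: times_quat_def power2_eq_square algebra_simps)
    then show ?thesis by (simp add: norm_quat_def real_sqrt_mult)
  qed
  define e where "e = (\<lambda>x. vector [qre x, qim1 x, qim2 x, qim3 x] :: real^4)"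
  have n: "norm x = norm (e x)" for x
    by (simp add: norm_quat_def norm_vec_def L2_set_def e_def sum_4 vector_def)
  have a: "e (x + y) = e x + e y"
    by (simp add: e_def plus_quat_def vec_eq_iff forall_4 vector_def)
  show "norm (x + y) \<le> norm x + norm y"
    unfolding n a by (rule norm_triangle_ineq)
qed

end

instantiation quat :: euclidean_space
begin

definition "x \<bullet> y = qre x * qre y + qim1 x * qim1 y + qim2 x * qim2 y + qim3 x * qim3 y"

definition "Basis = {Quat 1 0 0 0, Quat 0 1 0 0, Quat 0 0 1 0, Quat 0 0 0 1}"

instance
proof
  fix x y z :: quat and r :: real
  show "x \<bullet> y = y \<bullet> x" "(x + y) \<bullet> z = x \<bullet> z + y \<bullet> z" "(r *\<^sub>R x) \<bullet> y = r * (x \<bullet> y)"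
    "0 \<le> x \<bullet> x"
    by (simp_all add: inner_quat_def quat_defs algebra_simps)
  show "x \<bullet> x = 0 \<longleftrightarrow> x = 0"
    by (simp add: inner_quat_def zero_quat_def quat_eq_iff add_nonneg_eq_0_iff)
  show "norm x = sqrt (x \<bullet> x)"
    by (simp add: inner_quat_def norm_quat_def power2_eq_square)
  show "(Basis :: quat set) \<noteq> {}" "finite (Basis :: quat set)"
    by (simp_all add: Basis_quat_def)
  show "u \<bullet> v = (if u = v then 1 else 0)" if "u \<in> Basis" "v \<in> Basis" for u v :: quat
    using that unfolding Basis_quat_def by (elim insertE emptyE) (simp_all add: inner_quat_def)
  show "(\<forall>u\<in>Basis. x \<bullet> u = 0) \<longleftrightarrow> x = 0"
    unfolding Basis_quat_def ball_simps
    by (simp add: inner_quat_def quat_eq_iff[of x] zero_quat_def)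
qed

end

definition quat_i :: quat where
  "quat_i = Quat 0 1 0 0"

definition imag_units :: "quat set" where
  "imag_units = {u. u\<^sup>2 = - 1}"

definition quat_cis :: "quat \<Rightarrow> real \<Rightarrow> quat" where
  "quat_cis u \<theta> = of_real (cos \<theta>) + u * of_real (sin \<theta>)"


section \<open>The group \<open>SL(2,H)\<close> and its action\<close>

type_synonym qmat = "quat^2^2"

definition mat2 :: "quat \<Rightarrow> quat \<Rightarrow> quat \<Rightarrow> quat \<Rightarrow> qmat" where
  "mat2 a b c d = vector [vector [a, b], vector [c, d]]"

definition dieudonne_det :: "qmat \<Rightarrow> real" where
  "dieudonne_det M =
    (let a = M$1$1; b = M$1$2; c = M$2$1; d = M$2$2
     in if a \<noteq> 0 then norm (a * d - a * c * inverse a * b) else norm (c * b))"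

definition SL2H :: "qmat set" where
  "SL2H = {M. invertible M \<and> dieudonne_det M = 1}"

definition trH :: "qmat \<Rightarrow> real" where
  "trH M = qre (M$1$1 + M$2$2)"

text \<open>The projective line over the quaternions is \<open>quat option\<close>, with \<open>None\<close> the point at infinity.\<close>

fun moebius :: "qmat \<Rightarrow> quat option \<Rightarrow> quat option" where
  "moebius M (Some z) =
    (if M$2$1 * z + M$2$2 = 0 then None
     else Some ((M$1$1 * z + M$1$2) * inverse (M$2$1 * z + M$2$2)))"
| "moebius M None = (if M$2$1 = 0 then None else Some (M$1$1 * inverse (M$2$1)))"

definition fixed_points :: "qmat \<Rightarrow> quat option set" where
  "fixed_points M = {z. moebius M z = z}"

definition conj_by :: "qmat \<Rightarrow> qmat \<Rightarrow> qmat" where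
  "conj_by P M = P ** M ** matrix_inv P"

definition conj_class :: "qmat \<Rightarrow> qmat set" where
  "conj_class M = (\<lambda>P. conj_by P M) ` SL2H"

definition pair_class :: "qmat \<times> qmat \<Rightarrow> (qmat \<times> qmat) set" where
  "pair_class p = (\<lambda>P. (conj_by P (fst p), conj_by P (snd p))) ` SL2H"

definition tangent_space :: "'a::real_normed_vector set \<Rightarrow> 'a \<Rightarrow> 'a set" where
  "tangent_space S p =
    {v. \<exists>\<gamma>::real \<Rightarrow> 'a. \<gamma> 0 = p \<and> (\<forall>\<^sub>F t in nhds 0. \<gamma> t \<in> S) \<and> (\<gamma> has_vector_derivative v) (at 0)}"

definition sl2H :: "qmat set" where
  "sl2H = tangent_space SL2H (mat 1)"

text \<open>\<open>conj_by g\<close> restricted to the Lie algebra is the adjoint action of \<open>g\<close>.\<close>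

definition centralizer_algebra :: "qmat \<Rightarrow> qmat set" where
  "centralizer_algebra g = {X \<in> sl2H. X - conj_by g X = 0}"


section \<open>Regular loxodromic elements and pairs\<close>

definition regular_loxodromic :: "qmat \<Rightarrow> bool" where
  "regular_loxodromic A \<longleftrightarrow> A \<in> SL2H \<and>
    (\<exists>r>1. \<exists>\<theta>\<in>{0<..<pi}. \<exists>\<phi>\<in>{0<..<pi}. \<exists>I\<in>imag_units. \<exists>J\<in>imag_units.
       A \<in> conj_class (mat2 (r *\<^sub>R quat_cis I \<theta>) 0 0 (inverse r *\<^sub>R quat_cis J \<phi>)))"

definition regular_loxodromic_pair :: "qmat \<times> qmat \<Rightarrow> bool" where
  "regular_loxodromic_pair p \<longleftrightarrow>
    regular_loxodromic (fst p) \<and> regular_loxodromic (snd p) \<and>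
    fixed_points (fst p) \<inter> fixed_points (snd p) = {}"

definition normal_form_pairs :: "(qmat \<times> qmat) set" where
  "normal_form_pairs =
    {(mat2 (r *\<^sub>R quat_cis I \<theta>) 0 0 (inverse r *\<^sub>R quat_cis J \<phi>),
      conj_by ((norm (1 - w) powr (- 1 / 2)) *\<^sub>R mat2 1 w 1 1)
        (mat2 (s *\<^sub>R quat_cis K \<theta>') 0 0 (inverse s *\<^sub>R quat_cis L \<phi>'))) |
      r s \<theta> \<phi> \<theta>' \<phi>' I J K L w.
      r > 1 \<and> s > 1 \<and> {\<theta>, \<phi>, \<theta>', \<phi>'} \<subseteq> {0<..<pi} \<and>
      {I, J, K, L} \<subseteq> imag_units \<and> \<not> {I, J, K, L} \<subseteq> {quat_i, - quat_i} \<and>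
      (\<exists>x y. y > 0 \<and> w = of_real x + y *\<^sub>R quat_i)}"

definition M_reg :: "(qmat \<times> qmat) set set" where
  "M_reg = pair_class ` {p. regular_loxodromic_pair p \<and> (\<exists>q\<in>normal_form_pairs. p \<in> pair_class q)}"

text \<open>The words are in the order
  \<open>A, A\<inverse>, A\<^sup>2, B, B\<inverse>, B\<^sup>2, AB, AB\<inverse>, A\<inverse>B, A\<inverse>B\<inverse>, A\<^sup>2B, AB\<^sup>2, A\<^sup>2B\<^sup>2, ABAB\<inverse>, ABA\<inverse>B\<inverse>\<close>.\<close>

definition word_traces :: "qmat \<times> qmat \<Rightarrow> real^15" where
  "word_traces p =
    (let A = fst p; B = snd p; A' = matrix_inv A; B' = matrix_inv B
     in vector (map trH
       [A, A', A ** A, B, B', B ** B, A ** B, A ** B', A' ** B, A' ** B',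
        A ** A ** B, A ** B ** B, A ** A ** B ** B, A ** B ** A ** B', A ** B ** A' ** B']))"

text \<open>The traces are constant on a class (see \<open>trace_coords_pair_class\<close>), so the image below is a
  singleton.\<close>

definition trace_coords :: "(qmat \<times> qmat) set \<Rightarrow> real^15" where
  "trace_coords C = the_elem (word_traces ` C)"

lemma mat_1_in_SL2H: "mat 1 \<in> SL2H"
proof -
  have "invertible (mat 1 :: qmat)"
    unfolding invertible_def by (rule exI[of _ "mat 1"]) simp
  then show ?thesis
    by (simp add: SL2H_def dieudonne_det_def mat_def)
qed

lemma trH_mult_commute: "trH (X ** Y) = trH (Y ** X)"
  by (simp add: trH_def matrix_matrix_mult_def sum_2 times_quat_def plus_quat_def)

lemma matrix_inv_inverse:
  fixes X :: qmat
  assumes "invertible X"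
  shows "X ** matrix_inv X = mat 1" "matrix_inv X ** X = mat 1"
  using someI_ex[OF assms[unfolded invertible_def]] unfolding matrix_inv_def by blast+

lemma matrix_inv_SL2H:
  assumes "P \<in> SL2H"
  shows "P ** matrix_inv P = mat 1" "matrix_inv P ** P = mat 1"
  using assms matrix_inv_inverse by (auto simp: SL2H_def)

lemma trH_conj_by:
  assumes "P \<in> SL2H"
  shows "trH (conj_by P M) = trH M"
  by (metis assms conj_by_def matrix_inv_SL2H(2) matrix_mul_assoc matrix_mul_lid trH_mult_commute)

lemma conj_by_mult:
  assumes "P \<in> SL2H"
  shows "conj_by P (X ** Y) = conj_by P X ** conj_by P Y"
proof -
  have "conj_by P X ** conj_by P Y = P ** X ** (matrix_inv P ** P) ** Y ** matrix_inv P"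
    by (simp only: conj_by_def matrix_mul_assoc)
  then show ?thesis
    by (simp add: assms matrix_inv_SL2H conj_by_def matrix_mul_assoc)
qed

lemma matrix_inv_eqI:
  fixes X Y :: "qmat"
  assumes "X ** Y = mat 1" "Y ** X = mat 1"
  shows "matrix_inv X = Y"
  by (metis assms invertible_def matrix_inv_inverse(2) matrix_mul_assoc matrix_mul_lid matrix_mul_rid)

lemma matrix_inv_conj_by:
  assumes "P \<in> SL2H" "invertible X"
  shows "matrix_inv (conj_by P X) = conj_by P (matrix_inv X)"
proof (rule matrix_inv_eqI)
  have "conj_by P (mat 1) = mat 1"
    by (simp add: conj_by_def matrix_inv_SL2H assms)
  then show "conj_by P X ** conj_by P (matrix_inv X) = mat 1"
    "conj_by P (matrix_inv X) ** conj_by P X = mat 1"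
    by (simp_all add: conj_by_mult[symmetric] assms matrix_inv_inverse)
qed

lemma trace_coords_pair_class:
  assumes "A \<in> SL2H" "B \<in> SL2H"
  shows "trace_coords (pair_class (A, B)) = word_traces (A, B)"
proof -
  have inv: "invertible A" "invertible B" using assms by (simp_all add: SL2H_def)
  have "word_traces (conj_by P A, conj_by P B) = word_traces (A, B)" if "P \<in> SL2H" for P
    by (simp add: word_traces_def Let_def inv that matrix_inv_conj_by trH_conj_by
        flip: conj_by_mult)
  then have "word_traces ` pair_class (A, B) = {word_traces (A, B)}"
    using mat_1_in_SL2H by (auto simp: pair_class_def image_image intro: rev_image_eqI)
  then show ?thesis by (simp add: trace_coords_def)
qed


section \<open>Real-analytic functions and quotient charts\<close>

text \<open>Multi-indices are functions from the standard basis to \<open>nat\<close>.\<close>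

definition real_analytic_on :: "('a::euclidean_space \<Rightarrow> 'b::real_normed_vector) \<Rightarrow> 'a set \<Rightarrow> bool" where
  "real_analytic_on f S \<longleftrightarrow>
    (\<forall>x\<in>S. \<exists>e>0. \<exists>c. \<forall>y\<in>ball x e.
       ((\<lambda>m. (\<Prod>b\<in>Basis. ((y - x) \<bullet> b) ^ m b) *\<^sub>R c m) has_sum f y) (Basis \<rightarrow>\<^sub>E (UNIV :: nat set)))"

text \<open>Below, \<open>X\<close> is a partition of a subset \<open>\<Union>X\<close> of a Euclidean space. It carries the quotient
  topology of the subspace topology of \<open>\<Union>X\<close>, and a function on an open subset of \<open>X\<close> is real
  analytic if its pullback to \<open>\<Union>X\<close> extends locally to real-analytic functions on the ambient space.
  When \<open>\<Union>X\<close> is an analytic submanifold and the classes are the orbits of a free proper analytic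
  action, these are the topology and the real-analytic functions of the quotient manifold.
  A chart is an isomorphism from an open subset, with this structure, to an open subset of a
  Euclidean space.\<close>

definition quotient_open :: "'a::euclidean_space set set \<Rightarrow> 'a set set \<Rightarrow> bool" where
  "quotient_open X U \<longleftrightarrow> U \<subseteq> X \<and> openin (top_of_set (\<Union>X)) (\<Union>U)"

definition quotient_analytic_on :: "('a::euclidean_space set \<Rightarrow> real) \<Rightarrow> 'a set set \<Rightarrow> bool" where
  "quotient_analytic_on f U \<longleftrightarrow>
    (\<forall>p\<in>\<Union>U. \<exists>T g. open T \<and> p \<in> T \<and> real_analytic_on g T \<and> (\<forall>C\<in>U. \<forall>q\<in>C \<inter> T. g q = f C))"

definition analytic_chart ::
  "'a::euclidean_space set set \<Rightarrow> 'a set set \<Rightarrow> ('a set \<Rightarrow> 'n::euclidean_space) \<Rightarrow> bool" where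
  "analytic_chart X U \<phi> \<longleftrightarrow>
    quotient_open X U \<and> inj_on \<phi> U \<and> open (\<phi> ` U) \<and>
    (\<forall>W\<subseteq>U. quotient_open X W \<longleftrightarrow> open (\<phi> ` W)) \<and>
    (\<forall>W\<subseteq>U. \<forall>h :: 'n \<Rightarrow> real. quotient_open X W \<longrightarrow>
       (quotient_analytic_on (h \<circ> \<phi>) W \<longleftrightarrow> real_analytic_on h (\<phi> ` W)))"

text \<open>Invertibility of the differential of the trace map does not depend on the chart \<open>\<phi>\<close>.\<close>

definition trace_locus :: "(qmat \<times> qmat) set set" where
  "trace_locus = {C \<in> M_reg. \<exists>U (\<phi> :: _ \<Rightarrow> real^15) D.
     C \<in> U \<and> analytic_chart M_reg U \<phi> \<and>
     ((trace_coords \<circ> inv_into U \<phi>) has_derivative D) (at (\<phi> C)) \<and> bij D}"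

definition relative_deformation_space ::
  "qmat set \<Rightarrow> qmat set \<Rightarrow> qmat set \<Rightarrow> (qmat \<times> qmat) set set" where
  "relative_deformation_space \<A> \<B> \<C> =
    pair_class ` {(A', B'). A' \<in> SL2H \<and> B' \<in> SL2H \<and>
      A' \<in> \<A> \<and> B' \<in> \<B> \<and> matrix_inv (A' ** B') \<in> \<C>}"

end

theory Submission
  imports Defs "HOL-Complex_Analysis.Cauchy_Integral_Formula"
begin

text \<open>
  Conjugation fixes all traces, so the conditions \<open>A' \<in> [A]\<close>, \<open>B' \<in> [B]\<close>, \<open>(A'B')\<inverse> \<in> [(AB)\<inverse>]\<close> fix the
  values of trace functions. By the Cayley-Hamilton theorem an element \<open>M\<close> of \<open>SL(2,H)\<close> is a root of a real quartic
  whose coefficients are polynomials in \<open>tr M\<close>, \<open>tr M\<inverse>\<close>, \<open>tr M\<^sup>2\<close>. If \<open>M\<^sub>0\<close> is regular loxodromic, the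
  derivative of its quartic is invertible at \<open>M\<^sub>0\<close>, and the divided difference of the quartic at \<open>M\<close>, \<open>M\<^sub>0\<close>
  is then a matrix which depends continuously on \<open>M\<close> and conjugates \<open>M\<^sub>0\<close> into every nearby \<open>M\<close> with the same
  three traces (\<open>local_conjugator\<close>). Hence, near \<open>[(A,B)]\<close>, the relative deformation space is cut out by nine
  trace equations, three for each of \<open>A\<close>, \<open>B\<close> and \<open>N = (AB)\<inverse>\<close>.

  Eight of these nine traces are among the fifteen coordinates: the traces of \<open>A\<close>, \<open>A\<inverse>\<close>, \<open>A\<^sup>2\<close>, \<open>B\<close>,
  \<open>B\<inverse>\<close>, \<open>B\<^sup>2\<close>, of \<open>AB = N\<inverse>\<close>, and of \<open>A\<inverse>B\<inverse>\<close>, which is \<open>tr N\<close>. The ninth,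
  \<open>\<chi> = tr N\<^sup>2\<close>, is not. It is an analytic function of the fifteen coordinates, and its differential is independent
  of the eight others: move \<open>A\<close> along \<open>(1 + sX) A (1 + sX)\<inverse>\<close> with \<open>B\<close> fixed. If \<open>d\<chi>\<close> were a combination
  of the differentials of the eight coordinates, then a polynomial of degree two in \<open>N\<close> plus a multiple of \<open>N\<inverse>\<close>
  would commute with \<open>A\<close> and with \<open>B\<close>. As \<open>z(A) \<inter> z(B) = 0\<close> it would be a scalar, which contradicts
  the linear independence of \<open>1, N, N\<^sup>2, N\<^sup>3\<close> (\<open>third_trace_transversal\<close>). So some coordinate outside the eight
  can be exchanged for \<open>\<chi>\<close>, and the six coordinates that remain are local coordinates on the level set of the nine
  functions (\<open>level_set_chart\<close>). The map to \<open>real^6\<close> of the theorem is a linear projection of the trace vector.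

  The classes are sets of pairs, so these functions have to be compared with functions on pairs. For this an
  analytic section is needed, which assigns to a trace vector near that of \<open>(A,B)\<close> a pair in the corresponding class
  (\<open>trace_locus_section\<close>). It comes from an analytic slice of the conjugation action at \<open>(A,B)\<close>
  (\<open>analytic_slice\<close>), a chart of the quotient, and the inverse function theorem. An analytic section that inverts
  the coordinates gives a chart (\<open>analytic_chart_from_section\<close>). The quotient topology of the relative deformation space
  is the induced one because the set of pairs with a normal form is open in the set of all pairs with
  components in fixed conjugacy classes (\<open>Union_M_reg_locally_closed_under_conjugation\<close>).

  The inverse function theorem has to produce real-analytic inverses. Germs of real-analytic functions are therefore
  described as restrictions of bounded, separately holomorphic functions on a complex polydisc. This description
  is stable under composition, and Cauchy's estimates turn it back into a power series. The inverse is the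
  uniform limit of a Picard iteration that consists of such functions (\<open>real_analytic_inverse_function\<close>).
\<close>

section \<open>Power series of separately holomorphic functions\<close>

definition monomial_at :: "'i set \<Rightarrow> ('i \<Rightarrow> 'c::comm_monoid_mult) \<Rightarrow> ('i \<Rightarrow> nat) \<Rightarrow> 'c" where
  "monomial_at B z m = (\<Prod>b\<in>B. z b ^ m b)"

definition multi_degree :: "'i set \<Rightarrow> ('i \<Rightarrow> nat) \<Rightarrow> nat" where
  "multi_degree B m = (\<Sum>b\<in>B. m b)"

text \<open>
  Points have value \<open>0\<close> outside \<open>B\<close>, so that a function on the polydisc over \<open>insert b B\<close> restricts to the
  polydisc over \<open>B\<close> without any change of type.
\<close>

definition polydisc :: "'i set \<Rightarrow> real \<Rightarrow> ('i \<Rightarrow> complex) set" where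
  "polydisc B r = {z. (\<forall>b\<in>B. norm (z b) < r) \<and> (\<forall>b. b \<notin> B \<longrightarrow> z b = 0)}"

text \<open>
  Holomorphy in each variable separately is all that the proofs below manipulate; for bounded functions it gives
  joint power series by iterating the expansion in one variable.
\<close>

definition separately_holomorphic :: "'i set \<Rightarrow> real \<Rightarrow> (('i \<Rightarrow> complex) \<Rightarrow> complex) \<Rightarrow> bool" where
  "separately_holomorphic B r F \<longleftrightarrow>
    (\<forall>z\<in>polydisc B r. \<forall>b\<in>B. (\<lambda>\<zeta>. F (z(b := \<zeta>))) holomorphic_on ball 0 r)"

lemma monomial_at_insert:
  assumes "finite B" "b \<notin> B"
  shows "monomial_at (insert b B) z (m(b := k)) = z b ^ k * monomial_at B z m"
proof -
  have "(\<Prod>x\<in>B. z x ^ (m(b := k)) x) = (\<Prod>x\<in>B. z x ^ m x)"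
    using assms by (intro prod.cong) auto
  then show ?thesis using assms by (simp add: monomial_at_def)
qed

lemma multi_degree_insert:
  assumes "finite B" "b \<notin> B"
  shows "multi_degree (insert b B) (m(b := k)) = k + multi_degree B m"
proof -
  have "(\<Sum>x\<in>B. (m(b := k)) x) = (\<Sum>x\<in>B. m x)"
    using assms by (intro sum.cong) auto
  then show ?thesis using assms by (simp add: multi_degree_def)
qed

lemma monomial_at_cong: "(\<And>b. b \<in> B \<Longrightarrow> z b = w b) \<Longrightarrow> monomial_at B z m = monomial_at B w m"
  by (simp add: monomial_at_def)

lemma monomial_at_const: "monomial_at B (\<lambda>_. t) m = t ^ multi_degree B m"
  by (simp add: monomial_at_def multi_degree_def power_sum)

lemma norm_monomial_at:
  "norm (monomial_at B z m) = monomial_at B (\<lambda>b. norm (z b :: 'c::real_normed_field)) m"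
  by (simp add: monomial_at_def norm_power flip: prod_norm)

lemma monomial_at_mono:
  "(\<And>b. b \<in> B \<Longrightarrow> 0 \<le> x b \<and> x b \<le> (y b :: real)) \<Longrightarrow> monomial_at B x m \<le> monomial_at B y m"
  unfolding monomial_at_def by (intro prod_mono) (auto intro: power_mono)

lemma norm_monomial_at_le:
  "(\<And>b. b \<in> B \<Longrightarrow> norm (z b :: 'c::real_normed_field) \<le> t) \<Longrightarrow> norm (monomial_at B z m) \<le> t ^ multi_degree B m"
  unfolding norm_monomial_at monomial_at_const[symmetric] by (rule monomial_at_mono) auto

text \<open>
  Splits off one exponent from a multi-index, which lets sums over multi-indices be treated by induction on the
  number of variables.
\<close>

lemma has_sum_PiE_insert:
  assumes "b \<notin> B"
  shows "(f has_sum S) (insert b B \<rightarrow>\<^sub>E (UNIV::nat set)) \<longleftrightarrow>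
    ((\<lambda>(k, m). f (m(b := k))) has_sum S) (UNIV \<times> (B \<rightarrow>\<^sub>E UNIV))"
proof (rule sym, rule has_sum_reindex_bij_witness[where i = "\<lambda>m. (m b, m(b := undefined))" and j = "\<lambda>(k, m). m(b := k)"])
qed (use assms in \<open>auto simp: PiE_def extensional_def fun_eq_iff split: prod.splits\<close>)

lemma has_sum_geometric_real:
  fixes t :: real
  assumes "0 \<le> t" "t < 1"
  shows "((\<lambda>n. t ^ n) has_sum (1 / (1 - t))) UNIV"
  using assms by (intro sums_nonneg_imp_has_sum geometric_sums) auto

text \<open>
  The product of the geometric series in the single variables; it dominates every power series whose coefficients
  satisfy Cauchy's estimates.
\<close>

lemma multi_geometric:
  fixes t :: "'i \<Rightarrow> real"
  assumes "finite B" "\<And>b. b \<in> B \<Longrightarrow> 0 \<le> t b \<and> t b < 1"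
  shows "(monomial_at B t) summable_on (B \<rightarrow>\<^sub>E (UNIV::nat set))"
  using assms
proof (induction B rule: finite_induct)
  case empty
  then show ?case by simp
next
  case (insert b B)
  then have IH: "(monomial_at B t) summable_on (B \<rightarrow>\<^sub>E UNIV)" by simp
  have "(\<lambda>(k, m). t b ^ k * monomial_at B t m) summable_on (UNIV \<times> (B \<rightarrow>\<^sub>E UNIV))"
  proof (rule summable_on_SigmaI)
    show "((\<lambda>m. case (k, m) of (k, m) \<Rightarrow> t b ^ k * monomial_at B t m) has_sum
        (t b ^ k * infsum (monomial_at B t) (B \<rightarrow>\<^sub>E UNIV))) (B \<rightarrow>\<^sub>E UNIV)" for k
      using has_sum_cmult_right[OF has_sum_infsum[OF IH], of "t b ^ k"] by simp
    have "((\<lambda>k. t b ^ k) has_sum (1 / (1 - t b))) UNIV"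
      using insert.prems by (intro has_sum_geometric_real) auto
    from has_sum_cmult_left[OF this]
    show "(\<lambda>k. t b ^ k * infsum (monomial_at B t) (B \<rightarrow>\<^sub>E UNIV)) summable_on UNIV"
      by (auto simp: summable_on_def)
    show "0 \<le> (case (k, m) of (k, m) \<Rightarrow> t b ^ k * monomial_at B t m)" for k m
      using insert.prems by (auto simp: monomial_at_def intro!: mult_nonneg_nonneg prod_nonneg)
  qed
  then obtain S where S: "((\<lambda>(k, m). t b ^ k * monomial_at B t m) has_sum S) (UNIV \<times> (B \<rightarrow>\<^sub>E UNIV))"
    by (auto simp: summable_on_def)
  have "((\<lambda>(k, m). monomial_at (insert b B) t (m(b := k))) has_sum S) (UNIV \<times> (B \<rightarrow>\<^sub>E UNIV))"
    using S by (simp add: monomial_at_insert[OF insert.hyps])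
  then show ?case
    using has_sum_PiE_insert[OF insert.hyps(2), of "monomial_at (insert b B) t" S]
    by (auto simp: summable_on_def)
qed

lemma Cauchy_coefficient_bound:
  assumes "f holomorphic_on ball 0 \<rho>" "\<And>z. z \<in> ball 0 \<rho> \<Longrightarrow> norm (f z) \<le> M" "0 < r" "r < \<rho>"
  shows "norm ((deriv ^^ n) f 0 / fact n) \<le> M / r ^ n"
proof -
  have "cball 0 r \<subseteq> ball (0::complex) \<rho>" using assms by auto
  then have "norm ((deriv ^^ n) f 0) \<le> fact n * M / r ^ n"
    using assms by (intro Cauchy_inequality)
      (auto intro: holomorphic_on_subset continuous_on_subset holomorphic_on_imp_continuous_on)
  then show ?thesis using assms by (simp add: norm_divide field_simps)
qed

text \<open>
  The \<open>k\<close>-th Taylor coefficient is the limit of difference quotients that use only values of \<open>f\<close> and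
  lower coefficients. The explicit bound makes this limit uniform when \<open>f\<close> depends on parameters.
\<close>

lemma Taylor_remainder_quotient:
  assumes "f holomorphic_on ball 0 \<rho>" "\<And>z. z \<in> ball 0 \<rho> \<Longrightarrow> norm (f z) \<le> M" "0 < r" "r < \<rho>"
    and h: "h \<noteq> 0" "norm h \<le> r / 2"
  defines "c \<equiv> \<lambda>j. (deriv ^^ j) f 0 / fact j"
  shows "norm ((f h - (\<Sum>j<k. c j * h ^ j)) / h ^ k - c k) \<le> 2 * M * norm h / r ^ Suc k"
proof -
  have c: "norm (c j) \<le> M / r ^ j" for j
    unfolding c_def by (rule Cauchy_coefficient_bound) (use assms in auto)
  have "(\<lambda>j. c j * (h - 0) ^ j) sums f h"
    unfolding c_def by (rule holomorphic_power_series) (use assms in auto)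
  then have "(\<lambda>j. c (j + Suc k) * h ^ (j + Suc k)) sums (f h - (\<Sum>j<Suc k. c j * h ^ j))"
    by (intro sums_split_initial_segment) auto
  from sums_divide[OF this, of "h ^ k"]
  have s: "(\<lambda>j. c (j + Suc k) * h ^ Suc j) sums ((f h - (\<Sum>j<k. c j * h ^ j)) / h ^ k - c k)"
    using h by (simp add: power_add field_simps)
  have g: "(\<lambda>j. M * norm h / r ^ Suc k * (norm h / r) ^ j) sums (M * norm h / r ^ Suc k * (1 / (1 - norm h / r)))"
    using h \<open>0 < r\<close> by (intro sums_mult geometric_sums) (auto simp: field_simps)
  have le: "norm (c (j + Suc k) * h ^ Suc j) \<le> M * norm h / r ^ Suc k * (norm h / r) ^ j" for j
  proof -
    have "norm (c (j + Suc k)) * norm h ^ Suc j \<le> M / r ^ (j + Suc k) * norm h ^ Suc j"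
      by (intro mult_right_mono c) auto
    also have "\<dots> = M * norm h / r ^ Suc k * (norm h / r) ^ j"
      by (simp add: power_add power_divide field_simps)
    finally show ?thesis by (simp add: norm_mult norm_power)
  qed
  have "norm ((f h - (\<Sum>j<k. c j * h ^ j)) / h ^ k - c k) \<le> M * norm h / r ^ Suc k * (1 / (1 - norm h / r))"
    using norm_suminf_le[OF le sums_summable[OF g]] s g by (simp add: sums_iff)
  also have "\<dots> \<le> M * norm h / r ^ Suc k * 2"
  proof (rule mult_left_mono)
    show "1 / (1 - norm h / r) \<le> 2" using h \<open>0 < r\<close> by (simp add: field_simps)
    have "0 \<le> M" using order_trans[OF norm_ge_zero assms(2)[of 0]] assms(3,4) by simp
    then show "0 \<le> M * norm h / r ^ Suc k" using \<open>0 < r\<close> by simp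
  qed
  finally show ?thesis by (simp add: mult_ac)
qed

lemma polydisc_update:
  "z \<in> polydisc B \<rho> \<Longrightarrow> norm \<zeta> < \<rho> \<Longrightarrow> z(b := \<zeta>) \<in> polydisc (insert b B) \<rho>"
  by (auto simp: polydisc_def)

lemma separately_holomorphic_uniform_limit:
  assumes "\<And>n::nat. separately_holomorphic B \<rho> (F n)"
    and "\<And>n z. z \<in> polydisc B \<rho> \<Longrightarrow> norm (F n z - G z) \<le> e n" "e \<longlonglongrightarrow> 0"
  shows "separately_holomorphic B \<rho> G"
  unfolding separately_holomorphic_def
proof (intro ballI)
  fix z b assume z: "z \<in> polydisc B \<rho>" and b: "b \<in> B"
  show "(\<lambda>\<zeta>. G (z(b := \<zeta>))) holomorphic_on ball 0 \<rho>"
  proof (rule holomorphic_uniform_sequence)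
    show "(\<lambda>\<zeta>. F n (z(b := \<zeta>))) holomorphic_on ball 0 \<rho>" for n
      using assms(1) z b by (auto simp: separately_holomorphic_def)
    fix x :: complex assume "x \<in> ball 0 \<rho>"
    then obtain d where d: "d > 0" "cball x d \<subseteq> ball 0 \<rho>"
      using open_contains_cball[of "ball (0::complex) \<rho>"] open_ball by blast
    have le: "norm (F n (z(b := \<zeta>)) - G (z(b := \<zeta>))) \<le> e n" if "\<zeta> \<in> cball x d" for n \<zeta>
    proof (rule assms(2))
      have "norm \<zeta> < \<rho>" using that d(2) by auto
      then show "z(b := \<zeta>) \<in> polydisc B \<rho>"
        using polydisc_update[OF z, of \<zeta> b] b by (simp add: insert_absorb)
    qed
    have "uniform_limit (cball x d) (\<lambda>n \<zeta>. F n (z(b := \<zeta>))) (\<lambda>\<zeta>. G (z(b := \<zeta>))) sequentially"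
      unfolding uniform_limit_iff dist_norm
    proof (intro allI impI)
      fix \<epsilon> :: real assume "0 < \<epsilon>"
      from order_tendstoD(2)[OF assms(3) this]
      show "\<forall>\<^sub>F n in sequentially. \<forall>\<zeta>\<in>cball x d. norm (F n (z(b := \<zeta>)) - G (z(b := \<zeta>))) < \<epsilon>"
      proof eventually_elim
        case (elim n)
        then show ?case using le le_less_trans by blast
      qed
    qed
    then show "\<exists>d>0. cball x d \<subseteq> ball 0 \<rho> \<and>
        uniform_limit (cball x d) (\<lambda>n \<zeta>. F n (z(b := \<zeta>))) (\<lambda>\<zeta>. G (z(b := \<zeta>))) sequentially"
      using d by blast
  qed auto
qed

text \<open>
  The coefficients of the expansion in one variable are holomorphic in the other variables, because
  by the previous estimate they are uniform limits of functions that are.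
\<close>

lemma separately_holomorphic_Taylor_coefficient:
  assumes b: "b \<notin> B" and F: "separately_holomorphic (insert b B) \<rho> F"
    and M: "\<And>z. z \<in> polydisc (insert b B) \<rho> \<Longrightarrow> norm (F z) \<le> M" and r: "0 < r" "r < \<rho>"
  shows "separately_holomorphic B \<rho> (\<lambda>z. (deriv ^^ k) (\<lambda>w. F (z(b := w))) 0 / fact k)"
proof (induction k rule: less_induct)
  case (less k)
  define a where "a = (\<lambda>j z. (deriv ^^ j) (\<lambda>w. F (z(b := w))) 0 / fact j)"
  define h where "h = (\<lambda>n::nat. complex_of_real (r / (2 * real (Suc n))))"
  have h: "h n \<noteq> 0" "norm (h n) = r / (2 * real (Suc n))" "norm (h n) \<le> r / 2" "norm (h n) < \<rho>" for n
  proof -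
    show "h n \<noteq> 0" using r unfolding h_def of_real_eq_0_iff by simp
    show *: "norm (h n) = r / (2 * real (Suc n))" using r unfolding h_def norm_of_real by simp
    have "r / (2 * real (Suc n)) \<le> r / 2" using r by (intro divide_left_mono) auto
    then show "norm (h n) \<le> r / 2" "norm (h n) < \<rho>" using r unfolding * by linarith+
  qed
  have "separately_holomorphic B \<rho> (a k)"
  proof (rule separately_holomorphic_uniform_limit)
    show "separately_holomorphic B \<rho> (\<lambda>z. (F (z(b := h n)) - (\<Sum>j<k. a j z * h n ^ j)) / h n ^ k)" for n
      unfolding separately_holomorphic_def
    proof (intro ballI)
      fix z b' assume z: "z \<in> polydisc B \<rho>" and b': "b' \<in> B"
      have "z(b := h n) \<in> polydisc (insert b B) \<rho>" by (rule polydisc_update[OF z h(4)])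
      then have 1: "(\<lambda>\<zeta>. F (z(b := h n, b' := \<zeta>))) holomorphic_on ball 0 \<rho>"
        using F b' unfolding separately_holomorphic_def by blast
      have "b \<noteq> b'" using b b' by auto
      then have "z(b := h n, b' := \<zeta>) = z(b' := \<zeta>, b := h n)" for \<zeta> by (rule fun_upd_twist)
      with 1 have 1: "(\<lambda>\<zeta>. F (z(b' := \<zeta>, b := h n))) holomorphic_on ball 0 \<rho>" by simp
      have 2: "(\<lambda>\<zeta>. a j (z(b' := \<zeta>))) holomorphic_on ball 0 \<rho>" if "j < k" for j
        using less[OF that] z b' unfolding separately_holomorphic_def a_def by blast
      show "(\<lambda>\<zeta>. (F (z(b' := \<zeta>, b := h n)) - (\<Sum>j<k. a j (z(b' := \<zeta>)) * h n ^ j)) / h n ^ k) holomorphic_on ball 0 \<rho>"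
        using h by (intro holomorphic_intros 1 2) auto
    qed
    show "norm ((F (z(b := h n)) - (\<Sum>j<k. a j z * h n ^ j)) / h n ^ k - a k z) \<le> 2 * M * norm (h n) / r ^ Suc k"
      if z: "z \<in> polydisc B \<rho>" for n z
      unfolding a_def
    proof (rule Taylor_remainder_quotient)
      have "z(b := 0) = z" using z b by (auto simp: polydisc_def)
      then have "z \<in> polydisc (insert b B) \<rho>" using polydisc_update[OF z, of 0 b] r by simp
      then show "(\<lambda>w. F (z(b := w))) holomorphic_on ball 0 \<rho>"
        using F unfolding separately_holomorphic_def by blast
      show "norm (F (z(b := w))) \<le> M" if "w \<in> ball 0 \<rho>" for w
        using that by (intro M polydisc_update[OF z]) auto
    qed (use h r in auto)
    have "(\<lambda>n. 2 * M / r ^ Suc k * (r / 2) * inverse (real (Suc n))) \<longlonglongrightarrow> 2 * M / r ^ Suc k * (r / 2) * 0"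
      by (intro tendsto_intros LIMSEQ_inverse_real_of_nat)
    moreover have "2 * M / r ^ Suc k * (r / 2) * inverse (real (Suc n)) = 2 * M * norm (h n) / r ^ Suc k" for n
      unfolding h(2) by (simp only: divide_inverse inverse_mult_distrib mult_ac)
    ultimately show "(\<lambda>n. 2 * M * norm (h n) / r ^ Suc k) \<longlonglongrightarrow> 0" by (simp only: mult_zero_right)
  qed
  then show ?case unfolding a_def .
qed

text \<open>
  Expand in one variable, then expand every coefficient in the remaining ones by induction. The Cauchy
  estimates multiply, so the iterated sum converges absolutely and may be rearranged into a sum over multi-indices.
\<close>

lemma power_series_of_separately_holomorphic:
  assumes "finite B" "separately_holomorphic B \<rho> F"
    and "\<And>z. z \<in> polydisc B \<rho> \<Longrightarrow> norm (F z) \<le> M" and r: "0 < r" "r < \<rho>"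
  shows "\<exists>c. (\<forall>m. norm (c m) \<le> M / r ^ multi_degree B m) \<and>
    (\<forall>z\<in>polydisc B r. ((\<lambda>m. c m * monomial_at B z m) has_sum F z) (B \<rightarrow>\<^sub>E (UNIV::nat set)))"
  using assms(1-3)
proof (induction B arbitrary: F M rule: finite_induct)
  case empty
  show ?case
    by (rule exI[of _ "\<lambda>_. F (\<lambda>_. 0)"])
      (use empty(2)[of "\<lambda>_. 0"] in \<open>auto simp: polydisc_def multi_degree_def monomial_at_def fun_eq_iff[symmetric] intro!: has_sum_finiteI\<close>)
next
  case (insert b B)
  define a where "a = (\<lambda>k z. (deriv ^^ k) (\<lambda>w. F (z(b := w))) 0 / fact k)"
  have slice: "(\<lambda>w. F (z(b := w))) holomorphic_on ball 0 \<rho>" "w \<in> ball 0 \<rho> \<Longrightarrow> norm (F (z(b := w))) \<le> M"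
    if z: "z \<in> polydisc B \<rho>" for z w
  proof -
    have "z(b := 0) = z" using z insert.hyps by (auto simp: polydisc_def)
    then have "z \<in> polydisc (insert b B) \<rho>" using polydisc_update[OF z, of 0 b] r by simp
    then show "(\<lambda>w. F (z(b := w))) holomorphic_on ball 0 \<rho>"
      using insert.prems(1) unfolding separately_holomorphic_def by blast
    show "norm (F (z(b := w))) \<le> M" if "w \<in> ball 0 \<rho>" for w
      using that by (intro insert.prems(2) polydisc_update[OF z]) auto
  qed
  have a_bound: "norm (a k z) \<le> M / r ^ k" if "z \<in> polydisc B \<rho>" for k z
    unfolding a_def by (rule Cauchy_coefficient_bound[OF slice(1)[OF that] slice(2)[OF that] r])
  have "\<exists>c. (\<forall>m. norm (c m) \<le> M / r ^ k / r ^ multi_degree B m) \<and>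
    (\<forall>z\<in>polydisc B r. ((\<lambda>m. c m * monomial_at B z m) has_sum a k z) (B \<rightarrow>\<^sub>E (UNIV::nat set)))" for k
  proof (rule insert.IH)
    show "separately_holomorphic B \<rho> (a k)"
      unfolding a_def by (rule separately_holomorphic_Taylor_coefficient[OF insert.hyps(2) insert.prems r])
  qed (rule a_bound)
  then obtain c where c: "\<And>k m. norm (c k m) \<le> M / r ^ k / r ^ multi_degree B m"
    "\<And>k z. z \<in> polydisc B r \<Longrightarrow> ((\<lambda>m. c k m * monomial_at B z m) has_sum a k z) (B \<rightarrow>\<^sub>E (UNIV::nat set))"
    by metis
  (* multi-indices over B have the value undefined at b *)
  define C where "C = (\<lambda>m. c (m b) (m(b := undefined)))"
  have C: "C (m(b := k)) = c k m" if "m \<in> B \<rightarrow>\<^sub>E UNIV" for m k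
  proof -
    have "m(b := undefined) = m" using that insert.hyps by (auto simp: PiE_def extensional_def)
    then show ?thesis by (simp add: C_def)
  qed
  show ?case
  proof (intro exI[of _ C] conjI allI ballI)
    fix m
    have d: "multi_degree (insert b B) m = m b + multi_degree B (m(b := undefined))"
      using multi_degree_insert[OF insert.hyps, of "m(b := undefined)" "m b"] by simp
    show "norm (C m) \<le> M / r ^ multi_degree (insert b B) m"
      using c(1)[of "m b" "m(b := undefined)"] unfolding C_def d power_add by simp
  next
    fix z assume z: "z \<in> polydisc (insert b B) r"
    define y where "y = z(b := 0)"
    have y: "y \<in> polydisc B r" "y \<in> polydisc B \<rho>"
      using z r by (auto simp: polydisc_def y_def intro: less_trans)
    have zb: "norm (z b) < r" using z by (simp add: polydisc_def)
    have mon: "monomial_at B z m = monomial_at B y m" for m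
      using insert.hyps by (intro monomial_at_cong) (auto simp: y_def)
    define t where "t = (\<lambda>b. norm (z b) / r)"
    have t: "0 \<le> t x \<and> t x < 1" if "x \<in> insert b B" for x
      using z that r by (auto simp: t_def polydisc_def)
    have "(\<lambda>m. M * monomial_at (insert b B) t m) summable_on (insert b B \<rightarrow>\<^sub>E UNIV)"
      using t insert.hyps by (intro summable_on_cmult_right multi_geometric) auto
    moreover have "norm (C m * monomial_at (insert b B) z m) \<le> M * monomial_at (insert b B) t m" for m
    proof -
      have d: "multi_degree (insert b B) m = m b + multi_degree B (m(b := undefined))"
        using multi_degree_insert[OF insert.hyps, of "m(b := undefined)" "m b"] by simp
      have "norm (C m) \<le> M / r ^ multi_degree (insert b B) m"
        using c(1)[of "m b" "m(b := undefined)"] unfolding C_def d power_add by simp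
      then have "norm (C m * monomial_at (insert b B) z m) \<le>
          M / r ^ multi_degree (insert b B) m * monomial_at (insert b B) (\<lambda>b. norm (z b)) m"
        unfolding norm_mult norm_monomial_at
        by (intro mult_right_mono) (auto simp: monomial_at_def intro: prod_nonneg)
      also have "\<dots> = M * monomial_at (insert b B) t m"
        by (simp add: monomial_at_def t_def multi_degree_def power_divide prod_dividef power_sum)
      finally show ?thesis .
    qed
    ultimately have "(\<lambda>m. norm (C m * monomial_at (insert b B) z m)) summable_on (insert b B \<rightarrow>\<^sub>E UNIV)"
      by (rule Infinite_Sum.abs_summable_on_comparison_test')
    then have "(\<lambda>m. C m * monomial_at (insert b B) z m) summable_on (insert b B \<rightarrow>\<^sub>E UNIV)"
      by (rule abs_summable_summable)
    then obtain S where S: "((\<lambda>m. C m * monomial_at (insert b B) z m) has_sum S) (insert b B \<rightarrow>\<^sub>E UNIV)"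
      by (auto simp: summable_on_def)
    from S[unfolded has_sum_PiE_insert[OF insert.hyps(2)]]
    have S2: "((\<lambda>k. a k y * z b ^ k) has_sum S) UNIV"
    proof (rule has_sum_SigmaD)
      fix k
      have "((\<lambda>m. c k m * monomial_at B y m * z b ^ k) has_sum a k y * z b ^ k) (B \<rightarrow>\<^sub>E UNIV)"
        by (intro has_sum_cmult_left c(2) y)
      then show "((\<lambda>m. case (k, m) of (k, m) \<Rightarrow> C (m(b := k)) * monomial_at (insert b B) z (m(b := k)))
          has_sum a k y * z b ^ k) (B \<rightarrow>\<^sub>E UNIV)"
        by (rule has_sum_cong[THEN iffD1, rotated])
          (simp add: C monomial_at_insert[OF insert.hyps] mon mult_ac)
    qed
    have "(\<lambda>k. a k y * (z b - 0) ^ k) sums F (y(b := z b))"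
      unfolding a_def by (rule holomorphic_power_series[OF slice(1)[OF y(2)]]) (use zb r in auto)
    then have "S = F z"
      using has_sum_imp_sums[OF S2] by (auto simp: y_def intro: sums_unique2)
    with S show "((\<lambda>m. C m * monomial_at (insert b B) z m) has_sum F z) (insert b B \<rightarrow>\<^sub>E UNIV)" by simp
  qed
qed

section \<open>Real-analytic functions\<close>

abbreviation multi_indices :: "'i set \<Rightarrow> ('i \<Rightarrow> nat) set" where
  "multi_indices B \<equiv> B \<rightarrow>\<^sub>E (UNIV :: nat set)"

text \<open>
  The coordinates of a real vector, as a point of a complex polydisc.
\<close>

definition complex_coords :: "'a::euclidean_space \<Rightarrow> 'a \<Rightarrow> complex" where
  "complex_coords h = (\<lambda>b. if b \<in> Basis then of_real (h \<bullet> b) else 0)"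

definition multi_series :: "'i set \<Rightarrow> (('i \<Rightarrow> nat) \<Rightarrow> real) \<Rightarrow> ('i \<Rightarrow> complex) \<Rightarrow> complex" where
  "multi_series B c z = (\<Sum>\<^sub>\<infinity>m\<in>multi_indices B. of_real (c m) * monomial_at B z m)"

definition summable_at_radius :: "'i set \<Rightarrow> real \<Rightarrow> (('i \<Rightarrow> nat) \<Rightarrow> real) \<Rightarrow> bool" where
  "summable_at_radius B \<rho> c \<longleftrightarrow> 0 < \<rho> \<and> (\<lambda>m. \<bar>c m\<bar> * \<rho> ^ multi_degree B m) summable_on multi_indices B"

text \<open>
  Real-analyticity at a point, expressed through a bounded holomorphic extension of the function to a complex
  polydisc instead of a power series. It is equivalent to the expansion (\<open>real_analytic_on_iff\<close>), but composition
  and limits can be handled without multiplying series.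
\<close>

definition analytic_germ :: "('a::euclidean_space \<Rightarrow> real) \<Rightarrow> 'a \<Rightarrow> bool" where
  "analytic_germ f x \<longleftrightarrow> (\<exists>\<rho>>0. \<exists>M F. separately_holomorphic Basis \<rho> F \<and>
     (\<forall>z\<in>polydisc Basis \<rho>. norm (F z) \<le> M) \<and>
     (\<forall>h. complex_coords h \<in> polydisc Basis \<rho> \<longrightarrow> F (complex_coords h) = of_real (f (x + h))))"

definition power_series_at :: "('a::euclidean_space \<Rightarrow> real) \<Rightarrow> 'a \<Rightarrow> real \<Rightarrow> (('a \<Rightarrow> nat) \<Rightarrow> real) \<Rightarrow> bool" where
  "power_series_at f x \<rho> c \<longleftrightarrow> summable_at_radius Basis \<rho> c \<and>
     (\<forall>h. (\<forall>b\<in>Basis. \<bar>h \<bullet> b\<bar> \<le> \<rho>) \<longrightarrow> of_real (f (x + h)) = multi_series Basis c (complex_coords h))"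

lemma complex_coords_in_polydisc:
  "complex_coords h \<in> polydisc Basis \<rho> \<longleftrightarrow> (\<forall>b\<in>Basis. \<bar>h \<bullet> b\<bar> < \<rho>)"
  by (auto simp: complex_coords_def polydisc_def)

lemma monomial_at_of_real: "monomial_at B (\<lambda>b. of_real (z b)) m = (of_real (monomial_at B z m) :: complex)"
  by (simp add: monomial_at_def)

lemma monomial_at_complex_coords:
  "monomial_at Basis (complex_coords h) m = of_real (monomial_at Basis (\<lambda>b. h \<bullet> b) m)"
  unfolding monomial_at_of_real[symmetric] by (intro monomial_at_cong) (simp add: complex_coords_def)

lemma monomial_diff_bound:
  fixes z w :: "'i \<Rightarrow> complex"
  assumes "finite B" "0 < s" and z: "\<And>b. b \<in> B \<Longrightarrow> norm (z b) \<le> s" and w: "\<And>b. b \<in> B \<Longrightarrow> norm (w b) \<le> s"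
  shows "norm (monomial_at B z m - monomial_at B w m) \<le>
    s ^ multi_degree B m * real (multi_degree B m) / s * (\<Sum>b\<in>B. norm (z b - w b))"
proof -
  define z' w' where "z' = (\<lambda>b. z b / of_real s)" and "w' = (\<lambda>b. w b / of_real s)"
  have n: "norm (z' b) \<le> 1" "norm (w' b) \<le> 1" if "b \<in> B" for b
    using z[OF that] w[OF that] assms(2) by (simp_all add: z'_def w'_def norm_divide)
  have sc: "monomial_at B v m = of_real (s ^ multi_degree B m) * monomial_at B (\<lambda>b. v b / of_real s) m" for v :: "'i \<Rightarrow> complex"
    unfolding monomial_at_const[symmetric] monomial_at_of_real[symmetric]
    unfolding monomial_at_def prod.distrib[symmetric] of_real_prod
    using assms(2) by (intro prod.cong) (simp_all flip: power_mult_distrib)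
  have "norm (monomial_at B z' m - monomial_at B w' m) \<le> (\<Sum>b\<in>B. norm (z' b ^ m b - w' b ^ m b))"
    unfolding monomial_at_def by (intro norm_prod_diff) (auto simp: norm_power n intro!: power_le_one)
  also have "\<dots> \<le> (\<Sum>b\<in>B. real (multi_degree B m) * (norm (z b - w b) / s))"
  proof (rule sum_mono)
    fix b assume b: "b \<in> B"
    have "norm (z' b ^ m b - w' b ^ m b) \<le> real (m b) * norm (z' b - w' b)"
      by (intro norm_power_diff n b)
    also have "norm (z' b - w' b) = norm (z b - w b) / s"
      using assms(2) by (simp add: z'_def w'_def norm_divide flip: diff_divide_distrib)
    also have "real (m b) * (norm (z b - w b) / s) \<le> real (multi_degree B m) * (norm (z b - w b) / s)"
      using assms(1,2) b by (intro mult_right_mono) (auto simp: multi_degree_def intro: member_le_sum)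
    finally show "norm (z' b ^ m b - w' b ^ m b) \<le> real (multi_degree B m) * (norm (z b - w b) / s)" .
  qed
  also have "\<dots> = real (multi_degree B m) / s * (\<Sum>b\<in>B. norm (z b - w b))"
    by (simp add: sum_distrib_left)
  finally have "s ^ multi_degree B m * norm (monomial_at B z' m - monomial_at B w' m) \<le>
      s ^ multi_degree B m * (real (multi_degree B m) / s * (\<Sum>b\<in>B. norm (z b - w b)))"
    using assms(2) by (intro mult_left_mono) auto
  moreover have "monomial_at B z m - monomial_at B w m =
      of_real (s ^ multi_degree B m) * (monomial_at B z' m - monomial_at B w' m)"
    unfolding sc[of z] sc[of w] z'_def w'_def by (simp add: algebra_simps)
  ultimately show ?thesis using assms(2) by (simp add: norm_mult norm_power mult_ac)
qed

lemma multi_series_has_sum: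
  assumes "summable_at_radius B \<rho> c" "\<And>b. b \<in> B \<Longrightarrow> norm (z b) \<le> \<rho>"
  shows "((\<lambda>m. of_real (c m) * monomial_at B z m) has_sum multi_series B c z) (multi_indices B)"
proof -
  have "(\<lambda>m. norm (of_real (c m) * monomial_at B z m)) summable_on multi_indices B"
    using assms(1) unfolding summable_at_radius_def
    by (intro Infinite_Sum.abs_summable_on_comparison_test'[where g = "\<lambda>m. \<bar>c m\<bar> * \<rho> ^ multi_degree B m"])
      (auto simp: norm_mult intro!: mult_left_mono norm_monomial_at_le assms(2))
  then show ?thesis
    unfolding multi_series_def by (rule has_sum_infsum[OF abs_summable_summable])
qed

lemma degree_times_power_le:
  assumes "0 < t" "t \<le> 1 / 2" "k \<le> n"
  shows "real n * t ^ n \<le> (2 * t) ^ k"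
proof -
  have "real n * t ^ n \<le> 2 ^ n * t ^ n"
    using assms of_nat_less_two_power[of n] by (intro mult_right_mono) (auto intro: less_imp_le)
  also have "\<dots> = (2 * t) ^ n" by (simp add: power_mult_distrib)
  also have "\<dots> \<le> (2 * t) ^ k" using assms by (intro power_decreasing) auto
  finally show ?thesis .
qed

text \<open>
  On the polydisc of radius \<open>t \<rho>\<close> the series without terms of degree below \<open>k\<close> has a Lipschitz constant of order
  \<open>t ^ (k - 1)\<close>. For \<open>k = 2\<close> it tends to \<open>0\<close> with \<open>t\<close>, which is what makes a remainder of second order a
  contraction.
\<close>

lemma multi_series_lipschitz:
  assumes "finite B" and c: "summable_at_radius B \<rho> c" and t: "0 < t" "t \<le> 1 / 2"
    and low: "\<And>m. m \<in> multi_indices B \<Longrightarrow> multi_degree B m < k \<Longrightarrow> c m = 0"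
    and z: "\<And>b. b \<in> B \<Longrightarrow> norm (z b) \<le> t * \<rho>" and w: "\<And>b. b \<in> B \<Longrightarrow> norm (w b) \<le> t * \<rho>"
  shows "norm (multi_series B c z - multi_series B c w) \<le>
    (\<Sum>\<^sub>\<infinity>m\<in>multi_indices B. \<bar>c m\<bar> * \<rho> ^ multi_degree B m) * ((2 * t) ^ k / (t * \<rho>) * (\<Sum>b\<in>B. norm (z b - w b)))"
proof -
  have \<rho>: "0 < \<rho>" and sm: "(\<lambda>m. \<bar>c m\<bar> * \<rho> ^ multi_degree B m) summable_on multi_indices B"
    using c by (auto simp: summable_at_radius_def)
  have "t * \<rho> \<le> \<rho>" using t \<rho> by (simp add: field_simps)
  then have zw: "\<And>b. b \<in> B \<Longrightarrow> norm (z b) \<le> \<rho>" "\<And>b. b \<in> B \<Longrightarrow> norm (w b) \<le> \<rho>"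
    using z w by (auto intro: order_trans)
  define \<Delta> where "\<Delta> = (\<Sum>b\<in>B. norm (z b - w b))"
  have \<Delta>: "0 \<le> \<Delta>" by (auto simp: \<Delta>_def intro: sum_nonneg)
  have "((\<lambda>m. of_real (c m) * monomial_at B z m - of_real (c m) * monomial_at B w m) has_sum
      (multi_series B c z - multi_series B c w)) (multi_indices B)"
    using has_sum_add[OF multi_series_has_sum[OF c zw(1)] has_sum_uminusI[OF multi_series_has_sum[OF c zw(2)]]]
    by simp
  moreover have "((\<lambda>m. \<bar>c m\<bar> * \<rho> ^ multi_degree B m * ((2 * t) ^ k / (t * \<rho>) * \<Delta>)) has_sum
      ((\<Sum>\<^sub>\<infinity>m\<in>multi_indices B. \<bar>c m\<bar> * \<rho> ^ multi_degree B m) * ((2 * t) ^ k / (t * \<rho>) * \<Delta>))) (multi_indices B)"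
    by (intro has_sum_cmult_left has_sum_infsum sm)
  moreover have "norm (of_real (c m) * monomial_at B z m - of_real (c m) * monomial_at B w m) \<le>
      \<bar>c m\<bar> * \<rho> ^ multi_degree B m * ((2 * t) ^ k / (t * \<rho>) * \<Delta>)" if m: "m \<in> multi_indices B" for m
  proof (cases "multi_degree B m < k")
    case True
    then show ?thesis using low[OF m] by simp
  next
    case False
    let ?d = "multi_degree B m"
    have "norm (monomial_at B z m - monomial_at B w m) \<le> (t * \<rho>) ^ ?d * real ?d / (t * \<rho>) * \<Delta>"
      unfolding \<Delta>_def using t \<rho> by (intro monomial_diff_bound assms(1) z w) auto
    also have "\<dots> = \<rho> ^ ?d * (real ?d * t ^ ?d) * (\<Delta> / (t * \<rho>))"
      by (simp add: power_mult_distrib)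
    also have "\<dots> \<le> \<rho> ^ ?d * (2 * t) ^ k * (\<Delta> / (t * \<rho>))"
      using False t \<rho> \<Delta> by (intro mult_right_mono mult_left_mono degree_times_power_le) auto
    finally have "\<bar>c m\<bar> * norm (monomial_at B z m - monomial_at B w m) \<le> \<bar>c m\<bar> * (\<rho> ^ ?d * (2 * t) ^ k * (\<Delta> / (t * \<rho>)))"
      by (intro mult_left_mono) auto
    then show ?thesis
      unfolding right_diff_distrib[symmetric] norm_mult norm_of_real by (simp add: mult_ac)
  qed
  ultimately show ?thesis unfolding \<Delta>_def by (rule norm_infsum_le)
qed

lemma holomorphic_multi_series:
  assumes c: "summable_at_radius B \<rho> c" and "open S"
    and hol: "\<And>b. b \<in> B \<Longrightarrow> G b holomorphic_on S"
    and bd: "\<And>b \<zeta>. b \<in> B \<Longrightarrow> \<zeta> \<in> S \<Longrightarrow> norm (G b \<zeta>) \<le> \<rho>"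
  shows "(\<lambda>\<zeta>. multi_series B c (\<lambda>b. G b \<zeta>)) holomorphic_on S"
proof -
  define f where "f = (\<lambda>X \<zeta>. \<Sum>m\<in>X. of_real (c m) * monomial_at B (\<lambda>b. G b \<zeta>) m)"
  define g where "g = (\<lambda>\<zeta>. multi_series B c (\<lambda>b. G b \<zeta>))"
  have u: "uniform_limit S f g (finite_subsets_at_top (multi_indices B))"
    unfolding f_def g_def
  proof (rule Weierstrass_m_test_general')
    show "(\<lambda>m. \<bar>c m\<bar> * \<rho> ^ multi_degree B m) summable_on multi_indices B"
      using c by (simp add: summable_at_radius_def)
    show "norm (of_real (c m) * monomial_at B (\<lambda>b. G b \<zeta>) m) \<le> \<bar>c m\<bar> * \<rho> ^ multi_degree B m" if "\<zeta> \<in> S" for m \<zeta>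
      using that by (auto simp: norm_mult intro!: mult_left_mono norm_monomial_at_le bd)
    show "((\<lambda>m. of_real (c m) * monomial_at B (\<lambda>b. G b \<zeta>) m) has_sum multi_series B c (\<lambda>b. G b \<zeta>)) (multi_indices B)"
      if "\<zeta> \<in> S" for \<zeta>
      using that by (intro multi_series_has_sum[OF c] bd)
  qed
  have f: "f X holomorphic_on S" for X
    unfolding f_def monomial_at_def by (intro holomorphic_intros hol)
  have "g field_differentiable (at x)" if x: "x \<in> S" for x
  proof -
    obtain d where d: "d > 0" "cball x d \<subseteq> S" using open_contains_cball_eq[OF \<open>open S\<close>] x by blast
    obtain "g holomorphic_on ball x d"
    proof (rule holomorphic_uniform_limit)
      show "\<forall>\<^sub>F X in finite_subsets_at_top (multi_indices B). continuous_on (cball x d) (f X) \<and> f X holomorphic_on ball x d"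
        using d ball_subset_cball[of x d]
        by (intro always_eventually allI conjI holomorphic_on_imp_continuous_on holomorphic_on_subset[OF f]) auto
      show "uniform_limit (cball x d) f g (finite_subsets_at_top (multi_indices B))"
        using u d(2) by (rule uniform_limit_on_subset)
    qed auto
    then show ?thesis using d(1) by (auto simp: holomorphic_on_open field_differentiable_def)
  qed
  then show ?thesis
    unfolding g_def[symmetric] holomorphic_on_def by (blast intro: field_differentiable_at_within)
qed

lemma separately_holomorphic_multi_series:
  assumes "summable_at_radius B' \<rho>' c" and G: "\<And>b'. b' \<in> B' \<Longrightarrow> separately_holomorphic B \<rho> (G b')"
    and bd: "\<And>b' z. b' \<in> B' \<Longrightarrow> z \<in> polydisc B \<rho> \<Longrightarrow> norm (G b' z) \<le> \<rho>'"
  shows "separately_holomorphic B \<rho> (\<lambda>z. multi_series B' c (\<lambda>b'. G b' z))"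
  unfolding separately_holomorphic_def
proof (intro ballI)
  fix z b assume z: "z \<in> polydisc B \<rho>" and b: "b \<in> B"
  show "(\<lambda>\<zeta>. multi_series B' c (\<lambda>b'. G b' (z(b := \<zeta>)))) holomorphic_on ball 0 \<rho>"
  proof (rule holomorphic_multi_series[OF assms(1)])
    show "(\<lambda>\<zeta>. G b' (z(b := \<zeta>))) holomorphic_on ball 0 \<rho>" if "b' \<in> B'" for b'
      using G[OF that] z b by (auto simp: separately_holomorphic_def)
    show "norm (G b' (z(b := \<zeta>))) \<le> \<rho>'" if "b' \<in> B'" "\<zeta> \<in> ball 0 \<rho>" for b' \<zeta>
      using polydisc_update[OF z, of \<zeta> b] that b by (intro bd) (auto simp: insert_absorb)
  qed auto
qed

lemma separately_holomorphic_coordinate: "separately_holomorphic B \<rho> (\<lambda>z. z b)"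
  unfolding separately_holomorphic_def
proof (intro ballI)
  fix z b'
  show "(\<lambda>\<zeta>. (z(b' := \<zeta>)) b) holomorphic_on ball 0 \<rho>" by (cases "b = b'") auto
qed

lemma norm_multi_series_le:
  assumes "summable_at_radius B \<rho> c" "\<And>b. b \<in> B \<Longrightarrow> norm (z b) \<le> \<rho>"
  shows "norm (multi_series B c z) \<le> (\<Sum>\<^sub>\<infinity>m\<in>multi_indices B. \<bar>c m\<bar> * \<rho> ^ multi_degree B m)"
  by (rule norm_infsum_le[OF multi_series_has_sum[OF assms] has_sum_infsum])
    (use assms in \<open>auto simp: norm_mult summable_at_radius_def intro!: mult_left_mono norm_monomial_at_le\<close>)

lemma summable_at_radius_subset:
  assumes "finite B" "0 < r" "\<And>m. norm (c m) \<le> M / r ^ multi_degree B m"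
  shows "summable_at_radius B (r / 2) c"
  unfolding summable_at_radius_def
proof
  have "(\<lambda>m. M * monomial_at B (\<lambda>_. 1 / 2) m) summable_on multi_indices B"
    using assms by (intro summable_on_cmult_right multi_geometric) auto
  moreover have "norm (c m * (r / 2) ^ multi_degree B m) \<le> M * monomial_at B (\<lambda>_. 1 / 2) m" for m
  proof -
    have "norm (c m) * (r / 2) ^ multi_degree B m \<le> M / r ^ multi_degree B m * (r / 2) ^ multi_degree B m"
      using assms by (intro mult_right_mono) auto
    also have "\<dots> = M * monomial_at B (\<lambda>_. 1 / 2) m"
      using assms(2) by (simp add: monomial_at_const power_divide)
    finally show ?thesis using assms(2) by (simp add: abs_mult)
  qed
  ultimately have "(\<lambda>m. norm (c m * (r / 2) ^ multi_degree B m)) summable_on multi_indices B"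
    by (rule Infinite_Sum.abs_summable_on_comparison_test')
  then show "(\<lambda>m. \<bar>c m\<bar> * (r / 2) ^ multi_degree B m) summable_on multi_indices B"
    using assms(2) by (simp add: abs_mult)
qed (use assms in auto)

text \<open>
  Cauchy's estimates bound the coefficients of the holomorphic extension. Their real parts are the coefficients of
  a real series with the same sum on real points.
\<close>

lemma power_series_of_germ:
  assumes "analytic_germ f x"
  shows "\<exists>\<rho> c. power_series_at f x \<rho> c"
proof -
  obtain \<rho> M F where F: "\<rho> > 0" "separately_holomorphic Basis \<rho> F" "\<And>z. z \<in> polydisc Basis \<rho> \<Longrightarrow> norm (F z) \<le> M"
    "\<And>h. complex_coords h \<in> polydisc Basis \<rho> \<Longrightarrow> F (complex_coords h) = of_real (f (x + h))"
    using assms unfolding analytic_germ_def by blast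
  define r where "r = \<rho> / 2"
  have r: "0 < r" "r < \<rho>" using F(1) by (auto simp: r_def)
  obtain c where c: "\<And>m. norm (c m) \<le> M / r ^ multi_degree Basis m"
    "\<And>z. z \<in> polydisc Basis r \<Longrightarrow> ((\<lambda>m. c m * monomial_at Basis z m) has_sum F z) (multi_indices Basis)"
    using power_series_of_separately_holomorphic[OF finite_Basis F(2,3) r] by blast
  have s: "summable_at_radius Basis (r / 2) (\<lambda>m. Re (c m))"
    by (rule summable_at_radius_subset[OF finite_Basis r(1), where M = M])
      (use c(1) abs_Re_le_cmod order_trans in \<open>fastforce simp: real_norm_def\<close>)
  moreover have "of_real (f (x + h)) = multi_series Basis (\<lambda>m. Re (c m)) (complex_coords h)"
    if h: "\<And>b. b \<in> Basis \<Longrightarrow> \<bar>h \<bullet> b\<bar> \<le> r / 2" for h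
  proof -
    have in_r: "complex_coords h \<in> polydisc Basis r" "complex_coords h \<in> polydisc Basis \<rho>"
      using r(1,2) h by (force simp: complex_coords_in_polydisc)+
    from has_sum_Re[OF c(2)[OF in_r(1)]]
    have "((\<lambda>m. Re (c m) * monomial_at Basis (\<lambda>b. h \<bullet> b) m) has_sum f (x + h)) (multi_indices Basis)"
      by (simp add: F(4)[OF in_r(2)] monomial_at_complex_coords)
    from has_sum_of_real[OF this]
    have "((\<lambda>m. of_real (Re (c m)) * monomial_at Basis (complex_coords h) m) has_sum of_real (f (x + h))) (multi_indices Basis)"
      by (simp add: monomial_at_complex_coords)
    then show ?thesis unfolding multi_series_def by (simp add: infsumI)
  qed
  ultimately show ?thesis unfolding power_series_at_def by blast
qed

text \<open>
  On a small polydisc the extension of the increment \<open>f (x + h) - f x\<close> stays as small as desired. This is what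
  allows the extension of an inner function to be inserted into the polydisc of an outer one.
\<close>

lemma germ_difference_small:
  assumes "power_series_at f x \<rho> c" "0 < \<epsilon>"
  shows "\<exists>\<delta>>0. \<exists>F. separately_holomorphic Basis \<delta> F \<and> (\<forall>z\<in>polydisc Basis \<delta>. norm (F z) \<le> \<epsilon>) \<and>
    (\<forall>h. complex_coords h \<in> polydisc Basis \<delta> \<longrightarrow> F (complex_coords h) = of_real (f (x + h) - f x))"
proof -
  have c: "summable_at_radius Basis \<rho> c" and \<rho>: "0 < \<rho>"
    and f: "\<And>h. (\<And>b. b \<in> Basis \<Longrightarrow> \<bar>h \<bullet> b\<bar> \<le> \<rho>) \<Longrightarrow> of_real (f (x + h)) = multi_series Basis c (complex_coords h)"
    using assms(1) by (auto simp: power_series_at_def summable_at_radius_def)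
  define K where "K = (\<Sum>\<^sub>\<infinity>m\<in>multi_indices Basis. \<bar>c m\<bar> * \<rho> ^ multi_degree Basis m)"
  have K: "0 \<le> K" unfolding K_def using \<rho> by (intro infsum_nonneg) auto
  define L where "L = K * (2 / \<rho>) * DIM('a)"
  have L: "0 \<le> L" using K \<rho> by (simp add: L_def)
  define \<delta> where "\<delta> = min (\<rho> / 2) (\<epsilon> / (L + 1))"
  have \<delta>: "0 < \<delta>" "\<delta> \<le> \<rho> / 2" "L * \<delta> \<le> \<epsilon>"
  proof -
    have "L * \<delta> \<le> L * (\<epsilon> / (L + 1))" using L by (intro mult_left_mono) (auto simp: \<delta>_def)
    also have "\<dots> \<le> \<epsilon>" using L assms(2) by (simp add: field_simps)
    finally show "L * \<delta> \<le> \<epsilon>" .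
    show "\<delta> \<le> \<rho> / 2" unfolding \<delta>_def by (rule min.cobounded1)
  qed (use \<rho> L assms(2) in \<open>auto simp: \<delta>_def\<close>)
  let ?F = "\<lambda>z. multi_series Basis c z - multi_series Basis c (\<lambda>_. 0)"
  have "separately_holomorphic Basis \<delta> (\<lambda>z. multi_series Basis c (\<lambda>b. z b))"
    using \<delta> \<rho> by (intro separately_holomorphic_multi_series[OF c] separately_holomorphic_coordinate)
      (force simp: polydisc_def)
  then have "separately_holomorphic Basis \<delta> ?F"
    unfolding separately_holomorphic_def by (auto intro!: holomorphic_intros)
  moreover have "norm (?F z) \<le> \<epsilon>" if z: "z \<in> polydisc Basis \<delta>" for z
  proof -
    have "norm (?F z) \<le> K * ((2 * (1/2)) ^ 0 / ((1/2) * \<rho>) * (\<Sum>b\<in>Basis. norm (z b - 0)))"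
      unfolding K_def using z \<delta> \<rho>
      by (intro multi_series_lipschitz[OF finite_Basis c]) (force simp: polydisc_def)+
    also have "\<dots> \<le> K * ((2 * (1/2)) ^ 0 / ((1/2) * \<rho>) * (\<Sum>b\<in>(Basis::'a set). \<delta>))"
      using z K \<rho> by (intro mult_left_mono sum_mono) (force simp: polydisc_def)+
    also have "\<dots> = L * \<delta>" by (simp add: L_def)
    finally show ?thesis using \<delta>(3) by simp
  qed
  moreover have "?F (complex_coords h) = of_real (f (x + h) - f x)" if "complex_coords h \<in> polydisc Basis \<delta>" for h
  proof -
    have "of_real (f (x + h)) = multi_series Basis c (complex_coords h)"
      using that \<delta> \<rho> by (intro f) (force simp: complex_coords_in_polydisc)
    moreover have "of_real (f (x + 0)) = multi_series Basis c (complex_coords (0::'a))"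
      using \<rho> by (intro f) auto
    moreover have "complex_coords (0::'a) = (\<lambda>_. 0)" by (auto simp: complex_coords_def)
    ultimately show ?thesis by simp
  qed
  ultimately show ?thesis using \<delta>(1) by blast
qed

lemma polydisc_mono: "\<rho>' \<le> \<rho> \<Longrightarrow> polydisc B \<rho>' \<subseteq> polydisc B \<rho>"
  by (auto simp: polydisc_def intro: less_le_trans)

lemma separately_holomorphic_mono:
  "separately_holomorphic B \<rho> F \<Longrightarrow> \<rho>' \<le> \<rho> \<Longrightarrow> separately_holomorphic B \<rho>' F"
  unfolding separately_holomorphic_def
proof (intro ballI)
  fix z b assume F: "\<forall>z\<in>polydisc B \<rho>. \<forall>b\<in>B. (\<lambda>\<zeta>. F (z(b := \<zeta>))) holomorphic_on ball 0 \<rho>"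
    and le: "\<rho>' \<le> \<rho>" and z: "z \<in> polydisc B \<rho>'" and b: "b \<in> B"
  have "(\<lambda>\<zeta>. F (z(b := \<zeta>))) holomorphic_on ball 0 \<rho>" using F b polydisc_mono[OF le] z by auto
  then show "(\<lambda>\<zeta>. F (z(b := \<zeta>))) holomorphic_on ball 0 \<rho>'"
    by (rule holomorphic_on_subset) (rule subset_ball[OF le])
qed

text \<open>
  The extension of the outer function is evaluated at the extensions of the increments of the inner components.
\<close>

lemma analytic_germ_compose:
  fixes f :: "'b::euclidean_space \<Rightarrow> real" and g :: "'a::euclidean_space \<Rightarrow> 'b"
  assumes "analytic_germ f (g x)" and "\<And>b. b \<in> Basis \<Longrightarrow> analytic_germ (\<lambda>y. g y \<bullet> b) x"
  shows "analytic_germ (\<lambda>y. f (g y)) x"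
proof -
  obtain \<rho> c where ps: "power_series_at f (g x) \<rho> c" using power_series_of_germ[OF assms(1)] by blast
  then have c: "summable_at_radius Basis \<rho> c" and \<rho>: "0 < \<rho>"
    and f: "\<And>h. (\<And>b. b \<in> Basis \<Longrightarrow> \<bar>h \<bullet> b\<bar> \<le> \<rho>) \<Longrightarrow> of_real (f (g x + h)) = multi_series Basis c (complex_coords h)"
    by (auto simp: power_series_at_def summable_at_radius_def)
  have "\<exists>\<delta>>0. \<exists>F. separately_holomorphic Basis \<delta> F \<and> (\<forall>z\<in>polydisc Basis \<delta>. norm (F z) \<le> \<rho>) \<and>
    (\<forall>h. complex_coords h \<in> polydisc Basis \<delta> \<longrightarrow> F (complex_coords h) = of_real (g (x + h) \<bullet> b - g x \<bullet> b))"
    if "b \<in> Basis" for b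
  proof -
    from power_series_of_germ[OF assms(2)[OF that]]
    obtain \<rho>' c' where "power_series_at (\<lambda>y. g y \<bullet> b) x \<rho>' c'" by (elim exE)
    from germ_difference_small[OF this \<rho>] show ?thesis .
  qed
  then obtain \<delta> G where G: "\<And>b. b \<in> Basis \<Longrightarrow> 0 < \<delta> b" "\<And>b. b \<in> Basis \<Longrightarrow> separately_holomorphic Basis (\<delta> b) (G b)"
    "\<And>b z. b \<in> Basis \<Longrightarrow> z \<in> polydisc Basis (\<delta> b) \<Longrightarrow> norm (G b z) \<le> \<rho>"
    "\<And>b h. b \<in> Basis \<Longrightarrow> complex_coords h \<in> polydisc Basis (\<delta> b) \<Longrightarrow>
       G b (complex_coords h) = of_real (g (x + h) \<bullet> b - g x \<bullet> b)"
    by metis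
  define \<mu> where "\<mu> = Min (\<delta> ` Basis)"
  have \<mu>: "0 < \<mu>" "\<And>b. b \<in> Basis \<Longrightarrow> \<mu> \<le> \<delta> b" using G(1) by (auto simp: \<mu>_def)
  have bd: "norm (G b z) \<le> \<rho>" if "b \<in> Basis" "z \<in> polydisc Basis \<mu>" for b z
    using G(3)[OF that(1)] that polydisc_mono[OF \<mu>(2)[OF that(1)]] by blast
  have "separately_holomorphic Basis \<mu> (\<lambda>z. multi_series Basis c (\<lambda>b. G b z))"
    by (intro separately_holomorphic_multi_series[OF c] separately_holomorphic_mono[OF G(2) \<mu>(2)] bd)
  moreover have "\<forall>z\<in>polydisc Basis \<mu>. norm (multi_series Basis c (\<lambda>b. G b z)) \<le>
      (\<Sum>\<^sub>\<infinity>m\<in>multi_indices Basis. \<bar>c m\<bar> * \<rho> ^ multi_degree Basis m)"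
    by (auto intro!: norm_multi_series_le[OF c] bd)
  moreover have "multi_series Basis c (\<lambda>b. G b (complex_coords h)) = of_real (f (g (x + h)))"
    if h: "complex_coords h \<in> polydisc Basis \<mu>" for h
  proof -
    let ?k = "g (x + h) - g x"
    have e: "G b (complex_coords h) = of_real (?k \<bullet> b)" if "b \<in> Basis" for b
      using G(4)[OF that] h polydisc_mono[OF \<mu>(2)[OF that]] by (auto simp: inner_diff_left)
    have "multi_series Basis c (\<lambda>b. G b (complex_coords h)) = multi_series Basis c (complex_coords ?k)"
      unfolding multi_series_def
      by (intro infsum_cong arg_cong2[where f = "(*)"] monomial_at_cong) (simp_all add: e, simp add: complex_coords_def)
    also have "\<dots> = of_real (f (g x + ?k))"
      using bd[OF _ h] by (intro f[symmetric]) (auto simp: e)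
    finally show ?thesis by simp
  qed
  ultimately show ?thesis unfolding analytic_germ_def using \<mu>(1) by blast
qed

lemma analytic_germ_of_extension:
  assumes "0 < \<rho>" "separately_holomorphic Basis \<rho> F" "\<And>z. z \<in> polydisc Basis \<rho> \<Longrightarrow> norm (F z) \<le> M"
    "\<And>h. complex_coords h \<in> polydisc Basis \<rho> \<Longrightarrow> F (complex_coords h) = of_real (f (x + h))"
  shows "analytic_germ f x"
  using assms unfolding analytic_germ_def by blast

text \<open>
  A polydisc about an interior point is contained in the given one, so that analyticity at one point gives
  analyticity nearby.
\<close>

lemma analytic_germ_recenter:
  fixes f :: "'a::euclidean_space \<Rightarrow> real"
  assumes \<rho>: "0 < \<rho>" and F: "separately_holomorphic Basis \<rho> F" and M: "\<And>z. z \<in> polydisc Basis \<rho> \<Longrightarrow> norm (F z) \<le> M"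
    and ext: "\<And>h. complex_coords h \<in> polydisc Basis \<rho> \<Longrightarrow> F (complex_coords h) = of_real (f (x + h))"
    and k: "complex_coords k \<in> polydisc Basis \<rho>"
  shows "analytic_germ f (x + k)"
proof -
  define \<delta> where "\<delta> = \<rho> - Max ((\<lambda>b. \<bar>k \<bullet> b\<bar>) ` Basis)"
  have "Max ((\<lambda>b. \<bar>k \<bullet> b\<bar>) ` Basis) < \<rho>" using k by (auto simp: complex_coords_in_polydisc)
  then have \<delta>: "0 < \<delta>" by (simp add: \<delta>_def)
  have \<delta>': "\<bar>k \<bullet> b\<bar> + \<delta> \<le> \<rho>" if "b \<in> Basis" for b
  proof -
    have "\<bar>k \<bullet> b\<bar> \<le> Max ((\<lambda>b. \<bar>k \<bullet> b\<bar>) ` Basis)" using that by (intro Max_ge) auto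
    then show ?thesis unfolding \<delta>_def by linarith
  qed
  define T where "T = (\<lambda>z b. z b + complex_coords k b)"
  have T: "T z \<in> polydisc Basis \<rho>" if "z \<in> polydisc Basis \<delta>" for z
  proof -
    have "norm (z b + complex_coords k b) < \<rho>" if b: "b \<in> Basis" for b
    proof -
      have "norm (z b + complex_coords k b) \<le> norm (z b) + \<bar>k \<bullet> b\<bar>"
        using norm_triangle_ineq[of "z b" "complex_coords k b"] b by (simp add: complex_coords_def)
      also have "\<dots> < \<delta> + \<bar>k \<bullet> b\<bar>" using \<open>z \<in> _\<close> b by (auto simp: polydisc_def)
      finally show ?thesis using \<delta>'[OF b] by simp
    qed
    then show ?thesis using that by (auto simp: polydisc_def T_def complex_coords_def)
  qed
  show ?thesis
  proof (rule analytic_germ_of_extension[OF \<delta>])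
    show "separately_holomorphic Basis \<delta> (\<lambda>z. F (T z))"
      unfolding separately_holomorphic_def
    proof (intro ballI)
      fix z :: "'a \<Rightarrow> complex" and b assume z: "z \<in> polydisc Basis \<delta>" and b: "b \<in> (Basis :: 'a set)"
      have "(\<lambda>\<xi>. F ((T z)(b := \<xi>))) holomorphic_on ball 0 \<rho>"
        using F T[OF z] b by (auto simp: separately_holomorphic_def)
      moreover have "(\<lambda>\<zeta>. \<zeta> + complex_coords k b) ` ball 0 \<delta> \<subseteq> ball 0 \<rho>"
      proof clarsimp
        fix \<zeta> :: complex assume "norm \<zeta> < \<delta>"
        then show "norm (\<zeta> + complex_coords k b) < \<rho>"
          using norm_triangle_ineq[of \<zeta> "complex_coords k b"] \<delta>'[OF b] b by (simp add: complex_coords_def)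
      qed
      ultimately have "(\<lambda>\<xi>. F ((T z)(b := \<xi>))) \<circ> (\<lambda>\<zeta>. \<zeta> + complex_coords k b) holomorphic_on ball 0 \<delta>"
        by (intro holomorphic_on_compose_gen[where t = "ball 0 \<rho>"] holomorphic_intros)
      moreover have "T (z(b := \<zeta>)) = (T z)(b := \<zeta> + complex_coords k b)" for \<zeta>
        by (auto simp: T_def)
      ultimately show "(\<lambda>\<zeta>. F (T (z(b := \<zeta>)))) holomorphic_on ball 0 \<delta>" by (simp add: o_def)
    qed
    show "norm (F (T z)) \<le> M" if "z \<in> polydisc Basis \<delta>" for z using M T that by blast
    show "F (T (complex_coords h)) = of_real (f (x + k + h))" if "complex_coords h \<in> polydisc Basis \<delta>" for h
    proof -
      have "T (complex_coords h) = complex_coords (k + h)"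
        by (auto simp: T_def complex_coords_def inner_add_left)
      then show ?thesis using ext[of "k + h"] T[OF that] by (simp add: add.assoc)
    qed
  qed
qed

lemma abs_inner_le_if_small: "norm h < d \<Longrightarrow> b \<in> Basis \<Longrightarrow> \<bar>h \<bullet> b\<bar> < d"
  using Basis_le_norm[of b h] by simp

text \<open>
  Passes from the cubes that are the real parts of polydiscs to the balls of the metric.
\<close>

lemma norm_lt_if_coords_small:
  fixes h :: "'a::euclidean_space"
  assumes "\<And>b. b \<in> Basis \<Longrightarrow> \<bar>h \<bullet> b\<bar> < d / DIM('a)"
  shows "norm h < d"
proof -
  have "norm h \<le> (\<Sum>b\<in>Basis. \<bar>h \<bullet> b\<bar>)" by (rule norm_le_l1)
  also have "\<dots> < (\<Sum>b\<in>(Basis::'a set). d / DIM('a))" by (intro sum_strict_mono assms) auto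
  finally show ?thesis by simp
qed

lemma analytic_germ_cong:
  fixes f g :: "'a::euclidean_space \<Rightarrow> real"
  assumes "analytic_germ f x" and "0 < d" and eq: "\<And>y. dist y x < d \<Longrightarrow> f y = g y"
  shows "analytic_germ g x"
proof -
  obtain \<rho> M F where F: "\<rho> > 0" "separately_holomorphic Basis \<rho> F" "\<And>z. z \<in> polydisc Basis \<rho> \<Longrightarrow> norm (F z) \<le> M"
    "\<And>h. complex_coords h \<in> polydisc Basis \<rho> \<Longrightarrow> F (complex_coords h) = of_real (f (x + h))"
    using assms(1) unfolding analytic_germ_def by blast
  define r where "r = min \<rho> (d / DIM('a))"
  have r: "0 < r" "r \<le> \<rho>" "r \<le> d / DIM('a)" using F(1) assms(2) by (auto simp: r_def)
  show ?thesis
  proof (rule analytic_germ_of_extension[OF r(1) separately_holomorphic_mono[OF F(2) r(2)]])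
    show "norm (F z) \<le> M" if "z \<in> polydisc Basis r" for z
      using F(3) polydisc_mono[OF r(2)] that by blast
    show "F (complex_coords h) = of_real (g (x + h))" if h: "complex_coords h \<in> polydisc Basis r" for h
    proof -
      have "norm h < d"
        using h r(3) by (intro norm_lt_if_coords_small) (auto simp: complex_coords_in_polydisc)
      then have "f (x + h) = g (x + h)" by (intro eq) (simp add: dist_norm)
      then show ?thesis using F(4)[of h] h polydisc_mono[OF r(2)] by auto
    qed
  qed
qed

lemma germ_of_power_series:
  assumes "power_series_at f x \<rho> c"
  shows "analytic_germ f x"
proof -
  have c: "summable_at_radius Basis \<rho> c" and \<rho>: "0 < \<rho>"
    and f: "\<And>h. (\<And>b. b \<in> Basis \<Longrightarrow> \<bar>h \<bullet> b\<bar> \<le> \<rho>) \<Longrightarrow> of_real (f (x + h)) = multi_series Basis c (complex_coords h)"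
    using assms(1) by (auto simp: power_series_at_def summable_at_radius_def)
  show ?thesis
  proof (rule analytic_germ_of_extension[OF \<rho>])
    show "separately_holomorphic Basis \<rho> (\<lambda>z. multi_series Basis c (\<lambda>b. z b))"
      by (intro separately_holomorphic_multi_series[OF c] separately_holomorphic_coordinate)
        (auto simp: polydisc_def less_imp_le)
    show "norm (multi_series Basis c (\<lambda>b. z b)) \<le>
        (\<Sum>\<^sub>\<infinity>m\<in>multi_indices Basis. \<bar>c m\<bar> * \<rho> ^ multi_degree Basis m)" if "z \<in> polydisc Basis \<rho>" for z
      using that by (intro norm_multi_series_le[OF c]) (auto simp: polydisc_def less_imp_le)
    show "multi_series Basis c (\<lambda>b. complex_coords h b) = of_real (f (x + h))"
      if "complex_coords h \<in> polydisc Basis \<rho>" for h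
      using that by (intro f[symmetric]) (auto simp: complex_coords_in_polydisc less_imp_le)
  qed
qed

lemma power_series_at_has_sum:
  assumes "power_series_at f x \<rho> c" "\<And>b. b \<in> Basis \<Longrightarrow> \<bar>h \<bullet> b\<bar> \<le> \<rho>"
  shows "((\<lambda>m. c m * monomial_at Basis (\<lambda>b. h \<bullet> b) m) has_sum f (x + h)) (multi_indices Basis)"
proof -
  have c: "summable_at_radius Basis \<rho> c"
    and f: "of_real (f (x + h)) = multi_series Basis c (complex_coords h)"
    using assms by (auto simp: power_series_at_def)
  have "((\<lambda>m. of_real (c m) * monomial_at Basis (complex_coords h) m) has_sum multi_series Basis c (complex_coords h)) (multi_indices Basis)"
    by (rule multi_series_has_sum[OF c]) (use assms(2) in \<open>simp add: complex_coords_def\<close>)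
  from has_sum_Re[OF this] show ?thesis
    by (simp add: monomial_at_complex_coords flip: f)
qed

definition analytic_at_point :: "('a::euclidean_space \<Rightarrow> 'b::euclidean_space) \<Rightarrow> 'a \<Rightarrow> bool" where
  "analytic_at_point f x \<longleftrightarrow> (\<forall>b\<in>Basis. analytic_germ (\<lambda>y. f y \<bullet> b) x)"

lemma analytic_at_point_real [simp]: "analytic_at_point f x \<longleftrightarrow> analytic_germ f x" for f :: "_ \<Rightarrow> real"
  by (simp add: analytic_at_point_def)

lemma has_sum_finite_sum:
  fixes f :: "'i \<Rightarrow> 'm \<Rightarrow> 'b::real_normed_vector"
  assumes "finite I" "\<And>i. i \<in> I \<Longrightarrow> (f i has_sum s i) A"
  shows "((\<lambda>m. \<Sum>i\<in>I. f i m) has_sum (\<Sum>i\<in>I. s i)) A"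
  using assms by (induction I rule: finite_induct) (auto intro: has_sum_add)

text \<open>
  Evaluating the series at the point all of whose increments equal \<open>\<rho>\<close> gives absolute convergence at radius
  \<open>\<rho>\<close>, because an unconditionally convergent series of reals converges absolutely. This bounds its complexification.
\<close>

lemma real_analytic_germ_imp_series:
  fixes f :: "'a::euclidean_space \<Rightarrow> real"
  assumes "0 < e"
    and c: "\<And>y. y \<in> ball x e \<Longrightarrow> ((\<lambda>m. monomial_at Basis (\<lambda>b. (y - x) \<bullet> b) m * c m) has_sum f y) (multi_indices Basis)"
  shows "analytic_germ f x"
proof -
  define d where "d = e / DIM('a)"
  have d: "0 < d" using assms(1) by (simp add: d_def)
  define \<rho> where "\<rho> = d / 2"
  have \<rho>: "0 < \<rho>" using d by (simp add: \<rho>_def)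
  have small: "x + h \<in> ball x e" if "\<And>b. b \<in> Basis \<Longrightarrow> \<bar>h \<bullet> b\<bar> \<le> \<rho>" for h :: 'a
  proof -
    have "\<rho> < e / DIM('a)" using d unfolding \<rho>_def d_def[symmetric] by linarith
    then have "norm h < e" using that by (intro norm_lt_if_coords_small) (auto intro: le_less_trans)
    then show ?thesis by (simp add: dist_norm)
  qed
  define k :: 'a where "k = (\<Sum>b\<in>Basis. \<rho> *\<^sub>R b)"
  have k: "k \<bullet> b = \<rho>" if "b \<in> Basis" for b using that by (simp add: k_def inner_sum_left inner_Basis if_distrib cong: if_cong)
  have "monomial_at Basis (\<lambda>b. k \<bullet> b) m = \<rho> ^ multi_degree Basis m" for m
    unfolding monomial_at_const[symmetric] by (rule monomial_at_cong) (rule k)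
  moreover have "x + k \<in> ball x e" using k \<rho> by (intro small) auto
  ultimately have "((\<lambda>m. \<rho> ^ multi_degree Basis m * c m) has_sum f (x + k)) (multi_indices Basis)"
    using c[of "x + k"] by simp
  then have "(\<lambda>m. norm (\<rho> ^ multi_degree Basis m * c m)) summable_on multi_indices Basis"
    by (rule summable_on_iff_abs_summable_on_real[THEN iffD1, OF has_sum_imp_summable])
  then have s: "summable_at_radius Basis \<rho> c"
    using \<rho> by (simp add: summable_at_radius_def abs_mult mult.commute)
  have "of_real (f (x + h)) = multi_series Basis c (complex_coords h)" if "\<And>b. b \<in> Basis \<Longrightarrow> \<bar>h \<bullet> b\<bar> \<le> \<rho>" for h
  proof -
    have "((\<lambda>m. monomial_at Basis (\<lambda>b. h \<bullet> b) m * c m) has_sum f (x + h)) (multi_indices Basis)"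
      using c[OF small[OF that]] by simp
    from has_sum_of_real[OF this]
    have "((\<lambda>m. of_real (c m) * monomial_at Basis (complex_coords h) m) has_sum complex_of_real (f (x + h))) (multi_indices Basis)"
      by (simp add: monomial_at_complex_coords mult.commute)
    then show ?thesis unfolding multi_series_def by (simp add: infsumI)
  qed
  with s have "power_series_at f x \<rho> c" by (simp add: power_series_at_def)
  then show ?thesis by (rule germ_of_power_series)
qed

text \<open>
  Power series converge on balls and extensions live on polydiscs; after shrinking, each gives the other in every
  component.
\<close>

theorem real_analytic_on_iff:
  fixes f :: "'a::euclidean_space \<Rightarrow> 'b::euclidean_space"
  shows "real_analytic_on f S \<longleftrightarrow> (\<forall>x\<in>S. analytic_at_point f x)"
  unfolding real_analytic_on_def
proof (intro ball_cong refl iffI)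
  fix x
  assume "\<exists>e>0. \<exists>c. \<forall>y\<in>ball x e. ((\<lambda>m. (\<Prod>b\<in>Basis. ((y - x) \<bullet> b) ^ m b) *\<^sub>R c m) has_sum f y) (multi_indices Basis)"
  then obtain e c where e: "0 < e"
    and c: "\<And>y. y \<in> ball x e \<Longrightarrow> ((\<lambda>m. (\<Prod>b\<in>Basis. ((y - x) \<bullet> b) ^ m b) *\<^sub>R c m) has_sum f y) (multi_indices Basis)"
    by blast
  show "analytic_at_point f x"
    unfolding analytic_at_point_def
  proof
    fix i :: 'b assume "i \<in> Basis"
    show "analytic_germ (\<lambda>y. f y \<bullet> i) x"
    proof (rule real_analytic_germ_imp_series[OF e])
      fix y assume "y \<in> ball x e"
      from has_sum_bounded_linear[OF bounded_linear_inner_left c[OF this], of i]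
      show "((\<lambda>m. monomial_at Basis (\<lambda>b. (y - x) \<bullet> b) m * (c m \<bullet> i)) has_sum f y \<bullet> i) (multi_indices Basis)"
        by (simp add: monomial_at_def)
    qed
  qed
next
  fix x assume "analytic_at_point f x"
  then have "\<exists>\<rho> c. power_series_at (\<lambda>y. f y \<bullet> i) x \<rho> c" if "i \<in> Basis" for i
    using power_series_of_germ[of "\<lambda>y. f y \<bullet> i" x] that by (simp add: analytic_at_point_def)
  then obtain \<rho> c where c: "\<And>i. i \<in> Basis \<Longrightarrow> power_series_at (\<lambda>y. f y \<bullet> i) x (\<rho> i) (c i)"
    by metis
  define e where "e = Min (\<rho> ` Basis)"
  have "0 < e" using c by (auto simp: e_def power_series_at_def summable_at_radius_def)
  moreover have "((\<lambda>m. (\<Prod>b\<in>Basis. ((y - x) \<bullet> b) ^ m b) *\<^sub>R (\<Sum>i\<in>Basis. c i m *\<^sub>R i)) has_sum f y) (multi_indices Basis)"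
    if y: "y \<in> ball x e" for y
  proof -
    have *: "((\<lambda>m. c i m * monomial_at Basis (\<lambda>b. (y - x) \<bullet> b) m) has_sum f (x + (y - x)) \<bullet> i) (multi_indices Basis)"
      if i: "i \<in> Basis" for i
    proof (rule power_series_at_has_sum[OF c[OF i]])
      fix b :: 'a assume "b \<in> Basis"
      moreover have "norm (y - x) < e" using y by (simp add: dist_norm norm_minus_commute)
      moreover have "e \<le> \<rho> i" using i by (auto simp: e_def)
      ultimately show "\<bar>(y - x) \<bullet> b\<bar> \<le> \<rho> i" using abs_inner_le_if_small[of "y - x" e b] by linarith
    qed
    have "((\<lambda>m. (c i m * monomial_at Basis (\<lambda>b. (y - x) \<bullet> b) m) *\<^sub>R i) has_sum (f y \<bullet> i) *\<^sub>R i) (multi_indices Basis)"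
      if "i \<in> Basis" for i
      using has_sum_bounded_linear[OF bounded_linear_scaleR_left *[OF that]] by simp
    then have "((\<lambda>m. \<Sum>i\<in>Basis. (c i m * monomial_at Basis (\<lambda>b. (y - x) \<bullet> b) m) *\<^sub>R i) has_sum
        (\<Sum>i\<in>Basis. (f y \<bullet> i) *\<^sub>R i)) (multi_indices Basis)"
      by (intro has_sum_finite_sum finite_Basis)
    then show ?thesis by (simp add: euclidean_representation scaleR_sum_right monomial_at_def mult.commute)
  qed
  ultimately show "\<exists>e>0. \<exists>c. \<forall>y\<in>ball x e. ((\<lambda>m. (\<Prod>b\<in>Basis. ((y - x) \<bullet> b) ^ m b) *\<^sub>R c m) has_sum f y) (multi_indices Basis)"
    by (intro exI[of _ e] exI[of _ "\<lambda>m. \<Sum>i\<in>Basis. c i m *\<^sub>R i"] conjI ballI)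
qed

lemma analytic_germ_add:
  assumes "analytic_germ f x" "analytic_germ g x"
  shows "analytic_germ (\<lambda>y. f y + g y) x"
proof -
  obtain \<rho> M F where F: "\<rho> > 0" "separately_holomorphic Basis \<rho> F" "\<And>z. z \<in> polydisc Basis \<rho> \<Longrightarrow> norm (F z) \<le> M"
    "\<And>h. complex_coords h \<in> polydisc Basis \<rho> \<Longrightarrow> F (complex_coords h) = of_real (f (x + h))"
    using assms(1) unfolding analytic_germ_def by blast
  obtain \<rho>' M' G where G: "\<rho>' > 0" "separately_holomorphic Basis \<rho>' G" "\<And>z. z \<in> polydisc Basis \<rho>' \<Longrightarrow> norm (G z) \<le> M'"
    "\<And>h. complex_coords h \<in> polydisc Basis \<rho>' \<Longrightarrow> G (complex_coords h) = of_real (g (x + h))"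
    using assms(2) unfolding analytic_germ_def by blast
  define r where "r = min \<rho> \<rho>'"
  have r: "0 < r" "r \<le> \<rho>" "r \<le> \<rho>'" using F(1) G(1) by (auto simp: r_def)
  have sub: "z \<in> polydisc Basis \<rho>" "z \<in> polydisc Basis \<rho>'" if "z \<in> polydisc Basis r" for z
    using that polydisc_mono[OF r(2)] polydisc_mono[OF r(3)] by auto
  show ?thesis
  proof (rule analytic_germ_of_extension[OF r(1)])
    show "separately_holomorphic Basis r (\<lambda>z. F z + G z)"
      using separately_holomorphic_mono[OF F(2) r(2)] separately_holomorphic_mono[OF G(2) r(3)]
      unfolding separately_holomorphic_def by (auto intro!: holomorphic_on_add)
    show "norm (F z + G z) \<le> M + M'" if "z \<in> polydisc Basis r" for z
      using F(3)[OF sub(1)[OF that]] G(3)[OF sub(2)[OF that]] by (rule norm_triangle_mono)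
    show "F (complex_coords h) + G (complex_coords h) = of_real (f (x + h) + g (x + h))"
      if "complex_coords h \<in> polydisc Basis r" for h
      using F(4)[OF sub(1)[OF that]] G(4)[OF sub(2)[OF that]] by simp
  qed
qed

lemma analytic_germ_mult:
  assumes "analytic_germ f x" "analytic_germ g x"
  shows "analytic_germ (\<lambda>y. f y * g y) x"
proof -
  obtain \<rho> M F where F: "\<rho> > 0" "separately_holomorphic Basis \<rho> F" "\<And>z. z \<in> polydisc Basis \<rho> \<Longrightarrow> norm (F z) \<le> M"
    "\<And>h. complex_coords h \<in> polydisc Basis \<rho> \<Longrightarrow> F (complex_coords h) = of_real (f (x + h))"
    using assms(1) unfolding analytic_germ_def by blast
  obtain \<rho>' M' G where G: "\<rho>' > 0" "separately_holomorphic Basis \<rho>' G" "\<And>z. z \<in> polydisc Basis \<rho>' \<Longrightarrow> norm (G z) \<le> M'"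
    "\<And>h. complex_coords h \<in> polydisc Basis \<rho>' \<Longrightarrow> G (complex_coords h) = of_real (g (x + h))"
    using assms(2) unfolding analytic_germ_def by blast
  define r where "r = min \<rho> \<rho>'"
  have r: "0 < r" "r \<le> \<rho>" "r \<le> \<rho>'" using F(1) G(1) by (auto simp: r_def)
  have sub: "z \<in> polydisc Basis \<rho>" "z \<in> polydisc Basis \<rho>'" if "z \<in> polydisc Basis r" for z
    using that polydisc_mono[OF r(2)] polydisc_mono[OF r(3)] by auto
  show ?thesis
  proof (rule analytic_germ_of_extension[OF r(1)])
    show "separately_holomorphic Basis r (\<lambda>z. F z * G z)"
      using separately_holomorphic_mono[OF F(2) r(2)] separately_holomorphic_mono[OF G(2) r(3)]
      unfolding separately_holomorphic_def by (auto intro!: holomorphic_on_mult)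
    show "norm (F z * G z) \<le> M * M'" if "z \<in> polydisc Basis r" for z
      using F(3)[OF sub(1)[OF that]] G(3)[OF sub(2)[OF that]] unfolding norm_mult
      by (intro mult_mono) (auto intro: order_trans[OF norm_ge_zero])
    show "F (complex_coords h) * G (complex_coords h) = of_real (f (x + h) * g (x + h))"
      if "complex_coords h \<in> polydisc Basis r" for h
      using F(4)[OF sub(1)[OF that]] G(4)[OF sub(2)[OF that]] by simp
  qed
qed

lemma analytic_germ_const: "analytic_germ (\<lambda>_. a) x"
  by (rule analytic_germ_of_extension[where \<rho> = 1 and M = "norm (of_real a :: complex)" and F = "\<lambda>_. of_real a"])
    (auto simp: separately_holomorphic_def)

lemma analytic_germ_coord: 
  fixes b :: "'a::euclidean_space" assumes "b \<in> Basis" shows "analytic_germ (\<lambda>y. y \<bullet> b) x"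
proof -
  have "analytic_germ (\<lambda>y. y \<bullet> b) (0 + x)"
  proof (rule analytic_germ_recenter[where \<rho> = "norm x + 1" and F = "\<lambda>z. z b"])
    show "separately_holomorphic Basis (norm x + 1) (\<lambda>z. z b)" by (rule separately_holomorphic_coordinate)
    show "norm (z b) \<le> norm x + 1" if "z \<in> polydisc Basis (norm x + 1)" for z
      using that assms by (auto simp: polydisc_def less_imp_le)
    show "complex_coords x \<in> polydisc Basis (norm x + 1)"
      by (simp add: complex_coords_in_polydisc abs_inner_le_if_small)
  qed (use assms in \<open>auto simp: complex_coords_def add_nonneg_pos\<close>)
  then show ?thesis by simp
qed

lemma analytic_germ_sum:
  "finite I \<Longrightarrow> (\<And>i. i \<in> I \<Longrightarrow> analytic_germ (f i) x) \<Longrightarrow> analytic_germ (\<lambda>y. \<Sum>i\<in>I. f i y) x"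
  by (induction I rule: finite_induct) (auto intro: analytic_germ_const analytic_germ_add)

lemma analytic_at_point_const: "analytic_at_point (\<lambda>_. a) x"
  by (simp add: analytic_at_point_def analytic_germ_const)

lemma analytic_at_point_linear:
  fixes f :: "'a::euclidean_space \<Rightarrow> 'b::euclidean_space"
  assumes "linear f"
  shows "analytic_at_point f x"
  unfolding analytic_at_point_def
proof
  fix i :: 'b
  have "f y \<bullet> i = (\<Sum>b\<in>Basis. (y \<bullet> b) * (f b \<bullet> i))" for y
    by (rule Linear_Algebra.linear_componentwise[OF assms])
  then have eq: "(\<lambda>y. f y \<bullet> i) = (\<lambda>y. \<Sum>b\<in>Basis. (y \<bullet> b) * (f b \<bullet> i))" by (rule ext)
  show "analytic_germ (\<lambda>y. f y \<bullet> i) x"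
    by (subst eq) (intro analytic_germ_sum finite_Basis analytic_germ_mult analytic_germ_coord analytic_germ_const; assumption)
qed

lemma analytic_at_point_compose:
  fixes f :: "'b::euclidean_space \<Rightarrow> 'c::euclidean_space"
  assumes "analytic_at_point f (g x)" "analytic_at_point g x"
  shows "analytic_at_point (\<lambda>y. f (g y)) x"
  unfolding analytic_at_point_def
proof
  fix b assume b: "b \<in> (Basis :: 'c set)"
  show "analytic_germ (\<lambda>y. f (g y) \<bullet> b) x"
    by (rule analytic_germ_compose[where f = "\<lambda>z. f z \<bullet> b"]) (use assms b in \<open>simp_all add: analytic_at_point_def\<close>)
qed

lemma analytic_at_point_add:
  "analytic_at_point f x \<Longrightarrow> analytic_at_point g x \<Longrightarrow> analytic_at_point (\<lambda>y. f y + g y) x"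
  by (auto simp: analytic_at_point_def inner_add_left intro: analytic_germ_add)

text \<open>
  A bilinear map is a finite sum of products of coordinates.
\<close>

lemma analytic_at_point_bilinear:
  fixes B :: "'b::euclidean_space \<Rightarrow> 'c::euclidean_space \<Rightarrow> 'd::euclidean_space"
  assumes "bounded_bilinear B" "analytic_at_point f x" "analytic_at_point g x"
  shows "analytic_at_point (\<lambda>y. B (f y) (g y)) x"
  unfolding analytic_at_point_def
proof
  fix k :: 'd
  interpret bounded_bilinear B by fact
  have rep: "B u v = (\<Sum>j\<in>Basis. \<Sum>i\<in>Basis. (v \<bullet> j) *\<^sub>R (u \<bullet> i) *\<^sub>R B i j)" for u v
  proof -
    have "B u v = B (\<Sum>i\<in>Basis. (u \<bullet> i) *\<^sub>R i) (\<Sum>j\<in>Basis. (v \<bullet> j) *\<^sub>R j)"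
      by (simp only: euclidean_representation)
    also have "\<dots> = (\<Sum>j\<in>Basis. \<Sum>i\<in>Basis. (v \<bullet> j) *\<^sub>R (u \<bullet> i) *\<^sub>R B i j)"
      by (simp only: sum_left sum_right scaleR_left scaleR_right scaleR_sum_right)
    finally show ?thesis .
  qed
  have "B u v \<bullet> k = (\<Sum>j\<in>Basis. \<Sum>i\<in>Basis. (v \<bullet> j) * (u \<bullet> i) * (B i j \<bullet> k))" for u v
    by (subst rep) (simp add: inner_sum_left mult.assoc)
  then have eq: "(\<lambda>y. B (f y) (g y) \<bullet> k) =
      (\<lambda>y. \<Sum>j\<in>Basis. \<Sum>i\<in>Basis. (g y \<bullet> j) * (f y \<bullet> i) * (B i j \<bullet> k))" by (intro ext)
  show "analytic_germ (\<lambda>y. B (f y) (g y) \<bullet> k) x"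
    using assms(2,3) unfolding analytic_at_point_def
    by (subst eq) (intro analytic_germ_sum finite_Basis analytic_germ_mult analytic_germ_const; simp)
qed

lemma analytic_at_point_Pair:
  assumes "analytic_at_point f x" "analytic_at_point g x"
  shows "analytic_at_point (\<lambda>y. (f y, g y)) x"
  using assms by (auto simp: analytic_at_point_def Basis_prod_def)

lemma analytic_at_point_cong:
  assumes "analytic_at_point f x" "open S" "x \<in> S" "\<And>y. y \<in> S \<Longrightarrow> f y = g y"
  shows "analytic_at_point g x"
proof -
  obtain d where d: "0 < d" "\<And>y. dist y x < d \<Longrightarrow> y \<in> S" using assms(2,3) by (auto simp: open_dist)
  show ?thesis
    unfolding analytic_at_point_def
  proof
    fix i :: 'b assume "i \<in> Basis"
    then have "analytic_germ (\<lambda>y. f y \<bullet> i) x" using assms(1) by (simp add: analytic_at_point_def)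
    then show "analytic_germ (\<lambda>y. g y \<bullet> i) x" by (rule analytic_germ_cong[OF _ d(1)]) (simp add: assms(4) d(2))
  qed
qed

section \<open>The analytic inverse function theorem\<close>

definition zero_index :: "'a::euclidean_space \<Rightarrow> nat" where
  "zero_index = (\<lambda>i\<in>Basis. 0)"

definition unit_index :: "'a::euclidean_space \<Rightarrow> 'a \<Rightarrow> nat" where
  "unit_index b = (\<lambda>i\<in>Basis. if i = b then 1 else 0)"

lemma low_degree_indices:
  "{m \<in> multi_indices Basis. multi_degree Basis m < 2} = insert zero_index (unit_index ` Basis)"
proof (intro equalityI subsetI)
  fix m :: "'a \<Rightarrow> nat" assume "m \<in> {m \<in> multi_indices Basis. multi_degree Basis m < 2}"
  then have m: "m \<in> extensional Basis" and d: "multi_degree Basis m = 0 \<or> multi_degree Basis m = 1"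
    by (auto simp: PiE_def)
  from d show "m \<in> insert zero_index (unit_index ` Basis)"
  proof
    assume "multi_degree Basis m = 0"
    then have "m = zero_index"
      by (intro extensionalityI[OF m]) (auto simp: zero_index_def multi_degree_def)
    then show ?thesis by simp
  next
    assume "multi_degree Basis m = 1"
    then obtain b where b: "b \<in> Basis" "m b = 1" "\<And>i. i \<in> Basis \<Longrightarrow> b \<noteq> i \<Longrightarrow> m i = 0"
      unfolding multi_degree_def by (auto simp: sum_eq_Suc0_iff)
    then have "m = unit_index b"
      by (intro extensionalityI[OF m]) (auto simp: unit_index_def)
    then show ?thesis using b(1) by simp
  qed
next
  fix m :: "'a \<Rightarrow> nat" assume m: "m \<in> insert zero_index (unit_index ` Basis)"
  have "multi_degree Basis (unit_index b :: 'a \<Rightarrow> nat) = 1" if "b \<in> Basis" for b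
    using that by (simp add: multi_degree_def unit_index_def)
  moreover have "multi_degree Basis (zero_index :: 'a \<Rightarrow> nat) = 0"
    by (simp add: multi_degree_def zero_index_def)
  ultimately show "m \<in> {m \<in> multi_indices Basis. multi_degree Basis m < 2}"
    using m by (auto simp: zero_index_def unit_index_def PiE_def)
qed

lemma monomial_at_unit_index: "b \<in> Basis \<Longrightarrow> monomial_at Basis z (unit_index b) = (z b :: complex)"
proof -
  assume b: "b \<in> Basis"
  have "monomial_at Basis z (unit_index b) = (\<Prod>i\<in>Basis. if i = b then z i else 1)"
    unfolding monomial_at_def by (intro prod.cong) (auto simp: unit_index_def)
  then show ?thesis using b by simp
qed

lemma monomial_at_zero_index: "monomial_at Basis z zero_index = 1"
  by (simp add: monomial_at_def zero_index_def)

definition higher_terms :: "(('a::euclidean_space \<Rightarrow> nat) \<Rightarrow> real) \<Rightarrow> ('a \<Rightarrow> nat) \<Rightarrow> real" where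
  "higher_terms c m = (if multi_degree Basis m < 2 then 0 else c m)"

lemma summable_higher_terms:
  assumes "summable_at_radius Basis \<rho> c"
  shows "summable_at_radius Basis \<rho> (higher_terms c)"
proof -
  have "(\<lambda>m. norm (\<bar>higher_terms c m\<bar> * \<rho> ^ multi_degree Basis m)) summable_on multi_indices Basis"
    using assms unfolding summable_at_radius_def
    by (intro Infinite_Sum.abs_summable_on_comparison_test'[where g = "\<lambda>m. \<bar>c m\<bar> * \<rho> ^ multi_degree Basis m"])
      (auto simp: higher_terms_def abs_mult)
  moreover have "norm (\<bar>higher_terms c m\<bar> * \<rho> ^ multi_degree Basis m) = \<bar>higher_terms c m\<bar> * \<rho> ^ multi_degree Basis m" for m
    using assms by (simp add: summable_at_radius_def abs_mult)
  ultimately show ?thesis using assms by (simp add: summable_at_radius_def)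
qed

text \<open>
  The constant and linear terms are isolated because the constant term is the value, the linear terms are the
  derivative, and the rest is of second order.
\<close>

lemma multi_series_split:
  assumes c: "summable_at_radius Basis \<rho> c" and z: "\<And>b. b \<in> Basis \<Longrightarrow> norm (z b) \<le> \<rho>"
  shows "multi_series Basis c z = of_real (c zero_index) + (\<Sum>b\<in>Basis. of_real (c (unit_index b)) * z b)
    + multi_series Basis (higher_terms c) z"
proof -
  define L where "L = {m \<in> multi_indices (Basis :: 'a set). multi_degree Basis m < 2}"
  define t where "t = (\<lambda>m. of_real (c m) * monomial_at Basis z m)"
  have L: "L = insert zero_index (unit_index ` Basis)" unfolding L_def by (rule low_degree_indices)
  have inj: "inj_on unit_index (Basis :: 'a set)"
  proof (rule inj_onI)
    fix b b' :: 'a assume b: "b \<in> Basis" "b' \<in> Basis" and eq: "unit_index b = unit_index b'"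
    show "b = b'" using fun_cong[OF eq, of b] b by (auto simp: unit_index_def split: if_splits)
  qed
  have notin: "(zero_index :: 'a \<Rightarrow> nat) \<notin> unit_index ` Basis"
  proof
    assume "(zero_index :: 'a \<Rightarrow> nat) \<in> unit_index ` Basis"
    then obtain b :: 'a where b: "b \<in> Basis" "zero_index = unit_index b" by auto
    show False using fun_cong[OF b(2), of b] b(1) by (simp add: zero_index_def unit_index_def)
  qed
  have fin: "finite L" by (simp add: L)
  have sum: "sum t L = of_real (c zero_index) + (\<Sum>b\<in>Basis. of_real (c (unit_index b)) * z b)"
    unfolding L using inj notin
    by (simp add: sum.reindex t_def monomial_at_zero_index monomial_at_unit_index)
  have "(t has_sum sum t L) L" using fin by (intro has_sum_finiteI) auto
  then have "((\<lambda>m. if multi_degree Basis m < 2 then t m else 0) has_sum sum t L) (multi_indices Basis)"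
    by (rule has_sum_cong_neutral[THEN iffD1, rotated -1]) (auto simp: L_def)
  from has_sum_add[OF this multi_series_has_sum[where z = z, OF summable_higher_terms[OF c] z]]
  have "((\<lambda>m. (if multi_degree Basis m < 2 then t m else 0) + of_real (higher_terms c m) * monomial_at Basis z m)
      has_sum sum t L + multi_series Basis (higher_terms c) z) (multi_indices Basis)" by simp
  moreover have "(if multi_degree Basis m < 2 then t m else 0) + of_real (higher_terms c m) * monomial_at Basis z m
      = of_real (c m) * monomial_at Basis z m" for m
    by (simp add: t_def higher_terms_def)
  ultimately have "((\<lambda>m. of_real (c m) * monomial_at Basis z m) has_sum sum t L + multi_series Basis (higher_terms c) z) (multi_indices Basis)"
    by simp
  then have "multi_series Basis c z = sum t L + multi_series Basis (higher_terms c) z"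
    unfolding multi_series_def[of Basis c z] by (rule infsumI)
  then show ?thesis unfolding sum .
qed

lemma multi_series_higher_terms_0: "multi_series Basis (higher_terms c) (\<lambda>_. 0) = 0"
  unfolding multi_series_def by (rule infsum_0) (simp add: higher_terms_def monomial_at_const)

lemma complex_coords_0: "complex_coords 0 = (\<lambda>_. 0)"
  by (auto simp: complex_coords_def)

text \<open>
  The higher terms have a Lipschitz constant of order \<open>t\<close> on the polydisc of radius \<open>t \<rho>\<close>, so they are
  \<open>o(h)\<close>.
\<close>

lemma power_series_has_derivative:
  assumes ps: "power_series_at f x \<rho> c"
  shows "c zero_index = f x" and "(f has_derivative (\<lambda>h. \<Sum>b\<in>Basis. c (unit_index b) * (h \<bullet> b))) (at x)"
proof -
  have c: "summable_at_radius Basis \<rho> c" and \<rho>: "0 < \<rho>"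
    and f: "\<And>h. (\<And>b. b \<in> Basis \<Longrightarrow> \<bar>h \<bullet> b\<bar> \<le> \<rho>) \<Longrightarrow> of_real (f (x + h)) = multi_series Basis c (complex_coords h)"
    using ps by (auto simp: power_series_at_def summable_at_radius_def)
  let ?T = "multi_series Basis (higher_terms c)"
  have ex: "of_real (f (x + h)) = complex_of_real (c zero_index + (\<Sum>b\<in>Basis. c (unit_index b) * (h \<bullet> b))) + ?T (complex_coords h)"
    if h: "\<And>b. b \<in> Basis \<Longrightarrow> \<bar>h \<bullet> b\<bar> \<le> \<rho>" for h
  proof -
    have "norm (complex_coords h b) \<le> \<rho>" if "b \<in> Basis" for b using h[OF that] that by (simp add: complex_coords_def)
    from multi_series_split[where z = "complex_coords h", OF c this]
    have "multi_series Basis c (complex_coords h) = of_real (c zero_index) +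
        (\<Sum>b\<in>Basis. of_real (c (unit_index b)) * of_real (h \<bullet> b)) + ?T (complex_coords h)"
      by (simp add: complex_coords_def)
    moreover have "of_real (f (x + h)) = multi_series Basis c (complex_coords h)" by (rule f[OF h])
    ultimately show ?thesis by simp
  qed
  have "complex_of_real (f x) = of_real (c zero_index)"
    using ex[of 0] \<rho> by (simp add: complex_coords_0 multi_series_higher_terms_0)
  then show c0: "c zero_index = f x" by simp
  define K where "K = (\<Sum>\<^sub>\<infinity>m\<in>multi_indices Basis. \<bar>higher_terms c m\<bar> * \<rho> ^ multi_degree Basis m)"
  have K: "0 \<le> K" unfolding K_def using \<rho> by (intro infsum_nonneg) auto
  show "(f has_derivative (\<lambda>h. \<Sum>b\<in>Basis. c (unit_index b) * (h \<bullet> b))) (at x)"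
    unfolding has_derivative_at_alt
  proof (intro conjI allI impI)
    show "bounded_linear (\<lambda>h. \<Sum>b\<in>Basis. c (unit_index b) * (h \<bullet> b))"
      by (intro bounded_linear_sum bounded_linear_const_mult bounded_linear_inner_left)
    fix e :: real assume e: "0 < e"
    define D where "D = real DIM('a)"
    have D: "0 < D" by (simp add: D_def)
    define t where "t = min (1 / 2) (e * \<rho> / (4 * (K + 1) * D))"
    have t: "0 < t" using e \<rho> K D by (simp add: t_def)
    have t2: "t \<le> 1 / 2" unfolding t_def by (rule min.cobounded1)
    have "t \<le> e * \<rho> / (4 * (K + 1) * D)" by (simp add: t_def)
    then have "t * (4 * (K + 1) * D) \<le> e * \<rho>" using K D by (simp add: pos_le_divide_eq)
    moreover have "t * (4 * K * D) \<le> t * (4 * (K + 1) * D)" using t D by (intro mult_left_mono mult_right_mono) auto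
    ultimately have tK: "4 * t * K * D \<le> e * \<rho>" by (simp add: mult_ac)
    have "norm (f y - f x - (\<Sum>b\<in>Basis. c (unit_index b) * ((y - x) \<bullet> b))) \<le> e * norm (y - x)"
      if y: "norm (y - x) < t * \<rho>" for y
    proof -
      let ?h = "y - x"
      have hb: "\<bar>?h \<bullet> b\<bar> \<le> t * \<rho>" if "b \<in> Basis" for b
        using abs_inner_le_if_small[OF y that] by simp
      have "t * \<rho> \<le> 1 * \<rho>" using t t2 \<rho> by (intro mult_right_mono) auto
      then have hb': "\<bar>?h \<bullet> b\<bar> \<le> \<rho>" if "b \<in> Basis" for b using hb[OF that] by simp
      have "complex_of_real (f y - f x - (\<Sum>b\<in>Basis. c (unit_index b) * (?h \<bullet> b))) = ?T (complex_coords ?h)"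
        using ex[of ?h, OF hb'] c0 by simp
      then have "norm (complex_of_real (f y - f x - (\<Sum>b\<in>Basis. c (unit_index b) * (?h \<bullet> b)))) = norm (?T (complex_coords ?h))"
        by (rule arg_cong)
      then have "norm (f y - f x - (\<Sum>b\<in>Basis. c (unit_index b) * (?h \<bullet> b))) = norm (?T (complex_coords ?h) - ?T (\<lambda>_. 0))"
        unfolding norm_of_real multi_series_higher_terms_0 diff_zero real_norm_def .
      also have "\<dots> \<le> K * ((2 * t) ^ 2 / (t * \<rho>) * (\<Sum>b\<in>Basis. norm (complex_coords ?h b - 0)))"
        unfolding K_def using t t2 \<rho> hb
        by (intro multi_series_lipschitz[OF finite_Basis summable_higher_terms[OF c]])
          (auto simp: higher_terms_def complex_coords_def)
      also have "\<dots> \<le> K * ((2 * t) ^ 2 / (t * \<rho>) * (D * norm ?h))"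
      proof -
        have "(\<Sum>b\<in>Basis. norm (complex_coords ?h b - 0)) \<le> of_nat (card (Basis :: 'a set)) * norm ?h"
          by (rule sum_bounded_above) (simp add: complex_coords_def Basis_le_norm)
        then show ?thesis using K t t2 \<rho> unfolding D_def by (intro mult_left_mono) auto
      qed
      also have "\<dots> = (4 * t * K * D) / \<rho> * norm ?h"
        using t t2 \<rho> by (simp add: power2_eq_square field_simps)
      also have "\<dots> \<le> e * norm ?h"
        using tK \<rho> by (intro mult_right_mono) (auto simp: pos_divide_le_eq)
      finally show ?thesis .
    qed
    then show "\<exists>d>0. \<forall>y. norm (y - x) < d \<longrightarrow>
        norm (f y - f x - (\<Sum>b\<in>Basis. c (unit_index b) * ((y - x) \<bullet> b))) \<le> e * norm (y - x)"
      using t \<rho> by (intro exI[of _ "t * \<rho>"]) auto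
  qed
qed

lemma analytic_at_point_differentiable:
  fixes f :: "'a::euclidean_space \<Rightarrow> 'b::euclidean_space"
  assumes "analytic_at_point f x"
  shows "\<exists>D. (f has_derivative D) (at x)"
proof -
  have "\<exists>D. ((\<lambda>y. f y \<bullet> i) has_derivative D) (at x)" if "i \<in> Basis" for i
  proof -
    from power_series_of_germ[of "\<lambda>y. f y \<bullet> i" x] that assms
    obtain \<rho> c where "power_series_at (\<lambda>y. f y \<bullet> i) x \<rho> c" by (auto simp: analytic_at_point_def)
    from power_series_has_derivative(2)[OF this] show ?thesis by blast
  qed
  then obtain D where D: "\<And>i. i \<in> Basis \<Longrightarrow> ((\<lambda>y. f y \<bullet> i) has_derivative D i) (at x)" by metis
  have "(f has_derivative (\<lambda>h. \<Sum>i\<in>Basis. D i h *\<^sub>R i)) (at x)"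
    unfolding has_derivative_componentwise_within[of f]
  proof
    fix i :: 'b assume i: "i \<in> Basis"
    have "(\<lambda>h. (\<Sum>j\<in>Basis. D j h *\<^sub>R j) \<bullet> i) = D i"
      using i by (simp add: inner_sum_left inner_Basis if_distrib cong: if_cong)
    then show "((\<lambda>y. f y \<bullet> i) has_derivative (\<lambda>h. (\<Sum>j\<in>Basis. D j h *\<^sub>R j) \<bullet> i)) (at x)"
      using D[OF i] by simp
  qed
  then show ?thesis by blast
qed

lemma real_analytic_on_imp_continuous_on:
  fixes f :: "'a::euclidean_space \<Rightarrow> 'b::euclidean_space"
  assumes "real_analytic_on f S"
  shows "continuous_on S f"
proof (intro continuous_at_imp_continuous_on ballI)
  fix x assume "x \<in> S"
  then have "analytic_at_point f x" using assms by (simp add: real_analytic_on_iff)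
  from analytic_at_point_differentiable[OF this] obtain D where "(f has_derivative D) (at x)" by blast
  then show "isCont f x" by (rule has_derivative_continuous)
qed

lemma summable_at_radius_mono:
  assumes "summable_at_radius B \<rho> c" "0 < \<rho>'" "\<rho>' \<le> \<rho>"
  shows "summable_at_radius B \<rho>' c"
proof -
  have "(\<lambda>m. norm (\<bar>c m\<bar> * \<rho>' ^ multi_degree B m)) summable_on multi_indices B"
    using assms unfolding summable_at_radius_def
    by (intro Infinite_Sum.abs_summable_on_comparison_test'[where g = "\<lambda>m. \<bar>c m\<bar> * \<rho> ^ multi_degree B m"])
      (auto simp: abs_mult intro!: mult_left_mono power_mono)
  then show ?thesis using assms(2) by (simp add: summable_at_radius_def abs_mult)
qed

lemma power_series_at_mono:
  "power_series_at f x \<rho> c \<Longrightarrow> 0 < \<rho>' \<Longrightarrow> \<rho>' \<le> \<rho> \<Longrightarrow> power_series_at f x \<rho>' c"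
  unfolding power_series_at_def by (auto intro: summable_at_radius_mono order_trans)

lemma multi_series_real:
  assumes "\<And>b. b \<in> B \<Longrightarrow> z b \<in> \<real>"
  shows "multi_series B c z \<in> \<real>"
proof -
  have "cnj (monomial_at B z m) = monomial_at B z m" for m
    unfolding monomial_at_def cnj_prod complex_cnj_power
    using assms by (intro prod.cong refl) (simp add: Reals_cnj_iff)
  then show ?thesis
    unfolding multi_series_def Reals_cnj_iff by (simp flip: infsum_cnj)
qed

lemma geometric_steps_converge:
  fixes x :: "nat \<Rightarrow> complex"
  assumes "\<And>k. norm (x (Suc k) - x k) \<le> C * (1 / 2) ^ k"
  shows "\<exists>L. \<forall>k. norm (x k - L) \<le> 2 * C * (1 / 2) ^ k"
proof -
  define f where "f = (\<lambda>j. x (Suc j) - x j)"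
  have g: "(\<lambda>j. C * (1 / 2) ^ (j + k)) sums (2 * C * (1 / 2) ^ k)" for k
    using sums_mult[OF geometric_sums[of "1 / 2 :: real"], of "C * (1 / 2) ^ k"] by (simp add: power_add mult_ac)
  have sf: "summable (\<lambda>j. norm (f (j + k)))" for k
    by (rule summable_comparison_test'[OF sums_summable[OF g[of k]], of 0]) (use assms in \<open>simp add: f_def\<close>)
  define L where "L = x 0 + suminf f"
  have "norm (x k - L) \<le> 2 * C * (1 / 2) ^ k" for k
  proof -
    have "suminf f = (\<Sum>j. f (j + k)) + (\<Sum>j<k. f j)"
      using sf[of 0] by (intro suminf_split_initial_segment) (simp add: summable_norm_cancel)
    moreover have "(\<Sum>j<k. f j) = x k - x 0" unfolding f_def by (rule sum_lessThan_telescope)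
    ultimately have "x k - L = - (\<Sum>j. f (j + k))" by (simp add: L_def)
    then have "norm (x k - L) \<le> (\<Sum>j. norm (f (j + k)))" using summable_norm[OF sf[of k]] by simp
    also have "\<dots> \<le> (\<Sum>j. C * (1 / 2) ^ (j + k))"
      by (intro suminf_le sf sums_summable[OF g]) (use assms in \<open>simp add: f_def\<close>)
    finally show ?thesis using g[of k] by (simp add: sums_iff)
  qed
  then show ?thesis by blast
qed

text \<open>
  The solution of \<open>L y = y + R (L y)\<close> is the limit of the iteration of \<open>z \<mapsto> y + R z\<close> from \<open>0\<close>. The
  contraction constant \<open>1/2\<close> gives uniform convergence in the parameter \<open>y\<close>, so the limit is holomorphic
  in \<open>y\<close>; and the iterates are real for real \<open>y\<close>.
\<close>

lemma holomorphic_fixed_point: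
  fixes R :: "'a::euclidean_space \<Rightarrow> ('a \<Rightarrow> complex) \<Rightarrow> complex"
  assumes s: "0 < s"
    and lip: "\<And>z w. \<lbrakk>\<And>b. b \<in> Basis \<Longrightarrow> norm (z b) \<le> s; \<And>b. b \<in> Basis \<Longrightarrow> norm (w b) \<le> s\<rbrakk> \<Longrightarrow>
      (\<Sum>b\<in>Basis. norm (R b z - R b w)) \<le> 1 / 2 * (\<Sum>b\<in>Basis. norm (z b - w b))"
    and bd: "\<And>b z. \<lbrakk>b \<in> Basis; \<And>b. b \<in> Basis \<Longrightarrow> norm (z b) \<le> s\<rbrakk> \<Longrightarrow> norm (R b z) \<le> s / 2"
    and hol: "\<And>b \<delta> G. \<lbrakk>b \<in> Basis; \<And>b'. b' \<in> Basis \<Longrightarrow> separately_holomorphic Basis \<delta> (G b');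
        \<And>b' y. b' \<in> Basis \<Longrightarrow> y \<in> polydisc Basis \<delta> \<Longrightarrow> norm (G b' y) \<le> s\<rbrakk> \<Longrightarrow>
      separately_holomorphic Basis \<delta> (\<lambda>y :: 'a \<Rightarrow> complex. R b (\<lambda>b'. G b' y))"
    and real: "\<And>b z. \<lbrakk>b \<in> Basis; \<And>b. b \<in> Basis \<Longrightarrow> z b \<in> \<real>\<rbrakk> \<Longrightarrow> R b z \<in> \<real>"
  shows "\<exists>L :: ('a \<Rightarrow> complex) \<Rightarrow> 'a \<Rightarrow> complex. \<forall>b\<in>Basis. separately_holomorphic Basis (s / 2) (\<lambda>y. L y b) \<and>
    (\<forall>y\<in>polydisc Basis (s / 2). norm (L y b) \<le> s \<and> L y b = y b + R b (L y) \<and>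
      ((\<forall>b\<in>Basis. y b \<in> \<real>) \<longrightarrow> L y b \<in> \<real>))"
proof -
  define g :: "nat \<Rightarrow> ('a \<Rightarrow> complex) \<Rightarrow> 'a \<Rightarrow> complex" where
    "g = (\<lambda>k. ((\<lambda>G y b. y b + R b (G y)) ^^ k) (\<lambda>_ _. 0))"
  have g_0: "g 0 y b = 0" and g_Suc: "g (Suc k) y b = y b + R b (g k y)" for k y b
    by (simp_all add: g_def)
  have g_bd: "norm (g k y b) \<le> s" if y: "y \<in> polydisc Basis (s / 2)" and b: "b \<in> Basis" for k y b
    using b
  proof (induction k arbitrary: b)
    case 0
    then show ?case using s by (simp add: g_0)
  next
    case (Suc k)
    have "norm (y b) \<le> s / 2" using y Suc.prems by (simp add: polydisc_def less_imp_le)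
    moreover have "norm (R b (g k y)) \<le> s / 2" by (intro bd Suc)
    ultimately have "norm (y b + R b (g k y)) \<le> s / 2 + s / 2" by (rule norm_triangle_mono)
    then show ?case by (simp add: g_Suc)
  qed
  have g_hol: "separately_holomorphic Basis (s / 2) (\<lambda>y. g k y b)" if "b \<in> Basis" for k b
    using that
  proof (induction k arbitrary: b)
    case 0
    then show ?case by (simp add: g_0 separately_holomorphic_def)
  next
    case (Suc k)
    have "separately_holomorphic Basis (s / 2) (\<lambda>y. R b (\<lambda>b'. g k y b'))"
      by (rule hol[OF Suc.prems, where G = "\<lambda>b' y. g k y b'"]) (auto intro: Suc.IH g_bd)
    then show ?case using separately_holomorphic_coordinate[of Basis "s / 2" b]
      unfolding g_Suc separately_holomorphic_def by (auto intro!: holomorphic_on_add)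
  qed
  define C where "C = real DIM('a) * s"
  have step: "(\<Sum>b\<in>Basis. norm (g (Suc k) y b - g k y b)) \<le> C * (1 / 2) ^ k" if y: "y \<in> polydisc Basis (s / 2)" for k y
  proof (induction k)
    case 0
    have "(\<Sum>b\<in>Basis. norm (g (Suc 0) y b - g 0 y b)) \<le> of_nat (card (Basis :: 'a set)) * s"
      by (rule sum_bounded_above) (use g_bd[OF y, of _ "Suc 0"] in \<open>simp add: g_0\<close>)
    then show ?case by (simp add: C_def)
  next
    case (Suc k)
    have "(\<Sum>b\<in>Basis. norm (g (Suc (Suc k)) y b - g (Suc k) y b)) =
        (\<Sum>b\<in>Basis. norm (R b (g (Suc k) y) - R b (g k y)))" by (simp add: g_Suc)
    also have "\<dots> \<le> 1 / 2 * (\<Sum>b\<in>Basis. norm (g (Suc k) y b - g k y b))" by (intro lip g_bd[OF y])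
    also have "\<dots> \<le> C * (1 / 2) ^ Suc k" using Suc by simp
    finally show ?case .
  qed
  have "\<exists>l. \<forall>k. norm (g k y b - l) \<le> 2 * C * (1 / 2) ^ k" if "y \<in> polydisc Basis (s / 2)" "b \<in> Basis" for y b
  proof (rule geometric_steps_converge)
    fix k
    have "norm (g (Suc k) y b - g k y b) \<le> (\<Sum>b\<in>Basis. norm (g (Suc k) y b - g k y b))"
      using that by (intro member_le_sum) auto
    then show "norm (g (Suc k) y b - g k y b) \<le> C * (1 / 2) ^ k" using step[OF that(1), of k] by linarith
  qed
  then obtain L where L: "\<And>y b k. \<lbrakk>y \<in> polydisc Basis (s / 2); b \<in> Basis\<rbrakk> \<Longrightarrow> norm (g k y b - L y b) \<le> 2 * C * (1 / 2) ^ k"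
    by metis
  have "(\<lambda>k. 2 * C * (1 / 2) ^ k) \<longlonglongrightarrow> 2 * C * 0" by (intro tendsto_mult_left LIMSEQ_power_zero) auto
  then have null: "(\<lambda>k. 2 * C * (1 / 2) ^ k) \<longlonglongrightarrow> 0" by simp
  have lim: "(\<lambda>k. g k y b) \<longlonglongrightarrow> L y b" if "y \<in> polydisc Basis (s / 2)" "b \<in> Basis" for y b
  proof -
    have "(\<lambda>k. g k y b - L y b) \<longlonglongrightarrow> 0"
      by (rule Lim_null_comparison[OF always_eventually null]) (use L[OF that] in simp)
    then show ?thesis by (simp add: Lim_null[of "\<lambda>k. g k y b"])
  qed
  have L_bd: "norm (L y b) \<le> s" if "y \<in> polydisc Basis (s / 2)" "b \<in> Basis" for y b
    by (rule Lim_norm_ubound[OF _ lim[OF that] always_eventually]) (auto intro: g_bd that)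
  show ?thesis
  proof (intro exI[of _ L] ballI conjI impI)
    fix b :: 'a assume b: "b \<in> Basis"
    show "separately_holomorphic Basis (s / 2) (\<lambda>y. L y b)"
      by (rule separately_holomorphic_uniform_limit[OF g_hol[OF b] L[OF _ b] null])
    fix y :: "'a \<Rightarrow> complex" assume y: "y \<in> polydisc Basis (s / 2)"
    show "norm (L y b) \<le> s" by (rule L_bd[OF y b])
    have "(\<lambda>k. R b (g k y) - R b (L y)) \<longlonglongrightarrow> 0"
    proof (rule Lim_null_comparison[OF always_eventually])
      show "\<forall>k. norm (R b (g k y) - R b (L y)) \<le> 1 / 2 * (\<Sum>b\<in>Basis. norm (g k y b - L y b))"
      proof
        fix k
        have "norm (R b (g k y) - R b (L y)) \<le> (\<Sum>b\<in>Basis. norm (R b (g k y) - R b (L y)))"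
          using b by (intro member_le_sum) auto
        also have "\<dots> \<le> 1 / 2 * (\<Sum>b\<in>Basis. norm (g k y b - L y b))" by (intro lip g_bd L_bd y)
        finally show "norm (R b (g k y) - R b (L y)) \<le> 1 / 2 * (\<Sum>b\<in>Basis. norm (g k y b - L y b))" .
      qed
      have "(\<lambda>k. 1 / 2 * (\<Sum>b\<in>Basis. norm (g k y b - L y b))) \<longlonglongrightarrow> 1 / 2 * (\<Sum>b\<in>(Basis::'a set). norm (L y b - L y b))"
        by (intro tendsto_intros lim y)
      then show "(\<lambda>k. 1 / 2 * (\<Sum>b\<in>Basis. norm (g k y b - L y b))) \<longlonglongrightarrow> 0" by simp
    qed
    then have "(\<lambda>k. R b (g k y)) \<longlonglongrightarrow> R b (L y)" by (simp add: Lim_null[of "\<lambda>k. R b (g k y)"])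
    then have "(\<lambda>k. y b + R b (g k y)) \<longlonglongrightarrow> y b + R b (L y)" by (intro tendsto_intros)
    moreover have "(\<lambda>k. y b + R b (g k y)) \<longlonglongrightarrow> L y b"
      using LIMSEQ_Suc[OF lim[OF y b]] by (simp add: g_Suc)
    ultimately show "L y b = y b + R b (L y)" using LIMSEQ_unique by blast
    assume "\<forall>b\<in>Basis. y b \<in> \<real>"
    then have "g k y b \<in> \<real>" if "b \<in> Basis" for k b
      using that by (induction k arbitrary: b) (auto simp: g_0 g_Suc intro!: Reals_add real)
    then show "L y b \<in> \<real>"
      by (intro Lim_in_closed_set[OF closed_complex_Reals _ _ lim[OF y b]] always_eventually) (auto simp: b)
  qed
qed

lemma analytic_at_point_id: "analytic_at_point (\<lambda>y. y) x"
  by (rule analytic_at_point_linear) (simp add: linear_iff)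

text \<open>
  One common radius is chosen for all components.
\<close>

lemma second_order_series:
  fixes r :: "'a::euclidean_space \<Rightarrow> 'a"
  assumes r: "analytic_at_point r 0" and r0: "r 0 = 0" and d: "(r has_derivative (\<lambda>_. 0)) (at 0)"
  shows "\<exists>\<rho> c. \<forall>b\<in>Basis. power_series_at (\<lambda>h. r h \<bullet> b) 0 \<rho> (c b) \<and>
    (\<forall>m\<in>multi_indices Basis. multi_degree Basis m < 2 \<longrightarrow> c b m = 0)"
proof -
  have "\<exists>\<rho> c. power_series_at (\<lambda>h. r h \<bullet> b) 0 \<rho> c" if "b \<in> Basis" for b
    using power_series_of_germ[of "\<lambda>h. r h \<bullet> b" 0] that r by (simp add: analytic_at_point_def)
  then obtain \<rho> c where ps: "\<And>b. b \<in> Basis \<Longrightarrow> power_series_at (\<lambda>h. r h \<bullet> b) 0 (\<rho> b) (c b)"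
    by metis
  define \<mu> where "\<mu> = Min (\<rho> ` Basis)"
  have "0 < \<rho> b" if "b \<in> Basis" for b using ps[OF that] by (simp add: power_series_at_def summable_at_radius_def)
  then have \<mu>: "0 < \<mu>" "\<And>b. b \<in> Basis \<Longrightarrow> \<mu> \<le> \<rho> b" by (auto simp: \<mu>_def)
  have "c b m = 0" if b: "b \<in> Basis" and m: "m \<in> multi_indices Basis" "multi_degree Basis m < 2" for b m
  proof -
    have d1: "((\<lambda>h. r h \<bullet> b) has_derivative (\<lambda>h. \<Sum>i\<in>Basis. c b (unit_index i) * (h \<bullet> i))) (at 0)"
      by (rule power_series_has_derivative(2)[OF ps[OF b]])
    have d2: "((\<lambda>h. r h \<bullet> b) has_derivative (\<lambda>h. 0 \<bullet> b)) (at 0)"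
      by (rule bounded_linear.has_derivative[OF bounded_linear_inner_left d])
    have lin: "(\<lambda>h. \<Sum>i\<in>Basis. c b (unit_index i) * (h \<bullet> i)) = (\<lambda>h :: 'a. 0)"
      using has_derivative_unique[OF d1 d2] by simp
    have "c b (unit_index i) = 0" if i: "i \<in> Basis" for i
      using fun_cong[OF lin, of i] i by (simp add: inner_Basis if_distrib cong: if_cong)
    moreover have "c b zero_index = 0"
      using power_series_has_derivative(1)[OF ps[OF b]] r0 by simp
    moreover have "m \<in> insert zero_index (unit_index ` Basis)"
      using m low_degree_indices by blast
    ultimately show ?thesis by auto
  qed
  then show ?thesis
    using power_series_at_mono[OF ps \<mu>] by (intro exI[of _ \<mu>] exI[of _ c]) auto
qed

text \<open>
  The inverse of \<open>h \<mapsto> h - r h\<close> at \<open>y\<close> is the fixed point of \<open>h \<mapsto> y + r h\<close>. As \<open>r\<close> is of second order,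
  its complexification is a contraction on a small polydisc, so the fixed point exists there, is unique
  and depends holomorphically on \<open>y\<close>.
\<close>

lemma near_identity_inverse:
  fixes r :: "'a::euclidean_space \<Rightarrow> 'a"
  assumes r: "analytic_at_point r 0" and r0: "r 0 = 0" and d: "(r has_derivative (\<lambda>_. 0)) (at 0)" and \<epsilon>: "0 < \<epsilon>"
  shows "\<exists>U V g. open U \<and> 0 \<in> U \<and> U \<subseteq> ball 0 \<epsilon> \<and> open V \<and> (\<lambda>h. h - r h) ` U = V \<and> inj_on (\<lambda>h. h - r h) U \<and>
    (\<forall>y\<in>V. analytic_at_point g y) \<and> (\<forall>h\<in>U. g (h - r h) = h)"
proof -
  obtain \<rho> c where ps: "\<And>b. b \<in> Basis \<Longrightarrow> power_series_at (\<lambda>h. r h \<bullet> b) 0 \<rho> (c b)"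
    and low: "\<And>b m. b \<in> Basis \<Longrightarrow> m \<in> multi_indices Basis \<Longrightarrow> multi_degree Basis m < 2 \<Longrightarrow> c b m = 0"
    using second_order_series[OF r r0 d] by blast
  have c: "summable_at_radius Basis \<rho> (c b)" if "b \<in> Basis" for b
    using ps[OF that] by (simp add: power_series_at_def)
  have \<rho>: "0 < \<rho>" using c[OF SOME_Basis] by (simp add: summable_at_radius_def)
  define R where "R = (\<lambda>b. multi_series Basis (c b))"
  have R: "R b (complex_coords h) = of_real (r h \<bullet> b)" if "b \<in> Basis" "\<And>b. b \<in> Basis \<Longrightarrow> \<bar>h \<bullet> b\<bar> \<le> \<rho>" for b h
    using ps[OF that(1)] that(2) by (simp add: power_series_at_def R_def)
  define Kb where "Kb = (\<lambda>b. \<Sum>\<^sub>\<infinity>m\<in>multi_indices Basis. \<bar>c b m\<bar> * \<rho> ^ multi_degree Basis m)"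
  define K where "K = (\<Sum>b\<in>Basis. Kb b)"
  have Kb: "0 \<le> Kb b" for b unfolding Kb_def using \<rho> by (intro infsum_nonneg) auto
  have K: "0 \<le> K" unfolding K_def by (intro sum_nonneg Kb)
  define D where "D = real DIM('a)"
  have D: "1 \<le> D" using DIM_positive[where 'a='a] unfolding D_def by linarith
  (* The Lipschitz constant \<kappa> below is K * 4 t / \<rho>. The second entry of the minimum makes \<kappa> * D at most 1/2, so that R
     is a contraction which maps the polydisc of radius s into that of radius s / 2; the third keeps U inside the ball of
     radius \<epsilon>. *)
  define t where "t = min (1 / 2) (min (\<rho> / (8 * (K + 1) * D)) (\<epsilon> / (\<rho> * D)))"
  have t: "0 < t" using \<rho> K D \<epsilon> by (simp add: t_def)
  have t1: "t \<le> 1 / 2" unfolding t_def by (rule min.cobounded1)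
  have t2: "t \<le> \<rho> / (8 * (K + 1) * D)" and t3: "t \<le> \<epsilon> / (\<rho> * D)" unfolding t_def by simp_all
  define s where "s = t * \<rho>"
  have s: "0 < s" "s \<le> \<rho>" "s \<le> \<epsilon> / D"
  proof -
    have "t * \<rho> \<le> 1 * \<rho>" using t1 \<rho> by (intro mult_right_mono) auto
    then show "s \<le> \<rho>" by (simp add: s_def)
    have "t * \<rho> \<le> \<epsilon> / (\<rho> * D) * \<rho>" using t3 \<rho> by (intro mult_right_mono) auto
    then show "s \<le> \<epsilon> / D" using \<rho> by (simp add: s_def)
  qed (use t \<rho> in \<open>simp add: s_def\<close>)
  define \<kappa> where "\<kappa> = K * (4 * t / \<rho>)"
  have \<kappa>: "0 \<le> \<kappa>" "\<kappa> * D \<le> 1 / 2" "\<kappa> \<le> 1 / 2"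
  proof -
    show "0 \<le> \<kappa>" using K t \<rho> by (simp add: \<kappa>_def)
    have "t * (8 * (K + 1) * D) \<le> \<rho>" using t2 K D by (simp add: pos_le_divide_eq)
    moreover have "t * (8 * K * D) \<le> t * (8 * (K + 1) * D)" using t D by (intro mult_left_mono mult_right_mono) auto
    ultimately have "8 * (K * t * D) \<le> \<rho>" by (simp add: mult_ac)
    then show kd: "\<kappa> * D \<le> 1 / 2" using \<rho> by (simp add: \<kappa>_def field_simps)
    have "\<kappa> * 1 \<le> \<kappa> * D" using \<open>0 \<le> \<kappa>\<close> D by (intro mult_left_mono) auto
    with kd show "\<kappa> \<le> 1 / 2" by simp
  qed
  have lipK: "(\<Sum>b\<in>Basis. norm (R b z - R b w)) \<le> \<kappa> * (\<Sum>b\<in>Basis. norm (z b - w b))"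
    if z: "\<And>b. b \<in> Basis \<Longrightarrow> norm (z b) \<le> s" and w: "\<And>b. b \<in> Basis \<Longrightarrow> norm (w b) \<le> s" for z w
  proof -
    let ?\<Delta> = "\<Sum>b\<in>Basis. norm (z b - w b)"
    have "norm (R b z - R b w) \<le> Kb b * ((2 * t) ^ 2 / (t * \<rho>) * ?\<Delta>)" if b: "b \<in> Basis" for b
      unfolding R_def Kb_def
      by (rule multi_series_lipschitz[OF finite_Basis c[OF b] t t1 low[OF b]])
        (use z w in \<open>auto simp: s_def\<close>)
    then have "(\<Sum>b\<in>Basis. norm (R b z - R b w)) \<le> (\<Sum>b\<in>Basis. Kb b * ((2 * t) ^ 2 / (t * \<rho>) * ?\<Delta>))"
      by (rule sum_mono)
    also have "\<dots> = \<kappa> * ?\<Delta>"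
    proof -
      have "(2 * t) ^ 2 / (t * \<rho>) = 4 * t / \<rho>" using t \<rho> by (simp add: power2_eq_square field_simps)
      then show ?thesis by (simp only: \<kappa>_def K_def mult.assoc flip: sum_distrib_right)
    qed
    finally show ?thesis .
  qed
  have R_0: "R b (\<lambda>_. 0) = 0" if "b \<in> Basis" for b
    using R[OF that, of 0] \<rho> r0 by (simp add: complex_coords_0)
  have bd: "norm (R b z) \<le> s / 2" if b: "b \<in> Basis" and z: "\<And>b. b \<in> Basis \<Longrightarrow> norm (z b) \<le> s" for b z
  proof -
    have "norm (R b z) \<le> (\<Sum>b\<in>Basis. norm (R b z))" using b by (intro member_le_sum) auto
    also have "\<dots> = (\<Sum>b\<in>Basis. norm (R b z - R b (\<lambda>_. 0)))" by (intro sum.cong) (simp_all add: R_0)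
    also have "\<dots> \<le> \<kappa> * (\<Sum>b\<in>Basis. norm (z b - 0))" using s by (intro lipK z) auto
    also have "\<dots> \<le> \<kappa> * (D * s)"
    proof -
      have "(\<Sum>b\<in>Basis. norm (z b - 0)) \<le> of_nat (card (Basis :: 'a set)) * s"
        by (rule sum_bounded_above) (use z in simp)
      then show ?thesis using \<kappa> unfolding D_def by (intro mult_left_mono) auto
    qed
    also have "\<dots> = (\<kappa> * D) * s" by simp
    also have "\<dots> \<le> 1 / 2 * s" using \<kappa> s by (intro mult_right_mono) auto
    finally show ?thesis by simp
  qed
  have lip: "(\<Sum>b\<in>Basis. norm (R b z - R b w)) \<le> 1 / 2 * (\<Sum>b\<in>Basis. norm (z b - w b))"
    if z: "\<And>b. b \<in> Basis \<Longrightarrow> norm (z b) \<le> s" and w: "\<And>b. b \<in> Basis \<Longrightarrow> norm (w b) \<le> s" for z w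
  proof -
    have "\<kappa> * (\<Sum>b\<in>Basis. norm (z b - w b)) \<le> 1 / 2 * (\<Sum>b\<in>Basis. norm (z b - w b))"
      using \<kappa> by (intro mult_right_mono sum_nonneg) auto
    with lipK[where z = z and w = w, OF z w] show ?thesis by linarith
  qed
  have "\<exists>L :: ('a \<Rightarrow> complex) \<Rightarrow> 'a \<Rightarrow> complex. \<forall>b\<in>Basis. separately_holomorphic Basis (s / 2) (\<lambda>y. L y b) \<and>
    (\<forall>y\<in>polydisc Basis (s / 2). norm (L y b) \<le> s \<and> L y b = y b + R b (L y) \<and>
      ((\<forall>b\<in>Basis. y b \<in> \<real>) \<longrightarrow> L y b \<in> \<real>))"
  proof (rule holomorphic_fixed_point[OF s(1) lip bd])
    fix b :: 'a and \<delta> and G :: "'a \<Rightarrow> ('a \<Rightarrow> complex) \<Rightarrow> complex"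
    assume "b \<in> Basis" and G: "\<And>b'. b' \<in> Basis \<Longrightarrow> separately_holomorphic Basis \<delta> (G b')"
      and bG: "\<And>b' y. b' \<in> Basis \<Longrightarrow> y \<in> polydisc Basis \<delta> \<Longrightarrow> norm (G b' y) \<le> s"
    show "separately_holomorphic Basis \<delta> (\<lambda>y. R b (\<lambda>b'. G b' y))"
      unfolding R_def
    proof (rule separately_holomorphic_multi_series[OF c[OF \<open>b \<in> Basis\<close>] G])
      show "norm (G b' y) \<le> \<rho>" if "b' \<in> Basis" "y \<in> polydisc Basis \<delta>" for b' y
        using bG[OF that] s(2) by linarith
    qed
  next
    fix b :: 'a and z :: "'a \<Rightarrow> complex" assume "b \<in> Basis" "\<And>b. b \<in> Basis \<Longrightarrow> z b \<in> \<real>"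
    then show "R b z \<in> \<real>" unfolding R_def by (intro multi_series_real)
  qed
  then obtain L :: "('a \<Rightarrow> complex) \<Rightarrow> 'a \<Rightarrow> complex" where
    L: "\<forall>b\<in>Basis. separately_holomorphic Basis (s / 2) (\<lambda>y. L y b) \<and>
    (\<forall>y\<in>polydisc Basis (s / 2). norm (L y b) \<le> s \<and> L y b = y b + R b (L y) \<and>
      ((\<forall>b\<in>Basis. y b \<in> \<real>) \<longrightarrow> L y b \<in> \<real>))" by (elim exE)
  have L_hol: "separately_holomorphic Basis (s / 2) (\<lambda>y. L y b)" if "b \<in> Basis" for b
    using L that by simp
  have L_bd: "norm (L y b) \<le> s" and L_eq: "L y b = y b + R b (L y)"
    and L_real: "(\<And>b. b \<in> Basis \<Longrightarrow> y b \<in> \<real>) \<Longrightarrow> L y b \<in> \<real>"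
    if "b \<in> Basis" "y \<in> polydisc Basis (s / 2)" for b y
    using L that by blast+
  define g :: "'a \<Rightarrow> 'a" where "g = (\<lambda>y. \<Sum>b\<in>Basis. Re (L (complex_coords y) b) *\<^sub>R b)"
  have gb: "g y \<bullet> b = Re (L (complex_coords y) b)" if "b \<in> Basis" for y b
    using that by (simp add: g_def inner_sum_left inner_Basis if_distrib cong: if_cong)
  define box where "box = (\<lambda>s. {h :: 'a. \<forall>b\<in>Basis. \<bar>h \<bullet> b\<bar> < s})"
  have box_coords: "h \<in> box s' \<longleftrightarrow> complex_coords h \<in> polydisc Basis s'" for h s'
    by (simp add: box_def complex_coords_in_polydisc)
  have box_open: "open (box s')" for s'
  proof -
    have "box s' = (\<Inter>b\<in>Basis. {h. \<bar>h \<bullet> b\<bar> < s'})" by (auto simp: box_def)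
    moreover have "open {h :: 'a. \<bar>h \<bullet> b\<bar> < s'}" for b
      by (intro open_Collect_less continuous_intros)
    ultimately show ?thesis by (simp add: open_INT)
  qed
  have Lg: "L (complex_coords y) b = complex_of_real (g y \<bullet> b)" if y: "y \<in> box (s / 2)" and b: "b \<in> Basis" for y b
  proof -
    have "L (complex_coords y) b \<in> \<real>"
      using y by (intro L_real b) (auto simp: box_coords complex_coords_def)
    then show ?thesis unfolding gb[OF b] by (simp add: complex_is_Real_iff complex_eq_iff)
  qed
  have RL: "R b (L (complex_coords y)) = R b (complex_coords (g y))" if "y \<in> box (s / 2)" for y b
    unfolding R_def multi_series_def
    by (intro infsum_cong arg_cong2[where f = "(*)"] refl monomial_at_cong)
      (simp add: Lg[OF that], simp add: complex_coords_def)
  have g_le: "\<bar>g y \<bullet> b\<bar> \<le> s" if "y \<in> box (s / 2)" "b \<in> Basis" for y b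
    using L_bd[OF that(2), of "complex_coords y"] that by (simp add: Lg box_coords)
  have g_eq: "g y = y + r (g y)" if y: "y \<in> box (s / 2)" for y
  proof (rule euclidean_eqI)
    fix b :: 'a assume b: "b \<in> Basis"
    have "complex_of_real (g y \<bullet> b) = of_real (y \<bullet> b) + R b (complex_coords (g y))"
      using L_eq[OF b, of "complex_coords y"] y b unfolding Lg[OF y b] RL[OF y]
      by (simp add: box_coords) (simp add: complex_coords_def)
    also have "R b (complex_coords (g y)) = of_real (r (g y) \<bullet> b)"
      using g_le[OF y] s(2) by (intro R b) (auto intro: order_trans)
    finally have "complex_of_real (g y \<bullet> b) = of_real ((y + r (g y)) \<bullet> b)" by (simp add: inner_add_left)
    then show "g y \<bullet> b = (y + r (g y)) \<bullet> b" by (simp only: of_real_eq_iff)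
  qed
  have uniq: "h = h'" if h: "\<And>b. b \<in> Basis \<Longrightarrow> \<bar>h \<bullet> b\<bar> \<le> s" and h': "\<And>b. b \<in> Basis \<Longrightarrow> \<bar>h' \<bullet> b\<bar> \<le> s"
    and eq: "h - r h = h' - r h'" for h h'
  proof -
    let ?\<Delta> = "\<Sum>b\<in>Basis. norm (complex_coords h b - complex_coords h' b)"
    have "h - h' = r h - r h'" using eq by (simp add: algebra_simps)
    then have "(h - h') \<bullet> b = (r h - r h') \<bullet> b" for b by simp
    then have "complex_coords h b - complex_coords h' b = R b (complex_coords h) - R b (complex_coords h')"
      if "b \<in> Basis" for b
      using that h h' s(2) by (subst (1 2) R) (auto simp: complex_coords_def inner_diff_left intro: order_trans simp flip: of_real_diff)
    then have "?\<Delta> = (\<Sum>b\<in>Basis. norm (R b (complex_coords h) - R b (complex_coords h')))"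
      by (intro sum.cong) auto
    also have "\<dots> \<le> 1 / 2 * ?\<Delta>"
      using h h' by (intro lip) (auto simp: complex_coords_def)
    finally have "?\<Delta> \<le> 0" by simp
    then have "?\<Delta> = 0" by (rule antisym) (auto intro: sum_nonneg)
    then have eq0: "\<forall>b\<in>Basis. norm (complex_coords h b - complex_coords h' b) = 0"
      by (simp add: sum_nonneg_eq_0_iff)
    show ?thesis
    proof (rule euclidean_eqI)
      fix b :: 'a assume "b \<in> Basis"
      then show "h \<bullet> b = h' \<bullet> b" using eq0 by (simp add: complex_coords_def)
    qed
  qed
  have r_cont: "continuous_on (box s) (\<lambda>h. h - r h)"
  proof (intro continuous_at_imp_continuous_on ballI)
    fix k assume k: "k \<in> box s"
    have "analytic_at_point r (0 + k)"
      unfolding analytic_at_point_def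
    proof
      fix b :: 'a assume b: "b \<in> Basis"
      show "analytic_germ (\<lambda>y. r y \<bullet> b) (0 + k)"
      proof (rule analytic_germ_recenter[OF s(1)])
        show "separately_holomorphic Basis s (\<lambda>z. multi_series Basis (c b) (\<lambda>b. z b))"
          using s(2) by (intro separately_holomorphic_multi_series[OF c[OF b]] separately_holomorphic_coordinate)
            (force simp: polydisc_def)
        show "norm (multi_series Basis (c b) (\<lambda>b. z b)) \<le> s / 2" if "z \<in> polydisc Basis s" for z
          using bd[OF b, of z] that by (simp add: R_def polydisc_def less_imp_le)
        show "multi_series Basis (c b) (\<lambda>b. complex_coords h b) = of_real (r (0 + h) \<bullet> b)"
          if "complex_coords h \<in> polydisc Basis s" for h
          using R[OF b, of h] that s(2) by (force simp: R_def complex_coords_in_polydisc)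
        show "complex_coords k \<in> polydisc Basis s" using k by (simp add: box_coords)
      qed
    qed
    then obtain D where "(r has_derivative D) (at k)" using analytic_at_point_differentiable[of r k] by auto
    then have "isCont r k" by (rule has_derivative_continuous)
    then show "isCont (\<lambda>h. h - r h) k" by (intro continuous_intros)
  qed
  define U where "U = box s \<inter> (\<lambda>h. h - r h) -` box (s / 2)"
  have U_le: "\<bar>h \<bullet> b\<bar> \<le> s" if "h \<in> U" "b \<in> Basis" for h b
    using that by (auto simp: U_def box_def less_imp_le)
  have gU: "g y \<in> U" "g y - r (g y) = y" if y: "y \<in> box (s / 2)" for y
  proof -
    show eq: "g y - r (g y) = y" using g_eq[OF y] by (simp add: algebra_simps)
    have "\<bar>g y \<bullet> b\<bar> < s" if b: "b \<in> Basis" for b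
    proof -
      have "norm (R b (complex_coords (g y))) \<le> s / 2"
        using g_le[OF y] by (intro bd b) (auto simp: complex_coords_def)
      moreover have "R b (complex_coords (g y)) = of_real (r (g y) \<bullet> b)"
        using g_le[OF y] s(2) by (intro R b) (auto intro: order_trans)
      ultimately have "\<bar>r (g y) \<bullet> b\<bar> \<le> s / 2" by simp
      moreover have "\<bar>y \<bullet> b\<bar> < s / 2" using y b by (simp add: box_def)
      moreover have "g y \<bullet> b = y \<bullet> b + r (g y) \<bullet> b" by (subst g_eq[OF y]) (rule inner_add_left)
      ultimately show ?thesis by linarith
    qed
    then show "g y \<in> U" using y eq by (simp add: U_def box_def)
  qed
  have gh: "g (h - r h) = h" if h: "h \<in> U" for h
  proof -
    have y: "h - r h \<in> box (s / 2)" using h by (simp add: U_def)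
    show ?thesis by (rule uniq) (use gU[OF y] U_le h in auto)
  qed
  show ?thesis
  proof (intro exI conjI ballI)
    show "open U" unfolding U_def by (rule continuous_open_preimage[OF r_cont box_open box_open])
    show "0 \<in> U" using s by (simp add: U_def box_def r0)
    show "U \<subseteq> ball 0 \<epsilon>"
    proof
      fix h assume "h \<in> U"
      then have "norm h < \<epsilon>"
        using s(3) by (intro norm_lt_if_coords_small) (auto simp: U_def box_def D_def intro: less_le_trans)
      then show "h \<in> ball 0 \<epsilon>" by simp
    qed
    show "open (box (s / 2))" by (rule box_open)
    show "(\<lambda>h. h - r h) ` U = box (s / 2)"
    proof (intro equalityI subsetI)
      fix y assume "y \<in> box (s / 2)"
      then show "y \<in> (\<lambda>h. h - r h) ` U" using gU[of y] by (metis imageI)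
    qed (auto simp: U_def)
    show "inj_on (\<lambda>h. h - r h) U" by (rule inj_on_inverseI[of _ g]) (rule gh)
    show "g (h - r h) = h" if "h \<in> U" for h by (rule gh[OF that])
    show "analytic_at_point g y" if y: "y \<in> box (s / 2)" for y
      unfolding analytic_at_point_def
    proof
      fix b :: 'a assume b: "b \<in> Basis"
      have "analytic_germ (\<lambda>y. Re (L (complex_coords y) b)) (0 + y)"
      proof (rule analytic_germ_recenter[OF _ L_hol[OF b] L_bd[OF b]])
        show "L (complex_coords h) b = of_real (Re (L (complex_coords (0 + h)) b))"
          if "complex_coords h \<in> polydisc Basis (s / 2)" for h
          using Lg[of h b] that b by (simp add: box_coords gb)
      qed (use s y in \<open>auto simp: box_coords\<close>)
      then show "analytic_germ (\<lambda>y. g y \<bullet> b) y" using b by (simp add: gb)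
    qed
  qed
qed

text \<open>
  After translation and composition with the inverse of the derivative, the map is the identity minus an analytic
  map of second order.
\<close>

theorem real_analytic_inverse_function:
  fixes f :: "'a::euclidean_space \<Rightarrow> 'a"
  assumes f: "real_analytic_on f S" and S: "open S" "x0 \<in> S"
    and D: "(f has_derivative D) (at x0)" and inj: "inj D"
  shows "\<exists>U g. open U \<and> x0 \<in> U \<and> U \<subseteq> S \<and> open (f ` U) \<and> inj_on f U \<and> real_analytic_on g (f ` U) \<and>
    (\<forall>x\<in>U. g (f x) = x)"
proof -
  have lD: "linear D" using has_derivative_linear[OF D] .
  obtain E where lE: "linear E" and ED: "\<And>v. E (D v) = v" and DE: "\<And>v. D (E v) = v"
    using linear_injective_isomorphism[OF lD inj] by blast
  define r where "r = (\<lambda>h. h - E (f (x0 + h) - f x0))"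
  obtain \<epsilon> where \<epsilon>: "0 < \<epsilon>" "ball x0 \<epsilon> \<subseteq> S" using S open_contains_ball by blast
  have fa: "analytic_at_point f x" if "x \<in> S" for x using f that by (simp add: real_analytic_on_iff)
  have shift: "analytic_at_point (\<lambda>h. x0 + h) h" for h
    by (intro analytic_at_point_add analytic_at_point_const analytic_at_point_id)
  have "analytic_at_point (\<lambda>h. f (x0 + h)) 0"
    by (rule analytic_at_point_compose[where f = f, OF _ shift]) (use fa S in simp)
  then have "analytic_at_point (\<lambda>h. f (x0 + h) + (- f x0)) 0"
    by (intro analytic_at_point_add analytic_at_point_const)
  then have "analytic_at_point (\<lambda>h. E (f (x0 + h) + (- f x0))) 0"
    by (rule analytic_at_point_compose[OF analytic_at_point_linear[OF lE]])
  then have "analytic_at_point (\<lambda>h. - E (f (x0 + h) + (- f x0))) 0"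
    by (rule analytic_at_point_compose[OF analytic_at_point_linear[of uminus], rotated])
      (simp add: linear_iff)
  then have ra: "analytic_at_point r 0"
    unfolding r_def diff_conv_add_uminus
    by (intro analytic_at_point_add analytic_at_point_id)
  have "((\<lambda>h. f (x0 + h)) has_derivative D) (at 0)"
  proof -
    have "((\<lambda>h. x0 + h) has_derivative (\<lambda>h. h)) (at 0)" by (auto intro!: derivative_eq_intros)
    from has_derivative_compose[OF this, of f D] D show ?thesis by simp
  qed
  then have "((\<lambda>h. E (f (x0 + h) - f x0)) has_derivative (\<lambda>h. E (D h - 0))) (at 0)"
    by (intro bounded_linear.has_derivative[OF linear_conv_bounded_linear[THEN iffD1, OF lE]] derivative_intros)
  then have rd: "(r has_derivative (\<lambda>_. 0)) (at 0)"
    unfolding r_def by (auto simp: ED intro!: derivative_eq_intros)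
  have r0: "r 0 = 0" using linear_0[OF lE] by (simp add: r_def)
  obtain U V g where U: "open U" "0 \<in> U" "U \<subseteq> ball 0 \<epsilon>" "open V" "(\<lambda>h. h - r h) ` U = V" "inj_on (\<lambda>h. h - r h) U"
    and ga: "\<And>y. y \<in> V \<Longrightarrow> analytic_at_point g y" and g: "\<And>h. h \<in> U \<Longrightarrow> g (h - r h) = h"
    using near_identity_inverse[OF ra r0 rd \<epsilon>(1)] by blast
  have rr: "h - r h = E (f (x0 + h) - f x0)" for h by (simp add: r_def)
  have fE: "f (x0 + h) = f x0 + D (h - r h)" for h by (simp add: rr DE)
  define G where "G = (\<lambda>y. x0 + g (E (y - f x0)))"
  have inv: "G (f (x0 + h)) = x0 + h" if "h \<in> U" for h
    using g[OF that] by (simp add: G_def rr)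
  have img: "f ` (\<lambda>h. x0 + h) ` U = (\<lambda>y. f x0 + y) ` D ` V"
    unfolding U(5)[symmetric] image_image fE ..
  show ?thesis
  proof (intro exI[of _ "(\<lambda>h. x0 + h) ` U"] exI[of _ G] conjI)
    show "open ((\<lambda>h. x0 + h) ` U)" using U(1) by (rule open_translation)
    show "x0 \<in> (\<lambda>h. x0 + h) ` U" using U(2) by force
    show "(\<lambda>h. x0 + h) ` U \<subseteq> S" using U(3) \<epsilon>(2) by (force simp: dist_norm)
    have "surj D" using DE by (metis surjI)
    then have "open (D ` V)" using open_surjective_linear_image[OF U(4) lD] by blast
    then show "open (f ` (\<lambda>h. x0 + h) ` U)" unfolding img by (rule open_translation)
    show "inj_on f ((\<lambda>h. x0 + h) ` U)" by (rule inj_on_inverseI[of _ G]) (auto simp: inv)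
    show "\<forall>x\<in>(\<lambda>h. x0 + h) ` U. G (f x) = x" by (auto simp: inv)
    show "real_analytic_on G (f ` (\<lambda>h. x0 + h) ` U)"
      unfolding real_analytic_on_iff
    proof
      fix y assume "y \<in> f ` (\<lambda>h. x0 + h) ` U"
      then obtain h where h: "h \<in> U" "y = f (x0 + h)" by auto
      then have "E (y - f x0) \<in> V" using U(5) rr[of h] by force
      then have ga': "analytic_at_point g (E (y - f x0))" by (rule ga)
      have "analytic_at_point (\<lambda>y. y + (- f x0)) y"
        by (intro analytic_at_point_add analytic_at_point_const analytic_at_point_id)
      then have "analytic_at_point (\<lambda>y. E (y + (- f x0))) y"
        by (rule analytic_at_point_compose[OF analytic_at_point_linear[OF lE]])
      then have "analytic_at_point (\<lambda>y. g (E (y + (- f x0)))) y"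
        by (rule analytic_at_point_compose[rotated]) (use ga' in simp)
      then show "analytic_at_point G y"
        unfolding G_def diff_conv_add_uminus by (intro analytic_at_point_add analytic_at_point_const)
    qed
  qed
qed

section \<open>Matrices over the quaternions\<close>

lemma mat2_nth [simp]: "mat2 a b c d $ 1 $ 1 = a" "mat2 a b c d $ 1 $ 2 = b" "mat2 a b c d $ 2 $ 1 = c" "mat2 a b c d $ 2 $ 2 = d"
  by (simp_all add: mat2_def vector_def)

lemma qmat_eq_iff: "(M :: qmat) = N \<longleftrightarrow> M$1$1 = N$1$1 \<and> M$1$2 = N$1$2 \<and> M$2$1 = N$2$1 \<and> M$2$2 = N$2$2"
  by (auto simp: vec_eq_iff forall_2)

lemma mat2_eta: "mat2 (M$1$1) (M$1$2) (M$2$1) (M$2$2) = M"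
  by (simp add: qmat_eq_iff)

lemma qmat_mult_nth:
  "((M :: qmat) ** N) $ i $ j = M$i$1 * N$1$j + M$i$2 * N$2$j"
  by (simp add: matrix_matrix_mult_def sum_2)

lemma mat2_mult: "mat2 a b c d ** mat2 a' b' c' d' = mat2 (a * a' + b * c') (a * b' + b * d') (c * a' + d * c') (c * b' + d * d')"
  by (simp add: qmat_eq_iff qmat_mult_nth)

lemma mat_1_eq: "mat 1 = mat2 1 0 0 1"
  by (simp add: qmat_eq_iff mat_def)

lemma mat2_arith: "mat2 a b c d + mat2 a' b' c' d' = mat2 (a + a') (b + b') (c + c') (d + d')"
  "mat2 a b c d - mat2 a' b' c' d' = mat2 (a - a') (b - b') (c - c') (d - d')"
  "t *\<^sub>R mat2 a b c d = mat2 (t *\<^sub>R a) (t *\<^sub>R b) (t *\<^sub>R c) (t *\<^sub>R d)"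
  by (simp_all add: qmat_eq_iff)

lemma mat2_inject: "mat2 a b c d = mat2 a' b' c' d' \<longleftrightarrow> a = a' \<and> b = b' \<and> c = c' \<and> d = d'"
  by (simp add: qmat_eq_iff)

lemma qmat_scaleR_left: "(t *\<^sub>R (A :: qmat)) ** (B :: qmat) = t *\<^sub>R (A ** B)"
  by (simp add: qmat_eq_iff qmat_mult_nth scaleR_add_right)

lemma qmat_scaleR_right: "(A :: qmat) ** (t *\<^sub>R (B :: qmat)) = t *\<^sub>R (A ** B)"
  by (simp add: qmat_eq_iff qmat_mult_nth scaleR_add_right)

lemma qmat_diff_left: "((A :: qmat) - B) ** (C :: qmat) = A ** C - B ** C"
  by (simp add: qmat_eq_iff qmat_mult_nth algebra_simps)

lemma qmat_diff_right: "(A :: qmat) ** (B - C :: qmat) = A ** B - A ** C"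
  by (simp add: qmat_eq_iff qmat_mult_nth algebra_simps)

lemma qmat_add_left: "((A :: qmat) + B) ** (C :: qmat) = A ** C + B ** C"
  by (simp add: qmat_eq_iff qmat_mult_nth algebra_simps)

lemma qmat_zero: "(0 :: qmat) ** (A :: qmat) = 0" "A ** (0 :: qmat) = (0 :: qmat)"
  by (simp_all add: qmat_eq_iff qmat_mult_nth)

lemma qmat_minus: "(- (A :: qmat)) ** (B :: qmat) = - (A ** B)" "(A :: qmat) ** (- B :: qmat) = - (A ** B)"
  by (simp_all add: qmat_eq_iff qmat_mult_nth)

lemmas qmat_distribs = matrix_add_ldistrib qmat_add_left qmat_diff_left qmat_diff_right
  qmat_scaleR_left qmat_scaleR_right qmat_zero qmat_minus

lemma quat_inverse_cancel: "(a :: quat) \<noteq> 0 \<Longrightarrow> a * (inverse a * y) = y" "(a :: quat) \<noteq> 0 \<Longrightarrow> inverse a * (a * y) = y"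
  by (simp_all flip: mult.assoc)

text \<open>
  Multiplicativity of the norm removes the asymmetric commutator term of the definition.
\<close>

lemma dieudonne_det_mat2:
  "a \<noteq> 0 \<Longrightarrow> dieudonne_det (mat2 a b c d) = norm a * norm (d - c * inverse a * b)"
  "dieudonne_det (mat2 0 b c d) = norm c * norm b"
proof -
  assume "a \<noteq> 0"
  moreover have "a * d - a * c * inverse a * b = a * (d - c * inverse a * b)" by (simp add: algebra_simps)
  ultimately show "dieudonne_det (mat2 a b c d) = norm a * norm (d - c * inverse a * b)"
    by (simp add: dieudonne_det_def norm_mult)
qed (simp add: dieudonne_det_def norm_mult)

text \<open>
  Either entry of the first column may serve as the pivot; without this symmetry the effect of row operations could
  not be computed.
\<close>

lemma dieudonne_det_mat2_lower_pivot:
  assumes "c \<noteq> 0"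
  shows "dieudonne_det (mat2 a b c d) = norm c * norm (b - a * inverse c * d)"
proof (cases "a = 0")
  case False
  have "a * inverse c * (d - c * inverse a * b) = a * inverse c * d - b"
    using assms False by (simp add: right_diff_distrib mult.assoc quat_inverse_cancel)
  then have "norm (b - a * inverse c * d) = norm a * inverse (norm c) * norm (d - c * inverse a * b)"
    by (metis norm_inverse norm_minus_commute norm_mult)
  then show ?thesis using assms False by (simp add: dieudonne_det_mat2)
qed (simp add: dieudonne_det_mat2)

lemma dieudonne_det_lower_unipotent: "dieudonne_det (mat2 1 0 x 1 ** N) = dieudonne_det N"
proof -
  obtain a b c d where N: "N = mat2 a b c d" by (metis mat2_eta)
  show ?thesis
  proof (cases "a = 0")
    case False
    then have "x * b + d - (x * a + c) * inverse a * b = d - c * inverse a * b"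
      by (simp add: algebra_simps quat_inverse_cancel)
    then have "norm (x * b + d - (x * a + c) * inverse a * b) = norm (d - c * inverse a * b)"
      by (rule arg_cong)
    with False show ?thesis by (simp add: N mat2_mult dieudonne_det_mat2)
  qed (simp add: N mat2_mult dieudonne_det_mat2)
qed

lemma dieudonne_det_upper_unipotent: "dieudonne_det (mat2 1 x 0 1 ** N) = dieudonne_det N"
proof -
  obtain a b c d where N: "N = mat2 a b c d" by (metis mat2_eta)
  show ?thesis
  proof (cases "c = 0")
    case False
    then have "b + x * d - (a + x * c) * inverse c * d = b - a * inverse c * d"
      by (simp add: algebra_simps quat_inverse_cancel)
    then have "norm (b + x * d - (a + x * c) * inverse c * d) = norm (b - a * inverse c * d)"
      by (rule arg_cong)
    with False show ?thesis by (simp add: N mat2_mult dieudonne_det_mat2_lower_pivot)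
  next
    case True
    then show ?thesis by (cases "a = 0") (simp_all add: N mat2_mult dieudonne_det_mat2)
  qed
qed

lemma dieudonne_det_swap: "dieudonne_det (mat2 0 1 1 0 ** N) = dieudonne_det N"
proof -
  obtain a b c d where N: "N = mat2 a b c d" by (metis mat2_eta)
  show ?thesis
  proof (cases "c = 0")
    case False
    then show ?thesis by (simp add: N mat2_mult dieudonne_det_mat2 dieudonne_det_mat2_lower_pivot norm_minus_commute)
  next
    case True
    then show ?thesis by (cases "a = 0") (simp_all add: N mat2_mult dieudonne_det_mat2)
  qed
qed

lemma dieudonne_det_diagonal: "dieudonne_det (mat2 x 0 0 y ** N) = norm x * norm y * dieudonne_det N"
proof -
  obtain a b c d where N: "N = mat2 a b c d" by (metis mat2_eta)
  show ?thesis
  proof (cases "x * a = 0")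
    case False
    then have "y * d - y * c * inverse (x * a) * (x * b) = y * (d - c * inverse a * b)"
      by (simp add: nonzero_inverse_mult_distrib right_diff_distrib mult.assoc quat_inverse_cancel)
    with False show ?thesis by (simp add: N mat2_mult dieudonne_det_mat2 norm_mult)
  next
    case True
    then show ?thesis by (auto simp: N mat2_mult dieudonne_det_mat2 norm_mult)
  qed
qed

definition det_multiplicative :: "qmat \<Rightarrow> bool" where
  "det_multiplicative M \<longleftrightarrow> (\<forall>N. dieudonne_det (M ** N) = dieudonne_det M * dieudonne_det N)"

lemma dieudonne_det_1: "dieudonne_det (mat 1) = 1"
  using mat_1_in_SL2H by (simp add: SL2H_def)

lemma det_multiplicative_mult:
  assumes "det_multiplicative M" "det_multiplicative N"
  shows "det_multiplicative (M ** N)"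
  using assms unfolding det_multiplicative_def by (simp flip: matrix_mul_assoc)

lemma det_multiplicative_elementary:
  "det_multiplicative (mat2 1 0 x 1)" "det_multiplicative (mat2 1 x 0 1)"
  "det_multiplicative (mat2 0 1 1 0)" "det_multiplicative (mat2 x 0 0 y)"
proof -
  have "dieudonne_det (mat2 x 0 0 y) = norm x * norm y"
    using dieudonne_det_diagonal[of x y "mat 1"] by (simp add: dieudonne_det_1)
  then show "det_multiplicative (mat2 x 0 0 y)"
    by (simp add: det_multiplicative_def dieudonne_det_diagonal)
qed (simp_all add: det_multiplicative_def dieudonne_det_lower_unipotent dieudonne_det_upper_unipotent
    dieudonne_det_swap dieudonne_det_mat2)

lemma pivot_decomposition:
  assumes "a \<noteq> 0"
  shows "mat2 a b c d = mat2 1 0 (c * inverse a) 1 ** mat2 a 0 0 (d - c * inverse a * b) ** mat2 1 (inverse a * b) 0 1"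
  using assms by (simp add: mat2_mult mat2_inject mult.assoc quat_inverse_cancel)

text \<open>
  Elimination writes a matrix as a product of elementary ones, and left multiplication by an elementary matrix changes
  the determinant by its own determinant.
\<close>

lemma det_multiplicative_all: "det_multiplicative M"
proof -
  have pivot: "det_multiplicative (mat2 a b c d)" if "a \<noteq> 0" for a b c d
    unfolding pivot_decomposition[OF that, where b = b and c = c and d = d]
    by (intro det_multiplicative_mult det_multiplicative_elementary)
  obtain a b c d where M: "M = mat2 a b c d" by (metis mat2_eta)
  show ?thesis
  proof (cases "a = 0")
    case False
    then show ?thesis unfolding M by (rule pivot)
  next
    case True
    note a = True
    show ?thesis
    proof (cases "c = 0")
      case False
      have "M = mat2 0 1 1 0 ** mat2 c d a b" by (simp add: M mat2_mult)
      then show ?thesis using pivot[OF False] by (metis det_multiplicative_elementary(3) det_multiplicative_mult)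
    next
      case True
      show ?thesis
      proof (cases "b = 0")
        case False
        have "M = mat2 b 0 d 0 ** mat2 0 1 1 0" by (simp add: M mat2_mult a True)
        then show ?thesis using pivot[OF False] by (metis det_multiplicative_elementary(3) det_multiplicative_mult)
      next
        case b: True
        then show ?thesis using det_multiplicative_elementary(4)[of 0 d] by (simp add: M a True)
      qed
    qed
  qed
qed

theorem dieudonne_det_mult: "dieudonne_det (M ** N) = dieudonne_det M * dieudonne_det N"
  using det_multiplicative_all by (simp add: det_multiplicative_def)

lemma dieudonne_det_scaleR: "dieudonne_det (t *\<^sub>R M) = t\<^sup>2 * dieudonne_det M"
proof -
  have "t *\<^sub>R M = mat2 (of_real t) 0 0 (of_real t) ** M"
    by (simp add: qmat_eq_iff qmat_mult_nth) (simp add: scaleR_conv_of_real)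
  then show ?thesis by (simp add: dieudonne_det_diagonal power2_eq_square)
qed

lemma invertible_qmat_mult: "invertible (M :: qmat) \<Longrightarrow> invertible N \<Longrightarrow> invertible (M ** N)"
  by (rule invertible_mult)

lemma invertible_qmatI: "(X :: qmat) ** Y = mat 1 \<Longrightarrow> Y ** X = mat 1 \<Longrightarrow> invertible X"
  by (auto simp: invertible_def)

lemma invertible_matrix_inv: "invertible (M :: qmat) \<Longrightarrow> invertible (matrix_inv M)"
  by (rule invertible_qmatI[of _ M]) (auto simp: matrix_inv_inverse)

lemma matrix_inv_matrix_inv: "invertible (M :: qmat) \<Longrightarrow> matrix_inv (matrix_inv M) = M"
  by (rule matrix_inv_eqI) (auto simp: matrix_inv_inverse)

lemma invertible_elementary:
  "invertible (mat2 1 0 x 1)" "invertible (mat2 1 x 0 1)" "invertible (mat2 0 1 1 0)"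
  "x \<noteq> 0 \<Longrightarrow> y \<noteq> 0 \<Longrightarrow> invertible (mat2 x 0 0 y)"
proof -
  show "invertible (mat2 1 0 x 1)"
    by (rule invertible_qmatI[of _ "mat2 1 0 (- x) 1"]) (simp_all add: mat2_mult mat_1_eq)
  show "invertible (mat2 1 x 0 1)"
    by (rule invertible_qmatI[of _ "mat2 1 (- x) 0 1"]) (simp_all add: mat2_mult mat_1_eq)
  show "invertible (mat2 0 1 1 0)"
    by (rule invertible_qmatI[of _ "mat2 0 1 1 0"]) (simp_all add: mat2_mult mat_1_eq)
  show "invertible (mat2 x 0 0 y)" if "x \<noteq> 0" "y \<noteq> 0"
    by (rule invertible_qmatI[of _ "mat2 (inverse x) 0 0 (inverse y)"]) (use that in \<open>simp_all add: mat2_mult mat_1_eq\<close>)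
qed

lemma invertible_iff_dieudonne_det: "invertible M \<longleftrightarrow> dieudonne_det M \<noteq> 0"
proof
  assume "invertible M"
  then have "dieudonne_det M * dieudonne_det (matrix_inv M) = 1"
    by (simp add: matrix_inv_inverse dieudonne_det_1 flip: dieudonne_det_mult)
  then show "dieudonne_det M \<noteq> 0" by auto
next
  have pivot: "invertible (mat2 a b c d)" if "a \<noteq> 0" "dieudonne_det (mat2 a b c d) \<noteq> 0" for a b c d
  proof -
    have "d - c * inverse a * b \<noteq> 0" using that by (auto simp: dieudonne_det_mat2)
    then show ?thesis
      unfolding pivot_decomposition[OF that(1), where b = b and c = c and d = d]
      by (intro invertible_qmat_mult invertible_elementary that)
  qed
  assume D: "dieudonne_det M \<noteq> 0"
  obtain a b c d where M: "M = mat2 a b c d" by (metis mat2_eta)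
  show "invertible M"
  proof (cases "a = 0")
    case False
    then show ?thesis using pivot D by (simp add: M)
  next
    case True
    have sw: "M = mat2 0 1 1 0 ** mat2 c d a b" by (simp add: M mat2_mult)
    then have "dieudonne_det (mat2 c d a b) \<noteq> 0" using D by (simp add: dieudonne_det_swap)
    moreover have "c \<noteq> 0" using D True by (auto simp: M dieudonne_det_mat2)
    ultimately show ?thesis unfolding sw by (intro invertible_qmat_mult invertible_elementary pivot)
  qed
qed

lemma dieudonne_det_nonneg: "0 \<le> dieudonne_det M"
  by (simp add: dieudonne_det_def Let_def)

lemma SL2H_iff: "M \<in> SL2H \<longleftrightarrow> dieudonne_det M = 1"
  by (auto simp: SL2H_def invertible_iff_dieudonne_det)

lemma SL2H_mult: "M \<in> SL2H \<Longrightarrow> N \<in> SL2H \<Longrightarrow> M ** N \<in> SL2H"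
  by (simp add: SL2H_iff dieudonne_det_mult)

lemma dieudonne_det_matrix_inv: "invertible M \<Longrightarrow> dieudonne_det (matrix_inv M) = inverse (dieudonne_det M)"
  by (metis dieudonne_det_1 dieudonne_det_mult inverse_unique matrix_inv_inverse(1))

lemma SL2H_invertible: "M \<in> SL2H \<Longrightarrow> invertible M"
  by (simp add: SL2H_def)

lemma matrix_inv_in_SL2H: "M \<in> SL2H \<Longrightarrow> matrix_inv M \<in> SL2H"
  by (simp add: SL2H_iff dieudonne_det_matrix_inv invertible_iff_dieudonne_det)

lemma conj_by_scaleR:
  assumes "t \<noteq> 0" "invertible P"
  shows "conj_by (t *\<^sub>R P) X = conj_by P X"
proof -
  have "matrix_inv (t *\<^sub>R P) = (1 / t) *\<^sub>R matrix_inv P"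
    using assms by (intro matrix_inv_eqI) (simp_all add: qmat_scaleR_left qmat_scaleR_right matrix_inv_inverse)
  then show ?thesis using assms by (simp add: conj_by_def qmat_scaleR_left qmat_scaleR_right)
qed

text \<open>
  A real multiple of \<open>P\<close> lies in \<open>SL(2,H)\<close> and conjugates in the same way. Hence all conjugations below may
  use arbitrary invertible matrices.
\<close>

lemma SL2H_representative:
  assumes "invertible P"
  shows "\<exists>Q\<in>SL2H. \<forall>X. conj_by Q X = conj_by P X"
proof -
  define t where "t = 1 / sqrt (dieudonne_det P)"
  have "0 < dieudonne_det P" using assms dieudonne_det_nonneg[of P] by (simp add: invertible_iff_dieudonne_det less_le)
  then have "t \<noteq> 0" "t\<^sup>2 * dieudonne_det P = 1" by (simp_all add: t_def power_divide)
  then show ?thesis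
    using assms by (intro bexI[of _ "t *\<^sub>R P"]) (auto simp: conj_by_scaleR SL2H_iff dieudonne_det_scaleR)
qed

lemma conj_class_eq: "conj_class M = {conj_by P M |P. invertible P}"
proof (intro equalityI subsetI)
  fix N assume "N \<in> {conj_by P M |P. invertible P}"
  then obtain P where P: "invertible P" "N = conj_by P M" by auto
  from SL2H_representative[OF P(1)] obtain Q where "Q \<in> SL2H" "\<And>X. conj_by Q X = conj_by P X" by auto
  then show "N \<in> conj_class M" unfolding conj_class_def P(2) by (intro image_eqI[of _ _ Q]) simp_all
qed (auto simp: conj_class_def dest: SL2H_invertible)

lemma pair_class_eq: "pair_class p = {(conj_by P (fst p), conj_by P (snd p)) |P. invertible P}"
proof (intro equalityI subsetI)
  fix q assume "q \<in> {(conj_by P (fst p), conj_by P (snd p)) |P. invertible P}"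
  then obtain P where P: "invertible P" "q = (conj_by P (fst p), conj_by P (snd p))" by auto
  from SL2H_representative[OF P(1)] obtain Q where "Q \<in> SL2H" "\<And>X. conj_by Q X = conj_by P X" by auto
  then show "q \<in> pair_class p" unfolding pair_class_def P(2) by (intro image_eqI[of _ _ Q]) simp_all
qed (auto simp: pair_class_def dest: SL2H_invertible)

lemma matrix_inv_mult: "invertible (P :: qmat) \<Longrightarrow> invertible (Q :: qmat) \<Longrightarrow> matrix_inv (P ** Q) = matrix_inv Q ** matrix_inv P"
proof (rule matrix_inv_eqI)
  assume P: "invertible (P :: qmat)" and Q: "invertible (Q :: qmat)"
  have "P ** Q ** (matrix_inv Q ** matrix_inv P) = P ** (Q ** matrix_inv Q) ** matrix_inv P"
    by (simp only: matrix_mul_assoc)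
  then show "P ** Q ** (matrix_inv Q ** matrix_inv P) = mat 1" using P Q by (simp add: matrix_inv_inverse)
  have "matrix_inv Q ** matrix_inv P ** (P ** Q) = matrix_inv Q ** (matrix_inv P ** P) ** Q"
    by (simp only: matrix_mul_assoc)
  then show "matrix_inv Q ** matrix_inv P ** (P ** Q) = mat 1" using P Q by (simp add: matrix_inv_inverse)
qed

lemma conj_by_conj_by: "invertible P \<Longrightarrow> invertible Q \<Longrightarrow> conj_by P (conj_by Q X) = conj_by (P ** Q) X"
  by (simp add: conj_by_def matrix_inv_mult matrix_mul_assoc)

lemma conj_by_1 [simp]: "conj_by (mat 1) X = X"
proof -
  have "matrix_inv (mat 1 :: qmat) = mat 1" by (rule matrix_inv_eqI) simp_all
  then show ?thesis by (simp add: conj_by_def)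
qed

lemma conj_by_inverse: "invertible P \<Longrightarrow> conj_by (matrix_inv P) (conj_by P X) = X"
  by (simp add: conj_by_conj_by invertible_matrix_inv matrix_inv_inverse)

lemma conj_by_product: "invertible P \<Longrightarrow> conj_by P (X ** Y) = conj_by P X ** conj_by P Y"
proof -
  assume P: "invertible P"
  have "conj_by P X ** conj_by P Y = P ** X ** (matrix_inv P ** P) ** Y ** matrix_inv P"
    by (simp only: conj_by_def matrix_mul_assoc)
  then show ?thesis using P by (simp add: matrix_inv_inverse conj_by_def matrix_mul_assoc)
qed

lemma conj_by_linear: "conj_by P (X + Y) = conj_by P X + conj_by P Y"
  "conj_by P (X - Y) = conj_by P X - conj_by P Y" "conj_by P (t *\<^sub>R X) = t *\<^sub>R conj_by P X"
  "conj_by P 0 = 0"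
  by (simp_all add: conj_by_def qmat_distribs)

lemma conj_by_mat_1: "invertible P \<Longrightarrow> conj_by P (mat 1) = mat 1"
  by (simp add: conj_by_def matrix_inv_inverse)

lemma invertible_conj_by: "invertible P \<Longrightarrow> invertible X \<Longrightarrow> invertible (conj_by P X)"
  by (simp add: conj_by_def invertible_qmat_mult invertible_matrix_inv)

lemma matrix_inv_conj: "invertible P \<Longrightarrow> invertible X \<Longrightarrow> matrix_inv (conj_by P X) = conj_by P (matrix_inv X)"
  by (rule matrix_inv_eqI) (simp_all add: conj_by_mat_1 matrix_inv_inverse flip: conj_by_product)

lemma trH_conj: "invertible P \<Longrightarrow> trH (conj_by P M) = trH M"
  by (metis conj_by_def matrix_inv_inverse(2) matrix_mul_assoc matrix_mul_lid trH_mult_commute)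

lemma dieudonne_det_conj: "invertible P \<Longrightarrow> dieudonne_det (conj_by P X) = dieudonne_det X"
  by (simp add: conj_by_def dieudonne_det_mult dieudonne_det_matrix_inv) (simp add: invertible_iff_dieudonne_det)

lemma SL2H_conj: "invertible P \<Longrightarrow> X \<in> SL2H \<Longrightarrow> conj_by P X \<in> SL2H"
  by (simp add: SL2H_iff dieudonne_det_conj)

text \<open>
  Conjugacy as an intertwining relation, in which no inverse occurs.
\<close>

lemma conj_by_eq_iff: "invertible P \<Longrightarrow> conj_by P X = Y \<longleftrightarrow> P ** X = Y ** P"
proof -
  assume P: "invertible P"
  have "conj_by P X ** P = P ** X ** (matrix_inv P ** P)" by (simp only: conj_by_def matrix_mul_assoc)
  then have 1: "conj_by P X ** P = P ** X" using P by (simp add: matrix_inv_inverse)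
  have 2: "Y = Y ** P ** matrix_inv P"
    using P by (simp add: matrix_inv_inverse flip: matrix_mul_assoc)
  show ?thesis
  proof
    assume "P ** X = Y ** P"
    then have "conj_by P X = Y ** P ** matrix_inv P" by (simp add: conj_by_def)
    then show "conj_by P X = Y" using 2 by simp
  qed (use 1 in simp)
qed

definition conj_pair :: "qmat \<Rightarrow> qmat \<times> qmat \<Rightarrow> qmat \<times> qmat" where
  "conj_pair P p = (conj_by P (fst p), conj_by P (snd p))"

lemma pair_class_iff: "q \<in> pair_class p \<longleftrightarrow> (\<exists>P. invertible P \<and> q = conj_pair P p)"
  by (auto simp: pair_class_eq conj_pair_def)

lemma conj_pair_conj_pair: "invertible P \<Longrightarrow> invertible Q \<Longrightarrow> conj_pair P (conj_pair Q p) = conj_pair (P ** Q) p"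
  by (simp add: conj_pair_def conj_by_conj_by)

lemma pair_class_refl: "p \<in> pair_class p"
  unfolding pair_class_iff by (rule exI[of _ "mat 1"]) (simp add: conj_pair_def invertible_qmatI[of _ "mat 1"])

lemma pair_class_sym: "q \<in> pair_class p \<Longrightarrow> p \<in> pair_class q"
proof -
  assume "q \<in> pair_class p"
  then obtain P where P: "invertible P" "q = conj_pair P p" by (auto simp: pair_class_iff)
  then have "p = conj_pair (matrix_inv P) q" by (simp add: conj_pair_def conj_by_inverse)
  then show ?thesis using invertible_matrix_inv[OF P(1)] by (auto simp: pair_class_iff)
qed

lemma pair_class_trans: "q \<in> pair_class p \<Longrightarrow> s \<in> pair_class q \<Longrightarrow> s \<in> pair_class p"
  by (auto simp: pair_class_iff conj_pair_conj_pair intro: invertible_qmat_mult)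

lemma pair_class_eqI: "q \<in> pair_class p \<Longrightarrow> pair_class q = pair_class p"
  using pair_class_sym pair_class_trans by blast

lemma conj_class_iff: "N \<in> conj_class M \<longleftrightarrow> (\<exists>P. invertible P \<and> N = conj_by P M)"
  by (auto simp: conj_class_eq)

lemma conj_class_refl: "M \<in> conj_class M"
  unfolding conj_class_iff by (rule exI[of _ "mat 1"]) (simp add: invertible_qmatI[of _ "mat 1"])

lemma conj_class_sym: "N \<in> conj_class M \<Longrightarrow> M \<in> conj_class N"
proof -
  assume "N \<in> conj_class M"
  then obtain P where P: "invertible P" "N = conj_by P M" by (auto simp: conj_class_iff)
  then have "M = conj_by (matrix_inv P) N" by (simp add: conj_by_inverse)
  then show ?thesis using invertible_matrix_inv[OF P(1)] by (auto simp: conj_class_iff)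
qed

lemma conj_class_trans: "N \<in> conj_class M \<Longrightarrow> L \<in> conj_class N \<Longrightarrow> L \<in> conj_class M"
  by (auto simp: conj_class_iff conj_by_conj_by intro: invertible_qmat_mult)

section \<open>Cayley-Hamilton and the conjugation of nearby regular loxodromic elements\<close>

lemma bounded_bilinear_qmat_mult: "bounded_bilinear (\<lambda>(A :: qmat) (B :: qmat). A ** B)"
  by (simp add: bilinear_conv_bounded_bilinear[symmetric] bilinear_def linear_iff qmat_distribs)

lemma linear_trH: "linear trH"
  by (simp add: linear_iff trH_def quat_defs algebra_simps)

lemma trH_simps: "trH (A + B) = trH A + trH B" "trH (A - B) = trH A - trH B" "trH (t *\<^sub>R A) = t * trH A" "trH 0 = 0" "trH (mat 1) = 2"
  using linear_trH by (simp_all add: linear_add linear_diff linear_cmul linear_0) (simp add: trH_def mat_def one_quat_def plus_quat_def)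

text \<open>
  The curve \<open>1 + t X\<close>, divided by the square root of its determinant, lies in \<open>SL(2,H)\<close>. The determinant has
  derivative \<open>tr X = 0\<close> at \<open>t = 0\<close>, so the normalization does not change the velocity \<open>X\<close>.
\<close>

lemma traceless_in_sl2H:
  assumes "trH X = 0"
  shows "X \<in> sl2H"
proof -
  obtain x y z w where X: "X = mat2 x y z w" by (metis mat2_eta)
  have tr: "qre x + qre w = 0" using assms by (simp add: X trH_def plus_quat_def)
  define u where "u = (\<lambda>t::real. 1 + t *\<^sub>R x)"
  define v where "v = (\<lambda>t::real. 1 + t *\<^sub>R w - (t *\<^sub>R t *\<^sub>R (z * inverse (u t) * y)))"
  (* u and v are the pivots of 1 + t X, and G is the square of its determinant, which is smoother than the norm. *)
  define G where "G = (\<lambda>t. (u t \<bullet> u t) * (v t \<bullet> v t))"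
  define \<gamma> where "\<gamma> = (\<lambda>t. (G t powr (- 1 / 4)) *\<^sub>R (mat 1 + t *\<^sub>R X))"
  have u0: "u 0 = 1" "v 0 = 1" by (simp_all add: u_def v_def)
  have inner1: "(1::quat) \<bullet> h = qre h" "h \<bullet> (1::quat) = qre h" for h by (simp_all add: inner_quat_def one_quat_def)
  have q1: "qre 1 = 1" "qre (h *\<^sub>R k) = h * qre k" for h k by (simp_all add: one_quat_def scaleR_quat_def)
  have du: "(u has_derivative (\<lambda>h. h *\<^sub>R x)) (at 0)"
    unfolding u_def by (auto intro!: derivative_eq_intros)
  have dv: "(v has_derivative (\<lambda>h. h *\<^sub>R w)) (at 0)"
    unfolding v_def by (rule derivative_eq_intros du refl | simp add: u0)+
  have "(G has_derivative (\<lambda>h. (u 0 \<bullet> u 0) * (v 0 \<bullet> h *\<^sub>R w + h *\<^sub>R w \<bullet> v 0) + (u 0 \<bullet> h *\<^sub>R x + h *\<^sub>R x \<bullet> u 0) * (v 0 \<bullet> v 0))) (at 0)"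
    unfolding G_def by (intro has_derivative_mult has_derivative_inner du dv)
  also have "(\<lambda>h. (u 0 \<bullet> u 0) * (v 0 \<bullet> h *\<^sub>R w + h *\<^sub>R w \<bullet> v 0) + (u 0 \<bullet> h *\<^sub>R x + h *\<^sub>R x \<bullet> u 0) * (v 0 \<bullet> v 0)) = (\<lambda>h. h * 0)"
  proof
    fix h
    have "h * qre x + h * qre w = 0" using tr by (simp flip: distrib_left)
    then show "(u 0 \<bullet> u 0) * (v 0 \<bullet> h *\<^sub>R w + h *\<^sub>R w \<bullet> v 0) + (u 0 \<bullet> h *\<^sub>R x + h *\<^sub>R x \<bullet> u 0) * (v 0 \<bullet> v 0) = h * 0"
      by (simp add: u0 inner1 q1 flip: mult_2)
  qed
  finally have dG: "(G has_real_derivative 0) (at 0)"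
    by (simp add: has_field_derivative_def flip: lambda_zero)
  have G0: "G 0 = 1" by (simp add: G_def u0 inner1 q1)
  have dp: "((\<lambda>t. G t powr (- 1 / 4)) has_real_derivative 0) (at 0)"
    using DERIV_fun_powr[OF dG, of "- 1 / 4"] by (simp add: G0)
  have dM: "((\<lambda>t. mat 1 + t *\<^sub>R X) has_vector_derivative X) (at 0)"
    by (auto intro!: derivative_eq_intros)
  have "(\<gamma> has_vector_derivative (G 0 powr (- 1 / 4)) *\<^sub>R X + 0 *\<^sub>R (mat 1 + 0 *\<^sub>R X)) (at 0)"
    unfolding \<gamma>_def by (rule has_vector_derivative_scaleR[OF dp dM])
  then have d\<gamma>: "(\<gamma> has_vector_derivative X) (at 0)" by (simp add: G0)
  have cont: "isCont u 0" "isCont G 0" using du dG by (auto intro: has_derivative_continuous DERIV_isCont)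
  then have "(u \<longlongrightarrow> 1) (nhds 0)" "(G \<longlongrightarrow> 1) (nhds 0)"
    using tendsto_at_iff_tendsto_nhds[of u 0] tendsto_at_iff_tendsto_nhds[of G 0] u0 G0
    by (simp_all add: isCont_def)
  then have "\<forall>\<^sub>F t in nhds 0. u t \<noteq> 0" "\<forall>\<^sub>F t in nhds 0. 0 < G t"
    by (auto intro: tendsto_imp_eventually_ne order_tendstoD(1))
  then have "\<forall>\<^sub>F t in nhds 0. \<gamma> t \<in> SL2H"
  proof eventually_elim
    case (elim t)
    have eq: "mat 1 + t *\<^sub>R X = mat2 (u t) (t *\<^sub>R y) (t *\<^sub>R z) (1 + t *\<^sub>R w)"
      by (simp add: X mat_1_eq mat2_arith u_def)
    have "dieudonne_det (mat 1 + t *\<^sub>R X) = norm (u t) * norm (v t)"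
      unfolding eq dieudonne_det_mat2(1)[OF elim(1)] v_def by simp
    also have "\<dots> = sqrt (G t)" by (simp add: G_def real_sqrt_mult norm_eq_sqrt_inner)
    finally have D: "dieudonne_det (mat 1 + t *\<^sub>R X) = G t powr (1 / 2)" using elim(2) by (simp add: powr_half_sqrt)
    have "dieudonne_det (\<gamma> t) = G t powr (- 1 / 4) * G t powr (- 1 / 4) * G t powr (1 / 2)"
      unfolding \<gamma>_def dieudonne_det_scaleR D by (simp add: power2_eq_square)
    also have "\<dots> = 1" using elim(2) by (simp flip: powr_add)
    finally show ?case by (simp add: SL2H_iff)
  qed
  moreover have "\<gamma> 0 = mat 1" by (simp add: \<gamma>_def G0)
  ultimately show ?thesis using d\<gamma> unfolding sl2H_def tangent_space_def by blast
qed

text \<open>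
  The traceless part of \<open>X\<close> lies in the Lie algebra and is centralized by both elements.
\<close>

lemma scalar_if_commutes:
  assumes "A \<in> SL2H" "B \<in> SL2H" "centralizer_algebra A \<inter> centralizer_algebra B = {0}"
    and X: "X ** A = A ** X" "X ** B = B ** X"
  shows "X = (trH X / 2) *\<^sub>R mat 1"
proof -
  define Y where "Y = X - (trH X / 2) *\<^sub>R mat 1"
  have "trH Y = 0" by (simp add: Y_def trH_simps)
  then have Y: "Y \<in> sl2H" by (rule traceless_in_sl2H)
  have "conj_by A Y = Y" "conj_by B Y = Y"
    using assms(1,2) X by (simp_all add: conj_by_eq_iff SL2H_invertible Y_def qmat_distribs)
  then have "Y \<in> centralizer_algebra A \<inter> centralizer_algebra B"
    using Y by (simp add: centralizer_algebra_def)
  then have "Y = 0" using assms(3) by simp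
  then show ?thesis by (simp add: Y_def)
qed

definition quartic :: "real \<Rightarrow> real \<Rightarrow> real \<Rightarrow> qmat \<Rightarrow> qmat" where
  "quartic p e q X = X ** X ** X ** X - (2 * p) *\<^sub>R (X ** X ** X) + e *\<^sub>R (X ** X) - (2 * q) *\<^sub>R X + mat 1"

definition quartic_deriv :: "real \<Rightarrow> real \<Rightarrow> real \<Rightarrow> qmat \<Rightarrow> qmat" where
  "quartic_deriv p e q X = 4 *\<^sub>R (X ** X ** X) - (6 * p) *\<^sub>R (X ** X) + (2 * e) *\<^sub>R X - (2 * q) *\<^sub>R mat 1"

text \<open>
  The characteristic polynomial of \<open>M\<close> as a complex \<open>4\<times>4\<close> matrix of determinant \<open>1\<close>. Its complex trace
  is \<open>2 tr M\<close>, which explains the factors \<open>2\<close>; the coefficient of degree one comes from \<open>M\<inverse>\<close>.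
\<close>

definition char_quartic :: "qmat \<Rightarrow> qmat \<Rightarrow> qmat" where
  "char_quartic M = quartic (trH M) (2 * (trH M)\<^sup>2 - trH (M ** M)) (trH (matrix_inv M))"

lemma quartic_conj: "invertible P \<Longrightarrow> quartic p e q (conj_by P X) = conj_by P (quartic p e q X)"
  by (simp add: quartic_def conj_by_linear conj_by_product conj_by_mat_1)

lemma quartic_deriv_conj: "invertible P \<Longrightarrow> quartic_deriv p e q (conj_by P X) = conj_by P (quartic_deriv p e q X)"
  by (simp add: quartic_deriv_def conj_by_linear conj_by_product conj_by_mat_1)

lemma char_quartic_conj:
  "invertible P \<Longrightarrow> invertible M \<Longrightarrow> char_quartic (conj_by P M) X = char_quartic M X"
  by (simp add: char_quartic_def matrix_inv_conj trH_conj flip: conj_by_product)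

lemma conj_by_eq_0_iff: "invertible P \<Longrightarrow> conj_by P X = 0 \<longleftrightarrow> X = 0"
  by (metis conj_by_inverse conj_by_linear(4))

lemma norm_1_inverse: "norm (\<beta> :: quat) = 1 \<Longrightarrow> inverse \<beta> = Quat (qre \<beta>) (- qim1 \<beta>) (- qim2 \<beta>) (- qim3 \<beta>)"
  by (simp add: norm_quat_def inverse_quat_def scaleR_quat_def)

text \<open>
  The companion matrix satisfies \<open>N e\<^sub>1 = e\<^sub>2\<close> and \<open>N e\<^sub>2 = e\<^sub>1 \<beta> + e\<^sub>2 \<alpha>\<close>, so that its powers and its
  inverse have entries which are short expressions in \<open>\<alpha>\<close> and \<open>\<beta>\<close>.
\<close>

lemma companion_quartic:
  assumes "norm \<beta> = 1"
  shows "char_quartic (mat2 0 \<beta> 1 \<alpha>) (mat2 0 \<beta> 1 \<alpha>) = 0"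
proof -
  let ?N = "mat2 0 \<beta> 1 \<alpha>"
  have \<beta>0: "\<beta> \<noteq> 0" using assms by auto
  have inv: "matrix_inv ?N = mat2 (- (\<alpha> * inverse \<beta>)) 1 (inverse \<beta>) 0"
    by (rule matrix_inv_eqI) (simp_all add: mat2_mult mat_1_eq \<beta>0 mult.assoc)
  define p e q where "p = trH ?N" and "e = 2 * (trH ?N)\<^sup>2 - trH (?N ** ?N)" and "q = trH (matrix_inv ?N)"
  define F where "F = quartic p e q ?N"
  obtain a0 a1 a2 a3 where a: "\<alpha> = Quat a0 a1 a2 a3" by (cases \<alpha>)
  obtain b0 b1 b2 b3 where b: "\<beta> = Quat b0 b1 b2 b3" by (cases \<beta>)
  have nb: "b0\<^sup>2 + b1\<^sup>2 + b2\<^sup>2 + b3\<^sup>2 = 1" using assms by (simp add: norm_quat_def b)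
  have p: "p = a0" by (simp add: p_def trH_def a quat_defs)
  have e: "e = a0\<^sup>2 + a1\<^sup>2 + a2\<^sup>2 + a3\<^sup>2 - 2 * b0"
    by (simp add: e_def trH_def mat2_mult a b quat_defs power2_eq_square)
  have q: "q = - (a0 * b0 + a1 * b1 + a2 * b2 + a3 * b3)"
    by (simp add: q_def inv trH_def norm_1_inverse[OF assms]) (simp add: a b quat_defs)
  have F1: "F $ 1 $ 1 = \<beta> * \<beta> + \<beta> * (\<alpha> * \<alpha>) - (2 * p) *\<^sub>R (\<beta> * \<alpha>) + e *\<^sub>R \<beta> + (norm \<beta>)\<^sup>2 *\<^sub>R 1"
    using assms by (simp add: F_def quartic_def mat2_mult mat_1_eq mat2_arith algebra_simps)
  have "(norm \<beta>)\<^sup>2 = b0\<^sup>2 + b1\<^sup>2 + b2\<^sup>2 + b3\<^sup>2" by (simp add: norm_quat_def b)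
  then have F11: "F $ 1 $ 1 = 0"
    unfolding F1 p e a b by (simp add: quat_defs power2_eq_square algebra_simps)
  have "F $ 2 $ 1 = \<beta> * \<alpha> + \<alpha> * \<beta> + \<alpha> * \<alpha> * \<alpha> - (2 * p) *\<^sub>R (\<beta> + \<alpha> * \<alpha>) + e *\<^sub>R \<alpha> - (2 * q) *\<^sub>R 1"
    by (simp add: F_def quartic_def mat2_mult mat_1_eq mat2_arith algebra_simps)
  also have "\<dots> = 0"
    unfolding p e q a b by (simp add: quat_defs power2_eq_square algebra_simps)
  finally have F21: "F $ 2 $ 1 = 0" .
  have comm: "F ** ?N = ?N ** F"
    by (simp add: F_def quartic_def qmat_distribs matrix_mul_assoc)
  have "(F ** ?N) $ 1 $ 1 = F $ 1 $ 2" "(F ** ?N) $ 2 $ 1 = F $ 2 $ 2"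
    "(?N ** F) $ 1 $ 1 = 0" "(?N ** F) $ 2 $ 1 = 0"
    by (simp_all add: qmat_mult_nth F11 F21)
  then have "F = 0" using comm F11 F21 by (simp add: qmat_eq_iff)
  then show ?thesis by (simp add: char_quartic_def F_def p_def e_def q_def)
qed

text \<open>
  If the first basis vector is cyclic for \<open>M\<close>, then \<open>M\<close> is conjugate to a companion matrix, for which
  the identity is checked directly. A conjugation by a lower unipotent matrix makes it cyclic except when
  \<open>M\<close> is central, that is \<open>\<plusminus>1\<close>.
\<close>

theorem cayley_hamilton:
  assumes "M \<in> SL2H"
  shows "char_quartic M M = 0"
proof -
  have cyclic: "char_quartic M M = 0" if M: "M \<in> SL2H" and c: "M $ 2 $ 1 \<noteq> 0" for M
  proof -
    (* The columns of S are the first basis vector and its image under M. *)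
    define S where "S = mat2 1 (M$1$1) 0 (M$2$1)"
    have "S = mat2 1 (M$1$1 * inverse (M$2$1)) 0 1 ** mat2 1 0 0 (M$2$1)"
      using c by (simp add: S_def mat2_mult mult.assoc)
    then have S: "invertible S" using c by (simp add: invertible_qmat_mult invertible_elementary)
    define N where "N = conj_by (matrix_inv S) M"
    have MN: "M = conj_by S N"
      unfolding N_def using conj_by_inverse[of "matrix_inv S" M] S
      by (simp add: invertible_matrix_inv matrix_inv_matrix_inv)
    then have "M ** S = S ** N" using conj_by_eq_iff[OF S, of N M] by simp
    moreover have "(M ** S) $ i $ 1 = S $ i $ 2" for i
      using exhaust_2[of i] by (auto simp: S_def qmat_mult_nth)
    ultimately have "(S ** N) $ i $ 1 = S $ i $ 2" for i by simp
    from this[of 1] this[of 2] have "N$1$1 = 0" "N$2$1 = 1"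
      using c by (simp_all add: S_def qmat_mult_nth)
    then obtain \<alpha> \<beta> where N: "N = mat2 0 \<beta> 1 \<alpha>" by (metis mat2_eta)
    have "dieudonne_det N = 1"
      using M dieudonne_det_conj[OF invertible_matrix_inv[OF S], of M] by (simp add: N_def SL2H_iff)
    then have "norm \<beta> = 1" by (simp add: N dieudonne_det_mat2)
    then have "char_quartic N N = 0" unfolding N by (rule companion_quartic)
    moreover have "invertible N" unfolding N_def using S SL2H_invertible[OF M] by (intro invertible_conj_by invertible_matrix_inv)
    ultimately show ?thesis
      using S unfolding MN by (simp add: char_quartic_conj) (simp add: char_quartic_def quartic_conj conj_by_linear)
  qed
  show ?thesis
  proof (cases "\<exists>x. conj_by (mat2 1 0 x 1) M $ 2 $ 1 \<noteq> 0")
    case True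
    then obtain x where x: "conj_by (mat2 1 0 x 1) M $ 2 $ 1 \<noteq> 0" by blast
    have P: "invertible (mat2 1 0 x 1)" by (rule invertible_elementary)
    have "char_quartic (conj_by (mat2 1 0 x 1) M) (conj_by (mat2 1 0 x 1) M) = 0"
      by (rule cyclic[OF SL2H_conj[OF P assms] x])
    then show ?thesis
      using P assms by (simp add: char_quartic_conj SL2H_invertible)
        (simp add: char_quartic_def quartic_conj conj_by_eq_0_iff)
  next
    case False
    obtain a b c d where M: "M = mat2 a b c d" by (metis mat2_eta)
    have inv: "matrix_inv (mat2 1 0 x 1) = mat2 1 0 (- x) 1" for x
      by (rule matrix_inv_eqI) (simp_all add: mat2_mult mat_1_eq)
    have z: "x * a + c - (x * b + d) * x = 0" for x
    proof -
      have "conj_by (mat2 1 0 x 1) M $ 2 $ 1 = 0" using False by blast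
      then show ?thesis by (simp add: conj_by_def inv M mat2_mult)
    qed
    have c: "c = 0" using z[of 0] by simp
    have s: "a - d = b" "b = - (a - d)" using z[of 1] z[of "-1"] c by (simp_all add: algebra_simps)
    from s(2) have "b = - b" unfolding s(1) .
    then have "b + b = 0" by (simp add: eq_neg_iff_add_eq_0)
    then have "2 *\<^sub>R b = 0" by (simp only: scaleR_2)
    then have b0: "b = 0" by simp
    have ad: "a = d" using s(1) unfolding b0 by simp
    have "x * a = a * x" for x using z[of x] unfolding c b0 ad[symmetric] by simp
    from this[of "Quat 0 1 0 0"] this[of "Quat 0 0 1 0"] have "a = qre a *\<^sub>R 1"
      by (simp add: quat_eq_iff quat_defs)
    then obtain t where a: "a = t *\<^sub>R 1" by blast
    have Mt: "M = t *\<^sub>R mat 1" by (simp add: M b0 c a mat_1_eq mat2_arith flip: ad)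
    then have "t\<^sup>2 = 1" using assms by (simp add: SL2H_iff dieudonne_det_scaleR dieudonne_det_1)
    then have "t * t = 1" by (simp add: power2_eq_square)
    then have invM: "matrix_inv M = t *\<^sub>R mat 1"
      by (intro matrix_inv_eqI) (simp_all add: Mt qmat_distribs)
    have MM: "M ** M = mat 1" by (simp add: Mt qmat_distribs \<open>t * t = 1\<close>)
    have tr: "trH M = 2 * t" "trH (matrix_inv M) = 2 * t" unfolding invM unfolding Mt by (simp_all add: trH_simps)
    have e: "2 * (trH M)\<^sup>2 - trH (M ** M) = 6"
      unfolding MM tr by (simp add: trH_simps power_mult_distrib \<open>t\<^sup>2 = 1\<close>)
    have tM: "(2 * (2 * t)) *\<^sub>R M = 4 *\<^sub>R mat 1"
      unfolding Mt by (simp add: mult.assoc \<open>t * t = 1\<close>)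
    have "quartic (2 * t) 6 (2 * t) M = mat 1 - 4 *\<^sub>R mat 1 + 6 *\<^sub>R mat 1 - 4 *\<^sub>R mat 1 + mat 1"
      unfolding quartic_def MM matrix_mul_lid tM ..
    also have "\<dots> = (1 - 4 + 6 - 4 + 1) *\<^sub>R mat 1"
      by (simp only: scaleR_left_diff_distrib scaleR_left_distrib scaleR_one)
    finally show ?thesis unfolding char_quartic_def e unfolding tr by simp
  qed
qed

text \<open>
  The noncommutative divided difference \<open>\<delta>\<close> of a polynomial \<open>f\<close> satisfies
  \<open>M \<delta>(M) - \<delta>(M) M\<^sub>0 = f(M) - f(M\<^sub>0)\<close>, because the coefficients are real, and \<open>\<delta>(M\<^sub>0) = f'(M\<^sub>0)\<close>. If both
  matrices are roots, \<open>\<delta>(M)\<close> intertwines them; near \<open>M\<^sub>0\<close> it is invertible.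
\<close>

lemma intertwiner:
  assumes M0: "quartic p e q M0 = 0" and inv: "invertible (quartic_deriv p e q M0)"
  shows "\<exists>G. continuous_on UNIV G \<and> G M0 = mat 1 \<and> (\<forall>M. quartic p e q M = 0 \<longrightarrow> M ** G M = G M ** M0)"
proof -
  define \<delta> where "\<delta> = (\<lambda>M. M ** M ** M + M ** M ** M0 + M ** M0 ** M0 + M0 ** M0 ** M0
    - (2 * p) *\<^sub>R (M ** M + M ** M0 + M0 ** M0) + e *\<^sub>R (M + M0) - (2 * q) *\<^sub>R mat 1)"
  define E where "E = quartic_deriv p e q M0"
  have E: "E ** matrix_inv E = mat 1" "matrix_inv E ** E = mat 1"
    using inv by (simp_all add: E_def matrix_inv_inverse)
  define G where "G = (\<lambda>M. \<delta> M ** matrix_inv E)"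
  have cont_mult: "continuous_on UNIV (\<lambda>M. f M ** g M :: qmat)"
    if "continuous_on UNIV f" "continuous_on UNIV g" for f g :: "qmat \<Rightarrow> qmat"
    by (rule bounded_bilinear.continuous_on[OF bounded_bilinear_qmat_mult that])
  have "continuous_on UNIV G"
    unfolding G_def \<delta>_def by (intro cont_mult continuous_intros)
  moreover have "\<delta> M0 = E"
  proof -
    have "3 *\<^sub>R Y = (2 + 1) *\<^sub>R Y" "4 *\<^sub>R Y = (2 + 2) *\<^sub>R Y" for Y :: qmat by simp_all
    then have "Y + Y + Y = 3 *\<^sub>R Y" "Y + Y + Y + Y = 4 *\<^sub>R Y" "Y + Y = 2 *\<^sub>R Y" for Y :: qmat
      by (simp_all only: scaleR_left_distrib scaleR_2 scaleR_one add.assoc)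
    then show ?thesis
      unfolding \<delta>_def E_def quartic_deriv_def by (simp add: mult.commute)
  qed
  then have "G M0 = mat 1" by (simp add: G_def E)
  moreover have "M ** G M = G M ** M0" if M: "quartic p e q M = 0" for M
  proof -
    have "M ** \<delta> M - \<delta> M ** M0 = quartic p e q M - quartic p e q M0"
      by (simp add: \<delta>_def quartic_def qmat_distribs matrix_mul_assoc algebra_simps)
    then have 1: "M ** \<delta> M = \<delta> M ** M0" using M M0 by simp
    have "E ** M0 = M0 ** E" by (simp add: E_def quartic_deriv_def qmat_distribs matrix_mul_assoc)
    then have "matrix_inv E ** (E ** M0) ** matrix_inv E = matrix_inv E ** (M0 ** E) ** matrix_inv E" by simp
    then have "(matrix_inv E ** E) ** M0 ** matrix_inv E = matrix_inv E ** M0 ** (E ** matrix_inv E)"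
      by (simp only: matrix_mul_assoc)
    then have 2: "M0 ** matrix_inv E = matrix_inv E ** M0" using E by simp
    have "M ** G M = \<delta> M ** (M0 ** matrix_inv E)" using 1 by (simp add: G_def matrix_mul_assoc)
    also have "\<dots> = G M ** M0" unfolding 2 by (simp add: G_def matrix_mul_assoc)
    finally show ?thesis .
  qed
  ultimately show ?thesis by blast
qed

lemma quat_square: "\<nu> * \<nu> = (2 * qre \<nu>) *\<^sub>R \<nu> - (norm \<nu>)\<^sup>2 *\<^sub>R (1 :: quat)"
  by (simp add: norm_quat_def quat_defs power2_eq_square algebra_simps)

lemma quat_cube:
  "\<nu> * \<nu> * \<nu> = (4 * (qre \<nu>)\<^sup>2 - (norm \<nu>)\<^sup>2) *\<^sub>R \<nu> - (2 * qre \<nu> * (norm \<nu>)\<^sup>2) *\<^sub>R (1 :: quat)"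
proof -
  have "\<nu> * \<nu> * \<nu> = ((2 * qre \<nu>) *\<^sub>R \<nu> - (norm \<nu>)\<^sup>2 *\<^sub>R 1) * \<nu>" by (subst quat_square) simp
  also have "\<dots> = (2 * qre \<nu>) *\<^sub>R (\<nu> * \<nu>) - (norm \<nu>)\<^sup>2 *\<^sub>R \<nu>" by (simp add: left_diff_distrib)
  also have "\<dots> = (2 * qre \<nu>) *\<^sub>R ((2 * qre \<nu>) *\<^sub>R \<nu> - (norm \<nu>)\<^sup>2 *\<^sub>R 1) - (norm \<nu>)\<^sup>2 *\<^sub>R \<nu>"
    by (simp only: quat_square[of \<nu>])
  finally show ?thesis by (simp add: algebra_simps power2_eq_square)
qed

text \<open>
  The first hypothesis says that \<open>\<nu>\<close> is not real.
\<close>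

lemma nonreal_independent:
  assumes "\<bar>qre \<nu>\<bar> < norm \<nu>" "\<alpha> *\<^sub>R \<nu> + \<beta> *\<^sub>R (1 :: quat) = 0"
  shows "\<alpha> = 0 \<and> \<beta> = 0"
proof (cases "\<alpha> = 0")
  case True
  then show ?thesis using assms(2) by simp
next
  case False
  have "\<alpha> * qim1 \<nu> = 0" "\<alpha> * qim2 \<nu> = 0" "\<alpha> * qim3 \<nu> = 0"
    using assms(2) by (simp_all add: quat_eq_iff quat_defs)
  then have "norm \<nu> = \<bar>qre \<nu>\<bar>" using False by (simp add: norm_quat_def)
  then show ?thesis using assms(1) by simp
qed

lemma norm_quat_cis:
  assumes "I \<in> imag_units"
  shows "qre (quat_cis I \<theta>) = cos \<theta>" "norm (quat_cis I \<theta>) = 1"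
proof -
  have n: "norm I = 1"
  proof -
    have "norm (I\<^sup>2) = 1" using assms by (simp add: imag_units_def)
    then show ?thesis by (simp add: norm_power power2_eq_1_iff) (metis norm_ge_zero not_one_le_zero neg_0_le_iff_le order_trans zero_le_one)
  qed
  have "(2 * qre I) *\<^sub>R I = 0"
    using assms quat_square[of I] n by (simp add: imag_units_def power2_eq_square)
  then have re: "qre I = 0" using n by auto
  have im: "(qim1 I)\<^sup>2 + (qim2 I)\<^sup>2 + (qim3 I)\<^sup>2 = 1"
    using n re by (simp add: norm_quat_def)
  have e: "quat_cis I \<theta> = Quat (cos \<theta>) (qim1 I * sin \<theta>) (qim2 I * sin \<theta>) (qim3 I * sin \<theta>)"
    by (simp add: quat_cis_def of_real_def quat_defs re)
  show "qre (quat_cis I \<theta>) = cos \<theta>" by (simp add: e)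
  have "(cos \<theta>)\<^sup>2 + (qim1 I * sin \<theta>)\<^sup>2 + (qim2 I * sin \<theta>)\<^sup>2 + (qim3 I * sin \<theta>)\<^sup>2
      = (cos \<theta>)\<^sup>2 + ((qim1 I)\<^sup>2 + (qim2 I)\<^sup>2 + (qim3 I)\<^sup>2) * (sin \<theta>)\<^sup>2"
    by (simp add: power_mult_distrib algebra_simps)
  then show "norm (quat_cis I \<theta>) = 1" unfolding e by (simp add: norm_quat_def im)
qed

lemma abs_cos_less_1: "\<theta> \<in> {0<..<pi} \<Longrightarrow> \<bar>cos \<theta>\<bar> < 1"
  using cos_monotone_0_pi[of 0 \<theta>] cos_monotone_0_pi[of \<theta> pi] by (auto simp: abs_less_iff)

text \<open>
  The conditions on the real parts say that neither eigenvalue is real.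
\<close>

definition loxodromic_diagonal :: "quat \<Rightarrow> quat \<Rightarrow> bool" where
  "loxodromic_diagonal \<nu> \<mu> \<longleftrightarrow> 1 < norm \<nu> \<and> norm \<mu> = inverse (norm \<nu>) \<and> \<bar>qre \<nu>\<bar> < norm \<nu> \<and> \<bar>qre \<mu>\<bar> < norm \<mu>"

lemma loxodromic_diagonal_cis:
  assumes "1 < r" "\<theta> \<in> {0<..<pi}" "\<phi> \<in> {0<..<pi}" "I \<in> imag_units" "J \<in> imag_units"
  shows "loxodromic_diagonal (r *\<^sub>R quat_cis I \<theta>) (inverse r *\<^sub>R quat_cis J \<phi>)"
proof -
  have "qre (t *\<^sub>R x) = t * qre x" for t x by (simp add: scaleR_quat_def)
  moreover have "r * \<bar>cos \<theta>\<bar> < r * 1" "inverse r * \<bar>cos \<phi>\<bar> < inverse r * 1"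
    using assms abs_cos_less_1 by (intro mult_strict_left_mono; simp)+
  ultimately show ?thesis
    using assms by (simp add: loxodromic_diagonal_def norm_quat_cis abs_mult)
qed

lemma loxodromic_diagonal_in_SL2H: "loxodromic_diagonal \<nu> \<mu> \<Longrightarrow> mat2 \<nu> 0 0 \<mu> \<in> SL2H"
proof -
  assume l: "loxodromic_diagonal \<nu> \<mu>"
  then have "\<nu> \<noteq> 0" by (auto simp: loxodromic_diagonal_def)
  then show ?thesis using l by (simp add: loxodromic_diagonal_def SL2H_iff dieudonne_det_mat2)
qed

lemma regular_loxodromic_diagonal:
  assumes "regular_loxodromic A"
  obtains P \<nu> \<mu> where "invertible P" "A = conj_by P (mat2 \<nu> 0 0 \<mu>)" "loxodromic_diagonal \<nu> \<mu>"
proof -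
  obtain r \<theta> \<phi> I J where *: "1 < r" "\<theta> \<in> {0<..<pi}" "\<phi> \<in> {0<..<pi}" "I \<in> imag_units" "J \<in> imag_units"
    and A: "A \<in> conj_class (mat2 (r *\<^sub>R quat_cis I \<theta>) 0 0 (inverse r *\<^sub>R quat_cis J \<phi>))"
    using assms unfolding regular_loxodromic_def by blast
  from A obtain P where "invertible P" "A = conj_by P (mat2 (r *\<^sub>R quat_cis I \<theta>) 0 0 (inverse r *\<^sub>R quat_cis J \<phi>))"
    by (auto simp: conj_class_iff)
  then show ?thesis using that loxodromic_diagonal_cis[OF *] by blast
qed

text \<open>
  The expression is the resultant of \<open>x\<^sup>2 - 2 a x + r\<^sup>2\<close> and \<open>x\<^sup>2 - 2 c x + s\<^sup>2\<close>, the real minimal polynomials of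
  quaternions of real parts \<open>a\<close>, \<open>c\<close> and norms \<open>r\<close>, \<open>s\<close>. They have no common root, as their complex roots
  have absolute values \<open>r\<close> and \<open>s\<close>.
\<close>

lemma loxodromic_resultant_pos:
  fixes a c r s :: real
  assumes "1 < r" "s = inverse r" "\<bar>a\<bar> < r" "\<bar>c\<bar> < s"
  shows "0 < 4 * (a\<^sup>2 * s\<^sup>2 + c\<^sup>2 * r\<^sup>2 - a * c * (r\<^sup>2 + s\<^sup>2)) + (r\<^sup>2 - s\<^sup>2)\<^sup>2"
proof -
  have r: "0 < r" "0 < s" "r * s = 1" using assms by auto
  define u v where "u = a * s" and "v = c * r"
  have "\<bar>a\<bar> * s < r * s" "\<bar>c\<bar> * r < s * r" using assms r by (intro mult_strict_right_mono; simp)+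
  then have "\<bar>u\<bar> < r * s" "\<bar>v\<bar> < s * r" using r by (simp_all add: u_def v_def abs_mult)
  then have uv: "\<bar>u\<bar> < 1" "\<bar>v\<bar> < 1" using r by (simp_all add: mult.commute)
  have "a = u * r" "c = v * s" using r by (simp_all add: u_def v_def mult.assoc mult.commute[of s r])
  define T where "T = r\<^sup>2 + s\<^sup>2"
  have "0 < (r - s)\<^sup>2" using assms r by (simp add: less_imp_inverse_less) (metis inverse_1 less_imp_inverse_less less_trans not_less_iff_gr_or_eq zero_less_one)
  then have T: "2 < T" using r(3) by (simp add: T_def power2_diff)
  have "(r\<^sup>2 - s\<^sup>2)\<^sup>2 = T\<^sup>2 - 4 * (r * s)\<^sup>2" by (simp add: T_def power2_eq_square algebra_simps)
  then have 1: "(r\<^sup>2 - s\<^sup>2)\<^sup>2 = T\<^sup>2 - 4" using r(3) by simp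
  have 2: "a * c = u * v" using \<open>a = u * r\<close> \<open>c = v * s\<close> r(3) by (metis mult.assoc mult.commute mult.left_commute mult_1)
  have 3: "a\<^sup>2 * s\<^sup>2 = u\<^sup>2" "c\<^sup>2 * r\<^sup>2 = v\<^sup>2" by (simp_all add: u_def v_def power_mult_distrib)
  have "u * v \<le> \<bar>u\<bar> * \<bar>v\<bar>" by (metis abs_ge_self abs_mult)
  also have "\<dots> \<le> 1 * \<bar>v\<bar>" using uv by (intro mult_right_mono) auto
  also have "\<dots> < 1" using uv by simp
  finally have "u * v < 1" .
  then have "0 \<le> 2 * (1 - u * v)" "2 * (1 - u * v) < T - 2 * (u * v)" using T by auto
  then have "(2 * (1 - u * v))\<^sup>2 < (T - 2 * (u * v))\<^sup>2" by (intro power_strict_mono) auto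
  moreover have "4 * ((1 - u\<^sup>2) * (1 - v\<^sup>2)) = (2 * (1 - u * v))\<^sup>2 - 4 * (u - v)\<^sup>2"
    by (simp add: power2_eq_square algebra_simps)
  moreover have "0 \<le> 4 * (u - v)\<^sup>2" by simp
  ultimately have "4 * ((1 - u\<^sup>2) * (1 - v\<^sup>2)) < (T - 2 * (u * v))\<^sup>2" by linarith
  moreover have "(T - 2 * (u * v))\<^sup>2 - 4 * ((1 - u\<^sup>2) * (1 - v\<^sup>2)) = 4 * (u\<^sup>2 + v\<^sup>2 - u * v * T) + (T\<^sup>2 - 4)"
    by (simp add: power2_eq_square algebra_simps)
  ultimately show ?thesis unfolding 1 2 3 T_def[symmetric] by linarith
qed

text \<open>
  A real cubic that vanishes at \<open>\<nu>\<close> and \<open>\<mu>\<close> would be divisible by two coprime quadratics, the minimal polynomials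
  of \<open>\<nu>\<close> and \<open>\<mu>\<close>.
\<close>

lemma diagonal_independent:
  assumes lox: "loxodromic_diagonal \<nu> \<mu>"
    and eq: "\<And>x. x \<in> {\<nu>, \<mu>} \<Longrightarrow> g3 *\<^sub>R (x * x * x) + g2 *\<^sub>R (x * x) + g1 *\<^sub>R x + g0 *\<^sub>R (1 :: quat) = 0"
  shows "g3 = 0 \<and> g2 = 0 \<and> g1 = 0 \<and> g0 = 0"
proof -
  define r s a c where "r = norm \<nu>" and "s = norm \<mu>" and "a = qre \<nu>" and "c = qre \<mu>"
  have l: "1 < r" "s = inverse r" "\<bar>a\<bar> < r" "\<bar>c\<bar> < s"
    using lox by (simp_all add: loxodromic_diagonal_def r_def s_def a_def c_def)
  have *: "g3 * (4 * (qre x)\<^sup>2 - (norm x)\<^sup>2) + g2 * (2 * qre x) + g1 = 0 \<and>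
      g0 - g2 * (norm x)\<^sup>2 - g3 * (2 * qre x * (norm x)\<^sup>2) = 0" if x: "x \<in> {\<nu>, \<mu>}" for x
  proof (rule nonreal_independent)
    show "\<bar>qre x\<bar> < norm x" using x lox by (auto simp: loxodromic_diagonal_def)
    have "g3 *\<^sub>R (x * x * x) + g2 *\<^sub>R (x * x) + g1 *\<^sub>R x + g0 *\<^sub>R (1 :: quat) =
      (g3 * (4 * (qre x)\<^sup>2 - (norm x)\<^sup>2) + g2 * (2 * qre x) + g1) *\<^sub>R x +
      (g0 - g2 * (norm x)\<^sup>2 - g3 * (2 * qre x * (norm x)\<^sup>2)) *\<^sub>R 1"
      unfolding quat_cube by (subst quat_square) (simp add: algebra_simps)
    then show "(g3 * (4 * (qre x)\<^sup>2 - (norm x)\<^sup>2) + g2 * (2 * qre x) + g1) *\<^sub>R x +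
      (g0 - g2 * (norm x)\<^sup>2 - g3 * (2 * qre x * (norm x)\<^sup>2)) *\<^sub>R 1 = 0"
      using eq[OF x] by simp
  qed
  have e: "g3 * (4 * a\<^sup>2 - r\<^sup>2) + g2 * (2 * a) + g1 = 0" "g0 - g2 * r\<^sup>2 - g3 * (2 * a * r\<^sup>2) = 0"
    "g3 * (4 * c\<^sup>2 - s\<^sup>2) + g2 * (2 * c) + g1 = 0" "g0 - g2 * s\<^sup>2 - g3 * (2 * c * s\<^sup>2) = 0"
    using *[of \<nu>] *[of \<mu>] by (simp_all add: r_def s_def a_def c_def)
  have "s < r"
  proof -
    have "inverse r < 1" using l by (simp add: inverse_less_1_iff)
    then show ?thesis using l by linarith
  qed
  then have d: "s\<^sup>2 < r\<^sup>2" using l by (intro power_strict_mono) auto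
  have "g3 * (4 * (a\<^sup>2 * s\<^sup>2 + c\<^sup>2 * r\<^sup>2 - a * c * (r\<^sup>2 + s\<^sup>2)) + (r\<^sup>2 - s\<^sup>2)\<^sup>2) = 0"
    using e by algebra
  then have g3: "g3 = 0" using loxodromic_resultant_pos[OF l] by simp
  then have "g2 * (r\<^sup>2 - s\<^sup>2) = 0" using e by (simp add: algebra_simps)
  then have g2: "g2 = 0" using d by simp
  then show ?thesis using e g3 by simp
qed

lemma mat2_diag_mult: "mat2 x 0 0 y ** mat2 x' 0 0 y' = mat2 (x * x') 0 0 (y * y')"
  by (simp add: mat2_mult)

lemma regular_loxodromic_independent:
  assumes "regular_loxodromic A" "g3 *\<^sub>R (A ** A ** A) + g2 *\<^sub>R (A ** A) + g1 *\<^sub>R A + g0 *\<^sub>R mat 1 = 0"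
  shows "g3 = 0 \<and> g2 = 0 \<and> g1 = 0 \<and> g0 = 0"
proof -
  obtain P \<nu> \<mu> where P: "invertible P" and A: "A = conj_by P (mat2 \<nu> 0 0 \<mu>)" and l: "loxodromic_diagonal \<nu> \<mu>"
    using regular_loxodromic_diagonal[OF assms(1)] .
  let ?D = "mat2 \<nu> 0 0 \<mu>"
  have "conj_by P (g3 *\<^sub>R (?D ** ?D ** ?D) + g2 *\<^sub>R (?D ** ?D) + g1 *\<^sub>R ?D + g0 *\<^sub>R mat 1) = 0"
    using assms(2) P by (simp add: A conj_by_linear conj_by_product conj_by_mat_1)
  then have "g3 *\<^sub>R (?D ** ?D ** ?D) + g2 *\<^sub>R (?D ** ?D) + g1 *\<^sub>R ?D + g0 *\<^sub>R mat 1 = 0"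
    using P by (simp add: conj_by_eq_0_iff)
  then have "g3 *\<^sub>R (\<nu> * \<nu> * \<nu>) + g2 *\<^sub>R (\<nu> * \<nu>) + g1 *\<^sub>R \<nu> + g0 *\<^sub>R 1 = 0"
    "g3 *\<^sub>R (\<mu> * \<mu> * \<mu>) + g2 *\<^sub>R (\<mu> * \<mu>) + g1 *\<^sub>R \<mu> + g0 *\<^sub>R 1 = 0"
    by (simp_all add: qmat_eq_iff mat2_diag_mult mat_1_eq)
  then show ?thesis using diagonal_independent[OF l] by blast
qed

text \<open>
  The coefficients are those of \<open>(x\<^sup>2 - 2 a x + r\<^sup>2) (x\<^sup>2 - 2 c x + s\<^sup>2)\<close>, of which \<open>\<nu>\<close> is a simple root.
\<close>

lemma quartic_deriv_nonzero:
  fixes \<nu> :: quat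
  assumes "0 < r" "r \<noteq> 1" "s = inverse r" "norm \<nu> = r" "qre \<nu> = a" "\<bar>a\<bar> < r"
    and p: "p = a + c" and e: "e = r\<^sup>2 + s\<^sup>2 + 4 * a * c" and q: "q = a * s\<^sup>2 + c * r\<^sup>2"
  shows "4 *\<^sub>R (\<nu> * \<nu> * \<nu>) - (6 * p) *\<^sub>R (\<nu> * \<nu>) + (2 * e) *\<^sub>R \<nu> - (2 * q) *\<^sub>R 1 \<noteq> 0"
proof
  assume 0: "4 *\<^sub>R (\<nu> * \<nu> * \<nu>) - (6 * p) *\<^sub>R (\<nu> * \<nu>) + (2 * e) *\<^sub>R \<nu> - (2 * q) *\<^sub>R 1 = 0"
  have "4 *\<^sub>R (\<nu> * \<nu> * \<nu>) - (6 * p) *\<^sub>R (\<nu> * \<nu>) + (2 * e) *\<^sub>R \<nu> - (2 * q) *\<^sub>R 1 =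
      (4 * (4 * a\<^sup>2 - r\<^sup>2) - 6 * p * (2 * a) + 2 * e) *\<^sub>R \<nu> + (6 * p * r\<^sup>2 - 4 * (2 * a * r\<^sup>2) - 2 * q) *\<^sub>R 1"
    unfolding quat_cube by (subst quat_square) (simp add: assms(4,5) algebra_simps)
  then have "4 * (4 * a\<^sup>2 - r\<^sup>2) - 6 * p * (2 * a) + 2 * e = 0 \<and> 6 * p * r\<^sup>2 - 4 * (2 * a * r\<^sup>2) - 2 * q = 0"
    using 0 assms(4-6) by (intro nonreal_independent) simp_all
  then have z: "4 * (4 * a\<^sup>2 - r\<^sup>2) - 6 * (a + c) * (2 * a) + 2 * (r\<^sup>2 + s\<^sup>2 + 4 * a * c) = 0"
    "6 * (a + c) * r\<^sup>2 - 4 * (2 * a * r\<^sup>2) - 2 * (a * s\<^sup>2 + c * r\<^sup>2) = 0"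
    by (simp_all add: p e q)
  have "(r\<^sup>2 - s\<^sup>2) * (a\<^sup>2 - r\<^sup>2) = 0" using z by algebra
  moreover have "\<bar>a\<bar>\<^sup>2 < r\<^sup>2" by (rule power_strict_mono[OF assms(6)]) auto
  moreover have "r\<^sup>2 \<noteq> s\<^sup>2"
  proof
    assume "r\<^sup>2 = s\<^sup>2"
    then have "r = s" using assms(1,3) by (simp add: power2_eq_iff_nonneg)
    moreover have "r * s = 1" using assms(1,3) by simp
    ultimately have "r * r = 1" by simp
    then show False using assms(1,2) by (metis abs_of_pos abs_square_eq_1 power2_eq_square)
  qed
  ultimately show False by simp
qed

lemma quat_inverse_re: "qre (inverse x) = qre x * (inverse (norm x))\<^sup>2"
  by (simp add: inverse_quat_def scaleR_quat_def norm_quat_def power_inverse field_simps)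

text \<open>
  In diagonal form the derivative is diagonal, and its entries are nonzero since the characteristic quartic has
  simple roots.
\<close>

lemma regular_loxodromic_quartic_deriv_invertible:
  assumes "regular_loxodromic A"
  shows "invertible (quartic_deriv (trH A) (2 * (trH A)\<^sup>2 - trH (A ** A)) (trH (matrix_inv A)) A)"
proof -
  obtain P \<nu> \<mu> where P: "invertible P" and A: "A = conj_by P (mat2 \<nu> 0 0 \<mu>)" and l: "loxodromic_diagonal \<nu> \<mu>"
    using regular_loxodromic_diagonal[OF assms] .
  let ?D = "mat2 \<nu> 0 0 \<mu>"
  define r s a c where "r = norm \<nu>" and "s = norm \<mu>" and "a = qre \<nu>" and "c = qre \<mu>"
  have l': "1 < r" "s = inverse r" "\<bar>a\<bar> < r" "\<bar>c\<bar> < s"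
    using l by (simp_all add: loxodromic_diagonal_def r_def s_def a_def c_def)
  have ne: "\<nu> \<noteq> 0" "\<mu> \<noteq> 0" using l by (auto simp: loxodromic_diagonal_def)
  have inv: "matrix_inv ?D = mat2 (inverse \<nu>) 0 0 (inverse \<mu>)"
    by (rule matrix_inv_eqI) (simp_all add: mat2_mult mat_1_eq ne)
  have D: "invertible ?D" using ne by (rule invertible_elementary)
  have rr: "r = inverse s" using l' by simp
  have t1: "trH ?D = a + c" by (simp add: trH_def plus_quat_def a_def c_def)
  have sq: "qre (x * x) = 2 * (qre x)\<^sup>2 - (norm x)\<^sup>2" for x
    by (subst quat_square) (simp add: quat_defs power2_eq_square)
  have "trH (?D ** ?D) = 2 * a\<^sup>2 - r\<^sup>2 + (2 * c\<^sup>2 - s\<^sup>2)"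
    by (simp add: trH_def plus_quat_def mat2_diag_mult sq a_def c_def r_def s_def)
  then have t2: "2 * (trH ?D)\<^sup>2 - trH (?D ** ?D) = r\<^sup>2 + s\<^sup>2 + 4 * a * c"
    unfolding t1 by (simp add: power2_eq_square algebra_simps)
  have t3: "trH (matrix_inv ?D) = a * s\<^sup>2 + c * r\<^sup>2"
    using l' by (simp add: inv trH_def plus_quat_def quat_inverse_re flip: a_def c_def r_def s_def)
  define p e q where "p = trH ?D" and "e = 2 * (trH ?D)\<^sup>2 - trH (?D ** ?D)" and "q = trH (matrix_inv ?D)"
  have pA: "trH A = p" "2 * (trH A)\<^sup>2 - trH (A ** A) = e" "trH (matrix_inv A) = q"
    using P D by (simp_all add: A p_def e_def q_def trH_conj matrix_inv_conj flip: conj_by_product)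
  define f where "f = (\<lambda>x :: quat. 4 *\<^sub>R (x * x * x) - (6 * p) *\<^sub>R (x * x) + (2 * e) *\<^sub>R x - (2 * q) *\<^sub>R 1)"
  have "f \<nu> \<noteq> 0"
    unfolding f_def by (rule quartic_deriv_nonzero[where r = r and s = s and a = a and c = c])
      (use l' t1 t2 t3 ne in \<open>simp_all add: r_def a_def p_def e_def q_def\<close>)
  moreover have "f \<mu> \<noteq> 0"
    unfolding f_def
  proof (rule quartic_deriv_nonzero[where r = s and s = r and a = c and c = a])
    show "0 < s" "s \<noteq> 1" using l' by auto
  qed (use l' rr t1 t2 t3 ne in \<open>simp_all add: s_def c_def p_def e_def q_def\<close>)
  moreover have "quartic_deriv p e q ?D = mat2 (f \<nu>) 0 0 (f \<mu>)"
    by (simp add: quartic_deriv_def mat2_diag_mult mat_1_eq mat2_arith f_def)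
  ultimately have "invertible (quartic_deriv p e q ?D)" by (simp add: invertible_elementary)
  then show ?thesis
    unfolding pA(2) unfolding pA(1,3) by (simp add: A quartic_deriv_conj P invertible_conj_by)
qed

text \<open>
  The coefficients of the characteristic quartic, up to a polynomial change of coordinates.
\<close>

definition class_invariants :: "qmat \<Rightarrow> real \<times> real \<times> real" where
  "class_invariants M = (trH M, trH (matrix_inv M), trH (M ** M))"

lemma class_invariants_conj: "invertible P \<Longrightarrow> invertible M \<Longrightarrow> class_invariants (conj_by P M) = class_invariants M"
  by (simp add: class_invariants_def matrix_inv_conj trH_conj flip: conj_by_product)

text \<open>
  Elements with equal invariants have the same characteristic quartic, so the intertwiner of its roots applies.
  It is invertible near \<open>A\<close>, where it conjugates \<open>A\<close> to \<open>M\<close>.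
\<close>

theorem local_conjugator:
  assumes "regular_loxodromic A"
  shows "\<exists>G. continuous_on UNIV G \<and> G A = mat 1 \<and>
    (\<forall>M\<in>SL2H. class_invariants M = class_invariants A \<longrightarrow> M ** G M = G M ** A)"
proof -
  have A: "A \<in> SL2H" using assms by (simp add: regular_loxodromic_def)
  have "quartic (trH A) (2 * (trH A)\<^sup>2 - trH (A ** A)) (trH (matrix_inv A)) A = 0"
    using cayley_hamilton[OF A] by (simp add: char_quartic_def)
  from intertwiner[OF this regular_loxodromic_quartic_deriv_invertible[OF assms]]
  obtain G where G: "continuous_on UNIV G" "G A = mat 1"
    "\<And>M. quartic (trH A) (2 * (trH A)\<^sup>2 - trH (A ** A)) (trH (matrix_inv A)) M = 0 \<Longrightarrow> M ** G M = G M ** A"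
    by blast
  have "M ** G M = G M ** A" if "M \<in> SL2H" "class_invariants M = class_invariants A" for M
    using cayley_hamilton[OF that(1)] that(2) by (intro G(3)) (simp add: char_quartic_def class_invariants_def)
  then show ?thesis using G(1,2) by blast
qed

section \<open>A slice for simultaneous conjugation\<close>

lemma analytic_at_point_qmat_mult:
  fixes f g :: "'a::euclidean_space \<Rightarrow> qmat"
  assumes "analytic_at_point f x" "analytic_at_point g x"
  shows "analytic_at_point (\<lambda>y. f y ** g y) x"
  using bounded_bilinear_qmat_mult assms by (rule analytic_at_point_bilinear)

lemma analytic_at_point_linear_compose:
  fixes L :: "'b::euclidean_space \<Rightarrow> 'c::euclidean_space" and f :: "'a::euclidean_space \<Rightarrow> 'b"
  assumes "linear L" "analytic_at_point f x"
  shows "analytic_at_point (\<lambda>y. L (f y)) x"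
  using analytic_at_point_linear[OF assms(1)] assms(2) by (rule analytic_at_point_compose)

lemma linear_fst_snd: "linear fst" "linear snd"
  by (simp_all add: linear_iff)

lemma analytic_at_point_fst_snd:
  assumes "analytic_at_point f x"
  shows "analytic_at_point (\<lambda>y. fst (f y)) x" "analytic_at_point (\<lambda>y. snd (f y)) x"
  using assms by (rule analytic_at_point_linear_compose[OF linear_fst_snd(1)], rule analytic_at_point_linear_compose[OF linear_fst_snd(2)])

lemma analytic_at_point_diff:
  fixes f g :: "'a::euclidean_space \<Rightarrow> 'b::euclidean_space"
  assumes "analytic_at_point f x" "analytic_at_point g x"
  shows "analytic_at_point (\<lambda>y. f y - g y) x"
proof -
  have "linear (\<lambda>v :: 'b. - v)" by (simp add: linear_iff)
  then show ?thesis
    using analytic_at_point_add[OF assms(1) analytic_at_point_linear_compose[OF _ assms(2)]] by fastforce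
qed

lemma qmat_mult_has_derivative:
  fixes f g :: "'a::real_normed_vector \<Rightarrow> qmat"
  assumes "(f has_derivative f') (at x)" "(g has_derivative g') (at x)"
  shows "((\<lambda>y. f y ** g y) has_derivative (\<lambda>h. f x ** g' h + f' h ** g x)) (at x)"
  by (rule bounded_bilinear.FDERIV[OF bounded_bilinear_qmat_mult assms])

text \<open>
  The map \<open>(M, N) \<mapsto> (M, M N)\<close> has an invertible derivative at \<open>(M\<^sub>0, M\<^sub>0\<inverse>)\<close>, and its analytic inverse takes \<open>(M, 1)\<close> to \<open>(M, M\<inverse>)\<close>.
\<close>

lemma matrix_inv_analytic_near:
  fixes M0 :: qmat
  assumes "invertible M0"
  shows "\<exists>S. open S \<and> M0 \<in> S \<and> (\<forall>M\<in>S. invertible M \<and> analytic_at_point matrix_inv M)"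
proof -
  define f :: "qmat \<times> qmat \<Rightarrow> qmat \<times> qmat" where "f = (\<lambda>z. (fst z, fst z ** snd z))"
  define N0 where "N0 = matrix_inv M0"
  define D :: "qmat \<times> qmat \<Rightarrow> qmat \<times> qmat" where "D = (\<lambda>h. (fst h, M0 ** snd h + fst h ** N0))"
  have MN: "M0 ** N0 = mat 1" "N0 ** M0 = mat 1" using assms by (simp_all add: N0_def matrix_inv_inverse)
  have "real_analytic_on f UNIV"
    unfolding real_analytic_on_iff f_def
    by (intro ballI analytic_at_point_Pair analytic_at_point_qmat_mult analytic_at_point_fst_snd analytic_at_point_id)
  moreover have dD: "(f has_derivative D) (at (M0, N0))"
  proof -
    have 1: "(fst has_derivative fst) (at (M0, N0))" "(snd has_derivative snd) (at (M0, N0))"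
      using bounded_linear_fst bounded_linear_snd by (auto intro: bounded_linear_imp_has_derivative)
    show ?thesis
      using has_derivative_Pair[OF 1(1) qmat_mult_has_derivative[OF 1]] unfolding f_def D_def by simp
  qed
  moreover have "inj D"
  proof -
    have "h = 0" if "D h = 0" for h
    proof -
      have h: "fst h = 0" "M0 ** snd h = 0" using that by (auto simp: D_def prod_eq_iff qmat_zero)
      then have "N0 ** (M0 ** snd h) = 0" by (simp add: qmat_zero)
      then have "snd h = 0" by (simp add: matrix_mul_assoc MN)
      with h(1) show "h = 0" by (simp add: prod_eq_iff)
    qed
    then show ?thesis
      using linear_injective_0[OF has_derivative_linear[OF dD]] by blast
  qed
  ultimately obtain U g where U: "open U" "(M0, N0) \<in> U" "open (f ` U)" "real_analytic_on g (f ` U)"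
    and g: "\<And>z. z \<in> U \<Longrightarrow> g (f z) = z"
    using real_analytic_inverse_function[of f UNIV "(M0, N0)" D] by auto
  define S where "S = (\<lambda>M. (M, mat 1)) -` f ` U"
  have S: "open S"
    unfolding S_def by (rule open_vimage[OF U(3)]) (intro continuous_intros)
  have "f (M0, N0) = (M0, mat 1)" by (simp add: f_def MN)
  then have "M0 \<in> S" unfolding S_def using U(2) by (metis imageI vimageI)
  moreover have inv: "invertible M \<and> matrix_inv M = snd (g (M, mat 1))" if "M \<in> S" for M
  proof -
    obtain z where z: "z \<in> U" "f z = (M, mat 1)" using \<open>M \<in> S\<close> unfolding S_def by auto
    then have e: "M ** snd z = mat 1" "g (M, mat 1) = z" using g[OF z(1)] by (auto simp: f_def)
    then have "dieudonne_det M * dieudonne_det (snd z) = 1"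
      by (simp add: dieudonne_det_1 flip: dieudonne_det_mult)
    then have M: "invertible M" by (auto simp: invertible_iff_dieudonne_det)
    have "matrix_inv M ** (M ** snd z) = snd z" by (simp add: matrix_mul_assoc matrix_inv_inverse[OF M])
    then show ?thesis using e M by simp
  qed
  moreover have "analytic_at_point matrix_inv M" if M: "M \<in> S" for M
  proof (rule analytic_at_point_cong[OF _ S M])
    have "analytic_at_point g (M, mat 1)" using U(4) M by (auto simp: real_analytic_on_iff S_def)
    then have "analytic_at_point (\<lambda>M. g (M, mat 1)) M"
      by (rule analytic_at_point_compose[where g = "\<lambda>M. (M, mat 1)"])
        (intro analytic_at_point_Pair analytic_at_point_id analytic_at_point_const)
    then show "analytic_at_point (\<lambda>M. snd (g (M, mat 1))) M" by (rule analytic_at_point_fst_snd)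
  qed (use inv in auto)
  ultimately show ?thesis using S by blast
qed

lemma open_invertible: "open {M :: qmat. invertible M}"
proof (subst open_subopen, intro ballI)
  fix M :: qmat assume "M \<in> {M. invertible M}"
  then have "invertible M" by simp
  from matrix_inv_analytic_near[OF this]
  show "\<exists>T. open T \<and> M \<in> T \<and> T \<subseteq> {M. invertible M}" by blast
qed

lemma analytic_at_point_matrix_inv:
  fixes f :: "'a::euclidean_space \<Rightarrow> qmat"
  assumes "analytic_at_point f x" "invertible (f x)"
  shows "analytic_at_point (\<lambda>y. matrix_inv (f y)) x"
proof -
  have "analytic_at_point matrix_inv (f x)" using matrix_inv_analytic_near[OF assms(2)] by blast
  then show ?thesis using assms(1) by (rule analytic_at_point_compose)
qed

text \<open>
  The function \<open>vector\<close> fills the components one after the other. Which list element ends up in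
  component \<open>i\<close> depends only on the length of the list.
\<close>

lemma vector_nth_exists:
  fixes i :: 15
  shows "\<exists>k. \<forall>ys :: real list. length ys = l \<longrightarrow>
    foldr (\<lambda>x f n. fun_upd (f (n + 1)) n x) ys (\<lambda>n x. 0) n i = (if k < l then ys ! k else 0)"
proof (induction l arbitrary: n)
  case 0
  then show ?case by auto
next
  case (Suc l)
  show ?case
  proof (cases "i = n")
    case True
    then show ?thesis by (intro exI[of _ 0]) (auto simp: length_Suc_conv)
  next
    case False
    from Suc[of "n + 1"] obtain k where
      "\<forall>ys :: real list. length ys = l \<longrightarrow>
        foldr (\<lambda>x f n. fun_upd (f (n + 1)) n x) ys (\<lambda>n x. 0) (n + 1) i = (if k < l then ys ! k else 0)"
      by blast
    then show ?thesis using False by (intro exI[of _ "Suc k"]) (auto simp: length_Suc_conv fun_upd_def)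
  qed
qed

lemma analytic_at_point_vector:
  fixes ws :: "('a::euclidean_space \<Rightarrow> real) list"
  assumes "\<And>w. w \<in> set ws \<Longrightarrow> analytic_germ w x"
  shows "analytic_at_point (\<lambda>y. vector (map (\<lambda>w. w y) ws) :: real ^ 15) x"
  unfolding analytic_at_point_def
proof
  fix b :: "real ^ 15" assume "b \<in> Basis"
  then obtain i where b: "b = axis i 1" by (auto simp: Basis_vec_def)
  obtain k where k: "\<forall>ys :: real list. length ys = length ws \<longrightarrow>
      foldr (\<lambda>x f n. fun_upd (f (n + 1)) n x) ys (\<lambda>n x. 0) 1 i = (if k < length ws then ys ! k else 0)"
    using vector_nth_exists[of "length ws" 1 i] by blast
  have "(vector (map (\<lambda>w. w y) ws) :: real ^ 15) \<bullet> b = (if k < length ws then (ws ! k) y else 0)" for y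
    using k[rule_format, of "map (\<lambda>w. w y) ws"] by (simp add: b inner_axis vector_def)
  then have eq: "(\<lambda>y. (vector (map (\<lambda>w. w y) ws) :: real ^ 15) \<bullet> b) = (\<lambda>y. if k < length ws then (ws ! k) y else 0)"
    by (rule ext)
  show "analytic_germ (\<lambda>y. (vector (map (\<lambda>w. w y) ws) :: real ^ 15) \<bullet> b) x"
    unfolding eq using assms analytic_germ_const by (cases "k < length ws") auto
qed

definition invertible_pairs :: "(qmat \<times> qmat) set" where
  "invertible_pairs = {p. invertible (fst p) \<and> invertible (snd p)}"

lemma open_invertible_pairs: "open invertible_pairs"
proof -
  have "invertible_pairs = {M. invertible M} \<times> {M. invertible M}" by (auto simp: invertible_pairs_def)
  then show ?thesis using open_Times[OF open_invertible open_invertible] by simp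
qed

lemma word_traces_analytic: "real_analytic_on word_traces invertible_pairs"
  unfolding real_analytic_on_iff
proof
  fix p assume p: "p \<in> invertible_pairs"
  define ws :: "(qmat \<times> qmat \<Rightarrow> qmat) list" where "ws = [\<lambda>p. fst p, \<lambda>p. matrix_inv (fst p), \<lambda>p. fst p ** fst p,
    \<lambda>p. snd p, \<lambda>p. matrix_inv (snd p), \<lambda>p. snd p ** snd p, \<lambda>p. fst p ** snd p, \<lambda>p. fst p ** matrix_inv (snd p),
    \<lambda>p. matrix_inv (fst p) ** snd p, \<lambda>p. matrix_inv (fst p) ** matrix_inv (snd p),
    \<lambda>p. fst p ** fst p ** snd p, \<lambda>p. fst p ** snd p ** snd p, \<lambda>p. fst p ** fst p ** snd p ** snd p,
    \<lambda>p. fst p ** snd p ** fst p ** matrix_inv (snd p), \<lambda>p. fst p ** snd p ** matrix_inv (fst p) ** matrix_inv (snd p)]"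
  have eq: "word_traces = (\<lambda>p. vector (map (\<lambda>w. w p) (map (\<lambda>w p. trH (w p)) ws)))"
    by (simp add: word_traces_def ws_def Let_def fun_eq_iff)
  have ws: "\<forall>w\<in>set ws. analytic_at_point w p"
    using p unfolding ws_def invertible_pairs_def list.set ball_simps mem_Collect_eq
    by (intro conjI TrueI analytic_at_point_qmat_mult analytic_at_point_matrix_inv analytic_at_point_fst_snd analytic_at_point_id) auto
  show "analytic_at_point word_traces p"
    unfolding eq
  proof (rule analytic_at_point_vector)
    fix u assume "u \<in> set (map (\<lambda>w p. trH (w p)) ws)"
    then obtain w where w: "w \<in> set ws" "u = (\<lambda>p. trH (w p))" by auto
    have "analytic_at_point (\<lambda>p. trH (w p)) p"
      using ws w(1) by (intro analytic_at_point_linear_compose[OF linear_trH]) auto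
    then show "analytic_germ u p" by (simp add: w(2))
  qed
qed

text \<open>
  This replaces the properness of the conjugation action: limits of normalized intertwiners between pairs that tend
  to \<open>p0\<close> commute with \<open>p0\<close>, hence are scalars.
\<close>

lemma near_scalar_intertwiners:
  assumes scalar: "\<And>X. X ** fst p0 = fst p0 ** X \<Longrightarrow> X ** snd p0 = snd p0 ** X \<Longrightarrow> \<exists>c. X = c *\<^sub>R mat 1"
    and \<epsilon>: "0 < \<epsilon>"
  shows "\<exists>\<delta>>0. \<forall>q q' h. dist q p0 < \<delta> \<longrightarrow> dist q' p0 < \<delta> \<longrightarrow> norm h = 1 \<longrightarrow>
    fst q' ** h = h ** fst q \<longrightarrow> snd q' ** h = h ** snd q \<longrightarrow> (\<exists>c. norm (h - c *\<^sub>R (mat 1 :: qmat)) < \<epsilon>)"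
proof (rule ccontr)
  assume neg: "\<not> ?thesis"
  have "\<exists>q q' h. dist q p0 < inverse (real (Suc n)) \<and> dist q' p0 < inverse (real (Suc n)) \<and> norm h = 1 \<and>
    fst q' ** h = h ** fst q \<and> snd q' ** h = h ** snd q \<and> \<not> (\<exists>c. norm (h - c *\<^sub>R (mat 1 :: qmat)) < \<epsilon>)" for n
  proof -
    have "0 < inverse (real (Suc n))" by simp
    with neg show ?thesis by meson
  qed
  then obtain q q' h where q: "\<And>n. dist (q n) p0 < inverse (real (Suc n))" "\<And>n. dist (q' n) p0 < inverse (real (Suc n))"
    and h: "\<And>n. norm (h n) = 1" and e: "\<And>n. fst (q' n) ** h n = h n ** fst (q n)" "\<And>n. snd (q' n) ** h n = h n ** snd (q n)"
    and far: "\<And>n c. \<not> norm (h n - c *\<^sub>R (mat 1 :: qmat)) < \<epsilon>"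
    by metis
  have lim: "q \<longlonglongrightarrow> p0" "q' \<longlonglongrightarrow> p0"
    by (rule metric_tendsto_imp_tendsto[OF LIMSEQ_inverse_real_of_nat]; use q in \<open>auto intro!: always_eventually less_imp_le simp: dist_norm\<close>)+
  have "compact (sphere (0 :: qmat) 1)" by (rule compact_sphere)
  moreover have "\<forall>n. h n \<in> sphere 0 1" using h by (simp add: dist_norm)
  ultimately obtain l \<sigma> where l: "l \<in> sphere 0 1" "strict_mono (\<sigma> :: nat \<Rightarrow> nat)" "(h \<circ> \<sigma>) \<longlonglongrightarrow> l"
    unfolding compact_def by blast
  have ls: "(\<lambda>n. q (\<sigma> n)) \<longlonglongrightarrow> p0" "(\<lambda>n. q' (\<sigma> n)) \<longlonglongrightarrow> p0" "(\<lambda>n. h (\<sigma> n)) \<longlonglongrightarrow> l"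
    using LIMSEQ_subseq_LIMSEQ[OF lim(1) l(2)] LIMSEQ_subseq_LIMSEQ[OF lim(2) l(2)] l(3) by (simp_all add: o_def)
  note tm = bounded_bilinear.tendsto[OF bounded_bilinear_qmat_mult]
  have "fst p0 ** l = l ** fst p0"
  proof (rule LIMSEQ_unique)
    show "(\<lambda>n. fst (q' (\<sigma> n)) ** h (\<sigma> n)) \<longlonglongrightarrow> fst p0 ** l" by (intro tm tendsto_fst ls)
    show "(\<lambda>n. fst (q' (\<sigma> n)) ** h (\<sigma> n)) \<longlonglongrightarrow> l ** fst p0" unfolding e by (intro tm tendsto_fst ls)
  qed
  moreover have "snd p0 ** l = l ** snd p0"
  proof (rule LIMSEQ_unique)
    show "(\<lambda>n. snd (q' (\<sigma> n)) ** h (\<sigma> n)) \<longlonglongrightarrow> snd p0 ** l" by (intro tm tendsto_snd ls)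
    show "(\<lambda>n. snd (q' (\<sigma> n)) ** h (\<sigma> n)) \<longlonglongrightarrow> l ** snd p0" unfolding e by (intro tm tendsto_snd ls)
  qed
  ultimately obtain c where c: "l = c *\<^sub>R mat 1" using scalar[of l] by auto
  have "\<forall>\<^sub>F n in sequentially. dist (h (\<sigma> n)) l < \<epsilon>" using ls(3) \<epsilon> by (rule tendstoD)
  then obtain n where "dist (h (\<sigma> n)) l < \<epsilon>" by (auto dest: eventually_happens)
  then show False using far[of "\<sigma> n" c] by (simp add: dist_norm c)
qed

lemma norm_mat_1: "norm (mat 1 :: qmat) = sqrt 2"
  by (simp add: norm_vec_def L2_set_def sum_2 mat_def)

lemma inner_mat_1: "(mat 1 :: qmat) \<bullet> mat 1 = 2"
  using norm_mat_1 by (simp add: norm_eq_sqrt_inner)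

text \<open>
  The slice consists of the pairs near \<open>p0\<close> whose difference to \<open>p0\<close> is orthogonal to the tangent space of the orbit,
  that is, lies in the kernel of the adjoint of the infinitesimal action. The inverse function theorem, applied on the
  complement of the scalars, which act trivially, conjugates every nearby pair into the slice by a matrix
  close to \<open>1\<close>. Two conjugate pairs of the slice coincide: an intertwiner of them is nearly scalar, so after rescaling
  it is close to \<open>1\<close>, where the conjugation into the slice is unique.
\<close>

theorem analytic_slice:
  assumes scalar: "\<And>X. X ** fst p0 = fst p0 ** X \<Longrightarrow> X ** snd p0 = snd p0 ** X \<Longrightarrow> \<exists>c. X = c *\<^sub>R mat 1"
    and "open W" "p0 \<in> W"
  shows "\<exists>N n. open N \<and> p0 \<in> N \<and> N \<subseteq> W \<and> real_analytic_on n N \<and> (\<forall>p\<in>N. n p \<in> pair_class p) \<and>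
    (\<forall>p\<in>N. \<forall>p'\<in>N. p' \<in> pair_class p \<longrightarrow> n p' = n p)"
proof -
  (* The map ad is the derivative at 1 of the conjugation action on p0. *)
  define ad :: "qmat \<Rightarrow> qmat \<times> qmat" where "ad = (\<lambda>X. (X ** fst p0 - fst p0 ** X, X ** snd p0 - snd p0 ** X))"
  have lad: "linear ad" by (simp add: ad_def linear_iff qmat_distribs algebra_simps)
  define L where "L = adjoint ad"
  have lL: "linear L" unfolding L_def by (rule adjoint_linear[OF lad])
  have adj: "L u \<bullet> X = u \<bullet> ad X" for u X unfolding L_def by (metis adjoint_works[OF lad] inner_commute)
  define conjX :: "qmat \<times> qmat \<times> qmat \<Rightarrow> qmat \<times> qmat" where
    "conjX = (\<lambda>z. (matrix_inv (mat 1 + fst z) ** fst (snd z) ** (mat 1 + fst z), matrix_inv (mat 1 + fst z) ** snd (snd z) ** (mat 1 + fst z)))"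
  (* L takes values orthogonal to the scalars, so the first component of H vanishes if and only if the conjugated pair lies
     in the slice and X is orthogonal to the scalars. *)
  define H :: "qmat \<times> qmat \<times> qmat \<Rightarrow> qmat \<times> qmat \<times> qmat" where
    "H = (\<lambda>z. (L (conjX z - p0) + (fst z \<bullet> mat 1) *\<^sub>R mat 1, snd z))"
  define Dom :: "(qmat \<times> qmat \<times> qmat) set" where "Dom = {z. invertible (mat 1 + fst z)}"
  have Dom_open: "open Dom"
  proof -
    have "open ((\<lambda>z :: qmat \<times> qmat \<times> qmat. mat 1 + fst z) -` {M. invertible M})"
      by (rule open_vimage[OF open_invertible]) (intro continuous_intros)
    then show ?thesis by (simp add: Dom_def vimage_def)
  qed
  have conjX_an: "analytic_at_point conjX z" if "z \<in> Dom" for z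
    using that unfolding conjX_def Dom_def mem_Collect_eq
    by (intro analytic_at_point_Pair analytic_at_point_qmat_mult analytic_at_point_matrix_inv
        analytic_at_point_add analytic_at_point_const analytic_at_point_fst_snd analytic_at_point_id)
  have lin1: "linear (\<lambda>X :: qmat. (X \<bullet> mat 1) *\<^sub>R (mat 1 :: qmat))"
    by (simp add: linear_iff inner_add_left scaleR_left_distrib)
  have H_an: "real_analytic_on H Dom"
    unfolding real_analytic_on_iff H_def
    by (intro ballI analytic_at_point_Pair analytic_at_point_add analytic_at_point_linear_compose[OF lL]
        analytic_at_point_linear_compose[OF lin1] analytic_at_point_diff
        analytic_at_point_const analytic_at_point_fst_snd analytic_at_point_id conjX_an)
  define z0 :: "qmat \<times> qmat \<times> qmat" where "z0 = (0, p0)"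
  have z0: "z0 \<in> Dom" by (simp add: z0_def Dom_def invertible_qmatI[of _ "mat 1"])
  have inv1: "matrix_inv (mat 1 :: qmat) = mat 1" by (rule matrix_inv_eqI) simp_all
  have conj0: "conjX (0, p) = p" for p by (simp add: conjX_def inv1)
  obtain C where C: "(conjX has_derivative C) (at z0)"
    using analytic_at_point_differentiable[OF conjX_an[OF z0]] by blast
  have C_eq: "C h = snd h - ad (fst h)" for h
  proof -
    define T where "T = (\<lambda>z :: qmat \<times> qmat \<times> qmat. mat 1 + fst z)"
    have dT: "(T has_derivative (\<lambda>h. fst h)) (at z0)" unfolding T_def by (auto intro!: derivative_eq_intros)
    have T0: "T z0 = mat 1" by (simp add: T_def z0_def)
    have dC: "((\<lambda>z. fst (conjX z)) has_derivative (\<lambda>h. fst (C h))) (at z0)" "((\<lambda>z. snd (conjX z)) has_derivative (\<lambda>h. snd (C h))) (at z0)"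
      using C by (auto intro!: derivative_eq_intros)
    have "\<forall>\<^sub>F z in nhds z0. z \<in> Dom" using Dom_open z0 by (rule eventually_nhds_in_open)
    then have ev: "\<forall>\<^sub>F z in at z0. T z ** fst (conjX z) = fst (snd z) ** T z \<and> T z ** snd (conjX z) = snd (snd z) ** T z"
      unfolding eventually_at_filter
      by (rule eventually_mono) (simp add: conjX_def T_def Dom_def matrix_inv_inverse matrix_mul_assoc)
    have d1: "((\<lambda>z. T z ** fst (conjX z)) has_derivative (\<lambda>h. T z0 ** fst (C h) + fst h ** fst (conjX z0))) (at z0)"
      "((\<lambda>z. T z ** snd (conjX z)) has_derivative (\<lambda>h. T z0 ** snd (C h) + fst h ** snd (conjX z0))) (at z0)"
      by (intro qmat_mult_has_derivative dT dC)+
    have d2: "((\<lambda>z. fst (snd z) ** T z) has_derivative (\<lambda>h. fst (snd z0) ** fst h + fst (snd h) ** T z0)) (at z0)"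
      "((\<lambda>z. snd (snd z) ** T z) has_derivative (\<lambda>h. snd (snd z0) ** fst h + snd (snd h) ** T z0)) (at z0)"
      by (intro qmat_mult_has_derivative dT; auto intro!: derivative_eq_intros)+
    have "(\<lambda>h. T z0 ** fst (C h) + fst h ** fst (conjX z0)) = (\<lambda>h. fst (snd z0) ** fst h + fst (snd h) ** T z0)"
      by (rule has_derivative_unique[OF _ d2(1)], rule has_derivative_transform_eventually[OF d1(1)])
        (use ev conj0 in \<open>auto simp: z0_def T_def elim: eventually_mono\<close>)
    moreover have "(\<lambda>h. T z0 ** snd (C h) + fst h ** snd (conjX z0)) = (\<lambda>h. snd (snd z0) ** fst h + snd (snd h) ** T z0)"
      by (rule has_derivative_unique[OF _ d2(2)], rule has_derivative_transform_eventually[OF d1(2)])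
        (use ev conj0 in \<open>auto simp: z0_def T_def elim: eventually_mono\<close>)
    ultimately have "fst (C h) + fst h ** fst p0 = fst p0 ** fst h + fst (snd h)"
      "snd (C h) + fst h ** snd p0 = snd p0 ** fst h + snd (snd h)"
      using T0 conj0[of p0] by (cases h rule: prod_cases3; auto simp: z0_def fun_eq_iff)+
    then show ?thesis by (simp add: ad_def prod_eq_iff algebra_simps)
  qed
  define D where "D = (\<lambda>h :: qmat \<times> qmat \<times> qmat. (L (snd h - ad (fst h)) + (fst h \<bullet> mat 1) *\<^sub>R mat 1, snd h))"
  have dH: "(H has_derivative D) (at z0)"
  proof -
    have "((\<lambda>z. L (conjX z - p0)) has_derivative (\<lambda>h. L (C h - 0))) (at z0)"
      by (intro bounded_linear.has_derivative[OF linear_conv_bounded_linear[THEN iffD1, OF lL]] derivative_intros C)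
    moreover have "((\<lambda>z. (fst z \<bullet> mat 1) *\<^sub>R (mat 1 :: qmat)) has_derivative (\<lambda>h. (fst h \<bullet> mat 1) *\<^sub>R mat 1)) (at z0)"
      by (auto intro!: derivative_eq_intros)
    moreover have "(snd has_derivative snd) (at z0)" by (auto intro!: derivative_eq_intros)
    ultimately have "(H has_derivative (\<lambda>h. (L (C h - 0) + (fst h \<bullet> mat 1) *\<^sub>R mat 1, snd h))) (at z0)"
      unfolding H_def by (intro has_derivative_Pair has_derivative_add)
    then show ?thesis unfolding D_def C_eq by simp
  qed
  have "inj D"
  proof -
    have "h = 0" if "D h = 0" for h
    proof -
      define X where "X = fst h"
      have sh: "snd h = 0" using that by (simp add: D_def prod_eq_iff)
      have e: "L (- ad X) + (X \<bullet> mat 1) *\<^sub>R mat 1 = 0" using that by (simp add: D_def prod_eq_iff sh X_def)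
      have ad1: "ad (mat 1) = 0" by (simp add: ad_def prod_eq_iff)
      have "(L (- ad X) + (X \<bullet> mat 1) *\<^sub>R mat 1) \<bullet> mat 1 = 2 * (X \<bullet> mat 1)"
        by (simp add: inner_add_left adj ad1 inner_mat_1)
      then have X1: "X \<bullet> mat 1 = 0" using e by simp
      then have "L (- ad X) = 0" using e by simp
      then have "- ad X \<bullet> ad X = 0" using adj[of "- ad X" X] by simp
      then have "ad X = 0" by simp
      then obtain c where c: "X = c *\<^sub>R mat 1" using scalar[of X] by (auto simp: ad_def prod_eq_iff)
      then have "c = 0" using X1 by (simp add: inner_mat_1)
      then show "h = 0" using c sh by (simp add: prod_eq_iff X_def)
    qed
    then show ?thesis using linear_injective_0[OF has_derivative_linear[OF dH]] by blast
  qed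
  then obtain U \<Gamma> where U: "open U" "z0 \<in> U" "U \<subseteq> Dom" "open (H ` U)" "inj_on H U" "real_analytic_on \<Gamma> (H ` U)"
    and \<Gamma>: "\<And>z. z \<in> U \<Longrightarrow> \<Gamma> (H z) = z"
    using real_analytic_inverse_function[OF H_an Dom_open z0 dH] by blast
  define n where "n = (\<lambda>p. conjX (\<Gamma> (0, p)))"
  define N0 where "N0 = (\<lambda>p. (0 :: qmat, p)) -` H ` U"
  have N0: "open N0" unfolding N0_def by (rule open_vimage[OF U(4)]) (intro continuous_intros)
  have H0: "H z0 = (0, p0)" using conj0[of p0] linear_0[OF lL] by (simp add: H_def z0_def)
  have p0N0: "p0 \<in> N0" unfolding N0_def using U(2) H0 by (metis imageI vimageI)
  have \<Gamma>N: "\<exists>X. \<Gamma> (0, p) = (X, p) \<and> (X, p) \<in> U \<and> H (X, p) = (0, p)" if "p \<in> N0" for p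
  proof -
    have "(0, p) \<in> H ` U" using that by (simp add: N0_def)
    then obtain z where z: "z \<in> U" "H z = (0, p)" by (metis imageE)
    moreover have "snd z = p" using z(2) by (simp add: H_def)
    ultimately show ?thesis using \<Gamma>[OF z(1)] by (metis prod.collapse)
  qed
  have n_an: "analytic_at_point n p" if p: "p \<in> N0" for p
  proof -
    obtain X where X: "\<Gamma> (0, p) = (X, p)" "(X, p) \<in> U" using \<Gamma>N[OF p] by blast
    have "analytic_at_point \<Gamma> (0, p)" using U(6) p by (auto simp: real_analytic_on_iff N0_def)
    then have "analytic_at_point (\<lambda>p. \<Gamma> (0, p)) p"
      by (rule analytic_at_point_compose[where g = "\<lambda>p. (0, p)"])
        (intro analytic_at_point_Pair analytic_at_point_id analytic_at_point_const)
    then show ?thesis unfolding n_def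
      by (rule analytic_at_point_compose[rotated]) (use X U(3) in \<open>auto intro: conjX_an\<close>)
  qed
  have n_props: "n p \<in> pair_class p" "L (n p - p0) = 0" if p: "p \<in> N0" for p
  proof -
    obtain X where X: "\<Gamma> (0, p) = (X, p)" "(X, p) \<in> U" "H (X, p) = (0, p)" using \<Gamma>N[OF p] by blast
    have inv: "invertible (mat 1 + X)" using X(2) U(3) by (auto simp: Dom_def)
    have np: "n p = conjX (X, p)" by (simp add: n_def X)
    have "n p = conj_pair (matrix_inv (mat 1 + X)) p"
      unfolding np conjX_def conj_pair_def conj_by_def using matrix_inv_matrix_inv[OF inv] by simp
    then show "n p \<in> pair_class p" using invertible_matrix_inv[OF inv] by (auto simp: pair_class_iff)
    have e: "L (n p - p0) + (X \<bullet> mat 1) *\<^sub>R mat 1 = 0" using X(3) by (simp add: H_def np)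
    have ad1: "ad (mat 1) = 0" by (simp add: ad_def prod_eq_iff)
    have "(L (n p - p0) + (X \<bullet> mat 1) *\<^sub>R mat 1) \<bullet> mat 1 = 2 * (X \<bullet> mat 1)"
      by (simp add: inner_add_left adj ad1 inner_mat_1)
    then have "X \<bullet> mat 1 = 0" using e by simp
    then show "L (n p - p0) = 0" using e by simp
  qed
  have np0: "n p0 = p0"
    using \<Gamma>[OF U(2)] H0 conj0 by (simp add: n_def z0_def)
  obtain \<eta> where \<eta>: "0 < \<eta>" "ball z0 \<eta> \<subseteq> U" using U(1,2) open_contains_ball by blast
  have "\<exists>\<delta>>0. \<forall>q q' h. dist q p0 < \<delta> \<longrightarrow> dist q' p0 < \<delta> \<longrightarrow> norm h = 1 \<longrightarrow>
    fst q' ** h = h ** fst q \<longrightarrow> snd q' ** h = h ** snd q \<longrightarrow> (\<exists>c. norm (h - c *\<^sub>R (mat 1 :: qmat)) < min (1/4) (\<eta> / 16))"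
  proof (rule near_scalar_intertwiners)
    show "0 < min (1/4) (\<eta> / 16)" using \<eta>(1) by simp
  qed (rule scalar)
  then obtain \<delta> where \<delta>: "0 < \<delta>" and near_all: "\<forall>q q' h. dist q p0 < \<delta> \<longrightarrow> dist q' p0 < \<delta> \<longrightarrow> norm h = 1 \<longrightarrow>
    fst q' ** h = h ** fst q \<longrightarrow> snd q' ** h = h ** snd q \<longrightarrow> (\<exists>c. norm (h - c *\<^sub>R (mat 1 :: qmat)) < min (1/4) (\<eta> / 16))"
    by (elim exE conjE)
  note near = near_all[rule_format]
  have uniq: "q = q'" if q: "dist q p0 < min \<delta> (\<eta> / 4)" "dist q' p0 < min \<delta> (\<eta> / 4)" and Lq: "L (q - p0) = 0" "L (q' - p0) = 0"
    and qq: "q' \<in> pair_class q" for q q'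
  proof -
    obtain P where P: "invertible P" "q' = conj_pair P q" using qq by (auto simp: pair_class_iff)
    have Pn: "P \<noteq> 0" using P(1) by (auto simp: invertible_iff_dieudonne_det dieudonne_det_def)
    (* Conjugation is insensitive to scaling, so P may be normalized; this is the normalization of the previous lemma. *)
    define h where "h = (1 / norm P) *\<^sub>R P"
    have h: "norm h = 1" using Pn by (simp add: h_def)
    have "P ** fst q = fst q' ** P" "P ** snd q = snd q' ** P"
      using P by (simp_all add: conj_pair_def conj_by_eq_iff[symmetric])
    then have hq: "h ** fst q = fst q' ** h" "h ** snd q = snd q' ** h" by (simp_all add: h_def qmat_distribs)
    then obtain c where c: "norm (h - c *\<^sub>R (mat 1 :: qmat)) < min (1/4) (\<eta> / 16)"
      using near[of q q' h] q h by auto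
    (* The orthogonal projection of h to the scalars is no farther from h than c. *)
    define d where "d = (h \<bullet> mat 1) / 2"
    define K where "K = h - d *\<^sub>R (mat 1 :: qmat)"
    have K1: "K \<bullet> mat 1 = 0" by (simp add: K_def d_def inner_diff_left inner_mat_1)
    have "norm K \<le> norm (h - c *\<^sub>R mat 1)"
    proof -
      have "h - c *\<^sub>R mat 1 = K + (d - c) *\<^sub>R mat 1" by (simp add: K_def algebra_simps)
      moreover have "(norm (K + (d - c) *\<^sub>R mat 1))\<^sup>2 = (norm K)\<^sup>2 + (norm ((d - c) *\<^sub>R (mat 1 :: qmat)))\<^sup>2"
        by (rule norm_add_Pythagorean) (simp add: orthogonal_def K1)
      ultimately have "(norm K)\<^sup>2 \<le> (norm (h - c *\<^sub>R mat 1))\<^sup>2" by simp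
      then show ?thesis by (rule power2_le_imp_le) simp
    qed
    then have K: "norm K < 1 / 4" "norm K < \<eta> / 16" using c by auto
    have "norm h \<le> norm K + \<bar>d\<bar> * sqrt 2"
      using norm_triangle_ineq[of K "d *\<^sub>R mat 1"] by (simp add: K_def norm_mat_1)
    moreover have "sqrt 2 \<le> 3 / 2" by (rule real_le_lsqrt) (auto simp: power2_eq_square)
    then have "\<bar>d\<bar> * sqrt 2 \<le> \<bar>d\<bar> * (3 / 2)" by (intro mult_left_mono) auto
    ultimately have "1 / 2 \<le> \<bar>d\<bar>" using h K(1) by linarith
    then have d: "d \<noteq> 0" "1 / \<bar>d\<bar> \<le> 2" by (auto simp: divide_simps)
    define Y where "Y = (1 / d) *\<^sub>R K"
    have hY: "h = d *\<^sub>R (mat 1 + Y)" using d by (simp add: Y_def K_def algebra_simps)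
    have "norm Y = 1 / \<bar>d\<bar> * norm K" by (simp add: Y_def)
    also have "\<dots> \<le> 2 * norm K" using d by (intro mult_right_mono) auto
    finally have Y: "norm Y < \<eta> / 8" using K by simp
    have Yq: "(Y, q') \<in> ball z0 \<eta>" "(0, q') \<in> ball z0 \<eta>"
    proof -
      have "dist q' p0 < \<eta> / 4" using q by simp
      then have n: "norm (p0 - q') < \<eta> / 4" by (simp add: dist_norm norm_minus_commute)
      have "norm (z0 - (v, q')) \<le> norm v + norm (p0 - q')" for v
        using norm_Pair_le[of "- v" "p0 - q'"] by (simp add: z0_def)
      then have "norm (z0 - (Y, q')) \<le> norm Y + norm (p0 - q')" "norm (z0 - (0, q')) \<le> norm (0 :: qmat) + norm (p0 - q')"
        by blast+
      then show "(Y, q') \<in> ball z0 \<eta>" "(0, q') \<in> ball z0 \<eta>" using n Y \<eta>(1) by (simp_all add: dist_norm)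
    qed
    then have YU: "(Y, q') \<in> U" "(0, q') \<in> U" using \<eta>(2) by auto
    then have inv: "invertible (mat 1 + Y)" using U(3) by (auto simp: Dom_def)
    have "(mat 1 + Y) ** fst q = fst q' ** (mat 1 + Y)" "(mat 1 + Y) ** snd q = snd q' ** (mat 1 + Y)"
      using hq d unfolding hY qmat_scaleR_left qmat_scaleR_right by simp_all
    then have "matrix_inv (mat 1 + Y) ** (fst q' ** (mat 1 + Y)) = matrix_inv (mat 1 + Y) ** ((mat 1 + Y) ** fst q)"
      "matrix_inv (mat 1 + Y) ** (snd q' ** (mat 1 + Y)) = matrix_inv (mat 1 + Y) ** ((mat 1 + Y) ** snd q)" by simp_all
    then have "conjX (Y, q') = q"
      using inv by (simp add: conjX_def prod_eq_iff matrix_mul_assoc matrix_inv_inverse)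
    moreover have "Y \<bullet> mat 1 = 0" by (simp add: Y_def K1)
    ultimately have "H (Y, q') = H (0, q')" by (simp add: H_def conj0 Lq)
    then have "Y = 0" using inj_onD[OF U(5) _ YU] by simp
    then have "conjX (0, q') = q" using \<open>conjX (Y, q') = q\<close> by simp
    then show ?thesis by (simp add: conj0)
  qed
  define N where "N = N0 \<inter> W \<inter> {p. dist (n p) p0 < min \<delta> (\<eta> / 4)}"
  have "continuous_on N0 n"
    using n_an by (intro real_analytic_on_imp_continuous_on) (simp add: real_analytic_on_iff)
  then have "open (N0 \<inter> n -` ball p0 (min \<delta> (\<eta> / 4)))" using N0 by (intro continuous_open_preimage) auto
  moreover have "N = (N0 \<inter> n -` ball p0 (min \<delta> (\<eta> / 4))) \<inter> W" by (auto simp: N_def dist_commute)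
  ultimately have "open N" using \<open>open W\<close> by auto
  moreover have "p0 \<in> N" using p0N0 \<open>p0 \<in> W\<close> \<delta> \<eta> by (simp add: N_def np0)
  moreover have "N \<subseteq> W" by (auto simp: N_def)
  moreover have "real_analytic_on n N" using n_an by (auto simp: real_analytic_on_iff N_def)
  moreover have "\<forall>p\<in>N. n p \<in> pair_class p" using n_props by (auto simp: N_def)
  moreover have "n p' = n p" if "p \<in> N" "p' \<in> N" "p' \<in> pair_class p" for p p'
  proof -
    have "n p' \<in> pair_class (n p)"
      using that n_props(1)[of p] n_props(1)[of p'] pair_class_eqI[of p' p] pair_class_eqI[of "n p" p]
      by (simp add: N_def)
    then have "n p = n p'" using that n_props(2) by (intro uniq) (auto simp: N_def)
    then show ?thesis by simp
  qed
  ultimately show ?thesis by blast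
qed

section \<open>Regular loxodromic pairs near a normal form\<close>

text \<open>
  The action on the right vector space of column vectors. Its eigenlines are the fixed points of the Moebius
  action, which reduces statements about \<open>moebius\<close> to matrix products.
\<close>

definition act :: "qmat \<Rightarrow> quat \<times> quat \<Rightarrow> quat \<times> quat" where
  "act M v = (M$1$1 * fst v + M$1$2 * snd v, M$2$1 * fst v + M$2$2 * snd v)"

definition scale_right :: "quat \<times> quat \<Rightarrow> quat \<Rightarrow> quat \<times> quat" where
  "scale_right v \<kappa> = (fst v * \<kappa>, snd v * \<kappa>)"

lemma act_mult: "act (M ** N) v = act M (act N v)"
  by (simp add: act_def qmat_mult_nth algebra_simps)

lemma act_1: "act (mat 1) v = v"
  by (simp add: act_def mat_1_eq)

lemma act_scale: "act M (scale_right v \<kappa>) = scale_right (act M v) \<kappa>"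
  by (simp add: act_def scale_right_def algebra_simps)

lemma scale_scale: "scale_right (scale_right v \<kappa>) \<kappa>' = scale_right v (\<kappa> * \<kappa>')"
  by (simp add: scale_right_def mult.assoc)

lemma act_eq_0_iff: "invertible M \<Longrightarrow> act M v = 0 \<longleftrightarrow> v = 0"
proof -
  assume M: "invertible M"
  have "act (matrix_inv M) (act M v) = v" using M by (simp add: matrix_inv_inverse act_1 flip: act_mult)
  moreover have "act N 0 = 0" for N by (simp add: act_def zero_prod_def)
  ultimately show ?thesis by metis
qed

definition common_eigenvector :: "qmat \<times> qmat \<Rightarrow> bool" where
  "common_eigenvector p \<longleftrightarrow> (\<exists>v \<kappa> \<kappa>'. v \<noteq> 0 \<and> act (fst p) v = scale_right v \<kappa> \<and> act (snd p) v = scale_right v \<kappa>')"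

definition homogeneous :: "quat option \<Rightarrow> quat \<times> quat" where
  "homogeneous z = (case z of None \<Rightarrow> (1, 0) | Some x \<Rightarrow> (x, 1))"

lemma mult_inverse_eq_iff: "(d :: quat) \<noteq> 0 \<Longrightarrow> n * inverse d = x \<longleftrightarrow> n = x * d"
  by (auto simp: mult.assoc)

lemma fixed_points_iff:
  assumes "invertible M"
  shows "z \<in> fixed_points M \<longleftrightarrow> (\<exists>\<kappa>. act M (homogeneous z) = scale_right (homogeneous z) \<kappa>)"
proof (cases z)
  case None
  then show ?thesis by (auto simp: fixed_points_def act_def homogeneous_def scale_right_def)
next
  case (Some x)
  let ?n = "M$1$1 * x + M$1$2" and ?d = "M$2$1 * x + M$2$2"
  show ?thesis
  proof (cases "?d = 0")
    case True
    have "act M (x, 1) \<noteq> 0" using act_eq_0_iff[OF assms, of "(x, 1)"] by (simp add: zero_prod_def)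
    then have "?n \<noteq> 0" using True by (simp add: act_def zero_prod_def)
    then show ?thesis using True by (auto simp: Some fixed_points_def act_def homogeneous_def scale_right_def)
  next
    case False
    have "?n * inverse ?d = x \<longleftrightarrow> ?n = x * ?d"
      using False by (rule mult_inverse_eq_iff)
    then show ?thesis using False by (simp add: Some fixed_points_def act_def homogeneous_def scale_right_def)
  qed
qed

lemma disjoint_fixed_points_iff:
  assumes "invertible A" "invertible B"
  shows "fixed_points A \<inter> fixed_points B = {} \<longleftrightarrow> \<not> common_eigenvector (A, B)"
proof
  assume "\<not> common_eigenvector (A, B)"
  moreover have "homogeneous z \<noteq> 0" for z by (cases z) (simp_all add: homogeneous_def zero_prod_def)
  ultimately have "\<not> (z \<in> fixed_points A \<and> z \<in> fixed_points B)" for z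
    unfolding fixed_points_iff[OF assms(1)] fixed_points_iff[OF assms(2)] common_eigenvector_def fst_conv snd_conv by blast
  then show "fixed_points A \<inter> fixed_points B = {}" by blast
next
  assume dis: "fixed_points A \<inter> fixed_points B = {}"
  show "\<not> common_eigenvector (A, B)"
  proof
    assume "common_eigenvector (A, B)"
    then obtain v \<kappa> \<kappa>' where v: "v \<noteq> 0" "act A v = scale_right v \<kappa>" "act B v = scale_right v \<kappa>'"
      by (auto simp: common_eigenvector_def)
    obtain z t where t: "t \<noteq> 0" "v = scale_right (homogeneous z) t"
    proof (cases "snd v = 0")
      case True
      then have "fst v \<noteq> 0" using v(1) by (simp add: prod_eq_iff)
      then show ?thesis using that[of "fst v" None] True by (simp add: homogeneous_def scale_right_def prod_eq_iff)
    next
      case False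
      then show ?thesis using that[of "snd v" "Some (fst v * inverse (snd v))"]
        by (simp add: homogeneous_def scale_right_def prod_eq_iff mult.assoc)
    qed
    have h: "homogeneous z = scale_right v (inverse t)"
      unfolding t(2) scale_scale using t(1) by (simp add: scale_right_def)
    have "act M (homogeneous z) = scale_right (homogeneous z) (t * k * inverse t)" if "act M v = scale_right v k" for M k
      unfolding h act_scale that scale_scale using t by (simp add: quat_inverse_cancel mult.assoc)
    then have "z \<in> fixed_points A \<inter> fixed_points B" using v assms by (auto simp: fixed_points_iff)
    then show False using dis by simp
  qed
qed

text \<open>
  Conjugation moves a common eigenvector. Together with \<open>disjoint_fixed_points_iff\<close> this makes disjointness of the
  fixed point sets a property of the class of the pair.
\<close>

lemma common_eigenvector_conj:
  assumes "invertible P" "common_eigenvector p"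
  shows "common_eigenvector (conj_pair P p)"
proof -
  obtain v \<kappa> \<kappa>' where v: "v \<noteq> 0" "act (fst p) v = scale_right v \<kappa>" "act (snd p) v = scale_right v \<kappa>'"
    using assms(2) by (auto simp: common_eigenvector_def)
  have "act (conj_by P X) (act P v) = act P (act X v)" for X
  proof -
    have "conj_by P X ** P = P ** X" using conj_by_eq_iff[OF assms(1), of X "conj_by P X"] by simp
    then show ?thesis by (simp flip: act_mult)
  qed
  then have "act (conj_by P (fst p)) (act P v) = scale_right (act P v) \<kappa>" "act (conj_by P (snd p)) (act P v) = scale_right (act P v) \<kappa>'"
    using v by (simp_all add: act_scale)
  moreover have "act P v \<noteq> 0" using v(1) act_eq_0_iff[OF assms(1)] by simp
  ultimately show ?thesis unfolding common_eigenvector_def conj_pair_def fst_conv snd_conv by blast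
qed

lemma regular_loxodromic_conj:
  assumes "invertible P" "regular_loxodromic A"
  shows "regular_loxodromic (conj_by P A)"
proof -
  have "conj_by P A \<in> conj_class A" using assms(1) by (auto simp: conj_class_iff)
  then have "conj_by P A \<in> conj_class X" if "A \<in> conj_class X" for X using conj_class_trans[OF that] by blast
  then show ?thesis
    using assms(2) SL2H_conj[OF assms(1)] unfolding regular_loxodromic_def by fast
qed

lemma regular_loxodromic_invertible: "regular_loxodromic A \<Longrightarrow> invertible A"
  by (simp add: regular_loxodromic_def SL2H_invertible)

lemma regular_loxodromic_pair_iff:
  "regular_loxodromic_pair p \<longleftrightarrow> regular_loxodromic (fst p) \<and> regular_loxodromic (snd p) \<and> \<not> common_eigenvector p"
  using disjoint_fixed_points_iff[of "fst p" "snd p"] regular_loxodromic_invertible[of "fst p"]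
    regular_loxodromic_invertible[of "snd p"]
  unfolding regular_loxodromic_pair_def prod.collapse by blast

lemma regular_loxodromic_pair_conj:
  assumes "invertible P" "regular_loxodromic_pair p"
  shows "regular_loxodromic_pair (conj_pair P p)"
proof -
  have "conj_pair (matrix_inv P) (conj_pair P p) = p"
    using assms(1) by (simp add: conj_pair_def conj_by_inverse)
  then have "\<not> common_eigenvector (conj_pair P p)"
    using assms common_eigenvector_conj[OF invertible_matrix_inv[OF assms(1)], of "conj_pair P p"]
    by (auto simp: regular_loxodromic_pair_iff)
  then show ?thesis
    using assms by (simp add: regular_loxodromic_pair_iff regular_loxodromic_conj conj_pair_def)
qed

definition diagonal_form :: "real \<Rightarrow> quat \<Rightarrow> real \<Rightarrow> quat \<Rightarrow> real \<Rightarrow> qmat" where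
  "diagonal_form r I \<theta> J \<phi> = mat2 (r *\<^sub>R quat_cis I \<theta>) 0 0 (inverse r *\<^sub>R quat_cis J \<phi>)"

lemma invertible_normal_conjugator:
  assumes "w \<noteq> 1"
  shows "invertible (mat2 1 w 1 1)"
  using assms by (simp add: invertible_iff_dieudonne_det dieudonne_det_mat2)

text \<open>
  The scalar factor of the conjugating matrix is dropped, since it does not affect the conjugation.
\<close>

lemma normal_form_pairs_iff:
  "q \<in> normal_form_pairs \<longleftrightarrow> (\<exists>r s \<theta> \<phi> \<theta>' \<phi>' I J K L x y.
     q = (diagonal_form r I \<theta> J \<phi>, conj_by (mat2 1 (of_real x + y *\<^sub>R quat_i) 1 1) (diagonal_form s K \<theta>' L \<phi>')) \<and>
     r > 1 \<and> s > 1 \<and> {\<theta>, \<phi>, \<theta>', \<phi>'} \<subseteq> {0<..<pi} \<and>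
     {I, J, K, L} \<subseteq> imag_units \<and> \<not> {I, J, K, L} \<subseteq> {quat_i, - quat_i} \<and> y > 0)"
proof -
  have "conj_by ((norm (1 - w) powr (- 1 / 2)) *\<^sub>R mat2 1 w 1 1) X = conj_by (mat2 1 w 1 1) X"
    if "w = of_real x + y *\<^sub>R quat_i" "y > 0" for w x y X
  proof (rule conj_by_scaleR)
    have "qim1 w \<noteq> qim1 1" using that by (simp add: quat_i_def of_real_def quat_defs)
    then have w: "w \<noteq> 1" by auto
    then show "norm (1 - w) powr (- 1 / 2) \<noteq> 0" by simp
    show "invertible (mat2 1 w 1 1)" by (rule invertible_normal_conjugator[OF w])
  qed
  note c = this
  show ?thesis
  proof
    assume "q \<in> normal_form_pairs"
    then obtain r s \<theta> \<phi> \<theta>' \<phi>' I J K L w x y where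
      q: "q = (diagonal_form r I \<theta> J \<phi>, conj_by ((norm (1 - w) powr (- 1 / 2)) *\<^sub>R mat2 1 w 1 1) (diagonal_form s K \<theta>' L \<phi>'))"
      and w: "w = of_real x + y *\<^sub>R quat_i" "y > 0" and *: "r > 1" "s > 1" "{\<theta>, \<phi>, \<theta>', \<phi>'} \<subseteq> {0<..<pi}"
      "{I, J, K, L} \<subseteq> imag_units" "\<not> {I, J, K, L} \<subseteq> {quat_i, - quat_i}"
      unfolding normal_form_pairs_def mem_Collect_eq diagonal_form_def by (elim exE conjE)
    have q': "q = (diagonal_form r I \<theta> J \<phi>, conj_by (mat2 1 (of_real x + y *\<^sub>R quat_i) 1 1) (diagonal_form s K \<theta>' L \<phi>'))"
      using q unfolding c[OF w] unfolding w(1) .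
    show "\<exists>r s \<theta> \<phi> \<theta>' \<phi>' I J K L x y.
     q = (diagonal_form r I \<theta> J \<phi>, conj_by (mat2 1 (of_real x + y *\<^sub>R quat_i) 1 1) (diagonal_form s K \<theta>' L \<phi>')) \<and>
     r > 1 \<and> s > 1 \<and> {\<theta>, \<phi>, \<theta>', \<phi>'} \<subseteq> {0<..<pi} \<and>
     {I, J, K, L} \<subseteq> imag_units \<and> \<not> {I, J, K, L} \<subseteq> {quat_i, - quat_i} \<and> y > 0"
      by (intro exI conjI, rule q') (rule * w(2))+
  next
    assume "\<exists>r s \<theta> \<phi> \<theta>' \<phi>' I J K L x y.
     q = (diagonal_form r I \<theta> J \<phi>, conj_by (mat2 1 (of_real x + y *\<^sub>R quat_i) 1 1) (diagonal_form s K \<theta>' L \<phi>')) \<and>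
     r > 1 \<and> s > 1 \<and> {\<theta>, \<phi>, \<theta>', \<phi>'} \<subseteq> {0<..<pi} \<and>
     {I, J, K, L} \<subseteq> imag_units \<and> \<not> {I, J, K, L} \<subseteq> {quat_i, - quat_i} \<and> y > 0"
    then obtain r s \<theta> \<phi> \<theta>' \<phi>' I J K L x y where
      q: "q = (diagonal_form r I \<theta> J \<phi>, conj_by (mat2 1 (of_real x + y *\<^sub>R quat_i) 1 1) (diagonal_form s K \<theta>' L \<phi>'))"
      and y: "y > 0" and *: "r > 1" "s > 1" "{\<theta>, \<phi>, \<theta>', \<phi>'} \<subseteq> {0<..<pi}"
      "{I, J, K, L} \<subseteq> imag_units" "\<not> {I, J, K, L} \<subseteq> {quat_i, - quat_i}"
      by (elim exE conjE)
    define w where "w = of_real x + y *\<^sub>R quat_i"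
    have q': "q = (mat2 (r *\<^sub>R quat_cis I \<theta>) 0 0 (inverse r *\<^sub>R quat_cis J \<phi>),
      conj_by ((norm (1 - w) powr (- 1 / 2)) *\<^sub>R mat2 1 w 1 1)
        (mat2 (s *\<^sub>R quat_cis K \<theta>') 0 0 (inverse s *\<^sub>R quat_cis L \<phi>')))"
      using q unfolding c[OF w_def y] w_def[symmetric] diagonal_form_def .
    show "q \<in> normal_form_pairs"
      unfolding normal_form_pairs_def mem_Collect_eq
      by (intro exI conjI, rule q') (rule * y w_def)+
  qed
qed

lemma quat_cis_conj:
  "u \<noteq> 0 \<Longrightarrow> u * quat_cis I \<theta> * inverse u = quat_cis (u * I * inverse u) \<theta>"
proof -
  assume u: "u \<noteq> 0"
  have "of_real t * (x :: quat) = x * of_real t" for t x by (simp add: of_real_def)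
  then have "u * (I * of_real (sin \<theta>)) * inverse u = u * I * inverse u * of_real (sin \<theta>)"
    by (simp add: mult.assoc)
  moreover have "u * of_real (cos \<theta>) * inverse u = of_real (cos \<theta>)"
    using u by (simp add: of_real_def)
  ultimately show ?thesis by (simp add: quat_cis_def distrib_left distrib_right)
qed

lemma imag_units_conj: "u \<noteq> 0 \<Longrightarrow> I \<in> imag_units \<Longrightarrow> u * I * inverse u \<in> imag_units"
proof -
  assume u: "u \<noteq> 0" and I: "I \<in> imag_units"
  have "(u * I * inverse u)\<^sup>2 = u * I\<^sup>2 * inverse u"
    using u by (simp add: power2_eq_square mult.assoc quat_inverse_cancel)
  then show ?thesis using u I by (simp add: imag_units_def)
qed

lemma conj_by_diagonal:
  assumes "x \<noteq> 0" "y \<noteq> 0"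
  shows "conj_by (mat2 x 0 0 y) (diagonal_form r I \<theta> J \<phi>) = diagonal_form r (x * I * inverse x) \<theta> (y * J * inverse y) \<phi>"
proof -
  have "matrix_inv (mat2 x 0 0 y) = mat2 (inverse x) 0 0 (inverse y)"
    by (rule matrix_inv_eqI) (simp_all add: mat2_mult mat_1_eq assms)
  then show ?thesis
    by (simp add: conj_by_def diagonal_form_def mat2_mult quat_cis_conj[symmetric] assms)
qed

definition imag_part :: "quat \<Rightarrow> quat" where
  "imag_part x = x - of_real (qre x)"

lemma imag_part_square: "imag_part x * imag_part x = - ((norm (imag_part x))\<^sup>2 *\<^sub>R 1)"
  by (simp add: imag_part_def of_real_def norm_quat_def quat_defs power2_eq_square algebra_simps)

text \<open>
  If \<open>v\<close> is the imaginary part of \<open>x\<close>, then \<open>u = |v| - i v\<close> satisfies \<open>u v = |v| i u\<close>. So \<open>u\<close>, when nonzero, rotates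
  \<open>x\<close> into the complex plane, and it depends continuously on \<open>x\<close>.
\<close>

definition straighten :: "quat \<Rightarrow> quat" where
  "straighten x = norm (imag_part x) *\<^sub>R 1 - quat_i * imag_part x"

lemma quat_i_square: "quat_i * quat_i = - 1"
  by (simp add: quat_i_def quat_defs)

lemma straighten:
  assumes "straighten x \<noteq> 0"
  shows "straighten x * x * inverse (straighten x) = of_real (qre x) + norm (imag_part x) *\<^sub>R quat_i"
proof -
  let ?u = "straighten x" and ?m = "norm (imag_part x)" and ?v = "imag_part x"
  have "?u * ?v = ?m *\<^sub>R ?v + (?m)\<^sup>2 *\<^sub>R quat_i"
    by (simp add: straighten_def left_diff_distrib mult.assoc imag_part_square)
  moreover have "(?m *\<^sub>R quat_i) * ?u = ?m *\<^sub>R ?v + (?m)\<^sup>2 *\<^sub>R quat_i"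
    by (simp add: straighten_def right_diff_distrib scaleR_diff_right power2_eq_square quat_i_square flip: mult.assoc)
  ultimately have "?u * ?v * inverse ?u = ?m *\<^sub>R quat_i"
    using mult_inverse_eq_iff[OF assms] by simp
  moreover have "?u * of_real (qre x) * inverse ?u = of_real (qre x)" using assms by (simp add: of_real_def)
  moreover have "x = of_real (qre x) + ?v" by (simp add: imag_part_def)
  ultimately show ?thesis by (metis distrib_left distrib_right)
qed

lemma isCont_qre: "isCont qre x"
proof -
  have "linear qre" by (simp add: linear_iff quat_defs)
  then show ?thesis using linear_continuous_at linear_conv_bounded_linear by blast
qed

text \<open>
  Every conjugator \<open>P\<close> near \<open>mat2 1 w 1 1\<close> becomes a matrix of the same shape after multiplication by two diagonal
  matrices, one from each side. Conjugation by these rotates the imaginary units of the diagonal forms and changes nothing else. The cross-ratio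
  \<open>W\<close> of the entries of \<open>P\<close> is near \<open>w\<close> and is rotated into the upper half-plane; as \<open>w\<close> is there already,
  the diagonal matrices are nearly real scalars, so the units move little and do not all become \<open>\<plusminus>i\<close>.
\<close>

lemma normal_form_pairs_local:
  assumes w: "w = of_real x + y *\<^sub>R quat_i" "0 < y" and r: "r > 1" "s > 1"
    and angles: "{\<theta>, \<phi>, \<theta>', \<phi>'} \<subseteq> {0<..<pi}" and units: "{I, J, K, L} \<subseteq> imag_units"
    and not_i: "\<not> {I, J, K, L} \<subseteq> {quat_i, - quat_i}"
  shows "\<forall>\<^sub>F P in nhds (mat2 1 w 1 1). \<exists>q\<in>normal_form_pairs.
    (diagonal_form r I \<theta> J \<phi>, conj_by P (diagonal_form s K \<theta>' L \<phi>')) \<in> pair_class q"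
proof -
  let ?F = "nhds (mat2 1 w 1 1)"
  define a b c d where "a = (\<lambda>P :: qmat. P$1$1)" and "b = (\<lambda>P :: qmat. P$1$2)" and "c = (\<lambda>P :: qmat. P$2$1)" and "d = (\<lambda>P :: qmat. P$2$2)"
  have id: "((\<lambda>P :: qmat. P) \<longlongrightarrow> mat2 1 w 1 1) ?F" by (rule filterlim_ident)
  have e: "((\<lambda>P :: qmat. P$i$j) \<longlongrightarrow> mat2 1 w 1 1 $ i $ j) ?F" for i j by (intro tendsto_vec_nth id)
  have lim: "(a \<longlongrightarrow> 1) ?F" "(b \<longlongrightarrow> w) ?F" "(c \<longlongrightarrow> 1) ?F" "(d \<longlongrightarrow> 1) ?F"
    using e[of 1 1] e[of 1 2] e[of 2 1] e[of 2 2] by (simp_all add: a_def b_def c_def d_def)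
  (* For a matrix of the shape mat2 1 w 1 1 this is w; multiplication of P by diagonal matrices conjugates it. *)
  define W where "W = (\<lambda>P. inverse (a P) * b P * inverse (d P) * c P)"
  have W: "(W \<longlongrightarrow> w) ?F"
  proof -
    have "(W \<longlongrightarrow> inverse 1 * w * inverse 1 * 1) ?F" unfolding W_def by (intro tendsto_intros lim) auto
    then show ?thesis by simp
  qed
  have qre_W: "((\<lambda>P. qre (W P)) \<longlongrightarrow> qre w) ?F" by (rule isCont_tendsto_compose[OF isCont_qre W])
  have im_w: "imag_part w = y *\<^sub>R quat_i" "norm (imag_part w) = y"
    using w by (simp_all add: imag_part_def quat_i_def of_real_def quat_defs norm_quat_def)
  have imW: "((\<lambda>P. imag_part (W P)) \<longlongrightarrow> imag_part w) ?F"
    unfolding imag_part_def by (rule tendsto_diff[OF W tendsto_of_real[OF qre_W]])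
  define k where "k = (\<lambda>P. straighten (W P))"
  have "straighten w = y *\<^sub>R 1 - quat_i * (y *\<^sub>R quat_i)" unfolding straighten_def im_w(2) unfolding im_w(1) ..
  also have "\<dots> = y *\<^sub>R 1 + y *\<^sub>R 1" by (simp add: quat_i_square)
  also have "\<dots> = (2 * y) *\<^sub>R 1" by (simp only: mult_2 scaleR_left_distrib)
  finally have "straighten w = (2 * y) *\<^sub>R 1" .
  moreover have "(k \<longlongrightarrow> straighten w) ?F"
    unfolding k_def straighten_def by (intro tendsto_intros imW)
  ultimately have k: "(k \<longlongrightarrow> (2 * y) *\<^sub>R 1) ?F" by simp
  have y0: "(2 * y) *\<^sub>R (1 :: quat) \<noteq> 0" using w by simp
  (* The diagonal entries of the two matrices that bring P into the shape mat2 1 w' 1 1; they all tend to a nonzero real. *)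
  define u1 u2 u3 u4 where "u1 = (\<lambda>P. k P * inverse (a P))" and "u2 = (\<lambda>P. k P * inverse (c P))"
    and "u3 = k" and "u4 = (\<lambda>P. k P * inverse (c P) * d P)"
  have u: "(u1 \<longlongrightarrow> (2 * y) *\<^sub>R 1) ?F" "(u2 \<longlongrightarrow> (2 * y) *\<^sub>R 1) ?F" "(u3 \<longlongrightarrow> (2 * y) *\<^sub>R 1) ?F" "(u4 \<longlongrightarrow> (2 * y) *\<^sub>R 1) ?F"
  proof -
    have "(u1 \<longlongrightarrow> (2 * y) *\<^sub>R 1 * inverse 1) ?F" unfolding u1_def by (intro tendsto_intros lim k) auto
    moreover have "(u2 \<longlongrightarrow> (2 * y) *\<^sub>R 1 * inverse 1) ?F" unfolding u2_def by (intro tendsto_intros lim k) auto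
    moreover have "(u4 \<longlongrightarrow> (2 * y) *\<^sub>R 1 * inverse 1 * 1) ?F" unfolding u4_def by (intro tendsto_intros lim k) auto
    ultimately show "(u1 \<longlongrightarrow> (2 * y) *\<^sub>R 1) ?F" "(u2 \<longlongrightarrow> (2 * y) *\<^sub>R 1) ?F"
      "(u3 \<longlongrightarrow> (2 * y) *\<^sub>R 1) ?F" "(u4 \<longlongrightarrow> (2 * y) *\<^sub>R 1) ?F"
      using k by (simp_all add: u3_def)
  qed
  have conj_lim: "((\<lambda>P. v P * X * inverse (v P)) \<longlongrightarrow> X) ?F" if "(v \<longlongrightarrow> (2 * y) *\<^sub>R 1) ?F" for v :: "qmat \<Rightarrow> quat" and X
  proof -
    have "((\<lambda>P. v P * X * inverse (v P)) \<longlongrightarrow> (2 * y) *\<^sub>R 1 * X * inverse ((2 * y) *\<^sub>R 1)) ?F"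
      by (rule tendsto_mult[OF tendsto_mult[OF that tendsto_const] tendsto_inverse[OF that y0]])
    moreover have "(2 * y) *\<^sub>R 1 * X * inverse ((2 * y) *\<^sub>R 1) = X"
      using w(2) by (simp add: nonzero_inverse_scaleR_distrib)
    ultimately show ?thesis by (simp only:)
  qed
  have keep: "\<forall>\<^sub>F P in ?F. v P * X * inverse (v P) \<notin> {quat_i, - quat_i}"
    if "(v \<longlongrightarrow> (2 * y) *\<^sub>R 1) ?F" "X \<notin> {quat_i, - quat_i}" for v :: "qmat \<Rightarrow> quat" and X
  proof -
    have "open (- {quat_i, - quat_i})" by (intro open_Compl finite_imp_closed) simp
    from topological_tendstoD[OF conj_lim[OF that(1), of X] this] show ?thesis using that(2) by simp
  qed
  have not_i': "\<forall>\<^sub>F P in ?F. \<not> {u1 P * I * inverse (u1 P), u2 P * J * inverse (u2 P), u3 P * K * inverse (u3 P), u4 P * L * inverse (u4 P)} \<subseteq> {quat_i, - quat_i}"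
  proof -
    consider "I \<notin> {quat_i, - quat_i}" | "J \<notin> {quat_i, - quat_i}" | "K \<notin> {quat_i, - quat_i}" | "L \<notin> {quat_i, - quat_i}"
      using not_i by blast
    then show ?thesis
    proof cases
      case 1 show ?thesis using keep[OF u(1) 1] by (rule eventually_mono) blast
    next
      case 2 show ?thesis using keep[OF u(2) 2] by (rule eventually_mono) blast
    next
      case 3 show ?thesis using keep[OF u(3) 3] by (rule eventually_mono) blast
    next
      case 4 show ?thesis using keep[OF u(4) 4] by (rule eventually_mono) blast
    qed
  qed
  have "\<forall>\<^sub>F P in ?F. imag_part (W P) \<noteq> 0" using im_w w(2) by (intro tendsto_imp_eventually_ne[OF imW]) (auto simp: quat_i_def quat_defs)
  moreover have "\<forall>\<^sub>F P in ?F. a P \<noteq> 0" "\<forall>\<^sub>F P in ?F. c P \<noteq> 0" "\<forall>\<^sub>F P in ?F. d P \<noteq> 0"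
    using lim by (auto intro: tendsto_imp_eventually_ne)
  moreover have "\<forall>\<^sub>F P in ?F. k P \<noteq> 0" using k y0 by (rule tendsto_imp_eventually_ne)
  ultimately show ?thesis using not_i'
  proof eventually_elim
    case (elim P)
    define x' y' where "x' = qre (W P)" and "y' = norm (imag_part (W P))"
    have y': "0 < y'" using elim(1) by (simp add: y'_def)
    define w' where "w' = of_real x' + y' *\<^sub>R quat_i"
    have kW: "k P * W P * inverse (k P) = w'"
      using straighten[of "W P"] elim(5) by (simp add: k_def w'_def x'_def y'_def)
    have u0: "u1 P \<noteq> 0" "u2 P \<noteq> 0" "u3 P \<noteq> 0" "u4 P \<noteq> 0"
      using elim by (simp_all add: u1_def u2_def u3_def u4_def)
    let ?X = "mat2 (u1 P) 0 0 (u2 P)" and ?E = "mat2 (u3 P) 0 0 (u4 P)" and ?N = "mat2 1 w' 1 1"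
    have "qim1 w' \<noteq> qim1 1" using y' by (simp add: w'_def quat_i_def of_real_def quat_defs)
    then have w'1: "w' \<noteq> 1" by auto
    have inv: "invertible ?X" "invertible ?E" "invertible ?N"
      using u0 invertible_elementary(4) invertible_normal_conjugator[OF w'1] by auto
    have "?X ** P = ?N ** ?E"
    proof -
      have P: "P = mat2 (a P) (b P) (c P) (d P)" by (simp add: a_def b_def c_def d_def mat2_eta)
      have "w' * u4 P = u1 P * b P"
        unfolding kW[symmetric] W_def u4_def u1_def using elim by (simp add: mult.assoc quat_inverse_cancel)
      moreover have "u2 P * d P = u4 P" "u1 P * a P = u3 P" "u2 P * c P = u3 P"
        using elim by (simp_all add: u1_def u2_def u3_def u4_def mult.assoc)
      ultimately show ?thesis by (subst P) (simp add: mat2_mult)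
    qed
    then have XP: "P = matrix_inv ?X ** (?N ** ?E)"
      using inv(1) by (metis matrix_inv_inverse(2) matrix_mul_assoc matrix_mul_lid)
    let ?q = "(diagonal_form r (u1 P * I * inverse (u1 P)) \<theta> (u2 P * J * inverse (u2 P)) \<phi>,
      conj_by ?N (diagonal_form s (u3 P * K * inverse (u3 P)) \<theta>' (u4 P * L * inverse (u4 P)) \<phi>'))"
    have "(diagonal_form r I \<theta> J \<phi>, conj_by P (diagonal_form s K \<theta>' L \<phi>')) = conj_pair (matrix_inv ?X) ?q"
    proof -
      have "conj_by (matrix_inv ?X) (conj_by ?N (conj_by ?E (diagonal_form s K \<theta>' L \<phi>'))) =
          conj_by (matrix_inv ?X ** (?N ** ?E)) (diagonal_form s K \<theta>' L \<phi>')"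
        using inv by (simp only: conj_by_conj_by invertible_matrix_inv invertible_qmat_mult)
      moreover have "conj_by (matrix_inv ?X) (conj_by ?X (diagonal_form r I \<theta> J \<phi>)) = diagonal_form r I \<theta> J \<phi>"
        by (rule conj_by_inverse[OF inv(1)])
      ultimately show ?thesis
        unfolding conj_pair_def fst_conv snd_conv XP[symmetric]
        unfolding conj_by_diagonal[OF u0(1,2)] conj_by_diagonal[OF u0(3,4)] by simp
    qed
    then have "(diagonal_form r I \<theta> J \<phi>, conj_by P (diagonal_form s K \<theta>' L \<phi>')) \<in> pair_class ?q"
      using invertible_matrix_inv[OF inv(1)] by (auto simp: pair_class_iff)
    moreover have "?q \<in> normal_form_pairs"
      unfolding normal_form_pairs_iff
    proof (intro exI conjI)
      show "?q = (diagonal_form r (u1 P * I * inverse (u1 P)) \<theta> (u2 P * J * inverse (u2 P)) \<phi>,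
        conj_by (mat2 1 (of_real x' + y' *\<^sub>R quat_i) 1 1) (diagonal_form s (u3 P * K * inverse (u3 P)) \<theta>' (u4 P * L * inverse (u4 P)) \<phi>'))"
        by (simp add: w'_def)
      show "{u1 P * I * inverse (u1 P), u2 P * J * inverse (u2 P), u3 P * K * inverse (u3 P), u4 P * L * inverse (u4 P)} \<subseteq> imag_units"
        using units u0 by (auto intro: imag_units_conj)
    qed (fact r angles elim y')+
    ultimately show ?case by blast
  qed
qed

text \<open>
  The eigenlines of the two components are \<open>0, \<infinity>\<close> and \<open>w, 1\<close> as points of the projective line, and
  \<open>w\<close> is neither \<open>0\<close> nor \<open>1\<close>.
\<close>

lemma normal_form_pairs_regular:
  assumes "q \<in> normal_form_pairs"
  shows "regular_loxodromic_pair q"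
proof -
  obtain r s \<theta> \<phi> \<theta>' \<phi>' I J K L x y where
    q: "q = (diagonal_form r I \<theta> J \<phi>, conj_by (mat2 1 (of_real x + y *\<^sub>R quat_i) 1 1) (diagonal_form s K \<theta>' L \<phi>'))"
    and y: "y > 0" and *: "r > 1" "s > 1" "{\<theta>, \<phi>, \<theta>', \<phi>'} \<subseteq> {0<..<pi}" "{I, J, K, L} \<subseteq> imag_units"
    using assms unfolding normal_form_pairs_iff by (elim exE conjE)
  define w where "w = of_real x + y *\<^sub>R quat_i"
  have "qim1 w = y" by (simp add: w_def quat_i_def of_real_def quat_defs)
  then have w: "w \<noteq> 1" "w \<noteq> 0" using y by (auto simp: one_quat_def zero_quat_def)
  let ?P = "mat2 1 w 1 1"
  have P: "invertible ?P" by (rule invertible_normal_conjugator[OF w(1)])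
  have lox: "regular_loxodromic (diagonal_form r I \<theta> J \<phi>)" "loxodromic_diagonal (r *\<^sub>R quat_cis I \<theta>) (inverse r *\<^sub>R quat_cis J \<phi>)"
    if "r > 1" "\<theta> \<in> {0<..<pi}" "\<phi> \<in> {0<..<pi}" "I \<in> imag_units" "J \<in> imag_units" for r \<theta> \<phi> I J
  proof -
    show l: "loxodromic_diagonal (r *\<^sub>R quat_cis I \<theta>) (inverse r *\<^sub>R quat_cis J \<phi>)" by (rule loxodromic_diagonal_cis[OF that])
    show "regular_loxodromic (diagonal_form r I \<theta> J \<phi>)"
      unfolding regular_loxodromic_def diagonal_form_def
      using that loxodromic_diagonal_in_SL2H[OF l] conj_class_refl by blast
  qed
  have eigen: "fst v = 0 \<or> snd v = 0" if l: "loxodromic_diagonal \<nu> \<mu>" and a: "act (mat2 \<nu> 0 0 \<mu>) v = scale_right v \<kappa>" for \<nu> \<mu> v \<kappa>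
  proof (rule ccontr)
    assume "\<not> ?thesis"
    then have v: "fst v \<noteq> 0" "snd v \<noteq> 0" by auto
    have "\<nu> * fst v = fst v * \<kappa>" "\<mu> * snd v = snd v * \<kappa>" using a by (simp_all add: act_def scale_right_def)
    then have "norm (\<nu> * fst v) = norm (fst v * \<kappa>)" "norm (\<mu> * snd v) = norm (snd v * \<kappa>)" by simp_all
    then have n: "norm \<nu> = norm \<kappa>" "norm \<mu> = norm \<kappa>" using v by (simp_all add: norm_mult)
    have "1 < norm \<nu>" "norm \<mu> = inverse (norm \<nu>)" using l by (simp_all add: loxodromic_diagonal_def)
    moreover from this have "inverse (norm \<nu>) < 1" by (simp add: inverse_less_1_iff)
    ultimately show False using n by simp
  qed
  have "\<not> common_eigenvector q"
  proof
    assume "common_eigenvector q"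
    then obtain v \<kappa> \<kappa>' where v: "v \<noteq> 0" "act (diagonal_form r I \<theta> J \<phi>) v = scale_right v \<kappa>"
      "act (conj_by ?P (diagonal_form s K \<theta>' L \<phi>')) v = scale_right v \<kappa>'"
      by (auto simp: common_eigenvector_def q w_def)
    have 1: "fst v = 0 \<or> snd v = 0"
      by (rule eigen[OF lox(2) v(2)[unfolded diagonal_form_def]]) (use * in auto)
    define u where "u = act (matrix_inv ?P) v"
    have Pu: "v = act ?P u" by (simp add: u_def matrix_inv_inverse P act_1 flip: act_mult)
    have "act (conj_by ?P (diagonal_form s K \<theta>' L \<phi>')) v = act ?P (act (diagonal_form s K \<theta>' L \<phi>') u)"
      unfolding conj_by_def u_def act_mult ..
    then have "act ?P (act (diagonal_form s K \<theta>' L \<phi>') u) = act ?P (scale_right u \<kappa>')"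
      using v(3) Pu by (simp add: act_scale)
    then have "act (matrix_inv ?P) (act ?P (act (diagonal_form s K \<theta>' L \<phi>') u)) = act (matrix_inv ?P) (act ?P (scale_right u \<kappa>'))"
      by simp
    moreover have "act (matrix_inv ?P) (act ?P z) = z" for z
      by (simp add: matrix_inv_inverse P act_1 flip: act_mult)
    ultimately have "act (diagonal_form s K \<theta>' L \<phi>') u = scale_right u \<kappa>'" by simp
    then have 2: "fst u = 0 \<or> snd u = 0"
      by (intro eigen[OF lox(2)]) (use * in \<open>auto simp: diagonal_form_def\<close>)
    have "fst v = fst u + w * snd u" "snd v = fst u + snd u" by (simp_all add: Pu act_def)
    then have "u = 0" using 1 2 w by (auto simp: prod_eq_iff)
    then have "v = 0" by (simp add: Pu act_def zero_prod_def)
    then show False using v(1) by simp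
  qed
  then show ?thesis
    unfolding regular_loxodromic_pair_iff q fst_conv snd_conv w_def[symmetric]
    using * by (auto intro!: regular_loxodromic_conj P lox)
qed

lemma Union_M_reg_iff: "p \<in> \<Union>M_reg \<longleftrightarrow> (\<exists>q\<in>normal_form_pairs. p \<in> pair_class q)"
proof
  assume "p \<in> \<Union>M_reg"
  then obtain p' q where "p \<in> pair_class p'" "q \<in> normal_form_pairs" "p' \<in> pair_class q"
    by (auto simp: M_reg_def)
  then show "\<exists>q\<in>normal_form_pairs. p \<in> pair_class q" using pair_class_trans by blast
next
  assume "\<exists>q\<in>normal_form_pairs. p \<in> pair_class q"
  then obtain q where q: "q \<in> normal_form_pairs" "p \<in> pair_class q" by blast
  then obtain P where "invertible P" "p = conj_pair P q" unfolding pair_class_iff by blast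
  then have "regular_loxodromic_pair p"
    using regular_loxodromic_pair_conj[OF _ normal_form_pairs_regular[OF q(1)]] by simp
  then have "pair_class p \<in> M_reg" using q by (auto simp: M_reg_def)
  then show "p \<in> \<Union>M_reg" using pair_class_refl by blast
qed

lemma Union_M_reg_regular:
  assumes "p \<in> \<Union>M_reg"
  shows "regular_loxodromic_pair p"
proof -
  obtain q where q: "q \<in> normal_form_pairs" "p \<in> pair_class q" using assms unfolding Union_M_reg_iff by blast
  then obtain P where "invertible P" "p = conj_pair P q" unfolding pair_class_iff by blast
  then show ?thesis using regular_loxodromic_pair_conj[OF _ normal_form_pairs_regular[OF q(1)]] by simp
qed

lemma M_reg_class:
  assumes "C \<in> M_reg" "p \<in> C"
  shows "C = pair_class p"
proof -
  obtain p' where "C = pair_class p'" using assms(1) unfolding M_reg_def by blast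
  then show ?thesis using assms(2) pair_class_eqI by blast
qed

lemma isCont_matrix_inv: "invertible (M :: qmat) \<Longrightarrow> isCont matrix_inv M"
  using matrix_inv_analytic_near[of M] analytic_at_point_differentiable[of matrix_inv M] has_derivative_continuous by blast

lemma tendsto_qmat_mult:
  "(f \<longlongrightarrow> (a :: qmat)) F \<Longrightarrow> (g \<longlongrightarrow> (b :: qmat)) F \<Longrightarrow> ((\<lambda>x. f x ** g x) \<longlongrightarrow> a ** b) F"
  by (rule bounded_bilinear.tendsto[OF bounded_bilinear_qmat_mult])

text \<open>
  The components of a nearby \<open>p'\<close> are conjugate to those of \<open>p\<close> by matrices near \<open>1\<close>. So \<open>p'\<close> is conjugate
  to the pair of the same diagonal matrices with a slightly different relative conjugator, which again has a normal form.
\<close>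

theorem Union_M_reg_locally_closed_under_conjugation:
  assumes "p \<in> \<Union>M_reg"
  shows "\<forall>\<^sub>F p' in nhds p. fst p' \<in> conj_class (fst p) \<longrightarrow> snd p' \<in> conj_class (snd p) \<longrightarrow> p' \<in> \<Union>M_reg"
proof -
  obtain q where qn: "q \<in> normal_form_pairs" and qp: "p \<in> pair_class q" using assms unfolding Union_M_reg_iff by blast
  obtain g where g: "invertible g" and pg: "p = conj_pair g q" using qp unfolding pair_class_iff by blast
  from qn obtain r s \<theta> \<phi> \<theta>' \<phi>' I J K L x y where
    q: "q = (diagonal_form r I \<theta> J \<phi>, conj_by (mat2 1 (of_real x + y *\<^sub>R quat_i) 1 1) (diagonal_form s K \<theta>' L \<phi>'))"
    and y: "y > 0" and *: "r > 1" "s > 1" "{\<theta>, \<phi>, \<theta>', \<phi>'} \<subseteq> {0<..<pi}" "{I, J, K, L} \<subseteq> imag_units"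
      "\<not> {I, J, K, L} \<subseteq> {quat_i, - quat_i}"
    unfolding normal_form_pairs_iff by (elim exE conjE)
  have p: "p = conj_pair g (diagonal_form r I \<theta> J \<phi>, conj_by (mat2 1 (of_real x + y *\<^sub>R quat_i) 1 1) (diagonal_form s K \<theta>' L \<phi>'))"
    using pg unfolding q .
  define w where "w = of_real x + y *\<^sub>R quat_i"
  define P0 where "P0 = mat2 1 w 1 1"
  define D1 D2 where "D1 = diagonal_form r I \<theta> J \<phi>" and "D2 = diagonal_form s K \<theta>' L \<phi>'"
  have "qim1 w = y" by (simp add: w_def quat_i_def of_real_def quat_defs)
  then have "w \<noteq> 1" using y by (auto simp: one_quat_def)
  then have P0: "invertible P0" unfolding P0_def by (rule invertible_normal_conjugator)
  have p1: "fst p = conj_by g D1" and p2: "snd p = conj_by (g ** P0) D2"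
    unfolding p by (simp_all add: conj_pair_def conj_by_conj_by g P0 D1_def D2_def flip: P0_def w_def)
  have E: "\<forall>\<^sub>F P in nhds P0. \<exists>q\<in>normal_form_pairs. (D1, conj_by P D2) \<in> pair_class q"
    unfolding P0_def D1_def D2_def by (rule normal_form_pairs_local[OF w_def y *])
  have "regular_loxodromic_pair p" using assms by (rule Union_M_reg_regular)
  then have lox: "regular_loxodromic (fst p)" "regular_loxodromic (snd p)" by (simp_all add: regular_loxodromic_pair_def)
  then have sl: "fst p \<in> SL2H" "snd p \<in> SL2H" by (simp_all add: regular_loxodromic_def)
  obtain GA where GA: "continuous_on UNIV GA" "GA (fst p) = mat 1"
    "\<And>M. M \<in> SL2H \<Longrightarrow> class_invariants M = class_invariants (fst p) \<Longrightarrow> M ** GA M = GA M ** fst p"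
    using local_conjugator[OF lox(1)] by blast
  obtain GB where GB: "continuous_on UNIV GB" "GB (snd p) = mat 1"
    "\<And>M. M \<in> SL2H \<Longrightarrow> class_invariants M = class_invariants (snd p) \<Longrightarrow> M ** GB M = GB M ** snd p"
    using local_conjugator[OF lox(2)] by blast
  have cont: "isCont GA (fst p)" "isCont GB (snd p)" using GA(1) GB(1) by (simp_all add: continuous_on_eq_continuous_at)
  have id: "((\<lambda>p'. p') \<longlongrightarrow> p) (nhds p)" by (rule filterlim_ident)
  have a: "((\<lambda>p'. GA (fst p')) \<longlongrightarrow> mat 1) (nhds p)"
    using isCont_tendsto_compose[OF cont(1) tendsto_fst[OF id]] GA(2) by simp
  have b: "((\<lambda>p'. GB (snd p')) \<longlongrightarrow> mat 1) (nhds p)"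
    using isCont_tendsto_compose[OF cont(2) tendsto_snd[OF id]] GB(2) by simp
  have I1: "invertible (mat 1 :: qmat)" by (rule invertible_qmatI[of _ "mat 1"]) simp_all
  have inv1: "matrix_inv (mat 1 :: qmat) = mat 1" by (rule matrix_inv_eqI) simp_all
  (* If GA and GB conjugate the components of p to those of p', this is the relative conjugator of p'. *)
  define Q where "Q = (\<lambda>p'. matrix_inv g ** matrix_inv (GA (fst p')) ** GB (snd p') ** g ** P0)"
  have "(Q \<longlongrightarrow> matrix_inv g ** matrix_inv (mat 1) ** mat 1 ** g ** P0) (nhds p)"
    unfolding Q_def by (intro tendsto_qmat_mult tendsto_const b isCont_tendsto_compose[OF isCont_matrix_inv[OF I1] a])
  then have Q: "(Q \<longlongrightarrow> P0) (nhds p)" using g by (simp add: inv1 matrix_inv_inverse)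
  have "\<forall>\<^sub>F p' in nhds p. \<exists>q\<in>normal_form_pairs. (D1, conj_by (Q p') D2) \<in> pair_class q"
    using filterlim_iff[THEN iffD1, OF Q] E by blast
  moreover have "\<forall>\<^sub>F p' in nhds p. GA (fst p') \<in> {M. invertible M}" "\<forall>\<^sub>F p' in nhds p. GB (snd p') \<in> {M. invertible M}"
    using topological_tendstoD[OF a open_invertible] topological_tendstoD[OF b open_invertible] I1 by simp_all
  ultimately show ?thesis
  proof eventually_elim
    case (elim p')
    show ?case
    proof (intro impI)
      assume c: "fst p' \<in> conj_class (fst p)" "snd p' \<in> conj_class (snd p)"
      let ?a = "GA (fst p')" and ?b = "GB (snd p')"
      have inv: "invertible ?a" "invertible ?b" using elim by simp_all
      have sl': "fst p' \<in> SL2H" "snd p' \<in> SL2H" using c sl SL2H_conj by (auto simp: conj_class_iff)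
      have "class_invariants (fst p') = class_invariants (fst p)" "class_invariants (snd p') = class_invariants (snd p)"
        using c sl class_invariants_conj SL2H_invertible by (auto simp: conj_class_iff)
      then have e: "fst p' ** ?a = ?a ** fst p" "snd p' ** ?b = ?b ** snd p"
        using GA(3)[OF sl'(1)] GB(3)[OF sl'(2)] by auto
      then have "conj_by ?a (fst p) = fst p'" "conj_by ?b (snd p) = snd p'"
        using conj_by_eq_iff[OF inv(1)] conj_by_eq_iff[OF inv(2)] by simp_all
      then have f: "fst p' = conj_by (?a ** g) D1" "snd p' = conj_by (?b ** g ** P0) D2"
        using inv g P0 by (simp_all add: p1 p2 conj_by_conj_by invertible_qmat_mult matrix_mul_assoc)
      have "?a ** g ** Q p' = ?a ** (g ** matrix_inv g) ** matrix_inv ?a ** ?b ** g ** P0"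
        by (simp only: Q_def matrix_mul_assoc)
      then have aQ: "?a ** g ** Q p' = ?b ** g ** P0" using inv g by (simp add: matrix_inv_inverse)
      have "invertible (Q p')" unfolding Q_def using inv g P0 by (intro invertible_qmat_mult invertible_matrix_inv)
      then have "conj_by (?a ** g) (conj_by (Q p') D2) = conj_by (?b ** g ** P0) D2"
        using inv g by (simp only: conj_by_conj_by invertible_qmat_mult aQ)
      from trans[OF f(2) this[symmetric]] f(1) have "p' = conj_pair (?a ** g) (D1, conj_by (Q p') D2)"
        unfolding conj_pair_def fst_conv snd_conv by (intro prod_eqI) (simp only: fst_conv snd_conv)+
      moreover have "invertible (?a ** g)" using inv g by (intro invertible_qmat_mult)
      ultimately have "p' \<in> pair_class (D1, conj_by (Q p') D2)" unfolding pair_class_iff by blast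
      moreover obtain q' where "q' \<in> normal_form_pairs" "(D1, conj_by (Q p') D2) \<in> pair_class q'"
        using elim(1) by blast
      ultimately have "\<exists>q\<in>normal_form_pairs. p' \<in> pair_class q"
        by (intro bexI[of _ q'] pair_class_trans[of "(D1, conj_by (Q p') D2)" q' p'])
      then show "p' \<in> \<Union>M_reg" by (simp only: Union_M_reg_iff)
    qed
  qed
qed

section \<open>Analytic charts and sections of quotients\<close>

text \<open>
  The map \<open>\<phi>\<close> extends analytically to the ambient space, as \<open>\<omega>\<close>, and its inverse lifts analytically to points, as \<open>\<kappa>\<close>. The
  preimages under \<open>\<omega>\<close> and \<open>\<kappa>\<close> identify the open sets on both sides, and composition with \<open>\<omega>\<close> and
  \<open>\<kappa>\<close> identifies the analytic functions.
\<close>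

theorem analytic_chart_from_section:
  fixes X :: "'a::euclidean_space set set" and \<phi> :: "'a set \<Rightarrow> 'n::euclidean_space"
  assumes op: "quotient_open X U" and \<Omega>: "open \<Omega>" "\<Union>U \<subseteq> \<Omega>" and an: "real_analytic_on \<omega> \<Omega>"
    and \<omega>: "\<And>C p. C \<in> U \<Longrightarrow> p \<in> C \<Longrightarrow> \<omega> p = \<phi> C"
    and inj: "inj_on \<phi> U" and im: "open (\<phi> ` U)" and \<kappa>: "real_analytic_on \<kappa> (\<phi> ` U)"
    and sec: "\<And>c. c \<in> \<phi> ` U \<Longrightarrow> \<kappa> c \<in> \<Union>U \<and> \<omega> (\<kappa> c) = c"
  shows "analytic_chart X U \<phi>"
proof -
  have \<omega>_cont: "continuous_on \<Omega> \<omega>" and \<kappa>_cont: "continuous_on (\<phi> ` U) \<kappa>"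
    using an \<kappa> by (simp_all add: real_analytic_on_imp_continuous_on)
  obtain T0 where T0: "open T0" "\<Union>U = \<Union>X \<inter> T0" using op by (auto simp: quotient_open_def openin_open)
  have sec_class: "C' = C" if C: "C \<in> U" "C' \<in> U" and m: "\<kappa> (\<phi> C) \<in> C'" for C C'
  proof -
    have "\<phi> C' = \<phi> C" using \<omega>[OF C(2) m] sec[of "\<phi> C"] C(1) by auto
    then show ?thesis using inj_onD[OF inj _ C(2,1)] by simp
  qed
  have in_W: "\<kappa> c \<in> \<Union>W \<longleftrightarrow> c \<in> \<phi> ` W" if WU: "W \<subseteq> U" and cU: "c \<in> \<phi> ` U" for W c
  proof
    assume "\<kappa> c \<in> \<Union>W"
    then obtain C where C: "C \<in> W" "\<kappa> c \<in> C" by blast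
    then have "\<phi> C = c" using \<omega>[of C "\<kappa> c"] sec[OF cU] WU by auto
    then show "c \<in> \<phi> ` W" using C(1) by blast
  next
    assume "c \<in> \<phi> ` W"
    then obtain C where C: "C \<in> W" "c = \<phi> C" by blast
    obtain C' where C': "C' \<in> U" "\<kappa> c \<in> C'" using sec[OF cU] by blast
    then have "C' = C" using sec_class[of C C'] C WU by auto
    then show "\<kappa> c \<in> \<Union>W" using C C' by blast
  qed
  have mem: "p \<in> \<Union>W \<longleftrightarrow> p \<in> \<Union>U \<and> \<omega> p \<in> \<phi> ` W" if "W \<subseteq> U" for W p
  proof
    assume "p \<in> \<Union>U \<and> \<omega> p \<in> \<phi> ` W"
    then obtain C C' where C: "C \<in> U" "p \<in> C" "C' \<in> W" "\<omega> p = \<phi> C'" by blast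
    then have "C = C'" using \<omega>[of C p] inj_onD[OF inj, of C C'] that by auto
    then show "p \<in> \<Union>W" using C by blast
  next
    assume "p \<in> \<Union>W"
    then obtain C where "C \<in> W" "p \<in> C" by blast
    then show "p \<in> \<Union>U \<and> \<omega> p \<in> \<phi> ` W" using \<omega>[of C p] that by auto
  qed
  have top: "quotient_open X W \<longleftrightarrow> open (\<phi> ` W)" if W: "W \<subseteq> U" for W
  proof
    assume "quotient_open X W"
    then obtain T where T: "open T" "\<Union>W = \<Union>X \<inter> T" by (auto simp: quotient_open_def openin_open)
    have "\<phi> ` W = \<phi> ` U \<inter> \<kappa> -` T"
    proof (intro equalityI subsetI)
      fix c assume c: "c \<in> \<phi> ` W"
      then have "c \<in> \<phi> ` U" using W by blast
      moreover from this c have "\<kappa> c \<in> \<Union>W" using in_W[OF W] by simp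
      ultimately show "c \<in> \<phi> ` U \<inter> \<kappa> -` T" using T(2) by blast
    next
      fix c assume c: "c \<in> \<phi> ` U \<inter> \<kappa> -` T"
      then have "\<kappa> c \<in> \<Union>X" using sec[of c] T0(2) by blast
      then have "\<kappa> c \<in> \<Union>W" using c T(2) by blast
      then show "c \<in> \<phi> ` W" using in_W[OF W] c by blast
    qed
    then show "open (\<phi> ` W)" using continuous_open_preimage[OF \<kappa>_cont im T(1)] by simp
  next
    assume o: "open (\<phi> ` W)"
    have o1: "open (\<Omega> \<inter> \<omega> -` (\<phi> ` W))" by (rule continuous_open_preimage[OF \<omega>_cont \<Omega>(1) o])
    have eqW: "\<Union>W = \<Union>X \<inter> (T0 \<inter> (\<Omega> \<inter> \<omega> -` (\<phi> ` W)))"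
    proof (intro equalityI subsetI)
      fix p assume "p \<in> \<Union>W"
      then have "p \<in> \<Union>U" "\<omega> p \<in> \<phi> ` W" using mem[OF W, of p] by simp_all
      then show "p \<in> \<Union>X \<inter> (T0 \<inter> (\<Omega> \<inter> \<omega> -` (\<phi> ` W)))" using T0(2) \<Omega>(2) by blast
    next
      fix p assume p: "p \<in> \<Union>X \<inter> (T0 \<inter> (\<Omega> \<inter> \<omega> -` (\<phi> ` W)))"
      then have "p \<in> \<Union>U" using T0(2) by blast
      then show "p \<in> \<Union>W" using mem[OF W, of p] p by blast
    qed
    have "openin (top_of_set (\<Union>X)) (\<Union>W)"
      unfolding eqW by (rule openin_open_Int[OF open_Int[OF T0(1) o1]])
    then show "quotient_open X W" using W op by (auto simp: quotient_open_def)
  qed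
  have an_iff: "quotient_analytic_on (h \<circ> \<phi>) W \<longleftrightarrow> real_analytic_on h (\<phi> ` W)"
    if W: "W \<subseteq> U" and o: "open (\<phi> ` W)" for W and h :: "'n \<Rightarrow> real"
  proof
    assume q: "quotient_analytic_on (h \<circ> \<phi>) W"
    show "real_analytic_on h (\<phi> ` W)"
      unfolding real_analytic_on_iff
    proof
      fix c assume c: "c \<in> \<phi> ` W"
      then have cU: "c \<in> \<phi> ` U" using W by blast
      then have "\<kappa> c \<in> \<Union>W" using in_W[OF W] c by simp
      from bspec[OF q[unfolded quotient_analytic_on_def] this]
      obtain T g where T: "open T" "\<kappa> c \<in> T" "real_analytic_on g T"
        and g: "\<forall>C\<in>W. \<forall>q\<in>C \<inter> T. g q = (h \<circ> \<phi>) C" by (elim exE conjE)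
      have "open (\<phi> ` W \<inter> \<kappa> -` T)"
        using W by (intro continuous_open_preimage continuous_on_subset[OF \<kappa>_cont] o T) auto
      moreover have "analytic_at_point (\<lambda>c. g (\<kappa> c)) c"
      proof (rule analytic_at_point_compose[where f = g and g = \<kappa>])
        show "analytic_at_point g (\<kappa> c)"
          by (rule bspec[OF T(3)[unfolded real_analytic_on_iff] T(2)])
        show "analytic_at_point \<kappa> c"
          by (rule bspec[OF \<kappa>[unfolded real_analytic_on_iff] cU])
      qed
      moreover have "g (\<kappa> c') = h c'" if "c' \<in> \<phi> ` W \<inter> \<kappa> -` T" for c'
      proof -
        have c'U: "c' \<in> \<phi> ` U" using that W by blast
        then have "\<kappa> c' \<in> \<Union>W" using in_W[OF W] that by simp
        then obtain C where C: "C \<in> W" "\<kappa> c' \<in> C" by blast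
        then have "\<phi> C = c'" using \<omega>[of C "\<kappa> c'"] sec[OF c'U] W by auto
        then show ?thesis using bspec[OF bspec[OF g C(1)], of "\<kappa> c'"] C that by simp
      qed
      ultimately show "analytic_at_point h c"
        using c T(2) by - (rule analytic_at_point_cong[of "\<lambda>c. g (\<kappa> c)" c "\<phi> ` W \<inter> \<kappa> -` T" h], assumption, assumption, simp, blast)
    qed
  next
    assume h: "real_analytic_on h (\<phi> ` W)"
    show "quotient_analytic_on (h \<circ> \<phi>) W"
      unfolding quotient_analytic_on_def
    proof
      fix p assume p: "p \<in> \<Union>W"
      define T where "T = \<Omega> \<inter> \<omega> -` (\<phi> ` W)"
      have "open T" unfolding T_def by (rule continuous_open_preimage[OF \<omega>_cont \<Omega>(1) o])
      moreover have "p \<in> T" using mem[OF W, of p] p \<Omega>(2) by (auto simp: T_def)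
      moreover have "real_analytic_on (\<lambda>p. h (\<omega> p)) T"
        unfolding real_analytic_on_iff
      proof
        fix p' assume "p' \<in> T"
        then show "analytic_at_point (\<lambda>p. h (\<omega> p)) p'"
          using an h unfolding T_def real_analytic_on_iff
          by - (rule analytic_at_point_compose[where f = h and g = \<omega>], blast+)
      qed
      moreover have "h (\<omega> q) = (h \<circ> \<phi>) C" if "C \<in> W" "q \<in> C \<inter> T" for C q
        using \<omega>[of C q] that W by auto
      ultimately show "\<exists>T g. open T \<and> p \<in> T \<and> real_analytic_on g T \<and> (\<forall>C\<in>W. \<forall>q\<in>C \<inter> T. g q = (h \<circ> \<phi>) C)"
        by (intro exI[of _ T] exI[of _ "\<lambda>p. h (\<omega> p)"] conjI ballI)
    qed
  qed
  show ?thesis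
    unfolding analytic_chart_def
  proof (intro conjI allI impI op inj im)
    fix W assume W: "W \<subseteq> U"
    show "quotient_open X W = open (\<phi> ` W)" by (rule top[OF W])
    fix h :: "'n \<Rightarrow> real" assume "quotient_open X W"
    then show "quotient_analytic_on (h \<circ> \<phi>) W = real_analytic_on h (\<phi> ` W)"
      using top[OF W] by (intro an_iff[OF W]) simp
  qed
qed

text \<open>
  The map \<open>n\<close> of the slice is constant on classes, so in the given chart it is an analytic section. The traces of
  this section are the coordinate expression of the trace map, which has an invertible derivative; composing with its
  local inverse parametrizes the section by trace vectors.
\<close>

theorem trace_locus_section:
  assumes locus: "pair_class p0 \<in> trace_locus"
    and scalar: "\<And>X. X ** fst p0 = fst p0 ** X \<Longrightarrow> X ** snd p0 = snd p0 ** X \<Longrightarrow> \<exists>c. X = c *\<^sub>R mat 1"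
    and W: "open W" "p0 \<in> W"
  shows "\<exists>V \<sigma> U. open V \<and> word_traces p0 \<in> V \<and> real_analytic_on \<sigma> V \<and> quotient_open M_reg U \<and> pair_class p0 \<in> U \<and>
    inj_on trace_coords U \<and> trace_coords ` U = V \<and> (\<forall>C\<in>U. C \<inter> W \<noteq> {} \<and> \<sigma> (trace_coords C) \<in> C)"
proof -
  obtain U0 and \<phi> :: "(qmat \<times> qmat) set \<Rightarrow> real^15" and D where
    M: "pair_class p0 \<in> M_reg" and U0: "pair_class p0 \<in> U0" and ch: "analytic_chart M_reg U0 \<phi>"
    and D: "((trace_coords \<circ> inv_into U0 \<phi>) has_derivative D) (at (\<phi> (pair_class p0)))" "bij D"
    using locus unfolding trace_locus_def by blast
  note ch' = ch[unfolded analytic_chart_def]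
  have U0_open: "quotient_open M_reg U0" by (rule conjunct1[OF ch'])
  have inj: "inj_on \<phi> U0" by (rule conjunct1[OF conjunct2[OF ch']])
  have U0_sub: "U0 \<subseteq> M_reg" using U0_open by (simp add: quotient_open_def)
  have top: "quotient_open M_reg W \<longleftrightarrow> open (\<phi> ` W)" if "W \<subseteq> U0" for W
    using ch' that by blast
  have an_iff: "quotient_analytic_on (h \<circ> \<phi>) W \<longleftrightarrow> real_analytic_on h (\<phi> ` W)"
    if "W \<subseteq> U0" "quotient_open M_reg W" for W and h :: "real^15 \<Rightarrow> real"
    using ch' that by blast
  obtain N n where N: "open N" "p0 \<in> N" "N \<subseteq> W" and n_an: "real_analytic_on n N"
    and n_class: "\<And>p. p \<in> N \<Longrightarrow> n p \<in> pair_class p"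
    and n_inv: "\<And>p p'. p \<in> N \<Longrightarrow> p' \<in> N \<Longrightarrow> p' \<in> pair_class p \<Longrightarrow> n p' = n p"
    using analytic_slice[OF scalar W] by blast
  define U1 where "U1 = {C \<in> U0. C \<inter> N \<noteq> {}}"
  (* n is constant on the part of a class that lies in N, so the choice is immaterial. *)
  define nn where "nn = (\<lambda>C. n (SOME p. p \<in> C \<inter> N))"
  have nn: "nn C = n p" if "C \<in> M_reg" "p \<in> C \<inter> N" for C p
  proof -
    have "(SOME p. p \<in> C \<inter> N) \<in> C \<inter> N" using that(2) by (rule someI)
    then show ?thesis
      unfolding nn_def using M_reg_class[OF that(1)] that(2) by (intro n_inv) auto
  qed
  have nn_in: "nn C \<in> C" if "C \<in> U1" for C
  proof -
    obtain p where p: "p \<in> C \<inter> N" using \<open>C \<in> U1\<close> by (auto simp: U1_def)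
    have CM: "C \<in> M_reg" using that U0_sub by (auto simp: U1_def)
    then show ?thesis using nn[OF CM p] n_class[of p] M_reg_class[OF CM, of p] p by simp
  qed
  have move: "\<exists>T g. open T \<and> p \<in> T \<and> (\<forall>p'\<in>T. conj_pair g p' \<in> N) \<and> invertible g" if "C \<in> U1" "p \<in> C" for C p
  proof -
    obtain p1 where p1: "p1 \<in> C" "p1 \<in> N" using \<open>C \<in> U1\<close> by (auto simp: U1_def)
    have CM: "C \<in> M_reg" using that U0_sub by (auto simp: U1_def)
    have "p1 \<in> pair_class p" using p1(1) M_reg_class[OF CM that(2)] by simp
    then obtain g where g: "invertible g" "p1 = conj_pair g p" by (auto simp: pair_class_iff)
    have "linear (conj_pair g)" by (simp add: linear_iff conj_pair_def conj_by_linear)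
    then have "continuous_on UNIV (conj_pair g)"
      by (rule linear_continuous_on[OF linear_conv_bounded_linear[THEN iffD1]])
    then have "open (conj_pair g -` N)" by (rule open_vimage[OF N(1)])
    moreover have "p \<in> conj_pair g -` N" using g(2) p1(2) by simp
    ultimately show ?thesis using g(1) by (intro exI[of _ "conj_pair g -` N"] exI[of _ g] conjI ballI) simp_all
  qed
  have U1_sub: "U1 \<subseteq> U0" by (auto simp: U1_def)
  have U1_open: "quotient_open M_reg U1"
  proof -
    have "openin (top_of_set (\<Union>M_reg)) (\<Union>U1)"
    proof (subst openin_subopen, intro ballI)
      fix p assume "p \<in> \<Union>U1"
      then obtain C where C: "C \<in> U1" "p \<in> C" by blast
      from move[OF this] obtain T g where T: "open T" "p \<in> T" "\<forall>p'\<in>T. conj_pair g p' \<in> N" "invertible g"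
        by (elim exE conjE)
      have "openin (top_of_set (\<Union>M_reg)) (\<Union>U0)" using U0_open by (simp add: quotient_open_def)
      then have "openin (top_of_set (\<Union>M_reg)) (\<Union>U0 \<inter> T)" using T(1) by (rule openin_Int_open)
      moreover have "p \<in> \<Union>U0 \<inter> T" using C T U1_sub by blast
      moreover have "\<Union>U0 \<inter> T \<subseteq> \<Union>U1"
      proof
        fix p' assume "p' \<in> \<Union>U0 \<inter> T"
        then obtain C' where C': "C' \<in> U0" "p' \<in> C'" "p' \<in> T" by blast
        have "conj_pair g p' \<in> pair_class p'" using T(4) by (auto simp: pair_class_iff)
        then have "conj_pair g p' \<in> C'" using M_reg_class[of C' p'] C' U0_sub by auto
        then have "C' \<in> U1" using C' T(3) by (auto simp: U1_def)
        then show "p' \<in> \<Union>U1" using C' by blast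
      qed
      ultimately show "\<exists>T. openin (top_of_set (\<Union>M_reg)) T \<and> p \<in> T \<and> T \<subseteq> \<Union>U1"
        by (intro exI[of _ "\<Union>U0 \<inter> T"] conjI)
    qed
    then show ?thesis using subset_trans[OF U1_sub U0_sub] unfolding quotient_open_def by (rule conjI[rotated])
  qed
  define s where "s = (\<lambda>c. nn (inv_into U0 \<phi> c))"
  have s_\<phi>: "s (\<phi> C) = nn C" if "C \<in> U1" for C
    using that U1_sub inj by (simp add: s_def subset_iff)
  have s_an: "real_analytic_on s (\<phi> ` U1)"
  proof -
    have "real_analytic_on (\<lambda>c. s c \<bullet> b) (\<phi> ` U1)" for b
    proof (subst an_iff[OF U1_sub U1_open, symmetric], unfold quotient_analytic_on_def, intro ballI)
      fix p assume "p \<in> \<Union>U1"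
      then obtain C where C: "C \<in> U1" "p \<in> C" by blast
      from move[OF this] obtain T g where T: "open T" "p \<in> T" "\<forall>p'\<in>T. conj_pair g p' \<in> N" "invertible g"
        by (elim exE conjE)
      have lin: "linear (conj_pair g)" by (simp add: linear_iff conj_pair_def conj_by_linear)
      have "real_analytic_on (\<lambda>p'. n (conj_pair g p') \<bullet> b) T"
        unfolding real_analytic_on_iff
      proof
        fix p' assume "p' \<in> T"
        then have "analytic_at_point n (conj_pair g p')" using n_an T(3) by (auto simp: real_analytic_on_iff)
        then have "analytic_at_point (\<lambda>p'. n (conj_pair g p')) p'"
          by (rule analytic_at_point_compose[OF _ analytic_at_point_linear[OF lin]])
        then show "analytic_at_point (\<lambda>p'. n (conj_pair g p') \<bullet> b) p'"
          by (rule analytic_at_point_linear_compose[rotated]) (simp add: linear_iff inner_add_left)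
      qed
      moreover have "n (conj_pair g q) \<bullet> b = ((\<lambda>c. s c \<bullet> b) \<circ> \<phi>) C'" if "C' \<in> U1" "q \<in> C' \<inter> T" for C' q
      proof -
        have CM: "C' \<in> M_reg" using that(1) U1_sub U0_sub by blast
        have "conj_pair g q \<in> pair_class q" using T(4) by (auto simp: pair_class_iff)
        then have "conj_pair g q \<in> C' \<inter> N" using M_reg_class[OF CM, of q] that(2) T(3) by auto
        then show ?thesis using nn[OF CM] s_\<phi>[OF that(1)] by simp
      qed
      ultimately show "\<exists>T ga. open T \<and> p \<in> T \<and> real_analytic_on ga T \<and> (\<forall>C\<in>U1. \<forall>q\<in>C \<inter> T. ga q = ((\<lambda>c. s c \<bullet> b) \<circ> \<phi>) C)"
        using T(1,2) by (intro exI[of _ T] exI[of _ "\<lambda>p'. n (conj_pair g p') \<bullet> b"] conjI ballI)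
    qed
    then show ?thesis unfolding real_analytic_on_iff analytic_at_point_def[of s] by simp
  qed
  have SL_pair: "fst p \<in> SL2H \<and> snd p \<in> SL2H" if "p \<in> \<Union>M_reg" for p
    using Union_M_reg_regular[OF that] by (auto simp: regular_loxodromic_pair_def regular_loxodromic_def)
  have traces: "word_traces p = trace_coords C" if "C \<in> M_reg" "p \<in> C" for C p
  proof -
    have "p \<in> \<Union>M_reg" using that by blast
    then have "fst p \<in> SL2H" "snd p \<in> SL2H" using SL_pair by blast+
    from trace_coords_pair_class[OF this] show ?thesis using M_reg_class[OF that] by simp
  qed
  define f where "f = (\<lambda>c. word_traces (s c))"
  have f_\<phi>: "f (\<phi> C) = trace_coords C" if "C \<in> U1" for C
    using traces[OF _ nn_in[OF that]] that U1_sub U0_sub by (auto simp: f_def s_\<phi>[OF that])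
  have f_an: "real_analytic_on f (\<phi> ` U1)"
    unfolding real_analytic_on_iff f_def
  proof
    fix c assume c: "c \<in> \<phi> ` U1"
    then obtain C where C: "C \<in> U1" "c = \<phi> C" by blast
    then have "s c \<in> \<Union>M_reg" using nn_in[OF C(1)] s_\<phi>[OF C(1)] U1_sub U0_sub by auto
    then have "s c \<in> invertible_pairs" using SL_pair SL2H_invertible by (auto simp: invertible_pairs_def)
    then have "analytic_at_point word_traces (s c)"
      by (rule bspec[OF word_traces_analytic[unfolded real_analytic_on_iff]])
    moreover have "analytic_at_point s c" by (rule bspec[OF s_an[unfolded real_analytic_on_iff] c])
    ultimately show "analytic_at_point (\<lambda>c. word_traces (s c)) c" by (rule analytic_at_point_compose)
  qed
  have \<phi>U1: "open (\<phi> ` U1)" using top[OF U1_sub] U1_open by simp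
  have C0: "pair_class p0 \<in> U1" using U0 IntI[OF pair_class_refl[of p0] N(2)] by (auto simp: U1_def)
  have "(f has_derivative D) (at (\<phi> (pair_class p0)))"
  proof (rule has_derivative_transform_within_open[OF D(1) \<phi>U1])
    show "(trace_coords \<circ> inv_into U0 \<phi>) c = f c" if "c \<in> \<phi> ` U1" for c
      using that f_\<phi> inj U1_sub by (auto simp: subset_iff)
  qed (use C0 in blast)
  from real_analytic_inverse_function[OF f_an \<phi>U1 imageI[OF C0] this bij_is_inj[OF D(2)]]
  obtain Oo g where Oo: "open Oo" "\<phi> (pair_class p0) \<in> Oo" "Oo \<subseteq> \<phi> ` U1" "open (f ` Oo)" "inj_on f Oo"
    and g: "real_analytic_on g (f ` Oo)" and gf: "\<forall>c\<in>Oo. g (f c) = c"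
    by (elim exE conjE)
  define U2 where "U2 = {C \<in> U1. \<phi> C \<in> Oo}"
  have \<phi>U2: "\<phi> ` U2 = Oo" using Oo(3) by (auto simp: U2_def)
  have U2_sub: "U2 \<subseteq> U1" by (auto simp: U2_def)
  have tc: "trace_coords C = f (\<phi> C)" if "C \<in> U2" for C using f_\<phi> that by (simp add: U2_def)
  show ?thesis
  proof (intro exI conjI ballI)
    show "open (f ` Oo)" by fact
    have "word_traces p0 = f (\<phi> (pair_class p0))" using traces[OF M pair_class_refl] f_\<phi>[OF C0] by simp
    then show "word_traces p0 \<in> f ` Oo" using Oo(2) by blast
    show "real_analytic_on (\<lambda>t. s (g t)) (f ` Oo)"
      unfolding real_analytic_on_iff
    proof
      fix t assume t: "t \<in> f ` Oo"
      then have "g t \<in> \<phi> ` U1" using gf Oo(3) by auto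
      then have "analytic_at_point s (g t)" by (rule bspec[OF s_an[unfolded real_analytic_on_iff]])
      moreover have "analytic_at_point g t" by (rule bspec[OF g[unfolded real_analytic_on_iff] t])
      ultimately show "analytic_at_point (\<lambda>t. s (g t)) t" by (rule analytic_at_point_compose)
    qed
    show "quotient_open M_reg U2" using top[of U2] \<phi>U2 Oo(1) U2_sub U1_sub by auto
    show "pair_class p0 \<in> U2" using C0 Oo(2) by (simp add: U2_def)
    show "inj_on trace_coords U2"
    proof (rule inj_onI)
      fix C C' assume C: "C \<in> U2" "C' \<in> U2" "trace_coords C = trace_coords C'"
      then have "\<phi> C = \<phi> C'" using tc inj_onD[OF Oo(5)] by (auto simp: U2_def)
      then show "C = C'" using inj_onD[OF inj] C U2_sub U1_sub by blast
    qed
    have "trace_coords ` U2 = f ` \<phi> ` U2" using tc by (force simp: image_image)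
    then show "trace_coords ` U2 = f ` Oo" by (simp add: \<phi>U2)
    fix C assume C: "C \<in> U2"
    then show "C \<inter> W \<noteq> {}" using N(3) by (auto simp: U2_def U1_def)
    have "s (g (trace_coords C)) = nn C" using tc[OF C] gf s_\<phi> C by (simp add: U2_def)
    then show "s (g (trace_coords C)) \<in> C" using nn_in C U2_sub by auto
  qed
qed

section \<open>Traces and the relative deformation space\<close>

text \<open>
  For \<open>X\<close> take the conjugate transpose of \<open>R\<close>: the trace is then the sum of the squared norms of the entries.
\<close>

lemma trH_nondegenerate:
  assumes "\<And>X :: qmat. trH (X ** R) = 0"
  shows "(R :: qmat) = 0"
proof -
  define cj where "cj = (\<lambda>q. Quat (qre q) (- qim1 q) (- qim2 q) (- qim3 q))"
  have sq: "qre (cj q * q) = (norm q)\<^sup>2" for q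
    by (simp add: cj_def times_quat_def norm_quat_def power2_eq_square)
  have add: "qre (x + y) = qre x + qre y" for x y :: quat
    by (simp add: plus_quat_def)
  obtain a b c d where R: "R = mat2 a b c d" using mat2_eta[of R] by metis
  have "trH (mat2 (cj a) (cj c) (cj b) (cj d) ** R) = qre ((cj a * a + cj c * c) + (cj b * b + cj d * d))"
    unfolding R mat2_mult trH_def mat2_nth by (rule refl)
  also have "\<dots> = ((norm a)\<^sup>2 + (norm c)\<^sup>2) + ((norm b)\<^sup>2 + (norm d)\<^sup>2)" by (simp only: add sq)
  finally have "((norm a)\<^sup>2 + (norm c)\<^sup>2) + ((norm b)\<^sup>2 + (norm d)\<^sup>2) = 0" by (simp only: assms)
  then have "a = 0 \<and> b = 0 \<and> c = 0 \<and> d = 0" by (simp add: add_nonneg_eq_0_iff)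
  then show ?thesis by (simp add: R qmat_eq_iff)
qed

text \<open>
  With \<open>C = A\<inverse>\<close>, \<open>D = B\<inverse>\<close>, the three traces in the statement are the derivatives of \<open>tr (DC)\<^sup>2\<close>,
  \<open>tr AB\<close> and \<open>tr CD\<close> when \<open>A\<close> moves along \<open>(1 + sX) A (1 + sX)\<inverse>\<close>. A linear relation for all \<open>X\<close> gives
  \<open>h(CD) = h(DC)\<close> with \<open>h(x) = 2 x\<^sup>2 + a x\<inverse> - b x\<close>. As \<open>CD\<close> arises from \<open>DC\<close> both by conjugation
  with \<open>C = A\<inverse>\<close> and by conjugation with \<open>B\<close>, the matrix \<open>h(DC)\<close> commutes with \<open>A\<close> and \<open>B\<close>, so it is a scalar; and
  this is a cubic relation for \<open>DC = (AB)\<inverse>\<close>.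
\<close>

lemma product_trace_transversal:
  assumes A: "A \<in> SL2H" and B: "B \<in> SL2H" and N: "regular_loxodromic (matrix_inv (A ** B))"
    and scalar: "\<And>X. X ** A = A ** X \<Longrightarrow> X ** B = B ** X \<Longrightarrow> \<exists>c. X = c *\<^sub>R mat 1"
    and C: "C = matrix_inv A" and D: "D = matrix_inv B"
  shows "\<exists>X. 2 * trH (X ** (C ** D ** C ** D - D ** C ** D ** C))
    \<noteq> a * trH (X ** (A ** B - B ** A)) + b * trH (X ** (C ** D - D ** C))"
proof (rule ccontr)
  assume "\<not> ?thesis"
  then have eq: "2 * trH (X ** (C ** D ** C ** D - D ** C ** D ** C))
    = a * trH (X ** (A ** B - B ** A)) + b * trH (X ** (C ** D - D ** C))" for X by simp
  note A' = SL2H_invertible[OF A] and B' = SL2H_invertible[OF B]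
  have AC: "A ** C = mat 1" "C ** A = mat 1" "B ** D = mat 1" "D ** B = mat 1"
    using A' B' by (simp_all add: C D matrix_inv_inverse)
  have canc: "A ** (C ** Y) = Y" "C ** (A ** Y) = Y" "B ** (D ** Y) = Y" "D ** (B ** Y) = Y" for Y :: qmat
    by (simp_all add: matrix_mul_assoc AC)
  define h where "h = 2 *\<^sub>R (D ** C ** D ** C) + a *\<^sub>R (A ** B) - b *\<^sub>R (D ** C)"
  define h' where "h' = 2 *\<^sub>R (C ** D ** C ** D) + a *\<^sub>R (B ** A) - b *\<^sub>R (C ** D)"
  have "trH (X ** (h' - h)) = 0" for X
    using eq[of X] by (simp add: h_def h'_def qmat_distribs trH_simps algebra_simps)
  from trH_nondegenerate[OF this] have hh: "h' = h" by simp
  have "A ** h' = h ** A" "B ** h = h' ** B"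
    by (simp_all add: h_def h'_def qmat_distribs canc AC flip: matrix_mul_assoc)
  then have "h ** A = A ** h" "h ** B = B ** h" by (simp_all add: hh)
  from scalar[OF this] obtain c where c: "h = c *\<^sub>R mat 1" by blast
  have AB: "matrix_inv (A ** B) = D ** C" by (simp add: C D matrix_inv_mult A' B')
  have "h ** (D ** C) = 2 *\<^sub>R (D ** C ** (D ** C) ** (D ** C)) + a *\<^sub>R mat 1 - b *\<^sub>R (D ** C ** (D ** C))"
    by (simp add: h_def qmat_distribs canc AC flip: matrix_mul_assoc)
  then have "2 *\<^sub>R (D ** C ** (D ** C) ** (D ** C)) + (- b) *\<^sub>R (D ** C ** (D ** C)) + (- c) *\<^sub>R (D ** C) + a *\<^sub>R mat 1 = 0"
    by (simp add: c qmat_distribs algebra_simps)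
  from regular_loxodromic_independent[OF N[unfolded AB] this] show False by simp
qed

text \<open>
  The velocity is the commutator of \<open>X\<close> and \<open>Y\<close>.
\<close>

lemma conj_curve_derivative:
  "((\<lambda>s. conj_by (mat 1 + s *\<^sub>R X) Y) has_derivative (\<lambda>h. h *\<^sub>R (X ** Y - Y ** X))) (at (0::real))"
proof -
  define P where "P = (\<lambda>s::real. mat 1 + s *\<^sub>R X)"
  have P: "(P has_derivative (\<lambda>h. h *\<^sub>R X)) (at 0)"
    unfolding P_def by (auto intro!: derivative_eq_intros)
  have P0: "P 0 = mat 1" by (simp add: P_def)
  have inv1: "invertible (mat 1 :: qmat)" by (rule invertible_qmatI[of _ "mat 1"]) simp_all
  have m1: "matrix_inv (mat 1 :: qmat) = mat 1" by (rule matrix_inv_eqI) simp_all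
  have "analytic_at_point matrix_inv (P 0)" unfolding P0 using matrix_inv_analytic_near[OF inv1] by blast
  from analytic_at_point_differentiable[OF this] obtain L where
    "(matrix_inv has_derivative L) (at (P 0))" by blast
  from diff_chain_at[OF P this]
  have Q: "((\<lambda>s. matrix_inv (P s)) has_derivative (\<lambda>h. L (h *\<^sub>R X))) (at 0)" by (simp add: o_def)
  have op: "open (P -` {M. invertible M})"
    by (rule open_vimage[OF open_invertible]) (auto simp: P_def intro!: continuous_intros)
  have "((\<lambda>s. P s ** matrix_inv (P s)) has_derivative (\<lambda>h. P 0 ** L (h *\<^sub>R X) + (h *\<^sub>R X) ** matrix_inv (P 0))) (at 0)"
    by (rule qmat_mult_has_derivative[OF P Q])
  moreover have "((\<lambda>s. P s ** matrix_inv (P s)) has_derivative (\<lambda>h. 0)) (at 0)"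
  proof (rule has_derivative_transform_within_open[OF _ op])
    show "((\<lambda>s. mat 1 :: qmat) has_derivative (\<lambda>h. 0)) (at (0::real))" by simp
    show "(0::real) \<in> P -` {M. invertible M}" by (simp add: P0 inv1)
    show "mat 1 = P s ** matrix_inv (P s)" if "s \<in> P -` {M. invertible M}" for s
      using that by (simp add: matrix_inv_inverse)
  qed
  ultimately have "(\<lambda>h. P 0 ** L (h *\<^sub>R X) + (h *\<^sub>R X) ** matrix_inv (P 0)) = (\<lambda>h. 0)"
    by (rule has_derivative_unique)
  then have "P 0 ** L (h *\<^sub>R X) + (h *\<^sub>R X) ** matrix_inv (P 0) = 0" for h by (rule fun_cong)
  then have L: "L (h *\<^sub>R X) = - (h *\<^sub>R X)" for h by (simp add: P0 m1 add_eq_0_iff2)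
  have Y: "((\<lambda>s. P s ** Y) has_derivative (\<lambda>h. (h *\<^sub>R X) ** Y)) (at 0)"
    using qmat_mult_has_derivative[OF P has_derivative_const[of Y]] by (simp add: qmat_zero)
  have "((\<lambda>s. P s ** Y ** matrix_inv (P s)) has_derivative (\<lambda>h. P 0 ** Y ** L (h *\<^sub>R X) + ((h *\<^sub>R X) ** Y) ** matrix_inv (P 0))) (at 0)"
    by (rule qmat_mult_has_derivative[OF Y Q])
  then show ?thesis
    unfolding P0 m1 L by (simp add: P_def conj_by_def qmat_distribs algebra_simps)
qed

text \<open>
  The nine traces that cut out the relative deformation space.
\<close>

definition boundary_invariants :: "qmat \<times> qmat \<Rightarrow> (real \<times> real \<times> real) \<times> (real \<times> real \<times> real) \<times> (real \<times> real \<times> real)" where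
  "boundary_invariants p = (class_invariants (fst p), class_invariants (snd p), class_invariants (matrix_inv (fst p ** snd p)))"

definition in_boundary_classes :: "qmat \<times> qmat \<Rightarrow> qmat \<times> qmat \<Rightarrow> bool" where
  "in_boundary_classes p0 p \<longleftrightarrow> fst p \<in> conj_class (fst p0) \<and> snd p \<in> conj_class (snd p0) \<and>
    matrix_inv (fst p ** snd p) \<in> conj_class (matrix_inv (fst p0 ** snd p0))"

lemma boundary_invariants_eq_if_classes:
  assumes "in_boundary_classes p0 p" "fst p0 \<in> SL2H" "snd p0 \<in> SL2H"
  shows "boundary_invariants p = boundary_invariants p0"
proof -
  have *: "class_invariants M' = class_invariants M" if "M' \<in> conj_class M" "invertible M" for M M'
    using that class_invariants_conj by (auto simp: conj_class_iff)
  have "invertible (fst p0)" "invertible (snd p0)" "invertible (matrix_inv (fst p0 ** snd p0))"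
    using assms(2,3) by (simp_all add: SL2H_invertible invertible_matrix_inv invertible_qmat_mult)
  then show ?thesis
    using assms(1) unfolding in_boundary_classes_def boundary_invariants_def by (simp add: *)
qed

text \<open>
  The local conjugator equals \<open>1\<close> at \<open>A\<close>, hence is invertible near \<open>A\<close>.
\<close>

lemma regular_loxodromic_class_near:
  assumes "regular_loxodromic A"
  shows "\<exists>W. open W \<and> A \<in> W \<and> (\<forall>M\<in>W. M \<in> SL2H \<longrightarrow> class_invariants M = class_invariants A \<longrightarrow> M \<in> conj_class A)"
proof -
  from local_conjugator[OF assms] obtain G where G: "continuous_on UNIV G" "G A = mat 1"
    "\<And>M. M \<in> SL2H \<Longrightarrow> class_invariants M = class_invariants A \<Longrightarrow> M ** G M = G M ** A" by blast
  have I1: "invertible (mat 1 :: qmat)" by (rule invertible_qmatI[of _ "mat 1"]) simp_all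
  have "open (G -` {M. invertible M})" by (rule open_vimage[OF open_invertible G(1)])
  moreover have "M \<in> conj_class A" if "M \<in> G -` {M. invertible M}" "M \<in> SL2H" "class_invariants M = class_invariants A" for M
  proof -
    have "invertible (G M)" using that(1) by simp
    then show ?thesis using conj_by_eq_iff[of "G M" A M] G(3)[OF that(2,3)] unfolding conj_class_iff by auto
  qed
  ultimately show ?thesis using G(2) I1 by (intro exI[of _ "G -` {M. invertible M}"]) auto
qed

lemma boundary_classes_near:
  assumes "regular_loxodromic (fst p0)" "regular_loxodromic (snd p0)"
    "regular_loxodromic (matrix_inv (fst p0 ** snd p0))"
  shows "\<exists>W. open W \<and> p0 \<in> W \<and> (\<forall>p\<in>W. fst p \<in> SL2H \<longrightarrow> snd p \<in> SL2H \<longrightarrow>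
    boundary_invariants p = boundary_invariants p0 \<longrightarrow> in_boundary_classes p0 p)"
proof -
  from regular_loxodromic_class_near[OF assms(1)] obtain WA where
    WA: "open WA" "fst p0 \<in> WA" "\<forall>M\<in>WA. M \<in> SL2H \<longrightarrow> class_invariants M = class_invariants (fst p0) \<longrightarrow> M \<in> conj_class (fst p0)"
    by (elim exE conjE)
  from regular_loxodromic_class_near[OF assms(2)] obtain WB where
    WB: "open WB" "snd p0 \<in> WB" "\<forall>M\<in>WB. M \<in> SL2H \<longrightarrow> class_invariants M = class_invariants (snd p0) \<longrightarrow> M \<in> conj_class (snd p0)"
    by (elim exE conjE)
  let ?n = "\<lambda>p::qmat \<times> qmat. matrix_inv (fst p ** snd p)"
  from regular_loxodromic_class_near[OF assms(3)] obtain WN where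
    WN: "open WN" "?n p0 \<in> WN" "\<forall>M\<in>WN. M \<in> SL2H \<longrightarrow> class_invariants M = class_invariants (?n p0) \<longrightarrow> M \<in> conj_class (?n p0)"
    by (elim exE conjE)
  have "continuous_on invertible_pairs ?n"
  proof (rule real_analytic_on_imp_continuous_on)
    show "real_analytic_on ?n invertible_pairs"
      unfolding real_analytic_on_iff
      by (intro ballI analytic_at_point_matrix_inv analytic_at_point_qmat_mult analytic_at_point_fst_snd analytic_at_point_id)
        (auto simp: invertible_pairs_def intro: invertible_qmat_mult)
  qed
  from continuous_open_preimage[OF this open_invertible_pairs WN(1)]
  have "open (WA \<times> WB \<inter> (invertible_pairs \<inter> ?n -` WN))"
    by (rule open_Int[OF open_Times[OF WA(1) WB(1)]])
  moreover have "p0 \<in> WA \<times> WB \<inter> (invertible_pairs \<inter> ?n -` WN)"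
    using WA(2) WB(2) WN(2) assms(1,2) by (cases p0) (auto simp: invertible_pairs_def regular_loxodromic_invertible)
  moreover have "in_boundary_classes p0 p"
    if "p \<in> WA \<times> WB \<inter> (invertible_pairs \<inter> ?n -` WN)" "fst p \<in> SL2H" "snd p \<in> SL2H" "boundary_invariants p = boundary_invariants p0" for p
  proof -
    have "?n p \<in> SL2H" using that(2,3) by (intro matrix_inv_in_SL2H SL2H_mult)
    moreover have "fst p \<in> WA" "snd p \<in> WB" "?n p \<in> WN" using that(1) by (auto simp: mem_Times_iff)
    ultimately show ?thesis
      using that(2-4) WA(3) WB(3) WN(3) unfolding in_boundary_classes_def boundary_invariants_def by simp
  qed
  ultimately show ?thesis by (intro exI conjI ballI impI)
qed

text \<open>
  The trace vector in which coordinate \<open>j\<close> is replaced by \<open>f\<close> is a local coordinate system. On the level set the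
  coordinates in \<open>I\<close> and \<open>f\<close> are constant, so the six coordinates outside \<open>insert j I\<close> parametrize it.
\<close>

lemma level_set_chart:
  fixes f :: "real^15 \<Rightarrow> real" and I :: "15 set"
  assumes f: "real_analytic_on f V" and V: "open V" "\<tau> \<in> V"
    and D: "(f has_derivative D) (at \<tau>)" "D (axis j 1) \<noteq> 0" and I: "j \<notin> I" "card I = 8"
  shows "\<exists>(F :: real^15 \<Rightarrow> real^6) V0 g. linear F \<and> open V0 \<and> \<tau> \<in> V0 \<and> V0 \<subseteq> V \<and>
    (let S = {t \<in> V0. (\<forall>i\<in>I. t $ i = \<tau> $ i) \<and> f t = f \<tau>} in
      open (F ` S) \<and> real_analytic_on g (F ` S) \<and> (\<forall>t\<in>S. g (F t) = t))"
proof -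
  define L where "L = (\<lambda>t. t + (f t - t $ j) *\<^sub>R axis j (1::real) :: real^15)"
  have L_nth: "L t $ k = (if k = j then f t else t $ k)" for t k by (simp add: L_def axis_def)
  have nth_lin: "linear (\<lambda>t :: real^15. t $ j)" by (simp add: linear_iff)
  have L_an: "real_analytic_on L V"
    unfolding real_analytic_on_iff L_def
  proof
    fix t assume t: "t \<in> V"
    have "analytic_at_point f t" by (rule bspec[OF f[unfolded real_analytic_on_iff] t])
    from analytic_at_point_diff[OF this analytic_at_point_linear[OF nth_lin]]
    have d: "analytic_at_point (\<lambda>t. f t - t $ j) t" .
    have "linear (\<lambda>r. r *\<^sub>R (axis j 1 :: real^15))" by (simp add: linear_iff scaleR_add_left)
    from analytic_at_point_linear_compose[OF this d]
    show "analytic_at_point (\<lambda>t. t + (f t - t $ j) *\<^sub>R axis j 1) t"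
      by (rule analytic_at_point_add[OF analytic_at_point_id])
  qed
  have L_der: "(L has_derivative (\<lambda>h. h + (D h - h $ j) *\<^sub>R axis j 1)) (at \<tau>)"
  proof -
    have "((\<lambda>t :: real^15. t $ j) has_derivative (\<lambda>h. h $ j)) (at \<tau>)"
      by (rule linear_imp_has_derivative[OF nth_lin])
    from has_derivative_diff[OF D(1) this] show ?thesis
      unfolding L_def by (rule has_derivative_add[OF has_derivative_ident has_derivative_scaleR_left])
  qed
  have "inj (\<lambda>h. h + (D h - h $ j) *\<^sub>R axis j 1)"
  proof -
    have Dl: "linear D" using D(1) has_derivative_linear by blast
    have lin: "linear (\<lambda>h. h + (D h - h $ j) *\<^sub>R axis j 1)"
      by (simp add: linear_iff linear_add[OF Dl] linear_scale[OF Dl] algebra_simps)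
    have "h = 0" if e: "h + (D h - h $ j) *\<^sub>R axis j 1 = 0" for h
    proof -
      have nth: "(h + (D h - h $ j) *\<^sub>R axis j 1) $ k = 0" for k using e by simp
      have "h = (h $ j) *\<^sub>R axis j 1"
        unfolding vec_eq_iff
      proof
        fix k show "h $ k = ((h $ j) *\<^sub>R axis j 1) $ k"
          using nth[of k] by (cases "k = j") (simp_all add: axis_def)
      qed
      moreover from this have "D h = h $ j * D (axis j 1)" by (metis linear_scale[OF Dl] real_scaleR_def)
      moreover have "D h = 0" using nth[of j] by (simp add: axis_def)
      ultimately show ?thesis using D(2) by (metis mult_eq_0_iff scaleR_zero_left)
    qed
    then show ?thesis using linear_inj_iff_eq_0[OF lin] by blast
  qed
  from real_analytic_inverse_function[OF L_an V L_der this]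
  obtain V0 g where V0: "open V0" "\<tau> \<in> V0" "V0 \<subseteq> V" "open (L ` V0)" "inj_on L V0"
    and g_an: "real_analytic_on g (L ` V0)" and gL: "\<forall>t\<in>V0. g (L t) = t"
    by (elim exE conjE)
  have "card (insert j I) = 9" using I by simp
  then have "card (- insert j I) = card (UNIV :: 6 set)" unfolding Compl_eq_Diff_UNIV card_Diff_subset[OF finite subset_UNIV] by simp
  from finite_same_card_bij[OF finite finite this[symmetric]]
  obtain e :: "6 \<Rightarrow> 15" where e: "bij_betw e UNIV (- insert j I)" by (elim exE)
  have ei: "inj e" and er: "range e = - insert j I" using e by (simp_all add: bij_betw_def)
  define F :: "real^15 \<Rightarrow> real^6" where "F = (\<lambda>t. \<chi> k. t $ e k)"
  define E :: "real^6 \<Rightarrow> real^15" where "E = (\<lambda>c. \<chi> i. if i \<in> range e then c $ inv e i else 0)"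
  define \<tau>' :: "real^15" where "\<tau>' = (\<chi> i. if i \<in> range e then 0 else if i = j then f \<tau> else \<tau> $ i)"
  (* \<iota> inserts six coordinates into the vector of the fixed values of the nine others. *)
  define \<iota> where "\<iota> = (\<lambda>c. \<tau>' + E c)"
  have E_lin: "linear E" by (simp add: linear_iff E_def vec_eq_iff)
  have \<iota>_e: "\<iota> c $ e k = c $ k" for c k by (simp add: \<iota>_def E_def \<tau>'_def inv_f_f[OF ei])
  have \<iota>_I: "\<iota> c $ i = \<tau> $ i" if "i \<in> I" for c i using that I(1) er by (auto simp: \<iota>_def E_def \<tau>'_def)
  have \<iota>_j: "\<iota> c $ j = f \<tau>" for c using er by (auto simp: \<iota>_def E_def \<tau>'_def)
  define S where "S = {t \<in> V0. (\<forall>i\<in>I. t $ i = \<tau> $ i) \<and> f t = f \<tau>}"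
  have L\<iota>: "L t = \<iota> (F t)" if "t \<in> S" for t
    unfolding vec_eq_iff
  proof
    fix i
    consider "i = j" | "i \<in> I" | k where "i = e k" using er by blast
    then show "L t $ i = \<iota> (F t) $ i"
    proof cases
      case 1 then show ?thesis using that by (simp add: L_nth \<iota>_j S_def)
    next
      case 2 then show ?thesis using that I(1) by (auto simp: L_nth \<iota>_I S_def)
    next
      case 3
      then have "i \<noteq> j" using er by auto
      then show ?thesis using 3 by (simp add: L_nth \<iota>_e F_def)
    qed
  qed
  have FS: "F ` S = \<iota> -` (L ` V0)"
  proof (intro equalityI subsetI)
    fix c assume "c \<in> F ` S"
    then obtain t where t: "t \<in> S" "c = F t" by blast
    then have "\<iota> c = L t" "t \<in> V0" using L\<iota> by (auto simp: S_def)
    then show "c \<in> \<iota> -` (L ` V0)" by auto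
  next
    fix c assume "c \<in> \<iota> -` (L ` V0)"
    then obtain t where t: "t \<in> V0" "\<iota> c = L t" by auto
    have "t $ i = \<tau> $ i" if "i \<in> I" for i using \<iota>_I[OF that, of c] that I(1) unfolding t(2) L_nth by (cases "i = j") simp_all
    moreover have "f t = f \<tau>" using \<iota>_j[of c] unfolding t(2) L_nth by simp
    ultimately have "t \<in> S" using t(1) by (simp add: S_def)
    moreover have "c = F t"
      unfolding vec_eq_iff
    proof
      fix k
      have "e k \<noteq> j" using er by auto
      then show "c $ k = F t $ k" using \<iota>_e[of c k] unfolding t(2) L_nth by (simp add: F_def)
    qed
    ultimately show "c \<in> F ` S" by blast
  qed
  have \<iota>_an: "analytic_at_point \<iota> c" for c
    unfolding \<iota>_def by (rule analytic_at_point_add[OF analytic_at_point_const analytic_at_point_linear[OF E_lin]])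
  have "continuous_on UNIV \<iota>"
    by (rule real_analytic_on_imp_continuous_on) (use \<iota>_an in \<open>unfold real_analytic_on_iff, intro ballI\<close>)
  from open_vimage[OF V0(4) this] have "open (F ` S)" unfolding FS .
  moreover have "real_analytic_on (\<lambda>c. g (\<iota> c)) (F ` S)"
    unfolding real_analytic_on_iff
  proof
    fix c assume "c \<in> F ` S"
    then have "\<iota> c \<in> L ` V0" unfolding FS by simp
    from bspec[OF g_an[unfolded real_analytic_on_iff] this] \<iota>_an
    show "analytic_at_point (\<lambda>c. g (\<iota> c)) c" by (rule analytic_at_point_compose)
  qed
  moreover have "\<forall>t\<in>S. g (\<iota> (F t)) = t" using gL by (simp add: S_def flip: L\<iota>)
  moreover have "linear F" by (simp add: linear_iff F_def vec_eq_iff)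
  ultimately show ?thesis
    using V0(1-3) unfolding S_def Let_def by (intro exI[of _ F] exI[of _ V0] exI[of _ "\<lambda>c. g (\<iota> c)"] conjI)
qed

lemma word_traces_nth:
  "word_traces p $ 1 = trH (fst p)" "word_traces p $ 2 = trH (matrix_inv (fst p))" "word_traces p $ 3 = trH (fst p ** fst p)"
  "word_traces p $ 4 = trH (snd p)" "word_traces p $ 5 = trH (matrix_inv (snd p))" "word_traces p $ 6 = trH (snd p ** snd p)"
  "word_traces p $ 7 = trH (fst p ** snd p)" "word_traces p $ 10 = trH (matrix_inv (fst p) ** matrix_inv (snd p))"
  by (simp_all add: word_traces_def Let_def vector_def)

text \<open>
  The positions of the words \<open>A, A\<inverse>, A\<^sup>2, B, B\<inverse>, B\<^sup>2, AB, A\<inverse>B\<inverse>\<close>. For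
  \<open>N = (AB)\<inverse>\<close> the last two traces are \<open>tr N\<inverse>\<close> and \<open>tr N\<close>.
\<close>

definition boundary_indices :: "15 set" where
  "boundary_indices = {1, 2, 3, 4, 5, 6, 7, 10}"

text \<open>
  The invariant of the boundary classes which is not among the fifteen traces.
\<close>

definition third_trace :: "qmat \<times> qmat \<Rightarrow> real" where
  "third_trace p = trH (matrix_inv (fst p ** snd p) ** matrix_inv (fst p ** snd p))"

text \<open>
  Cyclicity of the trace identifies \<open>tr (AB)\<inverse> = tr B\<inverse>A\<inverse>\<close> with the trace of the word \<open>A\<inverse>B\<inverse>\<close>.
\<close>

lemma boundary_invariants_iff:
  assumes "invertible (fst p)" "invertible (snd p)" "invertible (fst q)" "invertible (snd q)"
  shows "boundary_invariants p = boundary_invariants q \<longleftrightarrow>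
    (\<forall>i\<in>boundary_indices. word_traces p $ i = word_traces q $ i) \<and> third_trace p = third_trace q"
proof -
  have *: "trH (matrix_inv (fst p ** snd p)) = trH (matrix_inv (fst p) ** matrix_inv (snd p))"
    "matrix_inv (matrix_inv (fst p ** snd p)) = fst p ** snd p"
    if "invertible (fst p)" "invertible (snd p)" for p :: "qmat \<times> qmat"
    using that by (simp_all add: matrix_inv_mult matrix_inv_matrix_inv invertible_qmat_mult invertible_matrix_inv
        trH_mult_commute[of "matrix_inv (fst p)"])
  show ?thesis
    unfolding boundary_invariants_def class_invariants_def third_trace_def boundary_indices_def ball_simps prod.inject word_traces_nth
      *[OF assms(1,2)] *[OF assms(3,4)]
    by (simp only: simp_thms) (rule iffI; elim conjE; intro conjI; assumption)
qed

lemma linear_real15_expand: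
  assumes "linear (D :: real^15 \<Rightarrow> real)"
  shows "D v = (\<Sum>i\<in>UNIV. v $ i * D (axis i 1))"
proof -
  have "D v = D (\<Sum>i\<in>UNIV. v $ i *\<^sub>R axis i 1)"
    using basis_expansion[of v] by (simp only: scalar_mult_eq_scaleR)
  then show ?thesis by (simp add: linear_sum[OF assms] linear_scale[OF assms])
qed

text \<open>
  The defining conditions are invariant under simultaneous conjugation, so membership of a class may be tested on any of
  its pairs.
\<close>

lemma Union_relative_deformation_space_iff:
  assumes "fst p0 \<in> SL2H" "snd p0 \<in> SL2H"
  defines "X \<equiv> relative_deformation_space (conj_class (fst p0)) (conj_class (snd p0)) (conj_class (matrix_inv (fst p0 ** snd p0)))"
  shows "in_boundary_classes p0 p \<Longrightarrow> pair_class p \<in> X" and "p \<in> \<Union>X \<Longrightarrow> in_boundary_classes p0 p"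
proof -
  assume *: "in_boundary_classes p0 p"
  then have "fst p \<in> SL2H" "snd p \<in> SL2H"
    using assms SL2H_conj by (auto simp: in_boundary_classes_def conj_class_iff)
  then show "pair_class p \<in> X"
    using * unfolding X_def relative_deformation_space_def in_boundary_classes_def by (intro imageI) (simp add: case_prod_unfold)
next
  assume "p \<in> \<Union>X"
  then obtain q where q: "fst q \<in> SL2H" "snd q \<in> SL2H" "in_boundary_classes p0 q" "p \<in> pair_class q"
    unfolding X_def relative_deformation_space_def in_boundary_classes_def by auto
  then obtain P where P: "invertible P" "p = conj_pair P q" by (auto simp: pair_class_iff)
  have "invertible (fst q ** snd q)" using q by (intro invertible_qmat_mult SL2H_invertible)
  then have "matrix_inv (fst p ** snd p) = conj_by P (matrix_inv (fst q ** snd q))"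
    using P by (simp add: conj_pair_def matrix_inv_conj flip: conj_by_product)
  then have "fst p \<in> conj_class (fst q)" "snd p \<in> conj_class (snd q)"
    "matrix_inv (fst p ** snd p) \<in> conj_class (matrix_inv (fst q ** snd q))"
    using P unfolding conj_class_iff by (auto simp: conj_pair_def)
  then show "in_boundary_classes p0 p"
    using q(3) conj_class_trans unfolding in_boundary_classes_def by blast
qed

lemma third_trace_conj:
  assumes "q \<in> pair_class p" "invertible (fst p)" "invertible (snd p)"
  shows "third_trace q = third_trace p"
proof -
  obtain P where P: "invertible P" "q = conj_pair P p" using assms(1) by (auto simp: pair_class_iff)
  have "invertible (fst p ** snd p)" using assms by (intro invertible_qmat_mult)
  then have "matrix_inv (fst q ** snd q) = conj_by P (matrix_inv (fst p ** snd p))"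
    using P by (simp add: conj_pair_def matrix_inv_conj flip: conj_by_product)
  then show ?thesis using P by (simp add: third_trace_def trH_conj flip: conj_by_product)
qed

lemma third_trace_analytic:
  assumes "real_analytic_on \<sigma> V" "\<sigma> ` V \<subseteq> invertible_pairs"
  shows "real_analytic_on (\<lambda>t. third_trace (\<sigma> t)) V"
  unfolding real_analytic_on_iff
proof
  fix t assume t: "t \<in> V"
  have s: "analytic_at_point \<sigma> t" by (rule bspec[OF assms(1)[unfolded real_analytic_on_iff] t])
  have "invertible (fst (\<sigma> t) ** snd (\<sigma> t))"
    using assms(2) t by (intro invertible_qmat_mult) (auto simp: invertible_pairs_def)
  then have n: "analytic_at_point (\<lambda>t. matrix_inv (fst (\<sigma> t) ** snd (\<sigma> t))) t"
    by (intro analytic_at_point_matrix_inv analytic_at_point_qmat_mult analytic_at_point_fst_snd s)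
  show "analytic_at_point (\<lambda>t. third_trace (\<sigma> t)) t"
    unfolding third_trace_def
    by (rule analytic_at_point_linear_compose[OF linear_trH analytic_at_point_qmat_mult[OF n n]])
qed

lemma traces_of_class:
  assumes that: "C \<in> M_reg" "p \<in> C"
  shows "word_traces p = trace_coords C" "fst p \<in> SL2H" "snd p \<in> SL2H"
proof -
  have "p \<in> \<Union>M_reg" using that by blast
  then show s: "fst p \<in> SL2H" "snd p \<in> SL2H"
    using Union_M_reg_regular by (auto simp: regular_loxodromic_pair_def regular_loxodromic_def)
  from trace_coords_pair_class[OF this] show "word_traces p = trace_coords C"
    using M_reg_class[OF that] by simp
qed

text \<open>
  Along the curve \<open>((1 + sX) A (1 + sX)\<inverse>, B)\<close> the classes of both components are fixed, so it stays in \<open>M_reg\<close>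
  and the traces of \<open>A\<close>, \<open>B\<close> and their powers are constant. If \<open>D\<close> vanished outside the eight directions, the
  derivative of the third trace along this curve would be a combination of those of \<open>tr AB\<close> and \<open>tr A\<inverse>B\<inverse>\<close>, with
  coefficients that do not depend on \<open>X\<close>; for a suitable \<open>X\<close> this is false.
\<close>

lemma third_trace_transversal:
  assumes A: "regular_loxodromic A" and B: "regular_loxodromic B" and N: "regular_loxodromic (matrix_inv (A ** B))"
    and scalar: "\<And>X. X ** A = A ** X \<Longrightarrow> X ** B = B ** X \<Longrightarrow> \<exists>c. X = c *\<^sub>R mat 1"
    and U: "quotient_open M_reg U" "pair_class (A, B) \<in> U"
    and f: "\<And>C p. C \<in> U \<Longrightarrow> p \<in> C \<Longrightarrow> f (trace_coords C) = third_trace p"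
    and D: "(f has_derivative D) (at (word_traces (A, B)))"
  shows "\<exists>j. j \<notin> boundary_indices \<and> D (axis j 1) \<noteq> 0"
proof (rule ccontr)
  assume "\<not> ?thesis"
  then have D0: "D (axis j 1) = 0" if "j \<notin> boundary_indices" for j using that by blast
  have Dl: "linear D" using D has_derivative_linear by blast
  have sl: "A \<in> SL2H" "B \<in> SL2H" using A B by (simp_all add: regular_loxodromic_def)
  note inv = SL2H_invertible[OF sl(1)] SL2H_invertible[OF sl(2)]
  define A' B' where "A' = matrix_inv A" and "B' = matrix_inv B"
  from product_trace_transversal[OF sl N scalar A'_def B'_def, of "D (axis 7 1)" "D (axis 10 1)"]
  obtain X where X: "2 * trH (X ** (A' ** B' ** A' ** B' - B' ** A' ** B' ** A'))
    \<noteq> D (axis 7 1) * trH (X ** (A ** B - B ** A)) + D (axis 10 1) * trH (X ** (A' ** B' - B' ** A'))" by blast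
  define P where "P = (\<lambda>s::real. mat 1 + s *\<^sub>R X)"
  define a where "a = (\<lambda>s. conj_by (P s) A)"
  define a' where "a' = (\<lambda>s. conj_by (P s) A')"
  have m1: "invertible (mat 1 :: qmat)" by (rule invertible_qmatI[of _ "mat 1"]) simp_all
  have a0: "a 0 = A" "a' 0 = A'" using m1 by (simp_all add: a_def a'_def P_def conj_by_eq_iff)
  have a_der: "(a has_derivative (\<lambda>h. h *\<^sub>R (X ** A - A ** X))) (at 0)"
    "(a' has_derivative (\<lambda>h. h *\<^sub>R (X ** A' - A' ** X))) (at 0)"
    unfolding a_def a'_def P_def by (rule conj_curve_derivative)+
  define p where "p = (\<lambda>s. (a s, B))"
  have p_der: "(p has_derivative (\<lambda>h. (h *\<^sub>R (X ** A - A ** X), 0))) (at 0)"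
    unfolding p_def by (rule has_derivative_Pair[OF a_der(1) has_derivative_const])
  have p0: "p 0 = (A, B)" by (simp add: p_def a0)
  have p_lim: "(p \<longlongrightarrow> (A, B)) (nhds 0)"
    using has_derivative_continuous[OF p_der] by (simp add: isCont_def p0 tendsto_nhds_iff)
  have P_inv: "\<forall>\<^sub>F s in nhds 0. invertible (P s)"
  proof -
    have "open (P -` {M. invertible M})"
      by (rule open_vimage[OF open_invertible]) (auto simp: P_def intro!: continuous_intros)
    then have "\<forall>\<^sub>F s in nhds 0. s \<in> P -` {M. invertible M}" by (rule eventually_nhds_in_open) (simp add: P_def m1)
    then show ?thesis by simp
  qed
  have UM: "U \<subseteq> M_reg" using U(1) by (simp add: quotient_open_def)
  then have pM: "(A, B) \<in> \<Union>M_reg" using U(2) pair_class_refl[of "(A, B)"] by blast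
  obtain T where T: "open T" "\<Union>U = \<Union>M_reg \<inter> T" using U(1) by (auto simp: quotient_open_def openin_open)
  then have "(A, B) \<in> T" using U(2) pair_class_refl[of "(A, B)"] by blast
  have pU: "\<forall>\<^sub>F s in nhds 0. p s \<in> \<Union>U"
  proof -
    have "\<forall>\<^sub>F s in nhds 0. fst (p s) \<in> conj_class (fst (A, B)) \<longrightarrow> snd (p s) \<in> conj_class (snd (A, B)) \<longrightarrow> p s \<in> \<Union>M_reg"
      using filterlim_iff[THEN iffD1, OF p_lim, rule_format, OF Union_M_reg_locally_closed_under_conjugation[OF pM]] .
    moreover have "\<forall>\<^sub>F s in nhds 0. p s \<in> T" using topological_tendstoD[OF p_lim T(1) \<open>(A, B) \<in> T\<close>] .
    ultimately show ?thesis using P_inv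
    proof eventually_elim
      case (elim s)
      have "fst (p s) \<in> conj_class A" "snd (p s) \<in> conj_class B"
        using elim(3) conj_class_refl[of B] unfolding conj_class_iff[of _ A] by (auto simp: p_def a_def)
      then show ?case using elim(1,2) T(2) by simp
    qed
  qed
  define t where "t = (\<lambda>s. word_traces (p s))"
  have ab_inv: "(A, B) \<in> invertible_pairs" using inv by (simp add: invertible_pairs_def)
  have "analytic_at_point word_traces (p 0)"
    unfolding p0 by (rule bspec[OF word_traces_analytic[unfolded real_analytic_on_iff] ab_inv])
  from analytic_at_point_differentiable[OF this] obtain L where "(word_traces has_derivative L) (at (p 0))" by blast
  from diff_chain_at[OF p_der this] obtain T' where t_der: "(t has_derivative T') (at 0)" by (auto simp: t_def o_def)
  have t0: "t 0 = word_traces (A, B)" by (simp add: t_def p0)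
  have inv_a: "matrix_inv (a s) = a' s" if "invertible (P s)" for s
    using that inv by (simp add: a_def a'_def A'_def matrix_inv_conj)
  have f_t: "\<forall>\<^sub>F s in nhds 0. f (t s) = trH (B' ** a' s ** (B' ** a' s))"
    using pU P_inv
  proof eventually_elim
    case (elim s)
    then obtain C where C: "C \<in> U" "p s \<in> C" by blast
    then have "t s = trace_coords C" unfolding t_def using UM by (intro traces_of_class) auto
    then have "f (t s) = third_trace (p s)" using f[OF C] by simp
    moreover have "invertible (a s)" unfolding a_def using elim(2) inv by (intro invertible_conj_by)
    ultimately show ?case
      using inv_a[OF elim(2)] inv by (simp add: third_trace_def p_def matrix_inv_mult B'_def)
  qed
  have nth_der: "((\<lambda>s. t s $ i) has_derivative (\<lambda>h. T' h $ i)) (at 0)" for i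
    using bounded_linear.has_derivative[OF bounded_linear_vec_nth t_der] .
  have component: "T' 1 $ i = r" if "\<forall>\<^sub>F s in nhds 0. t s $ i = w s" "(w has_derivative (\<lambda>h. h * r)) (at 0)" for i w r
  proof -
    from that(1)[unfolded eventually_nhds]
    obtain S where S: "open S" "0 \<in> S" "\<forall>s\<in>S. t s $ i = w s" by (elim exE conjE)
    have "((\<lambda>s. t s $ i) has_derivative (\<lambda>h. h * r)) (at 0)"
      using has_derivative_transform_within_open[OF that(2) S(1,2)] S(3) by simp
    from fun_cong[OF has_derivative_unique[OF nth_der this], of 1] show ?thesis by simp
  qed
  have const: "T' 1 $ i = 0" if "i \<in> {1,2,3,4,5,6}" for i
  proof (rule component)
    show "\<forall>\<^sub>F s in nhds 0. t s $ i = word_traces (A, B) $ i"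
      using P_inv
    proof eventually_elim
      case (elim s)
      have "trH (a s ** a s) = trH (A ** A)" "trH (a s) = trH A" "trH (a' s) = trH A'"
        unfolding a_def a'_def using elim by (simp_all add: trH_conj flip: conj_by_product)
      then show ?case
        using that inv_a[OF elim] unfolding t_def p_def by (elim insertE emptyE) (simp_all only: word_traces_nth fst_conv snd_conv A'_def)
    qed
  qed simp
  have trH_bl: "bounded_linear trH" using linear_trH by (simp add: linear_conv_bounded_linear)
  have prod_der: "((\<lambda>s. trH (b s ** Y)) has_derivative (\<lambda>h. h * trH (X ** (Z ** Y - Y ** Z)))) (at 0)"
    if "(b has_derivative (\<lambda>h. h *\<^sub>R (X ** Z - Z ** X))) (at 0)" for b and Y Z :: qmat
  proof -
    have "((\<lambda>s. b s ** Y) has_derivative (\<lambda>h. b 0 ** 0 + (h *\<^sub>R (X ** Z - Z ** X)) ** Y)) (at 0)"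
      by (rule qmat_mult_has_derivative[OF that has_derivative_const])
    from bounded_linear.has_derivative[OF trH_bl this]
    have "((\<lambda>s. trH (b s ** Y)) has_derivative (\<lambda>h. h * trH ((X ** Z - Z ** X) ** Y))) (at 0)"
      by (simp only: qmat_zero qmat_scaleR_left add_0 trH_simps)
    moreover have "trH ((X ** Z - Z ** X) ** Y) = trH (X ** (Z ** Y - Y ** Z))"
      using trH_mult_commute[of Z "X ** Y"] by (simp add: qmat_distribs trH_simps matrix_mul_assoc)
    ultimately show ?thesis by (simp only:)
  qed
  have T7: "T' 1 $ 7 = trH (X ** (A ** B - B ** A))"
  proof (rule component[OF _ prod_der[OF a_der(1), of B]])
    show "\<forall>\<^sub>F s in nhds 0. t s $ 7 = trH (a s ** B)" by (simp add: t_def p_def word_traces_nth)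
  qed
  have T10: "T' 1 $ 10 = trH (X ** (A' ** B' - B' ** A'))"
  proof (rule component[OF _ prod_der[OF a_der(2), of B']])
    show "\<forall>\<^sub>F s in nhds 0. t s $ 10 = trH (a' s ** B')"
      using P_inv by eventually_elim (simp add: t_def p_def word_traces_nth inv_a B'_def)
  qed
  have "D (T' 1) = D (axis 7 1) * trH (X ** (A ** B - B ** A)) + D (axis 10 1) * trH (X ** (A' ** B' - B' ** A'))"
  proof -
    have "D (T' 1) = (\<Sum>i\<in>UNIV. T' 1 $ i * D (axis i 1))" by (rule linear_real15_expand[OF Dl])
    also have "\<dots> = (\<Sum>i\<in>{7, 10}. T' 1 $ i * D (axis i 1))"
    proof (rule sum.mono_neutral_right)
      show "\<forall>i\<in>UNIV - {7, 10}. T' 1 $ i * D (axis i 1) = 0"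
      proof
        fix i :: 15 assume "i \<in> UNIV - {7, 10}"
        then have "i \<in> {1,2,3,4,5,6} \<or> i \<notin> boundary_indices" by (auto simp: boundary_indices_def)
        then show "T' 1 $ i * D (axis i 1) = 0" using const[of i] D0[of i] by auto
      qed
    qed simp_all
    also have "\<dots> = T' 1 $ 7 * D (axis 7 1) + T' 1 $ 10 * D (axis 10 1)" by simp
    finally show ?thesis by (simp add: T7 T10)
  qed
  moreover have "D (T' 1) = 2 * trH (X ** (A' ** B' ** A' ** B' - B' ** A' ** B' ** A'))"
  proof -
    define c where "c = (\<lambda>s. B' ** a' s)"
    define E where "E = B' ** (X ** A' - A' ** X)"
    have "(c has_derivative (\<lambda>h. B' ** (h *\<^sub>R (X ** A' - A' ** X)) + 0 ** a' 0)) (at 0)"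
      unfolding c_def by (rule qmat_mult_has_derivative[OF has_derivative_const a_der(2)])
    then have "(c has_derivative (\<lambda>h. h *\<^sub>R E)) (at 0)"
      by (simp only: qmat_zero qmat_scaleR_right add_0_right E_def)
    from bounded_linear.has_derivative[OF trH_bl qmat_mult_has_derivative[OF this this]]
    have "((\<lambda>s. trH (c s ** c s)) has_derivative (\<lambda>h. trH (c 0 ** (h *\<^sub>R E) + (h *\<^sub>R E) ** c 0))) (at 0)" .
    moreover have "trH (c 0 ** (h *\<^sub>R E) + (h *\<^sub>R E) ** c 0) = h * (2 * trH (E ** c 0))" for h
      using trH_mult_commute[of "c 0" E] by (simp add: qmat_distribs trH_simps algebra_simps)
    ultimately have c_der: "((\<lambda>s. trH (c s ** c s)) has_derivative (\<lambda>h. h * (2 * trH (E ** c 0)))) (at 0)"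
      by (simp only:)
    from f_t[folded c_def, unfolded eventually_nhds]
    obtain S where S: "open S" "0 \<in> S" "\<forall>s\<in>S. f (t s) = trH (c s ** c s)"
      unfolding c_def by (elim exE conjE)
    have "((\<lambda>s. f (t s)) has_derivative (\<lambda>h. h * (2 * trH (E ** c 0)))) (at 0)"
      using has_derivative_transform_within_open[OF c_der S(1,2)] S(3) by simp
    moreover have "((\<lambda>s. f (t s)) has_derivative (\<lambda>h. D (T' h))) (at 0)"
      using diff_chain_at[OF t_der, of f D] D by (simp add: t0 o_def)
    ultimately have "(\<lambda>h. D (T' h)) = (\<lambda>h. h * (2 * trH (E ** c 0)))" by (rule has_derivative_unique[rotated])
    from fun_cong[OF this, of 1] have "D (T' 1) = 2 * trH (E ** c 0)" by simp
    also have "trH (E ** c 0) = trH (X ** (A' ** B' ** A' ** B' - B' ** A' ** B' ** A'))"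
      using trH_mult_commute[of B' "X ** A' ** B' ** A'"] trH_mult_commute[of "B' ** A'" "X ** B' ** A'"]
      by (simp add: E_def c_def a0 qmat_distribs trH_simps matrix_mul_assoc)
    finally show ?thesis .
  qed
  ultimately show False using X by simp
qed

theorem corollary7p3:
  fixes A B :: "qmat"
  assumes "A \<in> SL2H" and "B \<in> SL2H"
    and "regular_loxodromic A" and "regular_loxodromic B"
    and "regular_loxodromic (matrix_inv (A ** B))"
    and "centralizer_algebra A \<inter> centralizer_algebra B = {0}"
    and "fixed_points A \<inter> fixed_points B = {}"
    and "pair_class (A, B) \<in> trace_locus"
  shows "\<exists>U (F :: real^15 \<Rightarrow> real^6) V.
    pair_class (A, B) \<in> U \<and>
    open V \<and> trace_coords ` U \<subseteq> V \<and> real_analytic_on F V \<and>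
    analytic_chart
      (relative_deformation_space (conj_class A) (conj_class B) (conj_class (matrix_inv (A ** B))))
      U (F \<circ> trace_coords)"
proof -
  define p0 where "p0 = (A, B)"
  define X where "X = relative_deformation_space (conj_class A) (conj_class B) (conj_class (matrix_inv (A ** B)))"
  have sl0: "fst p0 \<in> SL2H" "snd p0 \<in> SL2H" using assms(1,2) by (simp_all add: p0_def)
  have X_class: "pair_class p \<in> X" if "in_boundary_classes p0 p" for p
    using Union_relative_deformation_space_iff(1)[OF sl0 that] by (simp add: X_def p0_def)
  have X_bd: "in_boundary_classes p0 p" if "p \<in> \<Union>X" for p
    using Union_relative_deformation_space_iff(2)[OF sl0, of p] that by (simp add: X_def p0_def)
  have scalar: "\<exists>c. Y = c *\<^sub>R mat 1" if "Y ** A = A ** Y" "Y ** B = B ** Y" for Y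
    using scalar_if_commutes[OF assms(1,2,6) that] by (rule exI)
  have "\<exists>W. open W \<and> p0 \<in> W \<and> (\<forall>p\<in>W. fst p \<in> SL2H \<longrightarrow> snd p \<in> SL2H \<longrightarrow>
    boundary_invariants p = boundary_invariants p0 \<longrightarrow> in_boundary_classes p0 p)"
    by (rule boundary_classes_near) (simp_all add: p0_def assms)
  then obtain W where W: "open W" "p0 \<in> W"
    and W_bd: "\<forall>p\<in>W. fst p \<in> SL2H \<longrightarrow> snd p \<in> SL2H \<longrightarrow> boundary_invariants p = boundary_invariants p0 \<longrightarrow> in_boundary_classes p0 p"
    by (elim exE conjE)
  have locus: "pair_class p0 \<in> trace_locus" using assms(8) by (simp add: p0_def)
  have scalar0: "\<exists>c. Y = c *\<^sub>R mat 1" if "Y ** fst p0 = fst p0 ** Y" "Y ** snd p0 = snd p0 ** Y" for Y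
    using scalar[of Y] that by (simp add: p0_def)
  have "\<exists>V \<sigma> U. open V \<and> word_traces p0 \<in> V \<and> real_analytic_on \<sigma> V \<and> quotient_open M_reg U \<and> pair_class p0 \<in> U \<and>
      inj_on trace_coords U \<and> trace_coords ` U = V \<and> (\<forall>C\<in>U. C \<inter> W \<noteq> {} \<and> \<sigma> (trace_coords C) \<in> C)"
    by (rule trace_locus_section[OF locus _ W]) (rule scalar0)
  then obtain V \<sigma> U2 where V: "open V" "word_traces p0 \<in> V" "real_analytic_on \<sigma> V"
    and U2: "quotient_open M_reg U2" "pair_class p0 \<in> U2" "inj_on trace_coords U2" "trace_coords ` U2 = V"
    and sec: "\<forall>C\<in>U2. C \<inter> W \<noteq> {} \<and> \<sigma> (trace_coords C) \<in> C"
    by (elim exE conjE)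
  have U2M: "U2 \<subseteq> M_reg" using U2(1) by (simp add: quotient_open_def)
  have in_inv: "p \<in> invertible_pairs" if "C \<in> M_reg" "p \<in> C" for C p
    using traces_of_class(2,3)[OF that] SL2H_invertible by (auto simp: invertible_pairs_def)
  have inv_sl: "invertible (fst p)" "invertible (snd p)" if "C \<in> M_reg" "p \<in> C" for C p
    using traces_of_class(2,3)[OF that] SL2H_invertible by auto
  define f where "f = (\<lambda>t. third_trace (\<sigma> t))"
  have f_class: "f (trace_coords C) = third_trace p" if "C \<in> U2" "p \<in> C" for C p
  proof -
    have C: "C \<in> M_reg" using that U2M by blast
    have "\<sigma> (trace_coords C) \<in> pair_class p" using sec that M_reg_class[OF C that(2)] by auto
    then show ?thesis unfolding f_def by (rule third_trace_conj[OF _ inv_sl[OF C that(2)]])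
  qed
  have \<sigma>_im: "\<sigma> ` V \<subseteq> invertible_pairs"
  proof
    fix p assume "p \<in> \<sigma> ` V"
    then obtain C where C: "C \<in> U2" "p = \<sigma> (trace_coords C)" using U2(4) by blast
    then have "p \<in> C" using sec by simp
    then show "p \<in> invertible_pairs" using C(1) U2M by (intro in_inv[of C]) auto
  qed
  have f_an: "real_analytic_on f V" unfolding f_def by (rule third_trace_analytic[OF V(3) \<sigma>_im])
  have "analytic_at_point f (word_traces p0)" by (rule bspec[OF f_an[unfolded real_analytic_on_iff] V(2)])
  from analytic_at_point_differentiable[OF this] obtain D where D: "(f has_derivative D) (at (word_traces p0))" by (elim exE)
  have "\<exists>j. j \<notin> boundary_indices \<and> D (axis j 1) \<noteq> 0"
    by (rule third_trace_transversal[OF assms(3-5) _ U2(1) U2(2)[unfolded p0_def] _ D[unfolded p0_def]])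
      (rule scalar f_class; assumption)+
  then obtain j where j: "j \<notin> boundary_indices" "D (axis j 1) \<noteq> 0" by (elim exE conjE)
  have card8: "card boundary_indices = 8" unfolding boundary_indices_def by simp
  from level_set_chart[OF f_an V(1,2) D j(2,1) card8]
  obtain F :: "real^15 \<Rightarrow> real^6" and V0 g where F: "linear F" and V0: "open V0" "word_traces p0 \<in> V0" "V0 \<subseteq> V"
    and lev: "let S = {t \<in> V0. (\<forall>i\<in>boundary_indices. t $ i = word_traces p0 $ i) \<and> f t = f (word_traces p0)} in
      open (F ` S) \<and> real_analytic_on g (F ` S) \<and> (\<forall>t\<in>S. g (F t) = t)"
    by (elim exE conjE)
  define S where "S = {t \<in> V0. (\<forall>i\<in>boundary_indices. t $ i = word_traces p0 $ i) \<and> f t = f (word_traces p0)}"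
  have S: "open (F ` S)" "real_analytic_on g (F ` S)" "\<And>t. t \<in> S \<Longrightarrow> g (F t) = t"
    using lev unfolding S_def Let_def by simp_all
  have F_an: "real_analytic_on F UNIV"
    unfolding real_analytic_on_iff by (intro ballI analytic_at_point_linear F)
  have p0_M: "pair_class p0 \<in> M_reg" using U2(2) U2M by blast
  have t0: "trace_coords (pair_class p0) = word_traces p0"
    using traces_of_class(1)[OF p0_M pair_class_refl] by simp
  have f0: "f (word_traces p0) = third_trace p0" using f_class[OF U2(2) pair_class_refl] t0 by simp
  have inv0: "invertible (fst p0)" "invertible (snd p0)" using sl0 by (simp_all add: SL2H_invertible)
  have in_S: "trace_coords C \<in> S \<longleftrightarrow> trace_coords C \<in> V0 \<and> boundary_invariants p = boundary_invariants p0"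
    if "C \<in> U2" "p \<in> C" for C p
  proof -
    have C: "C \<in> M_reg" using that U2M by blast
    show ?thesis
      using boundary_invariants_iff[OF inv_sl[OF C that(2)] inv0]
      unfolding S_def f0 mem_Collect_eq f_class[OF that] traces_of_class(1)[OF C that(2)] by simp
  qed
  (* By the choice of W the nine trace equations describe the relative deformation space inside U2. *)
  define U where "U = {C \<in> U2. trace_coords C \<in> S}"
  have U_sub: "U \<subseteq> U2" by (auto simp: U_def)
  have U_im: "trace_coords ` U = S"
  proof
    show "trace_coords ` U \<subseteq> S" by (auto simp: U_def)
    show "S \<subseteq> trace_coords ` U"
    proof
      fix t assume t: "t \<in> S"
      then have "t \<in> trace_coords ` U2" using V0(3) U2(4) by (auto simp: S_def)
      then show "t \<in> trace_coords ` U" using t by (auto simp: U_def)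
    qed
  qed
  have U_X: "U \<subseteq> X"
  proof
    fix C assume C: "C \<in> U"
    then have C2: "C \<in> U2" and CM: "C \<in> M_reg" using U_sub U2M by auto
    then obtain p where p: "p \<in> C" "p \<in> W" using sec by blast
    have "boundary_invariants p = boundary_invariants p0" using C in_S[OF C2 p(1)] by (simp add: U_def)
    then have "in_boundary_classes p0 p" using W_bd p(2) traces_of_class(2,3)[OF CM p(1)] by simp
    from X_class[OF this] show "C \<in> X" using M_reg_class[OF CM p(1)] by simp
  qed
  obtain T2 where T2: "open T2" "\<Union>U2 = \<Union>M_reg \<inter> T2" using U2(1) by (auto simp: quotient_open_def openin_open)
  have wt_cont: "continuous_on invertible_pairs word_traces"
    by (rule real_analytic_on_imp_continuous_on[OF word_traces_analytic])
  define T3 where "T3 = invertible_pairs \<inter> word_traces -` V0"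
  have T3: "open T3" unfolding T3_def by (rule continuous_open_preimage[OF wt_cont open_invertible_pairs V0(1)])
  have U_open: "quotient_open X U"
  proof -
    have "openin (top_of_set (\<Union>X)) (\<Union>U)"
    proof (subst openin_subopen, intro ballI)
      fix p assume "p \<in> \<Union>U"
      then obtain C where C: "C \<in> U" "p \<in> C" by blast
      then have C2: "C \<in> U2" and CM: "C \<in> M_reg" using U_sub U2M by auto
      have pM: "p \<in> \<Union>M_reg" using C(2) CM by blast
      have pX: "in_boundary_classes p0 p" using U_X C by (intro X_bd) blast
      from Union_M_reg_locally_closed_under_conjugation[OF pM, unfolded eventually_nhds]
      obtain T1 where T1: "open T1" "p \<in> T1"
        "\<forall>p'\<in>T1. fst p' \<in> conj_class (fst p) \<longrightarrow> snd p' \<in> conj_class (snd p) \<longrightarrow> p' \<in> \<Union>M_reg" by (elim exE conjE)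
      have p_in: "p \<in> T1 \<inter> (T2 \<inter> T3)"
      proof -
        have "p \<in> T2" using C2 C(2) T2(2) by blast
        moreover have "word_traces p \<in> V0" using traces_of_class(1)[OF CM C(2)] C(1) by (simp add: U_def S_def)
        ultimately show ?thesis using T1(2) in_inv[OF CM C(2)] by (simp add: T3_def)
      qed
      have "\<Union>X \<inter> (T1 \<inter> (T2 \<inter> T3)) \<subseteq> \<Union>U"
      proof
        fix q assume q: "q \<in> \<Union>X \<inter> (T1 \<inter> (T2 \<inter> T3))"
        have qX: "in_boundary_classes p0 q" using q by (intro X_bd) blast
        have "fst q \<in> conj_class (fst p)" "snd q \<in> conj_class (snd p)"
          using pX qX unfolding in_boundary_classes_def by (blast intro: conj_class_trans[OF conj_class_sym])+
        then have "q \<in> \<Union>M_reg" using T1(3) q by blast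
        then have "q \<in> \<Union>U2" using T2(2) q by blast
        then obtain C' where C': "C' \<in> U2" "q \<in> C'" by blast
        then have C'M: "C' \<in> M_reg" using U2M by blast
        have "trace_coords C' \<in> V0" using q traces_of_class(1)[OF C'M C'(2)] by (simp add: T3_def)
        moreover have "boundary_invariants q = boundary_invariants p0"
          by (rule boundary_invariants_eq_if_classes[OF qX sl0])
        ultimately have "C' \<in> U" using in_S[OF C'] C'(1) by (simp add: U_def)
        then show "q \<in> \<Union>U" using C'(2) by blast
      qed
      moreover have "openin (top_of_set (\<Union>X)) (\<Union>X \<inter> (T1 \<inter> (T2 \<inter> T3)))"
        by (intro openin_open_Int open_Int T1(1) T2(1) T3)
      moreover have "p \<in> \<Union>X" using U_X C by blast
      ultimately show "\<exists>T. openin (top_of_set (\<Union>X)) T \<and> p \<in> T \<and> T \<subseteq> \<Union>U"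
        using p_in by (intro exI[of _ "\<Union>X \<inter> (T1 \<inter> (T2 \<inter> T3))"] conjI IntI[of p "\<Union>X"])
    qed
    then show ?thesis using U_X unfolding quotient_open_def by (rule conjI[rotated])
  qed
  have \<phi>U: "(F \<circ> trace_coords) ` U = F ` S" by (simp only: image_comp[symmetric] U_im)
  have chart: "analytic_chart X U (F \<circ> trace_coords)"
  proof (rule analytic_chart_from_section[OF U_open open_invertible_pairs,
        where \<omega> = "\<lambda>p. F (word_traces p)" and \<kappa> = "\<lambda>c. \<sigma> (g c)"])
    show "\<Union>U \<subseteq> invertible_pairs" using U_sub U2M in_inv by blast
    show "real_analytic_on (\<lambda>p. F (word_traces p)) invertible_pairs"
      unfolding real_analytic_on_iff
      by (intro ballI analytic_at_point_linear_compose[OF F] bspec[OF word_traces_analytic[unfolded real_analytic_on_iff]])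
    show "F (word_traces p) = (F \<circ> trace_coords) C" if "C \<in> U" "p \<in> C" for C p
    proof -
      have "C \<in> M_reg" using that(1) U_sub U2M by blast
      from traces_of_class(1)[OF this that(2)] show ?thesis by simp
    qed
    show "inj_on (F \<circ> trace_coords) U"
    proof (rule comp_inj_on)
      show "inj_on trace_coords U" using U2(3) U_sub by (rule inj_on_subset)
      show "inj_on F (trace_coords ` U)" unfolding U_im using S(3) by (rule inj_on_inverseI)
    qed
    show "open ((F \<circ> trace_coords) ` U)" unfolding \<phi>U by (rule S(1))
    show "real_analytic_on (\<lambda>c. \<sigma> (g c)) ((F \<circ> trace_coords) ` U)"
      unfolding \<phi>U real_analytic_on_iff
    proof
      fix c assume c: "c \<in> F ` S"
      then have "g c \<in> V" using S(3) V0(3) by (auto simp: S_def)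
      from bspec[OF V(3)[unfolded real_analytic_on_iff] this] bspec[OF S(2)[unfolded real_analytic_on_iff] c]
      show "analytic_at_point (\<lambda>c. \<sigma> (g c)) c" by (rule analytic_at_point_compose)
    qed
    fix c assume "c \<in> (F \<circ> trace_coords) ` U"
    then obtain C where C: "C \<in> U" "c = F (trace_coords C)" by auto
    then have "trace_coords C \<in> S" by (simp add: U_def)
    then have "g c = trace_coords C" using S(3) C(2) by simp
    then have m: "\<sigma> (g c) \<in> C" using sec C(1) U_sub by auto
    have "C \<in> M_reg" using C(1) U_sub U2M by blast
    from traces_of_class(1)[OF this m] m C
    show "\<sigma> (g c) \<in> \<Union>U \<and> F (word_traces (\<sigma> (g c))) = c" by auto
  qed
  have "trace_coords (pair_class p0) \<in> S" using V0(2) by (simp add: t0 S_def)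
  then have "pair_class (A, B) \<in> U" using U2(2) by (simp add: U_def p0_def)
  then show ?thesis
    using F_an chart unfolding X_def by (intro exI[of _ U] exI[of _ F] exI[of _ UNIV] conjI) simp_all
qed

end
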